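(* Let $T>0$, $\xi\in W$, and let $(y^i,z^i)\in X_{\omega,T}$, $i=1,2$, be two fixed points of $\mathcal M_{T,\omega,\xi}$. Then $(y^1,z^1)=(y^2,z^2)$.
   Context: Setting. $V$ is a Hilbert space, $W$ a separable Banach space; $|\cdot|$ is the norm of whichever space is relevant. $\otimes$ is a completed (projective) tensor product, so that bounded bilinear maps are identified with bounded linear maps on the tensor product. For $E\in\mathcal L(W\otimes V,W)$, $w\in W$, $K\in\mathcal L(V,W)$ write $Ew:=E(w\otimes\cdot)\in\mathcal L(V,W)$ and $EK:=E\circ(K\otimes\mathrm{Id})\in\mathcal L(V\otimes V,W)$. $A$ is a sectorial operator generating an analytic $C_0$-semigroup $(S(t))_{t\ge0}$ on $W$; $D_\gamma:=D((-A)^\gamma)$ with norm $|x|_{D_\gamma}=|(-A)^\gamma x|$. Exponents: $\frac13<\beta<\alpha\le\frac12$, $\alpha+2\beta>1$. $G:W\to\mathcal L(V,W)$ is three times continuously Fréchet differentiable with bounded derivatives, $DG(x)$ is viewed as an element of $\mathcal L(W\otimes V,W)$, and $G:W\to\mathcal L(V,D_\beta)$ is Lipschitz continuous. The equation considered is $dy_t=Ay_t\,dt+G(y_t)\,d\omega_t$, $y_0=\xi$. Increments. $\Delta_T=\{(t,s):T\ge t>s\ge0\}$; two-parameter functions vanish on the diagonal. $(\delta y)_{ts}=y_t-y_s$, $(\hat\delta y)_{ts}=y_t-S(t-s)y_s$, $(\hat\delta_2 z)_{t\tau s}=z_{ts}-z_{t\tau}-S(t-\tau)z_{\tau s}$.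 Noise. $(\omega,\omega^{(2)})$ is a fixed $\alpha$-Hölder rough path on $[0,T]$: $\omega$ is $V$-valued $\alpha$-Hölder, $\omega^{(2)}$ is $V\otimes V$-valued with $|\omega^{(2)}_{ts}|\lesssim (t-s)^{2\alpha}$, and $\omega^{(2)}_{ts}-\omega^{(2)}_{us}-\omega^{(2)}_{tu}=(\delta\omega)_{us}\otimes(\delta\omega)_{tu}$; moreover it is the limit, in the metric $\sup\frac{|\delta\omega_{ts}-\delta\tilde\omega_{ts}|}{(t-s)^\alpha}+\sup\frac{|\omega^{(2)}_{ts}-\tilde\omega^{(2)}_{ts}|}{(t-s)^{2\alpha}}$, of $(\omega^n,\omega^{(2),n})$ with $\omega^n$ piecewise linear and $\omega^{(2),n}_{ts}=\int_s^t(\delta\omega^n)_{rs}\otimes d\omega^n_r$. (In the paper: a path of a trace-class fractional Brownian motion with Hurst index in $(1/3,1/2]$ with its Lévy area.) Supporting processes, for $K\in\mathcal L(V,W)$, $E\in\mathcal L(W\otimes V,W)$, $x\in W$: $\omega^S_{ts}(K)=S(t-s)K(\delta\omega)_{ts}-A\int_s^tS(t-r)K(\delta\omega)_{tr}dr$ (this is $\int_s^tS(t-r)K\,d\omega_r$); $a_{ts}(E,x)=\omega^S_{ts}(Ex)+\int_s^t\omega^S_{tr}(EAS(r-s)x)dr$, the integral being improper at $r=s$ (this is $\int_s^tS(t-r)ES(r-s)x\,d\omega_r$); $c_{ts}(E,K)=S(t-s)EK\omega^{(2)}_{ts}-\int_s^tAS(t-r)EK\big[\omega^{(2)}_{tr}+(\delta\omega)_{rs}\otimes(\delta\omega)_{tr}\big]dr$,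 i.e. the limit of $\int_s^tS(t-r)EK(\delta\omega^n)_{rs}d\omega^n_r$; for $K\in\mathcal L(V,D_\beta)$, $b_{ts}(E,K)=\lim_{|\mathcal P|\to0}\sum_{[u,v]\in\mathcal P(s,t)}S(t-v)\big[\omega^S_{vu}(E\omega^S_{us}(K))+c_{vu}(E,K)\big]$ (this is $\int_s^tS(t-r)E\int_s^rS(r-q)K\,d\omega_q\,d\omega_r$). Sewing. For a suitable two-parameter $\Xi$, $\mathcal I\Xi$ is the path with $\mathcal I\Xi_0=0$ and $(\hat\delta\mathcal I\Xi)_{ts}=\lim_{|\mathcal P|\to0}\sum_{[u,v]\in\mathcal P(s,t)}S(t-v)\Xi_{vu}$ over partitions of $[s,t]$. Norms. $\|y\|_\infty=\sup|y_t|$, $|||y|||_{\beta,\beta}=\sup_{0<s<t\le T}s^\beta\frac{|y_t-y_s|}{(t-s)^\beta}$; $C^{\beta,\beta}([0,T],W)$ consists of the continuous $y$ with $\|y\|_{\beta,\beta}=\|y\|_\infty+|||y|||_{\beta,\beta}<\infty$. $\|z\|_\alpha=\sup_t|z_{t0}|+\sup_{0\le s<t\le T}\frac{|z_{ts}|}{(t-s)^\alpha}$, $\|z\|_{\alpha+\beta,\beta}=\sup_t|z_{t0}|+\sup_{0<s<t\le T}s^\beta\frac{|z_{ts}|}{(t-s)^{\alpha+\beta}}$, defining $C^\alpha(\Delta_T,\cdot)$ and $C^{\alpha+\beta,\beta}(\Delta_T,\cdot)$. Solution space. $X_{\omega,T}$ is the Banach space of pairs $(y,z)$ with $y\in C^{\beta,\beta}([0,T],W)$,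 $z\in C^\alpha(\Delta_T,Z)\cap C^{\alpha+\beta,\beta}(\Delta_T,Z)$, $Z=\mathcal L(\mathcal L(W\otimes V,W),W)$, and $(\hat\delta_2z)_{t\tau s}(E)=\omega^S_{t\tau}(E(\delta y)_{\tau s})$ for all $E$; norm $\|(y,z)\|_X=\|y\|_\infty+|||y|||_{\beta,\beta}+\|z\|_\alpha+\|z\|_{\alpha+\beta,\beta}$. Solution map. $\Xi^{(y)}(y,z)_{vu}=\omega^S_{vu}(G(y_u))+z_{vu}(DG(y_u))$, $\Xi^{(z)}(y,\tilde y)_{vu}(E)=b_{vu}(E,G(y_u))+a_{vu}(E,\tilde y_u)$. $\mathcal M_{T,\omega,\xi}(y,z)=(\tilde y,\tilde z)$ with $\tilde y_t=S(t)\xi+\mathcal I\Xi^{(y)}(y,z)_t$ and $\tilde z_{ts}(E)=(\hat\delta\mathcal I\Xi^{(z)}(y,\tilde y))_{ts}(E)-\omega^S_{ts}(E\tilde y_s)$. Thus a fixed point is a pair in $X_{\omega,T}$ with $y_t=S(t)\xi+\mathcal I\Xi^{(y)}(y,z)_t$ and $z_{ts}(E)=(\hat\delta\mathcal I\Xi^{(z)}(y,y))_{ts}(E)-\omega^S_{ts}(Ey_s)$. *)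

theory Defs
  imports "HOL-Analysis.Analysis"
begin

section \<open>Semigroups, sectorial operators, fractional powers\<close>

text \<open>An unbounded operator is a pair of its domain \<open>D\<close> and a function \<open>A\<close>, whose values outside
  \<open>D\<close> are irrelevant. For spectral notions the real space is complexified: \<open>x + i y\<close> is the pair
  \<open>(x, y)\<close>. The product norm is equivalent to every usual norm of the complexification, so
  sectoriality does not depend on this choice.\<close>

definition cscale :: "complex \<Rightarrow> 'a::real_normed_vector \<times> 'a \<Rightarrow> 'a \<times> 'a" where
  "cscale c p = (Re c *\<^sub>R fst p - Im c *\<^sub>R snd p, Re c *\<^sub>R snd p + Im c *\<^sub>R fst p)"

definition is_resolvent ::
  "'a set \<Rightarrow> ('a \<Rightarrow> 'a) \<Rightarrow> complex \<Rightarrow> (('a::real_normed_vector \<times> 'a) \<Rightarrow>\<^sub>L ('a \<times> 'a)) \<Rightarrow> bool" where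
  "is_resolvent D A c R \<longleftrightarrow>
     (\<forall>p. R p \<in> D \<times> D \<and>
          cscale c (R p) - map_prod A A (R p) = p) \<and>
     (\<forall>p \<in> D \<times> D. R (cscale c p - map_prod A A p) = p)"

definition resolvent_set :: "'a set \<Rightarrow> ('a \<Rightarrow> 'a::real_normed_vector) \<Rightarrow> complex set" where
  "resolvent_set D A = {c. \<exists>R. is_resolvent D A c R}"

definition sectorial :: "'a set \<Rightarrow> ('a \<Rightarrow> 'a::real_normed_vector) \<Rightarrow> bool" where
  "sectorial D A \<longleftrightarrow>
     subspace D \<and> closure D = UNIV \<and>
     (\<forall>x\<in>D. \<forall>y\<in>D. A (x + y) = A x + A y) \<and> (\<forall>c. \<forall>x\<in>D. A (c *\<^sub>R x) = c *\<^sub>R A x) \<and>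
     closed {(x, A x) | x. x \<in> D} \<and>
     (\<exists>(a::real) \<theta> M. pi / 2 < \<theta> \<and> \<theta> < pi \<and>
        (\<forall>c. c \<noteq> of_real a \<and> \<bar>Arg (c - of_real a)\<bar> < \<theta> \<longrightarrow>
           (\<exists>R. is_resolvent D A c R \<and> norm R \<le> M / cmod (c - of_real a))))"

text \<open>Analyticity is real analyticity of all orbits on the open half-line (Henry's definition).\<close>

definition analytic_C0_semigroup :: "(real \<Rightarrow> 'a::banach \<Rightarrow>\<^sub>L 'a) \<Rightarrow> bool" where
  "analytic_C0_semigroup S \<longleftrightarrow>
     S 0 = id_blinfun \<and> (\<forall>s\<ge>0. \<forall>t\<ge>0. S (s + t) = S s o\<^sub>L S t) \<and>
     (\<forall>x. ((\<lambda>t. S t x) \<longlongrightarrow> x) (at_right 0)) \<and>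
     (\<forall>x. \<forall>t>0. \<exists>r>0. \<exists>c :: nat \<Rightarrow> 'a. \<forall>h. \<bar>h\<bar> < r \<longrightarrow>
        (\<lambda>n. h ^ n *\<^sub>R c n) sums S (t + h) x)"

definition generates :: "'a set \<Rightarrow> ('a \<Rightarrow> 'a) \<Rightarrow> (real \<Rightarrow> 'a::banach \<Rightarrow>\<^sub>L 'a) \<Rightarrow> bool" where
  "generates D A S \<longleftrightarrow>
     (\<forall>x y. (x \<in> D \<and> A x = y) \<longleftrightarrow>
        ((\<lambda>h. (1 / h) *\<^sub>R (S h x - x)) \<longlongrightarrow> y) (at_right 0))"

text \<open>For \<open>\<gamma> > 0\<close> and spectrum in the open left half-plane, \<open>(-A)\<^sup>-\<^sup>\<gamma>\<close> is
  \<open>\<Gamma>(\<gamma>)\<^sup>-\<^sup>1 \<integral> t\<^sup>\<gamma>\<^sup>-\<^sup>1 S(t) dt\<close> over the half-line, and \<open>(-A)\<^sup>\<gamma>\<close> is its inverse,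
  defined on its range.\<close>

definition neg_frac_power ::
  "(real \<Rightarrow> 'a \<Rightarrow>\<^sub>L 'a) \<Rightarrow> real \<Rightarrow> 'a::{banach,second_countable_topology} \<Rightarrow> 'a" where
  "neg_frac_power S \<gamma> x =
     (1 / Gamma \<gamma>) *\<^sub>R (LINT t:{0<..}|lborel. t powr (\<gamma> - 1) *\<^sub>R S t x)"

definition frac_dom ::
  "(real \<Rightarrow> 'a \<Rightarrow>\<^sub>L 'a) \<Rightarrow> real \<Rightarrow> 'a::{banach,second_countable_topology} set" where
  "frac_dom S \<gamma> = range (neg_frac_power S \<gamma>)"

definition frac_power ::
  "(real \<Rightarrow> 'a \<Rightarrow>\<^sub>L 'a) \<Rightarrow> real \<Rightarrow> 'a::{banach,second_countable_topology} \<Rightarrow> 'a" where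
  "frac_power S \<gamma> x = (THE w. neg_frac_power S \<gamma> w = x)"


section \<open>The diffusion coefficient\<close>

definition C3_bounded_derivs :: "('a::real_normed_vector \<Rightarrow> 'b::real_normed_vector) \<Rightarrow> bool" where
  "C3_bounded_derivs G \<longleftrightarrow>
     (\<exists>(D1 :: 'a \<Rightarrow> 'a \<Rightarrow>\<^sub>L 'b) (D2 :: 'a \<Rightarrow> 'a \<Rightarrow>\<^sub>L 'a \<Rightarrow>\<^sub>L 'b) (D3 :: 'a \<Rightarrow> 'a \<Rightarrow>\<^sub>L 'a \<Rightarrow>\<^sub>L 'a \<Rightarrow>\<^sub>L 'b).
        (\<forall>x. (G has_derivative blinfun_apply (D1 x)) (at x)) \<and>
        (\<forall>x. (D1 has_derivative blinfun_apply (D2 x)) (at x)) \<and>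
        (\<forall>x. (D2 has_derivative blinfun_apply (D3 x)) (at x)) \<and>
        continuous_on UNIV D3 \<and>
        bounded (range D1) \<and> bounded (range D2) \<and> bounded (range D3))"

definition Dop :: "('a::real_normed_vector \<Rightarrow> 'b::real_normed_vector) \<Rightarrow> 'a \<Rightarrow> 'a \<Rightarrow>\<^sub>L 'b" where
  "Dop G x = Blinfun (frechet_derivative G (at x))"

text \<open>\<open>G\<close> is Lipschitz as a map into \<open>L(V, D\<^sub>\<gamma>)\<close>, where \<open>D\<^sub>\<gamma>\<close> has norm \<open>|(-A)\<^sup>\<gamma> x|\<close>.\<close>

definition lipschitz_into_frac ::
  "(real \<Rightarrow> 'w \<Rightarrow>\<^sub>L 'w) \<Rightarrow> real \<Rightarrow>
   ('w \<Rightarrow> 'v::real_normed_vector \<Rightarrow>\<^sub>L 'w::{banach,second_countable_topology}) \<Rightarrow> bool" where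
  "lipschitz_into_frac S \<gamma> G \<longleftrightarrow>
     (\<forall>x. range (G x) \<subseteq> frac_dom S \<gamma> \<and>
          bounded_linear (\<lambda>v. frac_power S \<gamma> (G x v))) \<and>
     (\<exists>L. \<forall>x y. onorm (\<lambda>v. frac_power S \<gamma> ((G x - G y) v)) \<le> L * norm (x - y))"


section \<open>Projective tensor products\<close>

definition tsum :: "('a \<Rightarrow> 'b \<Rightarrow> 'c::real_normed_vector) \<Rightarrow> ('a \<times> 'b) list \<Rightarrow> 'c" where
  "tsum tens xs = (\<Sum>(v, w)\<leftarrow>xs. tens v w)"

text \<open>The Banach space \<open>'c\<close> with the bilinear map \<open>tens\<close> is a completed projective tensor product
  of \<open>'a\<close> and \<open>'b\<close>: the finite sums of elementary tensors form the algebraic tensor product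
  (the condition on linearly independent sets), carry the projective norm, and are dense.\<close>

definition projective_tensor ::
  "('a::real_normed_vector \<Rightarrow> 'b::real_normed_vector \<Rightarrow> 'c::banach) \<Rightarrow> bool" where
  "projective_tensor tens \<longleftrightarrow>
     bounded_bilinear tens \<and>
     (\<forall>B f. finite B \<and> independent B \<and> (\<Sum>b\<in>B. tens b (f b)) = 0 \<longrightarrow> (\<forall>b\<in>B. f b = 0)) \<and>
     (\<forall>xs. norm (tsum tens xs) =
        (INF ys\<in>{ys. tsum tens ys = tsum tens xs}. \<Sum>(v, w)\<leftarrow>ys. norm v * norm w)) \<and>
     closure (range (tsum tens)) = UNIV"

text \<open>The bounded linear map on the tensor product that corresponds to a bounded bilinear map.\<close>

definition tensor_lift ::
  "('a::real_normed_vector \<Rightarrow> 'b::real_normed_vector \<Rightarrow> 'c::banach) \<Rightarrow>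
   ('a \<Rightarrow>\<^sub>L 'b \<Rightarrow>\<^sub>L 'd::banach) \<Rightarrow> 'c \<Rightarrow>\<^sub>L 'd" where
  "tensor_lift tens B =
     (THE L. \<forall>v w. blinfun_apply L (tens v w) = B v w)"


section \<open>Partitions and sewing\<close>

text \<open>Two-parameter functions take the later time first: \<open>z t s\<close> with \<open>s < t\<close>.\<close>

definition Delta :: "real \<Rightarrow> (real \<times> real) set" where
  "Delta T = {(t, s). 0 \<le> s \<and> s < t \<and> t \<le> T}"

definition partitions :: "real \<Rightarrow> real \<Rightarrow> real list set" where
  "partitions s t = {p. p \<noteq> [] \<and> sorted_wrt (<) p \<and> hd p = s \<and> last p = t}"

definition mesh_filter :: "real \<Rightarrow> real \<Rightarrow> real list filter" where
  "mesh_filter s t = (INF d\<in>{0<..}. principal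
     {p \<in> partitions s t. \<forall>i. Suc i < length p \<longrightarrow> p ! Suc i - p ! i < d})"

definition sew_sum ::
  "(real \<Rightarrow> 'a \<Rightarrow>\<^sub>L 'a) \<Rightarrow> (real \<Rightarrow> real \<Rightarrow> 'a::real_normed_vector) \<Rightarrow> real \<Rightarrow> real list \<Rightarrow> 'a" where
  "sew_sum S \<Xi> t p = (\<Sum>i<length p - 1. S (t - p ! Suc i) (\<Xi> (p ! Suc i) (p ! i)))"

text \<open>The path is made unique by letting it vanish outside \<open>[0, T]\<close>.\<close>

definition sewing ::
  "(real \<Rightarrow> 'a \<Rightarrow>\<^sub>L 'a) \<Rightarrow> real \<Rightarrow> (real \<Rightarrow> real \<Rightarrow> 'a::real_normed_vector) \<Rightarrow> real \<Rightarrow> 'a" where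
  "sewing S T \<Xi> = (THE I. I 0 = 0 \<and> (\<forall>t. t \<notin> {0..T} \<longrightarrow> I t = 0) \<and>
     (\<forall>s t. 0 \<le> s \<and> s \<le> t \<and> t \<le> T \<longrightarrow>
        (sew_sum S \<Xi> t \<longlongrightarrow> I t - S (t - s) (I s)) (mesh_filter s t)))"


section \<open>The rough path\<close>

definition piecewise_linear :: "real \<Rightarrow> (real \<Rightarrow> 'v::real_normed_vector) \<Rightarrow> bool" where
  "piecewise_linear T f \<longleftrightarrow>
     (\<exists>p \<in> partitions 0 T. \<forall>i. Suc i < length p \<longrightarrow> (\<forall>r \<in> {p ! i..p ! Suc i}.
        f r = f (p ! i) + ((r - p ! i) / (p ! Suc i - p ! i)) *\<^sub>R (f (p ! Suc i) - f (p ! i))))"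

text \<open>The iterated integral of \<open>\<delta>f\<^sub>r\<^sub>s \<otimes> df\<^sub>r\<close> for piecewise linear \<open>f\<close>; the finitely many points
  without derivative do not contribute.\<close>

definition canonical_lift ::
  "('v \<Rightarrow> 'v \<Rightarrow> 't::banach) \<Rightarrow> (real \<Rightarrow> 'v::real_normed_vector) \<Rightarrow> real \<Rightarrow> real \<Rightarrow> 't" where
  "canonical_lift tens f t s =
     integral {s..t} (\<lambda>r. tens (f r - f s) (vector_derivative f (at r)))"

definition rough_dist ::
  "real \<Rightarrow> real \<Rightarrow> (real \<Rightarrow> 'v::real_normed_vector) \<Rightarrow> (real \<Rightarrow> real \<Rightarrow> 't::real_normed_vector) \<Rightarrow>
   (real \<Rightarrow> 'v) \<Rightarrow> (real \<Rightarrow> real \<Rightarrow> 't) \<Rightarrow> ennreal" where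
  "rough_dist \<alpha> T \<omega> \<omega>2 \<eta> \<eta>2 =
     (SUP (t, s) \<in> Delta T. ennreal (norm ((\<omega> t - \<omega> s) - (\<eta> t - \<eta> s)) / (t - s) powr \<alpha>)) +
     (SUP (t, s) \<in> Delta T. ennreal (norm (\<omega>2 t s - \<eta>2 t s) / (t - s) powr (2 * \<alpha>)))"

text \<open>Chen's relation is required also for coinciding times, which encodes that \<open>\<omega>2\<close> vanishes
  on the diagonal.\<close>

definition rough_path ::
  "('v \<Rightarrow> 'v \<Rightarrow> 't::banach) \<Rightarrow> real \<Rightarrow> real \<Rightarrow>
   (real \<Rightarrow> 'v::real_normed_vector) \<Rightarrow> (real \<Rightarrow> real \<Rightarrow> 't) \<Rightarrow> bool" where
  "rough_path tens \<alpha> T \<omega> \<omega>2 \<longleftrightarrow>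
     (\<exists>C. \<forall>(t, s) \<in> Delta T. norm (\<omega> t - \<omega> s) \<le> C * (t - s) powr \<alpha>) \<and>
     (\<exists>C. \<forall>(t, s) \<in> Delta T. norm (\<omega>2 t s) \<le> C * (t - s) powr (2 * \<alpha>)) \<and>
     (\<forall>s u t. 0 \<le> s \<and> s \<le> u \<and> u \<le> t \<and> t \<le> T \<longrightarrow>
        \<omega>2 t s - \<omega>2 u s - \<omega>2 t u = tens (\<omega> u - \<omega> s) (\<omega> t - \<omega> u)) \<and>
     (\<exists>\<eta> :: nat \<Rightarrow> real \<Rightarrow> 'v. (\<forall>n. piecewise_linear T (\<eta> n)) \<and>
        (\<lambda>n. rough_dist \<alpha> T \<omega> \<omega>2 (\<eta> n) (canonical_lift tens (\<eta> n))) \<longlonglongrightarrow> 0)"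


section \<open>Supporting processes\<close>

text \<open>An element \<open>E\<close> of \<open>L(W \<otimes> V, W)\<close> is represented by the isometrically
  corresponding \<open>E :: 'w \<Rightarrow>\<^sub>L 'v \<Rightarrow>\<^sub>L 'w\<close>; thus \<open>E w\<close> is plain application and the operator \<open>E K\<close> on \<open>V \<otimes> V\<close> is the lift of \<open>E o\<^sub>L K\<close>.\<close>

definition omS ::
  "(real \<Rightarrow> 'w \<Rightarrow>\<^sub>L 'w) \<Rightarrow> ('w \<Rightarrow> 'w) \<Rightarrow> (real \<Rightarrow> 'v::real_normed_vector) \<Rightarrow> real \<Rightarrow> real \<Rightarrow>
   ('v \<Rightarrow>\<^sub>L 'w::{banach,second_countable_topology}) \<Rightarrow> 'w" where
  "omS S A \<omega> t s K =
     S (t - s) (K (\<omega> t - \<omega> s)) -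
     A (LINT r:{s..t}|lborel. S (t - r) (K (\<omega> t - \<omega> r)))"

definition proc_a ::
  "(real \<Rightarrow> 'w \<Rightarrow>\<^sub>L 'w) \<Rightarrow> ('w \<Rightarrow> 'w) \<Rightarrow> (real \<Rightarrow> 'v::real_normed_vector) \<Rightarrow> real \<Rightarrow> real \<Rightarrow>
   ('w \<Rightarrow>\<^sub>L 'v \<Rightarrow>\<^sub>L 'w::{banach,second_countable_topology}) \<Rightarrow> 'w \<Rightarrow> 'w" where
  "proc_a S A \<omega> t s E x =
     omS S A \<omega> t s (E x) +
     Lim (at_right s) (\<lambda>q. LINT r:{q..t}|lborel.
       omS S A \<omega> t r (E (A (S (r - s) x))))"

definition proc_c ::
  "('v \<Rightarrow> 'v \<Rightarrow> 't::banach) \<Rightarrow> (real \<Rightarrow> 'w \<Rightarrow>\<^sub>L 'w) \<Rightarrow> ('w \<Rightarrow> 'w) \<Rightarrow>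
   (real \<Rightarrow> 'v::real_normed_vector) \<Rightarrow> (real \<Rightarrow> real \<Rightarrow> 't) \<Rightarrow> real \<Rightarrow> real \<Rightarrow>
   ('w \<Rightarrow>\<^sub>L 'v \<Rightarrow>\<^sub>L 'w::{banach,second_countable_topology}) \<Rightarrow> ('v \<Rightarrow>\<^sub>L 'w) \<Rightarrow> 'w" where
  "proc_c tens S A \<omega> \<omega>2 t s E K =
     S (t - s) (tensor_lift tens (E o\<^sub>L K) (\<omega>2 t s)) -
     (LINT r:{s..t}|lborel. A (S (t - r)
        (tensor_lift tens (E o\<^sub>L K) (\<omega>2 t r + tens (\<omega> r - \<omega> s) (\<omega> t - \<omega> r)))))"

definition proc_b ::
  "('v \<Rightarrow> 'v \<Rightarrow> 't::banach) \<Rightarrow> (real \<Rightarrow> 'w \<Rightarrow>\<^sub>L 'w) \<Rightarrow> ('w \<Rightarrow> 'w) \<Rightarrow>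
   (real \<Rightarrow> 'v::real_normed_vector) \<Rightarrow> (real \<Rightarrow> real \<Rightarrow> 't) \<Rightarrow> real \<Rightarrow> real \<Rightarrow>
   ('w \<Rightarrow>\<^sub>L 'v \<Rightarrow>\<^sub>L 'w::{banach,second_countable_topology}) \<Rightarrow> ('v \<Rightarrow>\<^sub>L 'w) \<Rightarrow> 'w" where
  "proc_b tens S A \<omega> \<omega>2 t s E K =
     Lim (mesh_filter s t) (sew_sum S (\<lambda>v u.
       omS S A \<omega> v u (E (omS S A \<omega> u s K)) + proc_c tens S A \<omega> \<omega>2 v u E K) t)"


section \<open>The solution space\<close>

definition norm_C_bb :: "real \<Rightarrow> real \<Rightarrow> (real \<Rightarrow> 'w::real_normed_vector) \<Rightarrow> ennreal" where
  "norm_C_bb \<beta> T y =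
     (SUP t\<in>{0..T}. ennreal (norm (y t))) +
     (SUP (t, s) \<in> {(t, s) \<in> Delta T. 0 < s}.
        ennreal (s powr \<beta> * (norm (y t - y s) / (t - s) powr \<beta>)))"

definition norm_C_a :: "real \<Rightarrow> real \<Rightarrow> (real \<Rightarrow> real \<Rightarrow> 'z::real_normed_vector) \<Rightarrow> ennreal" where
  "norm_C_a \<alpha> T z =
     (SUP t\<in>{0..T}. ennreal (norm (z t 0))) +
     (SUP (t, s) \<in> Delta T. ennreal (norm (z t s) / (t - s) powr \<alpha>))"

definition norm_C_ab ::
  "real \<Rightarrow> real \<Rightarrow> real \<Rightarrow> (real \<Rightarrow> real \<Rightarrow> 'z::real_normed_vector) \<Rightarrow> ennreal" where
  "norm_C_ab \<alpha> \<beta> T z =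
     (SUP t\<in>{0..T}. ennreal (norm (z t 0))) +
     (SUP (t, s) \<in> {(t, s) \<in> Delta T. 0 < s}.
        ennreal (s powr \<beta> * (norm (z t s) / (t - s) powr (\<alpha> + \<beta>))))"

text \<open>Paths on \<open>[0, T]\<close> and functions on \<open>Delta T\<close> are extended by \<open>0\<close>, so that equality of
  pairs is equality on these domains; in particular \<open>z\<close> vanishes on the diagonal.\<close>

definition X_space ::
  "real \<Rightarrow> real \<Rightarrow> (real \<Rightarrow> 'w \<Rightarrow>\<^sub>L 'w) \<Rightarrow> ('w \<Rightarrow> 'w) \<Rightarrow> (real \<Rightarrow> 'v::real_normed_vector) \<Rightarrow> real \<Rightarrow>
   ((real \<Rightarrow> 'w::{banach,second_countable_topology}) \<times>
    (real \<Rightarrow> real \<Rightarrow> ('w \<Rightarrow>\<^sub>L 'v \<Rightarrow>\<^sub>L 'w) \<Rightarrow>\<^sub>L 'w)) set" where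
  "X_space \<alpha> \<beta> S A \<omega> T = {(y, z).
     (\<forall>t. t \<notin> {0..T} \<longrightarrow> y t = 0) \<and> (\<forall>t s. (t, s) \<notin> Delta T \<longrightarrow> z t s = 0) \<and>
     continuous_on {0..T} y \<and> norm_C_bb \<beta> T y < \<infinity> \<and>
     norm_C_a \<alpha> T z < \<infinity> \<and> norm_C_ab \<alpha> \<beta> T z < \<infinity> \<and>
     (\<forall>s \<tau> t E. 0 \<le> s \<and> s < \<tau> \<and> \<tau> < t \<and> t \<le> T \<longrightarrow>
        blinfun_apply (z t s) E - blinfun_apply (z t \<tau>) E
          - S (t - \<tau>) (blinfun_apply (z \<tau> s) E)
        = omS S A \<omega> t \<tau> (blinfun_apply E (y \<tau> - y s)))}"


section \<open>The solution map\<close>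

definition Xi_y ::
  "(real \<Rightarrow> 'w \<Rightarrow>\<^sub>L 'w) \<Rightarrow> ('w \<Rightarrow> 'w) \<Rightarrow> (real \<Rightarrow> 'v::real_normed_vector) \<Rightarrow>
   ('w \<Rightarrow> 'v \<Rightarrow>\<^sub>L 'w::{banach,second_countable_topology}) \<Rightarrow>
   (real \<Rightarrow> 'w) \<Rightarrow> (real \<Rightarrow> real \<Rightarrow> ('w \<Rightarrow>\<^sub>L 'v \<Rightarrow>\<^sub>L 'w) \<Rightarrow>\<^sub>L 'w) \<Rightarrow> real \<Rightarrow> real \<Rightarrow> 'w" where
  "Xi_y S A \<omega> G y z v u = omS S A \<omega> v u (G (y u)) + z v u (Dop G (y u))"

definition Xi_z ::
  "('v \<Rightarrow> 'v \<Rightarrow> 't::banach) \<Rightarrow> (real \<Rightarrow> 'w \<Rightarrow>\<^sub>L 'w) \<Rightarrow> ('w \<Rightarrow> 'w) \<Rightarrow>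
   (real \<Rightarrow> 'v::real_normed_vector) \<Rightarrow> (real \<Rightarrow> real \<Rightarrow> 't) \<Rightarrow>
   ('w \<Rightarrow> 'v \<Rightarrow>\<^sub>L 'w::{banach,second_countable_topology}) \<Rightarrow>
   (real \<Rightarrow> 'w) \<Rightarrow> (real \<Rightarrow> 'w) \<Rightarrow> ('w \<Rightarrow>\<^sub>L 'v \<Rightarrow>\<^sub>L 'w) \<Rightarrow> real \<Rightarrow> real \<Rightarrow> 'w" where
  "Xi_z tens S A \<omega> \<omega>2 G y y' E v u =
     proc_b tens S A \<omega> \<omega>2 v u E (G (y u)) + proc_a S A \<omega> v u E (y' u)"

text \<open>The second component is given by its values at the operators \<open>E\<close>; limits of the
  \<open>L(L(W \<otimes> V, W), W)\<close>-valued sums are evaluated at each \<open>E\<close>.\<close>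

definition sol_map_y ::
  "(real \<Rightarrow> 'w \<Rightarrow>\<^sub>L 'w) \<Rightarrow> ('w \<Rightarrow> 'w) \<Rightarrow> (real \<Rightarrow> 'v::real_normed_vector) \<Rightarrow>
   ('w \<Rightarrow> 'v \<Rightarrow>\<^sub>L 'w::{banach,second_countable_topology}) \<Rightarrow> real \<Rightarrow> 'w \<Rightarrow>
   (real \<Rightarrow> 'w) \<Rightarrow> (real \<Rightarrow> real \<Rightarrow> ('w \<Rightarrow>\<^sub>L 'v \<Rightarrow>\<^sub>L 'w) \<Rightarrow>\<^sub>L 'w) \<Rightarrow> real \<Rightarrow> 'w" where
  "sol_map_y S A \<omega> G T \<xi> y z t = S t \<xi> + sewing S T (Xi_y S A \<omega> G y z) t"

definition sol_map_z ::
  "('v \<Rightarrow> 'v \<Rightarrow> 't::banach) \<Rightarrow> (real \<Rightarrow> 'w \<Rightarrow>\<^sub>L 'w) \<Rightarrow> ('w \<Rightarrow> 'w) \<Rightarrow>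
   (real \<Rightarrow> 'v::real_normed_vector) \<Rightarrow> (real \<Rightarrow> real \<Rightarrow> 't) \<Rightarrow>
   ('w \<Rightarrow> 'v \<Rightarrow>\<^sub>L 'w::{banach,second_countable_topology}) \<Rightarrow> real \<Rightarrow> 'w \<Rightarrow>
   (real \<Rightarrow> 'w) \<Rightarrow> (real \<Rightarrow> real \<Rightarrow> ('w \<Rightarrow>\<^sub>L 'v \<Rightarrow>\<^sub>L 'w) \<Rightarrow>\<^sub>L 'w) \<Rightarrow>
   real \<Rightarrow> real \<Rightarrow> ('w \<Rightarrow>\<^sub>L 'v \<Rightarrow>\<^sub>L 'w) \<Rightarrow> 'w" where
  "sol_map_z tens S A \<omega> \<omega>2 G T \<xi> y z t s E =
     (let y' = sol_map_y S A \<omega> G T \<xi> y z; J = sewing S T (Xi_z tens S A \<omega> \<omega>2 G y y' E)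
      in J t - S (t - s) (J s) - omS S A \<omega> t s (E (y' s)))"

definition is_fixed_point ::
  "real \<Rightarrow> real \<Rightarrow> ('v \<Rightarrow> 'v \<Rightarrow> 't::banach) \<Rightarrow> (real \<Rightarrow> 'w \<Rightarrow>\<^sub>L 'w) \<Rightarrow> ('w \<Rightarrow> 'w) \<Rightarrow>
   (real \<Rightarrow> 'v::real_normed_vector) \<Rightarrow> (real \<Rightarrow> real \<Rightarrow> 't) \<Rightarrow>
   ('w \<Rightarrow> 'v \<Rightarrow>\<^sub>L 'w::{banach,second_countable_topology}) \<Rightarrow> real \<Rightarrow> 'w \<Rightarrow>
   (real \<Rightarrow> 'w) \<times> (real \<Rightarrow> real \<Rightarrow> ('w \<Rightarrow>\<^sub>L 'v \<Rightarrow>\<^sub>L 'w) \<Rightarrow>\<^sub>L 'w) \<Rightarrow> bool" where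
  "is_fixed_point \<alpha> \<beta> tens S A \<omega> \<omega>2 G T \<xi> p \<longleftrightarrow>
     p \<in> X_space \<alpha> \<beta> S A \<omega> T \<and>
     (case p of (y, z) \<Rightarrow>
        (\<forall>t\<in>{0..T}. sol_map_y S A \<omega> G T \<xi> y z t = y t) \<and>
        (\<forall>(t, s)\<in>Delta T. \<forall>E. sol_map_z tens S A \<omega> \<omega>2 G T \<xi> y z t s E = blinfun_apply (z t s) E))"

end

theory Submission
  imports Defs "HOL-Real_Asymp.Real_Asymp" "HOL-Probability.Characteristic_Functions"
    "HOL-Probability.Sinc_Integral"
begin

text \<open>Along an analytic semigroup the germs \<open>\<Xi>\<^sup>(\<^sup>y\<^sup>)\<close> and \<open>\<Xi>\<^sup>(\<^sup>z\<^sup>)\<close> are sewn by Young's maximal inequality for the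
  additive control \<open>v\<^sup>\<kappa> - u\<^sup>\<kappa>\<close>, which absorbs the singular weight \<open>s\<^sup>-\<^sup>\<beta>\<close> at time \<open>0\<close>. Let \<open>Y\<close>, \<open>Z\<close> be the differences
  of two fixed points that agree up to time \<open>\<tau>\<close>, with \<open>|Y\<^sub>t - S(t - s) Y\<^sub>s| \<le> N (t - s)\<^sup>\<alpha>\<close> and \<open>|Z| \<le> \<eta> N\<close> (weighted)
  on \<open>[\<tau>, \<tau> + h]\<close>. Since \<open>Y\<^sub>\<tau> = 0\<close>, a dyadic telescoping shows that \<open>Y\<close> takes values in the Favard space of
  order \<open>\<beta>\<close> with norm of order \<open>N h\<^sup>\<alpha>\<^sup>-\<^sup>\<beta>\<close>. Every term in the equations for \<open>Y\<close> and \<open>Z\<close> then carries a factor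
  \<open>h\<^sup>\<alpha>\<^sup>-\<^sup>\<beta>\<close> or \<open>\<eta>\<close>, so that for small \<open>\<eta>\<close> and \<open>h\<close>, chosen independently of \<open>\<tau>\<close> and \<open>N\<close>, the bound improves from
  \<open>N\<close> to \<open>N / 2\<close>. Hence \<open>Y = 0\<close> and \<open>Z = 0\<close> on \<open>[\<tau>, \<tau> + h]\<close>, and finitely many steps reach \<open>T\<close>.

  The smoothing bound \<open>|A S(t)| \<le> K / t\<close> is derived from the resolvent estimate of \<open>A\<close>
  and the exponential decay of \<open>S\<close>; domains of fractional powers enter only through their
  embedding into the Favard spaces.\<close>

section \<open>Sewing along partitions\<close>

text \<open>The two components need separate smallness parameters because they improve at different
  rates. The term \<open>z DG(y)\<close> feeds \<open>Z\<close> into the equation for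
  \<open>Y\<close> without any power of \<open>h\<close>, so \<open>Z\<close> is measured in the
  smaller unit \<eta> N; \<eta> is therefore fixed first and \<open>h\<close> afterwards. The
  delicate contribution to \<open>Z\<close> is the integral of
  \<open>S(t - r) E (S(r - s) - Id) Y\<^sub>s\<close> against \<omega>, linear in
  \<open>Y\<^sub>s\<close>. Its order exceeds \<alpha> only if \<open>Y\<^sub>s\<close> has spatial
  regularity, which a general element of the space lacks; a difference vanishing at \<tau> has it
  because it is assembled from increments that the semigroup has already smoothed. Singular weights
  stay attached to time 0 and are not restarted at \<tau>, so the a priori bounds on both solutions
  hold with the same constant on every window. Values \<open>z t s\<close> with \<open>s\<close>
  before and \<open>t\<close> after \<tau> are recovered from the Chen-type relation for
  \<open>z\<close>. The semigroup must be bounded with \<open>|A S(t)| \<le> M / t\<close> for all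
  \<open>t > 0\<close>, not only on bounded intervals: one bound for \<open>A S(t)\<close> on Favard
  spaces is obtained by telescoping to infinite time.\<close>

locale bounded_semigroup =
  fixes S :: "real \<Rightarrow> 'a::banach \<Rightarrow>\<^sub>L 'a" and M :: real
  assumes S_zero: "S 0 = id_blinfun"
    and S_add: "\<And>s t. 0 \<le> s \<Longrightarrow> 0 \<le> t \<Longrightarrow> S (s + t) = S s o\<^sub>L S t"
    and S_norm: "\<And>t. 0 \<le> t \<Longrightarrow> norm (S t) \<le> M"
    and M_ge_1: "1 \<le> M"
begin

lemma S_zero_apply [simp]: "S 0 x = x"
  by (simp add: S_zero)

lemma S_comp: "0 \<le> s \<Longrightarrow> 0 \<le> t \<Longrightarrow> S s (S t x) = S (s + t) x"
  by (simp add: S_add)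

lemma norm_S: "0 \<le> t \<Longrightarrow> norm (S t x) \<le> M * norm x"
  using norm_blinfun[of "S t" x] S_norm[of t]
  by (meson mult_right_mono norm_ge_zero order_trans)

lemma norm_S_le: "0 \<le> t \<Longrightarrow> norm x \<le> B \<Longrightarrow> norm (S t x) \<le> M * B"
  using norm_S[of t x] M_ge_1 by (meson mult_left_mono order_trans zero_le_one)

end

section \<open>Riemann sums over partitions and limits along vanishing mesh\<close>

lemma sew_sum_singleton [simp]: "sew_sum S \<Xi> t [x] = 0"
  by (simp add: sew_sum_def)

lemma sew_sum_Cons2:
  "sew_sum S \<Xi> t (x # y # p) = S (t - y) (\<Xi> y x) + sew_sum S \<Xi> t (y # p)"
  by (simp add: sew_sum_def sum.lessThan_Suc_shift del: sum.lessThan_Suc)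

lemma sew_sum_append:
  "sew_sum S \<Xi> t (p @ m # q) = sew_sum S \<Xi> t (p @ [m]) + sew_sum S \<Xi> t (m # q)"
proof (induction p)
  case (Cons a p)
  show ?case
    using Cons by (cases p) (simp_all add: sew_sum_Cons2)
qed simp

text \<open>Only the two intervals meeting at \<open>m\<close> are affected. For
  \<open>v \<le> t\<close> the right side is minus the defect of the germ at \<open>u\<close>,
  \<open>m\<close>, \<open>v\<close>, transported by \<open>S (t - v)\<close>.\<close>

lemma sew_sum_remove:
  "sew_sum S \<Xi> t (p @ u # m # v # q) - sew_sum S \<Xi> t (p @ u # v # q) =
   S (t - m) (\<Xi> m u) + S (t - v) (\<Xi> v m) - S (t - v) (\<Xi> v u)"
  by (subst (1 2) sew_sum_append) (simp add: sew_sum_Cons2)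

lemma sew_sum_add:
  "sew_sum S (\<lambda>v u. \<Xi> v u + \<Psi> v u) t p = sew_sum S \<Xi> t p + sew_sum S \<Psi> t p"
  by (simp add: sew_sum_def blinfun.add_right sum.distrib)

lemma sew_sum_diff:
  "sew_sum S (\<lambda>v u. \<Xi> v u - \<Psi> v u) t p = sew_sum S \<Xi> t p - sew_sum S \<Psi> t p"
  by (simp add: sew_sum_def blinfun.diff_right sum_subtractf)

lemma partitions_hd_last:
  assumes "p \<in> partitions s t"
  shows "s \<le> t" "set p \<subseteq> {s..t}"
proof -
  have p: "p \<noteq> []" "sorted_wrt (<) p" "hd p = s" "last p = t"
    using assms by (auto simp: partitions_def)
  have sd: "sorted p" using p(2) by (simp add: strict_sorted_iff)
  have 1: "s \<le> x" if "x \<in> set p" for x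
    using sd that p by (cases p) auto
  have 2: "x \<le> t" if "x \<in> set p" for x
    using sd that p by (cases p rule: rev_cases) (auto simp: sorted_append)
  show "set p \<subseteq> {s..t}" using 1 2 by auto
  show "s \<le> t" using 2 p by (metis hd_in_set)
qed

lemma partitions_Cons2:
  "x # y # p \<in> partitions s t \<longleftrightarrow> x = s \<and> s < y \<and> y # p \<in> partitions y t"
  by (auto simp: partitions_def dest: order_less_trans)

lemma partitions_singleton: "[x] \<in> partitions s t \<longleftrightarrow> x = s \<and> x = t"
  by (auto simp: partitions_def)

lemma partitions_append:
  "p @ m # q \<in> partitions s t \<longleftrightarrow> p @ [m] \<in> partitions s m \<and> m # q \<in> partitions m t"
proof (induction p arbitrary: s)
  case Nil
  then show ?case by (cases q) (auto simp: partitions_Cons2 partitions_singleton)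
next
  case (Cons a p)
  show ?case
  proof (cases p)
    case Nil
    then show ?thesis by (auto simp: partitions_Cons2 partitions_singleton)
  next
    case (Cons b p')
    have "b # p' @ m # q \<in> partitions b t \<longleftrightarrow> b # p' @ [m] \<in> partitions b m \<and> m # q \<in> partitions m t"
      using Cons.IH[of b] Cons by simp
    then show ?thesis using Cons by (auto simp: partitions_Cons2)
  qed
qed

lemma partitions_refl: "p \<in> partitions t t \<longleftrightarrow> p = [t]"
proof (cases p)
  case (Cons a q)
  then show ?thesis
    by (cases q) (use partitions_hd_last in \<open>fastforce simp: partitions_Cons2 partitions_singleton\<close>)+
qed (simp add: partitions_def)

lemma partitions_cases:
  assumes "p \<in> partitions s t"
  obtains "p = [s]" "s = t" | y q where "p = s # y # q" "s < y" "y # q \<in> partitions y t"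
  using assms
  by (cases p; cases "tl p") (auto simp: partitions_Cons2 partitions_singleton partitions_def)

text \<open>The first interval is peeled off, and not the last one, because the final time
  \<open>t\<close> enters every summand of \<open>sew_sum\<close> and must stay fixed.\<close>

lemma partitions_induct [consumes 1, case_names refl step]:
  assumes "p \<in> partitions s t"
    and "P t [t]"
    and "\<And>s y q. s < y \<Longrightarrow> y \<le> t \<Longrightarrow> y # q \<in> partitions y t \<Longrightarrow> P y (y # q) \<Longrightarrow> P s (s # y # q)"
  shows "P s p"
  using assms(1)
proof (induction "length p" arbitrary: s p)
  case 0
  then show ?case by (simp add: partitions_def)
next
  case (Suc n)
  from Suc.prems show ?case
  proof (cases rule: partitions_cases)
    case 1
    then show ?thesis using assms(2) by simp
  next
    case (2 y q)
    then show ?thesis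
      using assms(3)[of s y q] Suc.hyps partitions_hd_last(1)[of "y # q" y t] by auto
  qed
qed

lemma partition_split:
  assumes "p \<in> partitions s t" "m \<in> set p"
  obtains q r where "p = q @ m # r" "q @ [m] \<in> partitions s m" "m # r \<in> partitions m t"
  using assms by (metis partitions_append split_list)

lemma partition_of_set:
  assumes "finite F" "F \<subseteq> {s..t}" "s \<in> F" "t \<in> F"
  shows "sorted_list_of_set F \<in> partitions s t"
proof -
  let ?p = "sorted_list_of_set F"
  have set: "set ?p = F" using assms by simp
  have ne: "?p \<noteq> []" using assms by auto
  have sd: "sorted ?p" by simp
  have "hd ?p = s"
  proof (cases ?p)
    case (Cons a q)
    then have "a \<in> F" "a \<le> s" using set sd assms
      by (metis list.set_intros(1), metis assms(3) set sorted_simps(2) Cons set_ConsD order_refl)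
    then show ?thesis using Cons assms by force
  qed (use ne in simp)
  moreover have "last ?p = t"
  proof (cases ?p rule: rev_cases)
    case (snoc q a)
    then have "a \<in> F" using set by (metis in_set_conv_decomp)
    moreover have "t \<le> a" using set sd assms snoc by (fastforce simp: sorted_append)
    ultimately show ?thesis using snoc assms by force
  qed (use ne in simp)
  ultimately show ?thesis using ne by (simp add: partitions_def)
qed

definition mesh_less :: "real \<Rightarrow> real list \<Rightarrow> bool" where
  "mesh_less d p \<longleftrightarrow> (\<forall>i. Suc i < length p \<longrightarrow> p ! Suc i - p ! i < d)"

lemma mesh_less_singleton [simp]: "mesh_less d [x]"
  by (simp add: mesh_less_def)

lemma mesh_less_Cons2: "mesh_less d (x # y # p) \<longleftrightarrow> y - x < d \<and> mesh_less d (y # p)"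
  unfolding mesh_less_def by (auto simp: nth_Cons split: nat.splits)

lemma mesh_less_append: "mesh_less d (p @ m # q) \<longleftrightarrow> mesh_less d (p @ [m]) \<and> mesh_less d (m # q)"
proof (induction p)
  case Nil
  show ?case by simp
next
  case (Cons a p)
  then show ?case by (cases p) (auto simp: mesh_less_Cons2)
qed

text \<open>The sets of partitions of mesh below \<open>d\<close> are directed in \<open>d\<close>,
  so they form a base of the filter.\<close>

lemma eventually_mesh_filter:
  "eventually P (mesh_filter s t) \<longleftrightarrow> (\<exists>d>0. \<forall>p\<in>partitions s t. mesh_less d p \<longrightarrow> P p)"
proof -
  have "eventually P (mesh_filter s t) \<longleftrightarrow>
     (\<exists>d\<in>{0<..}. eventually P (principal
        {p \<in> partitions s t. \<forall>i. Suc i < length p \<longrightarrow> p ! Suc i - p ! i < d}))"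
    unfolding mesh_filter_def
  proof (rule eventually_INF_base)
    fix a b :: real assume "a \<in> {0<..}" "b \<in> {0<..}"
    then show "\<exists>x\<in>{0<..}. principal {p \<in> partitions s t. \<forall>i. Suc i < length p \<longrightarrow> p ! Suc i - p ! i < x} \<le>
        inf (principal {p \<in> partitions s t. \<forall>i. Suc i < length p \<longrightarrow> p ! Suc i - p ! i < a})
          (principal {p \<in> partitions s t. \<forall>i. Suc i < length p \<longrightarrow> p ! Suc i - p ! i < b})"
      by (intro bexI[of _ "min a b"]) auto
  qed auto
  then show ?thesis
    unfolding eventually_principal mesh_less_def by blast
qed

lemma ex_mesh_less_partition:
  assumes "s \<le> t" "0 < d"
  obtains p where "p \<in> partitions s t" "mesh_less d p"
proof -
  \<comment> \<open>Steps of length \<open>d / 2\<close> keep the mesh strictly below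
    \<open>d\<close>; the induction is on the number of steps.\<close>
  have "\<exists>p\<in>partitions s t. mesh_less d p" if "t - s \<le> real n * (d / 2)" "s \<le> t" for n s
    using that
  proof (induction n arbitrary: s)
    case 0
    then have "s = t" by simp
    then show ?case by (auto intro!: bexI[of _ "[t]"] simp: partitions_singleton)
  next
    case (Suc n)
    show ?case
    proof (cases "t - s \<le> d / 2")
      case True
      then show ?thesis
      proof (cases "s = t")
        case True
        then show ?thesis by (auto intro!: bexI[of _ "[t]"] simp: partitions_singleton)
      next
        case False
        then show ?thesis using True Suc.prems assms
          by (auto intro!: bexI[of _ "[s, t]"] simp: partitions_singleton partitions_Cons2 mesh_less_Cons2)
      qed
    next
      case False
      then have "\<exists>p\<in>partitions (s + d/2) t. mesh_less d p"
        using Suc.prems by (intro Suc.IH) (auto simp: algebra_simps)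
      then obtain p where p: "p \<in> partitions (s + d/2) t" "mesh_less d p" by blast
      then obtain q where "p = (s + d/2) # q"
        by (cases rule: partitions_cases) auto
      then show ?thesis using p assms
        by (intro bexI[of _ "s # p"]) (auto simp: partitions_Cons2 mesh_less_Cons2)
    qed
  qed
  moreover obtain n where "(t - s) / (d / 2) \<le> real n"
    using real_arch_simple by blast
  ultimately show ?thesis using assms that by (auto simp: field_simps)
qed

lemma mesh_filter_nontrivial: "s \<le> t \<Longrightarrow> mesh_filter s t \<noteq> bot"
  unfolding trivial_limit_def eventually_mesh_filter
  by (metis ex_mesh_less_partition)

lemma mesh_filter_refl: "(sew_sum S \<Xi> t \<longlongrightarrow> 0) (mesh_filter t t)"
  by (rule tendsto_eventually)
     (auto simp: eventually_mesh_filter partitions_refl intro: exI[of _ 1])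

lemma tendsto_mesh_filter_iff:
  "(f \<longlongrightarrow> L) (mesh_filter s t) \<longleftrightarrow>
     (\<forall>e>0. \<exists>d>0. \<forall>p\<in>partitions s t. mesh_less d p \<longrightarrow> dist (f p) L < e)"
  by (simp add: tendsto_iff eventually_mesh_filter)

lemma mesh_less_mono: "mesh_less d p \<Longrightarrow> d \<le> d' \<Longrightarrow> mesh_less d' p"
  by (fastforce simp: mesh_less_def)

context bounded_semigroup
begin

lemma sew_sum_shift:
  assumes "p \<in> partitions s m" "m \<le> t"
  shows "sew_sum S \<Xi> t p = S (t - m) (sew_sum S \<Xi> m p)"
  using assms
proof (induction rule: partitions_induct)
  case refl
  show ?case by simp
next
  case (step s y q)
  then show ?case by (simp add: sew_sum_Cons2 blinfun.add_right S_comp)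
qed

text \<open>A germ without defect telescopes, so its sums do not depend on the partition. The
  condition on the diagonal is what the one-point partition requires.\<close>

lemma sew_sum_eq_additive:
  assumes "p \<in> partitions s t"
    and "\<And>m. s \<le> m \<Longrightarrow> m \<le> t \<Longrightarrow> J m m = 0"
    and "\<And>u m v. s \<le> u \<Longrightarrow> u < m \<Longrightarrow> m < v \<Longrightarrow> v \<le> t \<Longrightarrow> J v u = J v m + S (v - m) (J m u)"
  shows "sew_sum S J t p = J t s"
  using assms(1) assms(2,3)
proof (induction rule: partitions_induct)
  case refl
  then show ?case by simp
next
  case (step s y q)
  then have "sew_sum S J t (y # q) = J t y" by simp
  moreover have "J t s = J t y + S (t - y) (J y s)"
    using step by (cases "y = t") auto
  ultimately show ?case by (simp add: sew_sum_Cons2)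
qed

text \<open>Fine partitions of the two halves concatenate to a fine partition of the whole, which
  compares all three limits. This compatibility turns the limits on subintervals into one
  path.\<close>

lemma sew_limit_split:
  assumes "s \<le> m" "m \<le> t"
    and L: "(sew_sum S \<Xi> t \<longlongrightarrow> L) (mesh_filter s t)"
    and L1: "(sew_sum S \<Xi> t \<longlongrightarrow> L1) (mesh_filter m t)"
    and L2: "(sew_sum S \<Xi> m \<longlongrightarrow> L2) (mesh_filter s m)"
  shows "L = L1 + S (t - m) L2"
proof (rule ccontr)
  assume "L \<noteq> L1 + S (t - m) L2"
  then have pos: "0 < dist L (L1 + S (t - m) L2)" by simp
  \<comment> \<open>The total error below is less than \<open>e + e + M * e\<close>, at most
    \<open>3 * M * e\<close> since \<open>1 \<le> M\<close>; this is exactly the distance to be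
    contradicted.\<close>
  define e where "e = dist L (L1 + S (t - m) L2) / (3 * M)"
  have e: "e > 0" using pos M_ge_1 by (simp add: e_def)
  obtain d where d: "d > 0" "\<And>p. p \<in> partitions s t \<Longrightarrow> mesh_less d p \<Longrightarrow> dist (sew_sum S \<Xi> t p) L < e"
    using L e unfolding tendsto_mesh_filter_iff by blast
  obtain d1 where d1: "d1 > 0" "\<And>p. p \<in> partitions m t \<Longrightarrow> mesh_less d1 p \<Longrightarrow> dist (sew_sum S \<Xi> t p) L1 < e"
    using L1 e unfolding tendsto_mesh_filter_iff by blast
  obtain d2 where d2: "d2 > 0" "\<And>p. p \<in> partitions s m \<Longrightarrow> mesh_less d2 p \<Longrightarrow> dist (sew_sum S \<Xi> m p) L2 < e"
    using L2 e unfolding tendsto_mesh_filter_iff by blast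
  define d' where "d' = min d (min d1 d2)"
  have d': "0 < d'" using d d1 d2 by (simp add: d'_def)
  obtain p where p: "p \<in> partitions s m" "mesh_less d' p" using ex_mesh_less_partition[OF assms(1) d'] .
  obtain q where q: "q \<in> partitions m t" "mesh_less d' q" using ex_mesh_less_partition[OF assms(2) d'] .
  obtain p' where p': "p = p' @ [m]" using p(1)
    by (cases p rule: rev_cases) (auto simp: partitions_def)
  obtain q' where q': "q = m # q'" using q(1) by (cases rule: partitions_cases) auto
  have pq: "p' @ m # q' \<in> partitions s t" "mesh_less d' (p' @ m # q')"
    using p q p' q' partitions_append[of p' m q' s t] mesh_less_append[of d' p' m q'] by simp_all
  have eq: "sew_sum S \<Xi> t (p' @ m # q') = S (t - m) (sew_sum S \<Xi> m p) + sew_sum S \<Xi> t q"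
    using sew_sum_append[of S \<Xi> t p' m q'] sew_sum_shift[OF p(1) assms(2), of \<Xi>] p' q' by simp
  have 1: "dist (sew_sum S \<Xi> t (p' @ m # q')) L < e"
    using d(2)[OF pq(1)] mesh_less_mono[OF pq(2), of d] by (simp add: d'_def)
  have 2: "dist (sew_sum S \<Xi> t q) L1 < e"
    using d1(2)[OF q(1)] mesh_less_mono[OF q(2), of d1] by (simp add: d'_def)
  have 3: "dist (sew_sum S \<Xi> m p) L2 < e"
    using d2(2)[OF p(1)] mesh_less_mono[OF p(2), of d2] by (simp add: d'_def)
  have 4: "norm (S (t - m) (sew_sum S \<Xi> m p - L2)) \<le> M * e"
    using 3 assms by (intro norm_S_le) (auto simp: dist_norm)
  have "L - (L1 + S (t - m) L2) = (L - sew_sum S \<Xi> t (p' @ m # q')) + (sew_sum S \<Xi> t q - L1)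
      + S (t - m) (sew_sum S \<Xi> m p - L2)"
    by (simp add: eq blinfun.diff_right)
  then have "norm (L - (L1 + S (t - m) L2)) \<le> norm (L - sew_sum S \<Xi> t (p' @ m # q'))
      + norm (sew_sum S \<Xi> t q - L1) + norm (S (t - m) (sew_sum S \<Xi> m p - L2))"
    by (metis norm_triangle_le add_mono norm_triangle_ineq order_refl)
  also have "\<dots> < e + e + M * e"
    using 1 2 4 by (simp add: dist_norm norm_minus_commute)
  also have "\<dots> \<le> 3 * M * e" using e M_ge_1 by simp
  also have "\<dots> = norm (L - (L1 + S (t - m) L2))"
    using M_ge_1 by (simp add: e_def dist_norm)
  finally show False by simp
qed

end

section \<open>Young's maximal inequality and convergence of the sums\<close>

text \<open>Pigeonhole on the overlapping double intervals: every increment of \<open>g\<close> is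
  counted at most twice, so one of the \<open>length p - 2\<close> double intervals carries at most
  the average of \<open>2 * (g t - g s)\<close>. Its midpoint is the cheapest one to delete.\<close>

lemma ex_light_point:
  fixes g :: "real \<Rightarrow> real"
  assumes "p \<in> partitions s t" "2 < length p"
    and mono: "\<And>u v. s \<le> u \<Longrightarrow> u \<le> v \<Longrightarrow> v \<le> t \<Longrightarrow> g u \<le> g v"
  obtains xs u m v ys where "p = xs @ u # m # v # ys"
    "g v - g u \<le> 2 * (g t - g s) / real (length p - 2)"
proof -
  define k where "k = length p - 2"
  have k: "k > 0" "length p = k + 2" using assms by (auto simp: k_def)
  have in_set: "p ! i \<in> {s..t}" if "i < length p" for i
    using partitions_hd_last(2)[OF assms(1)] that nth_mem by blast
  have gb: "g s \<le> g (p ! i)" "g (p ! i) \<le> g t" if "i < length p" for i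
    using in_set[OF that] mono by auto
  have tel: "(\<Sum>i<n. g (p ! (i + 2)) - g (p ! i)) = g (p ! (n + 1)) + g (p ! n) - g (p ! 1) - g (p ! 0)" for n
    by (induction n) auto
  have "\<exists>i<k. g (p ! (i + 2)) - g (p ! i) \<le> 2 * (g t - g s) / real k"
  proof (rule ccontr)
    assume "\<not> ?thesis"
    then have "(\<Sum>i<k. 2 * (g t - g s) / real k) < (\<Sum>i<k. g (p ! (i + 2)) - g (p ! i))"
      using k by (intro sum_strict_mono) (auto simp: not_le)
    also have "\<dots> \<le> 2 * (g t - g s)"
      unfolding tel using gb[of "k + 1"] gb[of k] gb[of 1] gb[of 0] k by simp
    finally show False using k by simp
  qed
  then obtain i where i: "i < k" "g (p ! (i + 2)) - g (p ! i) \<le> 2 * (g t - g s) / real k" by blast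
  have "p = take i p @ p ! i # p ! (i + 1) # p ! (i + 2) # drop (i + 3) p"
    using i k by (simp add: Cons_nth_drop_Suc numeral_3_eq_3 numeral_2_eq_2)
  then show ?thesis using that i k_def by metis
qed

lemma sum_powr_le:
  fixes p :: real
  assumes "1 < p"
  shows "(\<Sum>k<n. 1 / real (Suc k) powr p) \<le> (\<Sum>k. 1 / real (Suc k) powr p)"
proof -
  have "summable (\<lambda>k. real k powr (- p))"
    using assms by (simp add: summable_real_powr_iff)
  then have "summable (\<lambda>k. real (Suc k) powr (- p))"
    by (subst summable_Suc_iff)
  then have "summable (\<lambda>k. 1 / real (Suc k) powr p)"
    by (simp add: powr_minus divide_inverse)
  then show ?thesis by (intro sum_le_suminf) auto
qed

text \<open>This is \<open>2 powr p\<close> times the zeta value at \<open>p\<close>: deleting a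
  point while \<open>k\<close> interior points are left costs a multiple of
  \<open>(2 / k) powr p\<close>.\<close>

definition sew_const :: "real \<Rightarrow> real" where
  "sew_const p = 2 powr p * (\<Sum>k. 1 / real (Suc k) powr p)"

lemma sew_const_nonneg: "1 < p \<Longrightarrow> 0 \<le> sew_const p"
  using sum_powr_le[of p 0] by (simp add: sew_const_def)

locale sewable = bounded_semigroup S M
  for S :: "real \<Rightarrow> 'a::banach \<Rightarrow>\<^sub>L 'a" and M +
  fixes \<Xi> :: "real \<Rightarrow> real \<Rightarrow> 'a" and g :: "real \<Rightarrow> real" and s t p B :: real
  assumes g_mono: "\<And>u v. s \<le> u \<Longrightarrow> u \<le> v \<Longrightarrow> v \<le> t \<Longrightarrow> g u \<le> g v"
    and p_gt_1: "1 < p" and B_nonneg: "0 \<le> B"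
    and defect: "\<And>u m v. s \<le> u \<Longrightarrow> u < m \<Longrightarrow> m < v \<Longrightarrow> v \<le> t \<Longrightarrow>
      norm (\<Xi> v u - \<Xi> v m - S (v - m) (\<Xi> m u)) \<le> B * (g v - g u) powr p"
begin

lemma sub_sewable: "s \<le> s' \<Longrightarrow> t' \<le> t \<Longrightarrow> sewable S M \<Xi> g s' t' p B"
  by unfold_locales (use g_mono p_gt_1 B_nonneg defect in auto)

text \<open>Interior points are deleted one at a time, always the lightest, until only
  \<open>s\<close> and \<open>t\<close> remain; the factor \<open>M\<close> pays for transporting
  each defect to time \<open>t\<close>.\<close>

lemma sew_sum_bound_aux:
  assumes "P \<in> partitions s t" "length P = Suc (Suc n)"
  shows "norm (sew_sum S \<Xi> t P - \<Xi> t s) \<le>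
     M * B * (2 * (g t - g s)) powr p * (\<Sum>k<n. 1 / real (Suc k) powr p)"
  using assms
proof (induction n arbitrary: P)
  case 0
  then have "P = [s, t]"
    by (cases rule: partitions_cases) (auto simp: length_Suc_conv partitions_singleton)
  then show ?case by (simp add: sew_sum_Cons2)
next
  case (Suc n)
  have "2 < length P" using Suc.prems(2) by simp
  then obtain xs u m v ys where P: "P = xs @ u # m # v # ys"
    and gv: "g v - g u \<le> 2 * (g t - g s) / real (length P - 2)"
    by (rule ex_light_point[OF Suc.prems(1) _ g_mono])
  have um: "s \<le> u" "u < m" "m < v" "v \<le> t"
    using Suc.prems(1) partitions_hd_last[OF Suc.prems(1)] partitions_append[of xs u "m # v # ys" s t]
    unfolding P by (auto simp: partitions_Cons2)
  \<comment> \<open>The partition without its light point \<open>m\<close>.\<close>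
  define Q where "Q = xs @ u # v # ys"
  have Q: "Q \<in> partitions s t" "length Q = Suc (Suc n)"
    using Suc.prems um partitions_append[of xs u "m # v # ys" s t] partitions_append[of xs u "v # ys" s t]
    unfolding P Q_def by (auto simp: partitions_Cons2)
  have "sew_sum S \<Xi> t P - sew_sum S \<Xi> t Q = - S (t - v) (\<Xi> v u - \<Xi> v m - S (v - m) (\<Xi> m u))"
    unfolding P Q_def sew_sum_remove using um by (simp add: blinfun.diff_right S_comp)
  then have "norm (sew_sum S \<Xi> t P - sew_sum S \<Xi> t Q) \<le> M * (B * (g v - g u) powr p)"
    using norm_S_le[OF _ defect, of "t - v" u m v] um by simp
  also have "(g v - g u) powr p \<le> (2 * (g t - g s) / real (Suc n)) powr p"
    using gv g_mono[of u v] um p_gt_1 Suc.prems(2) by (intro powr_mono2) auto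
  also have "\<dots> = (2 * (g t - g s)) powr p * (1 / real (Suc n) powr p)"
    using g_mono[of s t] um by (subst powr_divide) auto
  finally have 1: "norm (sew_sum S \<Xi> t P - sew_sum S \<Xi> t Q) \<le>
      M * B * (2 * (g t - g s)) powr p * (1 / real (Suc n) powr p)"
    using B_nonneg M_ge_1 by (simp add: mult_left_mono mult.assoc)
  have "norm (sew_sum S \<Xi> t P - \<Xi> t s) \<le>
      norm (sew_sum S \<Xi> t P - sew_sum S \<Xi> t Q) + norm (sew_sum S \<Xi> t Q - \<Xi> t s)"
    by (metis diff_add_cancel add_diff_eq norm_triangle_ineq)
  also have "\<dots> \<le> M * B * (2 * (g t - g s)) powr p * (\<Sum>k<Suc n. 1 / real (Suc k) powr p)"
    using 1 Suc.IH[OF Q] by (simp add: distrib_left)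
  finally show ?case .
qed

lemma sew_sum_bound:
  assumes "P \<in> partitions s t" "s < t"
  shows "norm (sew_sum S \<Xi> t P - \<Xi> t s) \<le> M * sew_const p * B * (g t - g s) powr p"
proof -
  have len: "2 \<le> length P"
    using assms by (cases rule: partitions_cases) auto
  then obtain n where n: "length P = Suc (Suc n)"
    by (metis add_2_eq_Suc le_Suc_ex)
  have "norm (sew_sum S \<Xi> t P - \<Xi> t s) \<le>
     M * B * (2 * (g t - g s)) powr p * (\<Sum>k<n. 1 / real (Suc k) powr p)"
    by (rule sew_sum_bound_aux[OF assms(1) n])
  also have "\<dots> \<le> M * B * (2 * (g t - g s)) powr p * (\<Sum>k. 1 / real (Suc k) powr p)"
    using sum_powr_le[OF p_gt_1] B_nonneg M_ge_1 by (intro mult_left_mono) auto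
  also have "(2 * (g t - g s)) powr p = 2 powr p * (g t - g s) powr p"
    using g_mono[of s t] assms by (simp add: powr_mult del: right_diff_distrib_numeral)
  finally show ?thesis by (simp add: sew_const_def mult_ac)
qed

lemma sew_bound:
  assumes "(sew_sum S \<Xi> t \<longlongrightarrow> L) (mesh_filter s t)" "s < t"
  shows "norm (L - \<Xi> t s) \<le> M * sew_const p * B * (g t - g s) powr p"
proof (rule tendsto_upperbound)
  show "((\<lambda>P. norm (sew_sum S \<Xi> t P - \<Xi> t s)) \<longlongrightarrow> norm (L - \<Xi> t s)) (mesh_filter s t)"
    by (intro tendsto_intros assms)
  show "\<forall>\<^sub>F P in mesh_filter s t. norm (sew_sum S \<Xi> t P - \<Xi> t s) \<le> M * sew_const p * B * (g t - g s) powr p"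
    unfolding eventually_mesh_filter using sew_sum_bound[OF _ assms(2)] by (auto intro: exI[of _ 1])
qed (use assms mesh_filter_nontrivial in auto)

end

text \<open>Cuts a refinement \<open>Q\<close> at the second point of the coarse partition, which is
  what the interval-by-interval induction in \<open>sew_sum_refine\<close> consumes.\<close>

lemma sorted_wrt_split_insert:
  assumes "set (x # y # P) \<subseteq> set Q" "x # y # P \<in> partitions x t" "Q \<in> partitions x t"
  obtains Q1 Q2 where "Q = Q1 @ y # Q2" "Q1 @ [y] \<in> partitions x y" "y # Q2 \<in> partitions y t"
    "set (y # P) \<subseteq> set (y # Q2)"
proof -
  have "y \<in> set Q" using assms by auto
  then obtain Q1 Q2 where Q: "Q = Q1 @ y # Q2" "Q1 @ [y] \<in> partitions x y" "y # Q2 \<in> partitions y t"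
    using partition_split[OF assms(3)] by metis
  have "z \<in> set (y # Q2)" if "z \<in> set (y # P)" for z
  proof -
    have "y # P \<in> partitions y t" using assms(2) by (simp add: partitions_Cons2)
    then have "y \<le> z" using partitions_hd_last(2)[of "y # P" y t] that by auto
    moreover have "z \<in> set Q" using assms(1) that by auto
    moreover have "sorted_wrt (<) Q" using assms(3) by (simp add: partitions_def)
    ultimately show ?thesis using Q(1) by (fastforce simp: sorted_wrt_append)
  qed
  then show ?thesis using that Q by blast
qed

context bounded_semigroup
begin

text \<open>The maximal inequality is applied on each interval of the coarse partition. Of the
  \<open>p\<close> powers of the control, \<open>p - 1\<close> are estimated by the small increment
  \<open>e\<close>, and the remaining one sums to \<open>g t - g s\<close>.\<close>

lemma sew_sum_refine:
  assumes "P \<in> partitions s t" "Q \<in> partitions s t" "set P \<subseteq> set Q" "sewable S M \<Xi> g s t p B"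
    and "mesh_less d P" "\<And>u v. s \<le> u \<Longrightarrow> u < v \<Longrightarrow> v \<le> t \<Longrightarrow> v - u < d \<Longrightarrow> g v - g u \<le> e"
  shows "norm (sew_sum S \<Xi> t Q - sew_sum S \<Xi> t P) \<le>
     M * (M * sew_const p * B) * e powr (p - 1) * (g t - g s)"
  using assms
proof (induction arbitrary: Q rule: partitions_induct)
  case refl
  then show ?case by (simp add: partitions_refl)
next
  case (step s y P)
  interpret sewable S M \<Xi> g s t p B by fact
  obtain Q1 Q2 where Q: "Q = Q1 @ y # Q2" "Q1 @ [y] \<in> partitions s y" "y # Q2 \<in> partitions y t"
    "set (y # P) \<subseteq> set (y # Q2)"
    using sorted_wrt_split_insert[of s y P Q t] step by (auto simp: partitions_Cons2)
  have yt: "y \<le> t" using partitions_hd_last(1)[OF Q(3)] .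
  interpret sub: sewable S M \<Xi> g s y p B using sub_sewable[of s y] yt by simp
  have IH: "norm (sew_sum S \<Xi> t (y # Q2) - sew_sum S \<Xi> t (y # P)) \<le>
     M * (M * sew_const p * B) * e powr (p - 1) * (g t - g y)"
    using step Q sub_sewable[of y t] by (intro step.IH) (auto simp: mesh_less_Cons2)
  have ge: "g y - g s \<le> e" using step yt by (auto simp: mesh_less_Cons2)
  have g0: "0 \<le> g y - g s" using g_mono[of s y] step yt by auto
  have "norm (sew_sum S \<Xi> y (Q1 @ [y]) - \<Xi> y s) \<le> M * sew_const p * B * (g y - g s) powr p"
    using sub.sew_sum_bound[OF Q(2)] step by auto
  also have "(g y - g s) powr p = (g y - g s) powr (p - 1) * (g y - g s)"
    using g0 by (cases "g y - g s = 0") (auto simp: powr_diff)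
  also have "\<dots> \<le> e powr (p - 1) * (g y - g s)"
    using g0 ge p_gt_1 by (intro mult_right_mono powr_mono2) auto
  finally have 1: "norm (sew_sum S \<Xi> y (Q1 @ [y]) - \<Xi> y s) \<le>
      M * sew_const p * B * e powr (p - 1) * (g y - g s)"
    using M_ge_1 B_nonneg sew_const_nonneg[OF p_gt_1] by (simp add: mult_left_mono mult.assoc)
  have 2: "sew_sum S \<Xi> t Q - sew_sum S \<Xi> t (s # y # P) =
      S (t - y) (sew_sum S \<Xi> y (Q1 @ [y]) - \<Xi> y s) + (sew_sum S \<Xi> t (y # Q2) - sew_sum S \<Xi> t (y # P))"
    unfolding Q(1) by (subst sew_sum_append)
      (simp add: sew_sum_Cons2 sew_sum_shift[OF Q(2) yt] blinfun.diff_right)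
  have "norm (sew_sum S \<Xi> t Q - sew_sum S \<Xi> t (s # y # P)) \<le>
      M * (M * sew_const p * B * e powr (p - 1) * (g y - g s)) +
      M * (M * sew_const p * B) * e powr (p - 1) * (g t - g y)"
    unfolding 2 using norm_S_le[OF _ 1, of "t - y"] IH yt by (intro norm_triangle_le add_mono) auto
  also have "\<dots> = M * (M * sew_const p * B) * e powr (p - 1) * (g t - g s)"
    by (simp add: algebra_simps)
  finally show ?case .
qed

end

context sewable
begin

text \<open>Both sums are compared with the one over the common refinement, hence the factor
  2.\<close>

lemma sew_sum_compare:
  assumes "P \<in> partitions s t" "Q \<in> partitions s t" "mesh_less d P" "mesh_less d Q"
    and "\<And>u v. s \<le> u \<Longrightarrow> u < v \<Longrightarrow> v \<le> t \<Longrightarrow> v - u < d \<Longrightarrow> g v - g u \<le> e"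
  shows "norm (sew_sum S \<Xi> t Q - sew_sum S \<Xi> t P) \<le>
     2 * (M * (M * sew_const p * B) * e powr (p - 1) * (g t - g s))"
proof -
  define R where "R = sorted_list_of_set (set P \<union> set Q)"
  have "s \<in> set P" "t \<in> set P"
    using assms(1) by (auto simp: partitions_def)
  then have R: "R \<in> partitions s t" unfolding R_def
    using partitions_hd_last(2)[OF assms(1)] partitions_hd_last(2)[OF assms(2)]
    by (intro partition_of_set) auto
  have set: "set R = set P \<union> set Q" by (simp add: R_def)
  have 1: "norm (sew_sum S \<Xi> t R - sew_sum S \<Xi> t P) \<le>
     M * (M * sew_const p * B) * e powr (p - 1) * (g t - g s)"
    using assms set R sewable_axioms by (intro sew_sum_refine[where d = d and e = e]) auto
  have 2: "norm (sew_sum S \<Xi> t R - sew_sum S \<Xi> t Q) \<le>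
     M * (M * sew_const p * B) * e powr (p - 1) * (g t - g s)"
    using assms set R sewable_axioms by (intro sew_sum_refine[where d = d and e = e]) auto
  have "norm (sew_sum S \<Xi> t Q - sew_sum S \<Xi> t P) \<le>
    norm (sew_sum S \<Xi> t R - sew_sum S \<Xi> t P) + norm (sew_sum S \<Xi> t R - sew_sum S \<Xi> t Q)"
    using norm_triangle_ineq4[of "sew_sum S \<Xi> t R - sew_sum S \<Xi> t P" "sew_sum S \<Xi> t R - sew_sum S \<Xi> t Q"]
    by simp
  then show ?thesis using 1 2 by simp
qed

lemma uniform_small_increments:
  assumes "continuous_on {s..t} g" "0 < e"
  obtains d where "0 < d" "\<And>u v. s \<le> u \<Longrightarrow> u < v \<Longrightarrow> v \<le> t \<Longrightarrow> v - u < d \<Longrightarrow> g v - g u \<le> e"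
proof -
  have "uniformly_continuous_on {s..t} g"
    using assms by (intro compact_uniformly_continuous) auto
  then obtain d where "d > 0" "\<And>u v. u \<in> {s..t} \<Longrightarrow> v \<in> {s..t} \<Longrightarrow> dist v u < d \<Longrightarrow> dist (g v) (g u) < e"
    using assms(2) unfolding uniformly_continuous_on_def by metis
  note d = this
  have "g v - g u \<le> e" if "s \<le> u" "u < v" "v \<le> t" "v - u < d" for u v
    using that d(2)[of u v] by (simp add: dist_real_def)
  then show ?thesis using that d(1) by blast
qed

lemma sew_limit_exists:
  assumes cont: "continuous_on {s..t} g" and st: "s \<le> t"
  obtains L where "(sew_sum S \<Xi> t \<longlongrightarrow> L) (mesh_filter s t)"
proof -
  define K where "K = 2 * (M * (M * sew_const p * B) * (g t - g s))"
  have K: "0 \<le> K" unfolding K_def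
    using M_ge_1 B_nonneg sew_const_nonneg[OF p_gt_1] g_mono[of s t] st by simp
  have small: "\<exists>d>0. \<forall>P\<in>partitions s t. \<forall>Q\<in>partitions s t. mesh_less d P \<longrightarrow> mesh_less d Q \<longrightarrow>
      dist (sew_sum S \<Xi> t Q) (sew_sum S \<Xi> t P) < e" if e: "e > 0" for e
  proof -
    \<comment> \<open>Solves \<open>(K + 1) * e' powr (p - 1) = e\<close>; adding 1 keeps the
      quotient meaningful when \<open>K = 0\<close>.\<close>
    define e' where "e' = (e / (K + 1)) powr (1 / (p - 1))"
    have e': "e' > 0" using e K by (simp add: e'_def)
    obtain d where d: "d > 0" "\<And>u v. s \<le> u \<Longrightarrow> u < v \<Longrightarrow> v \<le> t \<Longrightarrow> v - u < d \<Longrightarrow> g v - g u \<le> e'"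
      using uniform_small_increments[OF cont e'] by metis
    have "K * e' powr (p - 1) < e"
      using e K p_gt_1 by (simp add: e'_def powr_powr field_simps)
    moreover have "dist (sew_sum S \<Xi> t Q) (sew_sum S \<Xi> t P) \<le> K * e' powr (p - 1)"
      if "P \<in> partitions s t" "Q \<in> partitions s t" "mesh_less d P" "mesh_less d Q" for P Q
      using sew_sum_compare[OF that d(2)] unfolding dist_norm K_def by (simp only: mult_ac)
    ultimately show ?thesis using d(1) by (intro exI[of _ d]) (auto intro: le_less_trans)
  qed
  \<comment> \<open>The mesh filter is not sequential, so a candidate for the limit is first
    obtained along one sequence of partitions; the uniform estimate \<open>small\<close> then
    extends convergence to the filter.\<close>
  have "\<exists>P. \<forall>n. P n \<in> partitions s t \<and> mesh_less (1 / real (Suc n)) (P n)"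
    by (intro choice allI) (metis ex_mesh_less_partition[OF st] of_nat_0_less_iff zero_less_Suc zero_less_divide_1_iff)
  then obtain P where P: "\<And>n. P n \<in> partitions s t" "\<And>n. mesh_less (1 / real (Suc n)) (P n)" by metis
  have ev: "\<exists>N. \<forall>n\<ge>N. mesh_less d (P n)" if "d > 0" for d
  proof -
    obtain N where N: "1 / real (Suc N) < d" using nat_approx_posE[OF \<open>d > 0\<close>] by blast
    have "mesh_less d (P n)" if "n \<ge> N" for n
    proof -
      have "1 / real (Suc n) \<le> 1 / real (Suc N)" using that by (intro divide_left_mono) auto
      then show ?thesis using mesh_less_mono[OF P(2)[of n], of d] N by linarith
    qed
    then show ?thesis by blast
  qed
  have "Cauchy (\<lambda>n. sew_sum S \<Xi> t (P n))"
    unfolding Cauchy_def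
  proof (intro allI impI)
    fix e :: real assume "e > 0"
    then obtain d where d: "d > 0" "\<And>P Q. P \<in> partitions s t \<Longrightarrow> Q \<in> partitions s t \<Longrightarrow>
        mesh_less d P \<Longrightarrow> mesh_less d Q \<Longrightarrow> dist (sew_sum S \<Xi> t Q) (sew_sum S \<Xi> t P) < e"
      using small by meson
    then show "\<exists>N. \<forall>m\<ge>N. \<forall>n\<ge>N. dist (sew_sum S \<Xi> t (P m)) (sew_sum S \<Xi> t (P n)) < e"
      using ev[OF d(1)] P(1) by meson
  qed
  then obtain L where L: "(\<lambda>n. sew_sum S \<Xi> t (P n)) \<longlonglongrightarrow> L"
    using Cauchy_convergent convergent_def by blast
  have "(sew_sum S \<Xi> t \<longlongrightarrow> L) (mesh_filter s t)"
    unfolding tendsto_mesh_filter_iff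
  proof (intro allI impI)
    fix e :: real assume "e > 0"
    then have e2: "e / 2 > 0" by simp
    obtain d where d: "d > 0" "\<And>P Q. P \<in> partitions s t \<Longrightarrow> Q \<in> partitions s t \<Longrightarrow>
        mesh_less d P \<Longrightarrow> mesh_less d Q \<Longrightarrow> dist (sew_sum S \<Xi> t Q) (sew_sum S \<Xi> t P) < e / 2"
      using small[OF e2] by meson
    obtain N where N: "\<And>n. n \<ge> N \<Longrightarrow> mesh_less d (P n)" using ev[OF d(1)] by blast
    obtain N' where N': "\<And>n. n \<ge> N' \<Longrightarrow> dist (sew_sum S \<Xi> t (P n)) L < e / 2"
      using L e2 unfolding lim_sequentially by blast
    define n where "n = max N N'"
    have "dist (sew_sum S \<Xi> t Q) L < e" if "Q \<in> partitions s t" "mesh_less d Q" for Q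
      using d(2)[OF P(1)[of n] that(1) N that(2)] N'[of n] dist_triangle[of "sew_sum S \<Xi> t Q" L "sew_sum S \<Xi> t (P n)"]
      by (simp add: n_def)
    then show "\<exists>d>0. \<forall>p\<in>partitions s t. mesh_less d p \<longrightarrow> dist (sew_sum S \<Xi> t p) L < e"
      using d(1) by blast
  qed
  then show ?thesis by (rule that)
qed

end

context bounded_semigroup
begin

text \<open>A germ of order above 1 contributes nothing in the limit. Hence two germs that differ by
  such a term are sewn to the same path.\<close>

lemma sew_limit_zero:
  assumes mono: "\<And>u v. s \<le> u \<Longrightarrow> u \<le> v \<Longrightarrow> v \<le> t \<Longrightarrow> g u \<le> g v"
    and cont: "continuous_on {s..t} g" and "s \<le> t" "1 < p" "0 \<le> B"
    and bound: "\<And>u v. s \<le> u \<Longrightarrow> u < v \<Longrightarrow> v \<le> t \<Longrightarrow> norm (\<Xi> v u) \<le> B * (g v - g u) powr p"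
  shows "(sew_sum S \<Xi> t \<longlongrightarrow> 0) (mesh_filter s t)"
proof -
  \<comment> \<open>The zero germ gives access to \<open>uniform_small_increments\<close>, which
    concerns the control alone.\<close>
  interpret z: sewable S M "\<lambda>_ _. 0" g s t p 0
    using assms by unfold_locales auto
  have est: "norm (sew_sum S \<Xi> t P) \<le> M * B * e powr (p - 1) * (g t - g s)"
    if "P \<in> partitions s t" "mesh_less d P" "\<And>u v. s \<le> u \<Longrightarrow> u < v \<Longrightarrow> v \<le> t \<Longrightarrow> v - u < d \<Longrightarrow> g v - g u \<le> e" for P d e
    using that mono bound
  proof (induction rule: partitions_induct)
    case refl
    then show ?case by simp
  next
    case (step s y q)
    have g0: "0 \<le> g y - g s" using step by auto
    have ge: "g y - g s \<le> e" using step by (auto simp: mesh_less_Cons2)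
    have "norm (\<Xi> y s) \<le> B * (g y - g s) powr p" using step by auto
    also have "(g y - g s) powr p = (g y - g s) powr (p - 1) * (g y - g s)"
      using g0 by (cases "g y - g s = 0") (auto simp: powr_diff)
    also have "\<dots> \<le> e powr (p - 1) * (g y - g s)"
      using g0 ge \<open>1 < p\<close> by (intro mult_right_mono powr_mono2) auto
    finally have "norm (\<Xi> y s) \<le> B * (e powr (p - 1) * (g y - g s))"
      using \<open>0 \<le> B\<close> by (simp add: mult_left_mono)
    then have 1: "norm (S (t - y) (\<Xi> y s)) \<le> M * (B * (e powr (p - 1) * (g y - g s)))"
      using step by (intro norm_S_le) auto
    have "norm (sew_sum S \<Xi> t (y # q)) \<le> M * B * e powr (p - 1) * (g t - g y)"
      using step by (intro step.IH) (auto simp: mesh_less_Cons2)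
    then have "norm (sew_sum S \<Xi> t (s # y # q)) \<le>
      M * (B * (e powr (p - 1) * (g y - g s))) + M * B * e powr (p - 1) * (g t - g y)"
      unfolding sew_sum_Cons2 using 1 by (intro norm_triangle_le add_mono)
    then show ?case by (simp add: algebra_simps)
  qed
  define K where "K = M * B * (g t - g s)"
  have K: "0 \<le> K" unfolding K_def using M_ge_1 assms mono[of s t] by simp
  show ?thesis
    unfolding tendsto_mesh_filter_iff
  proof (intro allI impI)
    fix e :: real assume e: "e > 0"
    define e' where "e' = (e / (K + 1)) powr (1 / (p - 1))"
    have e': "e' > 0" using e K by (simp add: e'_def)
    obtain d where d: "d > 0" "\<And>u v. s \<le> u \<Longrightarrow> u < v \<Longrightarrow> v \<le> t \<Longrightarrow> v - u < d \<Longrightarrow> g v - g u \<le> e'"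
      using z.uniform_small_increments[OF cont e'] by metis
    have "K * e' powr (p - 1) < e"
      using e K \<open>1 < p\<close> by (simp add: e'_def powr_powr field_simps)
    moreover have "norm (sew_sum S \<Xi> t P) \<le> K * e' powr (p - 1)"
      if "P \<in> partitions s t" "mesh_less d P" for P
      using est[OF that d(2)] by (simp add: K_def mult_ac)
    ultimately show "\<exists>d>0. \<forall>p\<in>partitions s t. mesh_less d p \<longrightarrow> dist (sew_sum S \<Xi> t p) 0 < e"
      using d(1) by (intro exI[of _ d]) (auto intro: le_less_trans)
  qed
qed

end

section \<open>Weights that are singular at an initial time\<close>

text \<open>The quotient has \<open>v\<close> and not \<open>u\<close> in the denominator: it never
  exceeds 1 on ordered nonnegative times, equals 1 at \<open>u = 0\<close>, and is comparable to
  \<open>(v - u) / u\<close> when \<open>v - u\<close> is small against \<open>u\<close>. One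
  expression thus covers both the unweighted and the weighted norm.\<close>

definition weight :: "real \<Rightarrow> real \<Rightarrow> real \<Rightarrow> real \<Rightarrow> real" where
  "weight a b v u = (v - u) powr a * ((v - u) / v) powr b"

text \<open>The weight is comparable to a power of the additive control \<open>v\<^sup>\<kappa> - u\<^sup>\<kappa>\<close> with
  \<open>\<kappa> = a / (a + b)\<close>, so that the singularity at \<open>u = 0\<close> needs no separate treatment.\<close>

lemma weight_control:
  assumes "0 \<le> u" "u < v" "0 < a" "0 \<le> b"
  defines "k \<equiv> a / (a + b)"
  shows "weight a b v u \<le> (1 / k) powr (a + b) * (v powr k - u powr k) powr (a + b)"
    and "(v powr k - u powr k) powr (a + b) \<le> weight a b v u"
proof -
  have k: "0 < k" "k \<le> 1" using assms by (auto simp: k_def field_simps)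
  have ab: "a + b > 0" "k * (a + b) = a" using assms by (auto simp: k_def)
  \<comment> \<open>The choice of \<open>k\<close> makes \<open>(k - 1) * (a + b) = - b\<close>, so
    both factors of the weight become one power.\<close>
  have eq: "weight a b v u = ((v - u) * v powr (k - 1)) powr (a + b)"
  proof -
    have "((v - u) * v powr (k - 1)) powr (a + b) = (v - u) powr (a + b) * v powr ((k - 1) * (a + b))"
      using assms by (simp add: powr_mult powr_powr)
    also have "(k - 1) * (a + b) = - b" using ab(2) by (simp add: algebra_simps)
    finally have "((v - u) * v powr (k - 1)) powr (a + b) = (v - u) powr a * (v - u) powr b * (1 / v powr b)"
      using assms by (simp add: powr_add powr_minus_divide)
    then show ?thesis using assms by (simp add: weight_def powr_divide)
  qed
  \<comment> \<open>Mean value theorem: the derivative of \<open>x powr k\<close> decreases since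
    \<open>k \<le> 1\<close>, so its value at \<open>v\<close> is a lower bound.\<close>
  have lower: "k * ((v - u) * v powr (k - 1)) \<le> v powr k - u powr k"
  proof -
    have "\<exists>l z. u < z \<and> z < v \<and> ((\<lambda>x. x powr k) has_real_derivative l) (at z) \<and> v powr k - u powr k = (v - u) * l"
    proof (rule MVT)
      show "u < v" by fact
      show "continuous_on {u..v} (\<lambda>x. x powr k)"
        using assms(1) k by (intro continuous_on_powr' continuous_intros) auto
      show "(\<lambda>x. x powr k) differentiable (at x)" if "u < x" "x < v" for x
        using that assms(1) has_real_derivative_powr[of x k] real_differentiable_def by fastforce
    qed
    then obtain l z where z: "u < z" "z < v" "((\<lambda>x. x powr k) has_real_derivative l) (at z)"
      "v powr k - u powr k = (v - u) * l" by blast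
    have "((\<lambda>x. x powr k) has_real_derivative k * z powr (k - 1)) (at z)"
      using z assms by (auto intro!: derivative_eq_intros)
    then have l: "l = k * z powr (k - 1)" using z(3) DERIV_unique by blast
    have "v powr (k - 1) \<le> z powr (k - 1)"
      using z k assms by (intro powr_mono2') auto
    then have "(v - u) * (k * v powr (k - 1)) \<le> (v - u) * (k * z powr (k - 1))"
      using assms(1,2) k(1) by (intro mult_left_mono) auto
    then show ?thesis unfolding z(4) l by (simp add: mult_ac)
  qed
  have upper: "v powr k - u powr k \<le> (v - u) * v powr (k - 1)"
  proof -
    have "u * v powr (k - 1) \<le> u powr k"
    proof (cases "u = 0")
      case False
      then have "v powr (k - 1) \<le> u powr (k - 1)"
        using k assms by (intro powr_mono2') auto
      then have "u * v powr (k - 1) \<le> u * u powr (k - 1)" using assms by (simp add: mult_left_mono)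
      then show ?thesis using False assms by (simp add: powr_mult_base)
    qed simp
    moreover have "v * v powr (k - 1) = v powr k" using assms by (simp add: powr_mult_base)
    ultimately show ?thesis by (simp add: left_diff_distrib)
  qed
  have nn: "0 \<le> k * ((v - u) * v powr (k - 1))" using assms k by simp
  show "(v powr k - u powr k) powr (a + b) \<le> weight a b v u"
    unfolding eq using upper lower nn ab by (intro powr_mono2) auto
  have "(v - u) * v powr (k - 1) \<le> (1 / k) * (v powr k - u powr k)"
    using lower k by (simp add: field_simps)
  then have "weight a b v u \<le> ((1 / k) * (v powr k - u powr k)) powr (a + b)"
    unfolding eq using ab assms by (intro powr_mono2) auto
  also have "\<dots> = (1 / k) powr (a + b) * (v powr k - u powr k) powr (a + b)"
    using k lower nn by (subst powr_mult) auto
  finally show "weight a b v u \<le> (1 / k) powr (a + b) * (v powr k - u powr k) powr (a + b)" .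
qed

lemma weight_nonneg: "0 \<le> weight a b v u"
  by (simp add: weight_def)

text \<open>The last factor is the price for passing from the weight to the additive
  control.\<close>

definition wsew_const :: "real \<Rightarrow> real \<Rightarrow> real \<Rightarrow> real" where
  "wsew_const M a b = M * sew_const (a + b) * (1 / (a / (a + b))) powr (a + b)"

context bounded_semigroup
begin

text \<open>The time \<open>r\<close> of the singularity is kept apart from the left end
  \<open>s\<close>: it is 0 for the fixed-point equations and \<open>s\<close> itself for the
  supporting processes.\<close>

lemma weight_sewable:
  assumes "r \<le> s" "0 < a" "0 \<le> b" "1 < a + b" "0 \<le> B"
    and "\<And>u m v. s \<le> u \<Longrightarrow> u < m \<Longrightarrow> m < v \<Longrightarrow> v \<le> t \<Longrightarrow>
      norm (\<Xi> v u - \<Xi> v m - S (v - m) (\<Xi> m u)) \<le> B * weight a b (v - r) (u - r)"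
  shows "sewable S M \<Xi> (\<lambda>x. (x - r) powr (a / (a + b))) s t (a + b) (B * (1 / (a / (a + b))) powr (a + b))"
proof (unfold_locales)
  fix u m v assume *: "s \<le> u" "u < m" "m < v" "v \<le> t"
  have "norm (\<Xi> v u - \<Xi> v m - S (v - m) (\<Xi> m u)) \<le> B * weight a b (v - r) (u - r)"
    using assms * by auto
  also have "\<dots> \<le> B * ((1 / (a / (a + b))) powr (a + b) *
      ((v - r) powr (a / (a + b)) - (u - r) powr (a / (a + b))) powr (a + b))"
    using weight_control(1)[of "u - r" "v - r" a b] assms * by (intro mult_left_mono) auto
  finally show "norm (\<Xi> v u - \<Xi> v m - S (v - m) (\<Xi> m u)) \<le> B * (1 / (a / (a + b))) powr (a + b) *
      ((v - r) powr (a / (a + b)) - (u - r) powr (a / (a + b))) powr (a + b)"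
    by (simp add: mult.assoc)
next
  show "(u - r) powr (a / (a + b)) \<le> (v - r) powr (a / (a + b))" if "s \<le> u" "u \<le> v" for u v
    using that assms by (intro powr_mono2) auto
qed (use assms in auto)

lemma continuous_on_shifted_powr:
  "r \<le> s \<Longrightarrow> 0 < k \<Longrightarrow> continuous_on {s..t} (\<lambda>x. (x - r) powr k)" for r s t k :: real
  by (intro continuous_on_powr' continuous_intros) auto

lemma weight_sew_exists:
  assumes "s \<le> t" "r \<le> s" "0 < a" "0 \<le> b" "1 < a + b" "0 \<le> B"
    and "\<And>u m v. s \<le> u \<Longrightarrow> u < m \<Longrightarrow> m < v \<Longrightarrow> v \<le> t \<Longrightarrow>
      norm (\<Xi> v u - \<Xi> v m - S (v - m) (\<Xi> m u)) \<le> B * weight a b (v - r) (u - r)"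
  obtains L where "(sew_sum S \<Xi> t \<longlongrightarrow> L) (mesh_filter s t)"
proof (rule sewable.sew_limit_exists[OF weight_sewable[OF assms(2-7)] _ assms(1)])
  show "continuous_on {s..t} (\<lambda>x. (x - r) powr (a / (a + b)))"
    using assms by (intro continuous_on_shifted_powr) auto
qed (use that in auto)

lemma weight_sew_bound:
  assumes "(sew_sum S \<Xi> t \<longlongrightarrow> L) (mesh_filter s t)"
    and "s < t" "r \<le> s" "0 < a" "0 \<le> b" "1 < a + b" "0 \<le> B"
    and "\<And>u m v. s \<le> u \<Longrightarrow> u < m \<Longrightarrow> m < v \<Longrightarrow> v \<le> t \<Longrightarrow>
      norm (\<Xi> v u - \<Xi> v m - S (v - m) (\<Xi> m u)) \<le> B * weight a b (v - r) (u - r)"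
  shows "norm (L - \<Xi> t s) \<le> wsew_const M a b * B * weight a b (t - r) (s - r)"
proof -
  have "norm (L - \<Xi> t s) \<le> M * sew_const (a + b) * (B * (1 / (a / (a + b))) powr (a + b)) *
      ((t - r) powr (a / (a + b)) - (s - r) powr (a / (a + b))) powr (a + b)"
    by (rule sewable.sew_bound[OF weight_sewable[OF assms(3-8)] assms(1,2)])
  also have "\<dots> \<le> M * sew_const (a + b) * (B * (1 / (a / (a + b))) powr (a + b)) * weight a b (t - r) (s - r)"
    using weight_control(2)[of "s - r" "t - r" a b] assms M_ge_1 sew_const_nonneg[of "a + b"]
    by (intro mult_left_mono) auto
  finally show ?thesis by (simp add: wsew_const_def mult_ac)
qed

lemma weight_sew_zero:
  assumes "s \<le> t" "r \<le> s" "0 < a" "0 \<le> b" "1 < a + b" "0 \<le> B"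
    and bound: "\<And>u v. s \<le> u \<Longrightarrow> u < v \<Longrightarrow> v \<le> t \<Longrightarrow> norm (\<Xi> v u) \<le> B * weight a b (v - r) (u - r)"
  shows "(sew_sum S \<Xi> t \<longlongrightarrow> 0) (mesh_filter s t)"
proof (rule sew_limit_zero[where g = "\<lambda>x. (x - r) powr (a / (a + b))" and p = "a + b"
      and B = "B * (1 / (a / (a + b))) powr (a + b)"])
  show "(u - r) powr (a / (a + b)) \<le> (v - r) powr (a / (a + b))" if "s \<le> u" "u \<le> v" for u v
    using that assms by (intro powr_mono2) auto
  show "continuous_on {s..t} (\<lambda>x. (x - r) powr (a / (a + b)))"
    using assms by (intro continuous_on_shifted_powr) auto
  fix u v assume *: "s \<le> u" "u < v" "v \<le> t"
  have "norm (\<Xi> v u) \<le> B * ((1 / (a / (a + b))) powr (a + b) *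
      ((v - r) powr (a / (a + b)) - (u - r) powr (a / (a + b))) powr (a + b))"
    using weight_control(1)[of "u - r" "v - r" a b] assms *
    by (intro order_trans[OF bound] mult_left_mono) auto
  then show "norm (\<Xi> v u) \<le> B * (1 / (a / (a + b))) powr (a + b) *
      ((v - r) powr (a / (a + b)) - (u - r) powr (a / (a + b))) powr (a + b)"
    by (simp add: mult.assoc)
qed (use assms in auto)

text \<open>Existence of the limits on all subintervals is enough for the definite description to
  denote, since \<open>sew_limit_split\<close> makes the limits compatible and the limits over
  \<open>[0, t]\<close> form the required path.\<close>

lemma sewing_eqI:
  assumes "0 \<le> T"
    and "\<And>s t. 0 \<le> s \<Longrightarrow> s \<le> t \<Longrightarrow> t \<le> T \<Longrightarrow> \<exists>L. (sew_sum S \<Xi> t \<longlongrightarrow> L) (mesh_filter s t)"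
  shows "sewing S T \<Xi> 0 = 0"
    and "\<And>s t. 0 \<le> s \<Longrightarrow> s \<le> t \<Longrightarrow> t \<le> T \<Longrightarrow>
      (sew_sum S \<Xi> t \<longlongrightarrow> sewing S T \<Xi> t - S (t - s) (sewing S T \<Xi> s)) (mesh_filter s t)"
proof -
  define J where "J s t = (SOME L. (sew_sum S \<Xi> t \<longlongrightarrow> L) (mesh_filter s t))" for s t
  have J: "(sew_sum S \<Xi> t \<longlongrightarrow> J s t) (mesh_filter s t)" if "0 \<le> s" "s \<le> t" "t \<le> T" for s t
    unfolding J_def using someI_ex[OF assms(2)[OF that]] .
  define I where "I t = (if t \<in> {0..T} then J 0 t else 0)" for t
  let ?P = "\<lambda>I. I 0 = 0 \<and> (\<forall>t. t \<notin> {0..T} \<longrightarrow> I t = 0) \<and>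
     (\<forall>s t. 0 \<le> s \<and> s \<le> t \<and> t \<le> T \<longrightarrow>
        (sew_sum S \<Xi> t \<longlongrightarrow> I t - S (t - s) (I s)) (mesh_filter s t))"
  have PI: "?P I"
  proof (intro conjI allI impI)
    have "J 0 0 = 0"
      using J[of 0 0] mesh_filter_refl[of S \<Xi> 0] mesh_filter_nontrivial[of 0 0] assms
      by (auto intro: tendsto_unique)
    then show "I 0 = 0" using assms by (simp add: I_def)
    fix s t assume st: "0 \<le> s \<and> s \<le> t \<and> t \<le> T"
    have "J 0 t = J s t + S (t - s) (J 0 s)"
      using st by (intro sew_limit_split[OF _ _ J J J]) auto
    then have "I t - S (t - s) (I s) = J s t" using st by (simp add: I_def)
    then show "(sew_sum S \<Xi> t \<longlongrightarrow> I t - S (t - s) (I s)) (mesh_filter s t)"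
      using J[of s t] st by simp
  qed (auto simp: I_def)
  have "K = I" if K: "?P K" for K
  proof
    fix t
    show "K t = I t"
    proof (cases "t \<in> {0..T}")
      case True
      then have "0 \<le> (0::real) \<and> 0 \<le> t \<and> t \<le> T" by simp
      then have "(sew_sum S \<Xi> t \<longlongrightarrow> K t - S (t - 0) (K 0)) (mesh_filter 0 t)"
        "(sew_sum S \<Xi> t \<longlongrightarrow> I t - S (t - 0) (I 0)) (mesh_filter 0 t)" using K PI by blast+
      then have "K t - S (t - 0) (K 0) = I t - S (t - 0) (I 0)"
        using mesh_filter_nontrivial[of 0 t] True by (auto intro: tendsto_unique)
      then show ?thesis using K PI by simp
    qed (use K PI in auto)
  qed
  then have "sewing S T \<Xi> = I"
    unfolding sewing_def using PI by (intro the_equality) blast+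
  then show "sewing S T \<Xi> 0 = 0"
    and "\<And>s t. 0 \<le> s \<Longrightarrow> s \<le> t \<Longrightarrow> t \<le> T \<Longrightarrow>
      (sew_sum S \<Xi> t \<longlongrightarrow> sewing S T \<Xi> t - S (t - s) (sewing S T \<Xi> s)) (mesh_filter s t)"
    using PI by auto
qed

end

section \<open>Bochner integrals on the line\<close>

lemma set_integrable_continuous_bound:
  fixes f :: "real \<Rightarrow> 'b::{banach, second_countable_topology}"
  assumes "continuous_on A f" "A \<in> sets borel" "set_integrable lborel A h"
    and "\<And>x. x \<in> A \<Longrightarrow> norm (f x) \<le> h x"
  shows "set_integrable lborel A f"
proof (rule set_integrable_bound[OF assms(3)])
  show "set_borel_measurable lborel A f"
    unfolding set_borel_measurable_def
    using borel_measurable_continuous_on_indicator[OF assms(2,1)] by simp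
  show "AE x in lborel. x \<in> A \<longrightarrow> norm (f x) \<le> norm (h x)"
    using order_trans[OF assms(4) abs_ge_self] by (intro AE_I2) simp
qed

lemma set_integral_norm_le:
  fixes f :: "real \<Rightarrow> 'b::{banach, second_countable_topology}"
  assumes "set_integrable M A f" "set_integrable M A h" "\<And>x. x \<in> A \<Longrightarrow> norm (f x) \<le> h x"
  shows "norm (LINT x:A|M. f x) \<le> (LINT x:A|M. h x)"
  unfolding set_lebesgue_integral_def
  using assms(1,2)[unfolded set_integrable_def] assms(3)
  by (intro Bochner_Integration.integral_norm_bound_integral) (auto simp: indicator_def)

lemma set_integral_blinfun:
  assumes "set_integrable M A f"
  shows "(LINT x:A|M. blinfun_apply L (f x)) = blinfun_apply L (LINT x:A|M. f x)"
    and "set_integrable M A (\<lambda>x. blinfun_apply L (f x))"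
proof -
  have eq: "(\<lambda>x. indicat_real A x *\<^sub>R blinfun_apply L (f x)) = (\<lambda>x. blinfun_apply L (indicat_real A x *\<^sub>R f x))"
    by (simp add: blinfun.scaleR_right)
  show "(LINT x:A|M. blinfun_apply L (f x)) = blinfun_apply L (LINT x:A|M. f x)"
    using assms unfolding set_lebesgue_integral_def set_integrable_def eq
    by (rule integral_bounded_linear[OF blinfun.bounded_linear_right])
  show "set_integrable M A (\<lambda>x. blinfun_apply L (f x))"
    using assms unfolding set_integrable_def eq
    by (rule integrable_bounded_linear[OF blinfun.bounded_linear_right])
qed

lemma set_integral_Icc_Ioo:
  fixes f :: "real \<Rightarrow> 'b::{banach, second_countable_topology}"
  shows "(LINT x:{a..b}|lborel. f x) = (LINT x:{a<..<b}|lborel. f x)"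
    and "(LINT x:{a<..b}|lborel. f x) = (LINT x:{a<..<b}|lborel. f x)"
    and "set_integrable lborel {a..b} f \<longleftrightarrow> set_integrable lborel {a<..<b} f"
    and "set_integrable lborel {a<..b} f \<longleftrightarrow> set_integrable lborel {a<..<b} f"
     apply (rule set_integral_discrete_difference[of "{a, b}"]; auto)
    apply (rule set_integral_discrete_difference[of "{a, b}"]; auto)
   apply (rule set_integrable_discrete_difference[of "{a, b}"]; auto)
  apply (rule set_integrable_discrete_difference[of "{a, b}"]; auto)
  done

lemma set_integral_Ioo_split:
  fixes f :: "real \<Rightarrow> 'b::{banach, second_countable_topology}"
  assumes "set_integrable lborel {a<..<b} f" "a \<le> c" "c \<le> b"
  shows "(LINT x:{a<..<b}|lborel. f x) = (LINT x:{a<..<c}|lborel. f x) + (LINT x:{c<..<b}|lborel. f x)"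
proof -
  have "(LINT x:{a<..c} \<union> {c<..<b}|lborel. f x) = (LINT x:{a<..c}|lborel. f x) + (LINT x:{c<..<b}|lborel. f x)"
    using assms
    by (intro set_integral_Un) (auto simp: set_integral_Icc_Ioo intro: set_integrable_subset[OF assms(1)])
  moreover have "(LINT x:{a<..<b}|lborel. f x) = (LINT x:{a<..c} \<union> {c<..<b}|lborel. f x)"
    using assms by (intro set_integral_discrete_difference[of "{b}"]) auto
  ultimately show ?thesis by (simp add: set_integral_Icc_Ioo)
qed

text \<open>The Bochner integral \<open>H\<close> with variable upper end is itself shown to be a
  primitive; \<open>H - F\<close> then has zero derivative and is constant.\<close>

lemma lborel_FTC_Icc:
  fixes F f :: "real \<Rightarrow> 'b::{banach, second_countable_topology}"
  assumes "a \<le> b" and cont: "continuous_on {a..b} f"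
    and F: "\<And>x. x \<in> {a..b} \<Longrightarrow> (F has_vector_derivative f x) (at x within {a..b})"
  shows "(LINT x:{a..b}|lborel. f x) = F b - F a"
proof -
  define H where "H x = (LINT r:{a..x}|lborel. f r)" for x
  have int: "set_integrable lborel {x..y} f" if "a \<le> x" "y \<le> b" for x y
    using that by (intro borel_integrable_atLeastAtMost' continuous_on_subset[OF cont]) auto
  have H_diff: "H y - H x = (LINT r:{x..y}|lborel. f r)" if "a \<le> x" "x \<le> y" "y \<le> b" for x y
    using set_integral_Ioo_split[of a y f x] int[of a y] that
    by (simp add: H_def set_integral_Icc_Ioo)
  have H_est: "norm (H y - H x - (y - x) *\<^sub>R c) \<le> (y - x) * e"
    if "a \<le> x" "x \<le> y" "y \<le> b" "\<And>r. r \<in> {x..y} \<Longrightarrow> norm (f r - c) \<le> e" for x y c e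
  proof -
    have 1: "H y - H x - (y - x) *\<^sub>R c = (LINT r:{x..y}|lborel. f r - c)"
      using that int[of x y] by (subst set_integral_diff) (auto simp: H_diff set_integral_const set_integrable_def)
    have "norm (LINT r:{x..y}|lborel. f r - c) \<le> (LINT r:{x..y}|lborel. e)"
      using that int[of x y] by (intro set_integral_norm_le set_integral_diff) (auto simp: set_integrable_def)
    also have "\<dots> = (y - x) * e" using that by (subst set_integral_const) auto
    finally show ?thesis unfolding 1 .
  qed
  have H_deriv: "(H has_vector_derivative f x) (at x within {a..b})" if x: "x \<in> {a..b}" for x
    unfolding has_vector_derivative_def has_derivative_within_alt
  proof (intro conjI allI impI bounded_linear_scaleR_left)
    fix e :: real assume e: "0 < e"
    obtain d where d: "d > 0" "\<And>r. r \<in> {a..b} \<Longrightarrow> dist r x < d \<Longrightarrow> dist (f r) (f x) < e"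
      using cont x e unfolding continuous_on_iff by metis
    have "norm (H y - H x - (y - x) *\<^sub>R f x) \<le> e * norm (y - x)" if y: "y \<in> {a..b}" "norm (y - x) < d" for y
    proof (cases "x \<le> y")
      case True
      have "norm (f r - f x) \<le> e" if "r \<in> {x..y}" for r
        using that x y d(2)[of r] by (simp add: dist_norm)
      then have "norm (H y - H x - (y - x) *\<^sub>R f x) \<le> (y - x) * e"
        using True x y by (intro H_est) auto
      then show ?thesis using True by (simp add: mult.commute)
    next
      case False
      have "norm (f r - f x) \<le> e" if "r \<in> {y..x}" for r
        using that x y d(2)[of r] by (simp add: dist_norm)
      then have "norm (H x - H y - (x - y) *\<^sub>R f x) \<le> (x - y) * e"
        using False x y by (intro H_est) auto
      moreover have "H y - H x - (y - x) *\<^sub>R f x = - (H x - H y - (x - y) *\<^sub>R f x)"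
        by (simp add: algebra_simps)
      then have "norm (H y - H x - (y - x) *\<^sub>R f x) = norm (H x - H y - (x - y) *\<^sub>R f x)"
        by (metis norm_minus_cancel)
      ultimately show ?thesis using False by (simp add: mult.commute)
    qed
    then show "\<exists>d>0. \<forall>y\<in>{a..b}. norm (y - x) < d \<longrightarrow> norm (H y - H x - (y - x) *\<^sub>R f x) \<le> e * norm (y - x)"
      using d(1) by blast
  qed
  have "((\<lambda>x. H x - F x) has_vector_derivative 0) (at x within {a..b})" if "x \<in> {a..b}" for x
    using has_vector_derivative_diff[OF H_deriv[OF that] F[OF that]] by simp
  then obtain c where c: "\<And>x. x \<in> {a..b} \<Longrightarrow> H x - F x = c"
    using has_vector_derivative_zero_constant[of "{a..b}" "\<lambda>x. H x - F x"] by blast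
  have "{a<..<a} = {}" by simp
  then have "H a = 0" using set_integral_Icc_Ioo(1)[of a a f]
    by (simp only: H_def) (simp add: set_lebesgue_integral_def)
  moreover have "H b - F b = H a - F a" using c[of a] c[of b] assms(1) by simp
  ultimately have "H b = F b - F a" by (simp add: diff_eq_eq)
  then show ?thesis by (simp only: H_def)
qed

text \<open>Dominated convergence with \<open>norm f\<close> as the dominating function reduces the
  claim to compact subintervals, so \<open>F\<close> needs only limits, not values, at the ends of
  \<open>A\<close>.\<close>

lemma lborel_FTC_exhaust:
  fixes F f :: "real \<Rightarrow> 'b::{banach, second_countable_topology}"
  assumes cont: "continuous_on A f" and int: "set_integrable lborel A f"
    and F: "\<And>x. x \<in> A \<Longrightarrow> (F has_vector_derivative f x) (at x)"
    and ab: "\<And>n. a n \<le> b n" "\<And>n. {a n..b n} \<subseteq> A"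
    and ex: "\<And>x. x \<in> A \<Longrightarrow> \<forall>\<^sub>F n in sequentially. x \<in> {a n..b n}"
    and lim: "(\<lambda>n::nat. F (b n) - F (a n)) \<longlonglongrightarrow> L"
  shows "(LINT x:A|lborel. f x) = L"
proof -
  have eq: "(LINT x:{a n..b n}|lborel. f x) = F (b n) - F (a n)" for n
    using ab[of n] by (intro lborel_FTC_Icc continuous_on_subset[OF cont] has_vector_derivative_at_within[OF F]) auto
  have "(\<lambda>n. LINT x:{a n..b n}|lborel. f x) \<longlonglongrightarrow> (LINT x:A|lborel. f x)"
    unfolding set_lebesgue_integral_def
  proof (rule integral_dominated_convergence[where w = "\<lambda>x. norm (indicator A x *\<^sub>R f x)"])
    show "integrable lborel (\<lambda>x. norm (indicator A x *\<^sub>R f x))"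
      using int unfolding set_integrable_def by (rule integrable_norm)
    show "(\<lambda>x. indicator A x *\<^sub>R f x) \<in> borel_measurable lborel"
      using int unfolding set_integrable_def by (rule borel_measurable_integrable)
    show "(\<lambda>x. indicator {a n..b n} x *\<^sub>R f x) \<in> borel_measurable lborel" for n
      using borel_measurable_continuous_on_indicator[OF _ continuous_on_subset[OF cont ab(2)[of n]]] by simp
    show "AE x in lborel. (\<lambda>n. indicat_real {a n..b n} x *\<^sub>R f x) \<longlonglongrightarrow> indicat_real A x *\<^sub>R f x"
    proof (rule AE_I2)
      fix x
      have "\<forall>\<^sub>F n in sequentially. indicat_real {a n..b n} x *\<^sub>R f x = indicat_real A x *\<^sub>R f x"
      proof (cases "x \<in> A")
        case True
        then show ?thesis by (intro eventually_mono[OF ex[OF True]]) (simp add: indicator_def)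
      next
        case False
        then have "x \<notin> {a n..b n}" for n using ab(2)[of n] by blast
        then show ?thesis using False by (simp add: indicator_def)
      qed
      then show "(\<lambda>n. indicat_real {a n..b n} x *\<^sub>R f x) \<longlonglongrightarrow> indicat_real A x *\<^sub>R f x"
        by (rule tendsto_eventually)
    qed
    show "AE x in lborel. norm (indicat_real {a n..b n} x *\<^sub>R f x) \<le> norm (indicat_real A x *\<^sub>R f x)" for n
      using ab(2)[of n] by (intro AE_I2) (auto simp: indicator_def)
  qed
  then show ?thesis using lim unfolding eq by (rule LIMSEQ_unique)
qed

lemma lborel_FTC_Ioi:
  fixes F f :: "real \<Rightarrow> 'b::{banach, second_countable_topology}"
  assumes "continuous_on {0<..} f" "set_integrable lborel {0<..} f"
    and "\<And>x. 0 < x \<Longrightarrow> (F has_vector_derivative f x) (at x)"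
    and "(F \<longlongrightarrow> x0) (at_right 0)" "(F \<longlongrightarrow> 0) at_top"
  shows "(LINT x:{0<..}|lborel. f x) = - x0"
proof (rule lborel_FTC_exhaust[where a = "\<lambda>n. 1 / real (n + 1)" and b = "\<lambda>n. real (n + 1)"])
  show "1 / real (n + 1) \<le> real (n + 1)" for n
    by (simp add: field_simps)
  show "{1 / real (n + 1)..real (n + 1)} \<subseteq> {0<..}" for n
    by (auto intro: less_le_trans[of 0 "1 / real (n + 1)"])
  show "\<forall>\<^sub>F n in sequentially. x \<in> {1 / real (n + 1)..real (n + 1)}" if x: "x \<in> {0<..}" for x
  proof -
    have "(\<lambda>n. 1 / real (n + 1)) \<longlonglongrightarrow> 0" by real_asymp
    then have "\<forall>\<^sub>F n in sequentially. 1 / real (n + 1) < x" using x by (auto dest: order_tendstoD)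
    moreover have "filterlim (\<lambda>n. real (n + 1)) at_top sequentially" by real_asymp
    then have "\<forall>\<^sub>F n in sequentially. x \<le> real (n + 1)" by (simp add: filterlim_at_top)
    ultimately show ?thesis by eventually_elim auto
  qed
  have "filterlim (\<lambda>n. 1 / real (n + 1)) (at_right 0) sequentially" by real_asymp
  then have 1: "(\<lambda>n. F (1 / real (n + 1))) \<longlonglongrightarrow> x0" by (rule filterlim_compose[OF assms(4)])
  have "filterlim (\<lambda>n. real (n + 1)) at_top sequentially" by real_asymp
  then have 2: "(\<lambda>n. F (real (n + 1))) \<longlonglongrightarrow> 0" by (rule filterlim_compose[OF assms(5)])
  show "(\<lambda>n. F (real (n + 1)) - F (1 / real (n + 1))) \<longlonglongrightarrow> - x0"
    using tendsto_diff[OF 2 1] by simp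
qed (use assms in auto)

section \<open>A Fourier inequality\<close>

text \<open>Real part of the characteristic function of the standard normal distribution.\<close>

lemma integral_std_normal_cos:
  "integrable lborel (\<lambda>x. std_normal_density x * cos (t * x))"
  "(LINT x|lborel. std_normal_density x * cos (t * x)) = exp (- t\<^sup>2 / 2)"
proof -
  interpret prob_space std_normal_distribution
    by (rule prob_space_normal_density) simp
  have int: "integrable std_normal_distribution (\<lambda>x. iexp (t * x))"
    by (rule integrable_const_bound[where B = 1]) auto
  have "exp (- t\<^sup>2 / 2) = Re (char std_normal_distribution t)"
    by (simp only: char_std_normal_distribution) simp
  also have "\<dots> = (LINT x|std_normal_distribution. Re (iexp (t * x)))"
    unfolding char_def using int by (rule integral_Re[symmetric])
  also have "\<dots> = (LINT x|std_normal_distribution. cos (t * x))"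
    by (simp add: Re_exp)
  also have "\<dots> = (LINT x|lborel. std_normal_density x * cos (t * x))"
    by (subst integral_density) auto
  finally show "(LINT x|lborel. std_normal_density x * cos (t * x)) = exp (- t\<^sup>2 / 2)" by simp
  have "integrable std_normal_distribution (\<lambda>x. cos (t * x))"
    by (rule integrable_const_bound[where B = 1]) auto
  then show "integrable lborel (\<lambda>x. std_normal_density x * cos (t * x))"
    by (subst (asm) integrable_density) auto
qed

text \<open>Only the inequality half of Fourier inversion is needed; a Gaussian factor makes
  the double integral converge absolutely and is then removed.\<close>

lemma fourier_bound:
  fixes f :: "real \<Rightarrow> 'b::{banach, second_countable_topology}"
  assumes f: "integrable lborel f" and B: "\<And>s. norm (f s) \<le> B" and cont: "isCont f t"
    and h: "integrable lborel h"
    and bound: "\<And>\<eta>. norm (LINT s|lborel. cos (\<eta> * (t - s)) *\<^sub>R f s) \<le> h \<eta>"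
  shows "2 * pi * norm (f t) \<le> (LINT \<eta>|lborel. h \<eta>)"
proof -
  have [measurable]: "f \<in> borel_measurable borel" using borel_measurable_integrable[OF f] by simp
  have [measurable]: "h \<in> borel_measurable borel" using borel_measurable_integrable[OF h] by simp
  define N where "N = (\<lambda>x::real. exp (- x\<^sup>2 / 2))"
  have [measurable]: "N \<in> borel_measurable borel" unfolding N_def by measurable
  have N_eq: "N x = sqrt (2 * pi) * std_normal_density x" for x
    by (simp add: N_def std_normal_density_def)
  have N_int: "integrable lborel N" "(LINT x|lborel. N x) = sqrt (2 * pi)"
  proof -
    have i: "integrable lborel std_normal_density" by simp
    show "integrable lborel N"
      using integrable_mult_right[OF i, of "sqrt (2 * pi)"] by (simp add: N_eq[abs_def])
    show "(LINT x|lborel. N x) = sqrt (2 * pi)"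
      by (simp add: N_eq)
  qed
  \<comment> \<open>The left side is \<open>sqrt (2 * pi)\<close> times an average of
    \<open>f\<close> over a Gaussian window of width \<open>1 / n\<close> around
    \<open>t\<close>.\<close>
  have main: "norm (LINT r|lborel. N r *\<^sub>R f (t + r / real n)) \<le> (LINT \<eta>|lborel. h \<eta>) / sqrt (2 * pi)"
    if n: "n > 0" for n :: nat
  proof -
    define c where "c = real n"
    have c: "c > 0" using n by (simp add: c_def)
    \<comment> \<open>Integrating over \<eta> first turns \<open>P\<close> into the Gaussian average
      of \<open>f\<close> near \<open>t\<close>; integrating over \<open>s\<close> first leaves the
      cosine transform of \<open>f\<close> at frequency \<open>c * \<eta>\<close>, which
      \<open>h\<close> bounds.\<close>
    define P where "P = (LINT \<eta>|lborel. LINT s|lborel. (c * std_normal_density \<eta> * cos ((c * (t - s)) * \<eta>)) *\<^sub>R f s)"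
    have int2: "integrable (lborel \<Otimes>\<^sub>M lborel) (\<lambda>(\<eta>, s). (c * std_normal_density \<eta> * cos ((c * (t - s)) * \<eta>)) *\<^sub>R f s)"
    proof (rule lborel_pair.Fubini_integrable)
      have le: "norm ((c * std_normal_density \<eta> * cos ((c * (t - s)) * \<eta>)) *\<^sub>R f s) \<le> c * std_normal_density \<eta> * norm (f s)" for \<eta> s
      proof -
        have "\<bar>cos ((c * (t - s)) * \<eta>)\<bar> \<le> 1" by (rule abs_cos_le_one)
        then have "c * std_normal_density \<eta> * \<bar>cos ((c * (t - s)) * \<eta>)\<bar> \<le> c * std_normal_density \<eta> * 1"
          using c by (intro mult_left_mono) (auto simp: normal_density_nonneg)
        then have "(c * std_normal_density \<eta> * \<bar>cos ((c * (t - s)) * \<eta>)\<bar>) * norm (f s) \<le>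
            (c * std_normal_density \<eta> * 1) * norm (f s)"
          by (rule mult_right_mono) simp
        then show ?thesis using c
          by (simp add: abs_mult normal_density_nonneg)
      qed
      show int1: "AE \<eta> in lborel. integrable lborel (\<lambda>s. case (\<eta>, s) of (\<eta>, s) \<Rightarrow> (c * std_normal_density \<eta> * cos ((c * (t - s)) * \<eta>)) *\<^sub>R f s)"
      proof (rule AE_I2)
        fix \<eta> :: real
        have "integrable lborel (\<lambda>s. (c * std_normal_density \<eta> * cos ((c * (t - s)) * \<eta>)) *\<^sub>R f s)"
        proof (rule Bochner_Integration.integrable_bound[where f = "\<lambda>s. c * std_normal_density \<eta> * norm (f s)"])
          show "integrable lborel (\<lambda>s. c * std_normal_density \<eta> * norm (f s))"
            by (intro integrable_mult_right integrable_norm f)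
          show "AE s in lborel. norm ((c * std_normal_density \<eta> * cos ((c * (t - s)) * \<eta>)) *\<^sub>R f s)
              \<le> norm (c * std_normal_density \<eta> * norm (f s))"
            using le[of \<eta>] c by (intro AE_I2) (simp add: normal_density_nonneg abs_mult)
        qed simp
        then show "integrable lborel (\<lambda>s. case (\<eta>, s) of (\<eta>, s) \<Rightarrow> (c * std_normal_density \<eta> * cos ((c * (t - s)) * \<eta>)) *\<^sub>R f s)"
          by simp
      qed
      show "integrable lborel (\<lambda>\<eta>. LINT s|lborel. norm (case (\<eta>, s) of (\<eta>, s) \<Rightarrow> (c * std_normal_density \<eta> * cos ((c * (t - s)) * \<eta>)) *\<^sub>R f s))"
      proof (rule Bochner_Integration.integrable_bound[where f = "\<lambda>\<eta>. c * std_normal_density \<eta> * (LINT s|lborel. norm (f s))"])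
        show "integrable lborel (\<lambda>\<eta>. c * std_normal_density \<eta> * (LINT s|lborel. norm (f s)))"
          by simp
        show "AE \<eta> in lborel. norm (LINT s|lborel. norm (case (\<eta>, s) of (\<eta>, s) \<Rightarrow> (c * std_normal_density \<eta> * cos ((c * (t - s)) * \<eta>)) *\<^sub>R f s))
           \<le> norm (c * std_normal_density \<eta> * (LINT s|lborel. norm (f s)))"
        proof (intro AE_I2)
          fix \<eta> :: real
          have "(LINT s|lborel. norm ((c * std_normal_density \<eta> * cos ((c * (t - s)) * \<eta>)) *\<^sub>R f s)) \<le>
              (LINT s|lborel. c * std_normal_density \<eta> * norm (f s))"
            using le integrable_mult_right[OF integrable_norm[OF f]]
            using c by (intro integral_mono') (auto simp: normal_density_nonneg)
          then show "norm (LINT s|lborel. norm (case (\<eta>, s) of (\<eta>, s) \<Rightarrow> (c * std_normal_density \<eta> * cos ((c * (t - s)) * \<eta>)) *\<^sub>R f s))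
             \<le> norm (c * std_normal_density \<eta> * (LINT s|lborel. norm (f s)))"
            using c by (simp add: normal_density_nonneg abs_mult)
        qed
      qed simp
    qed simp
    have "P = (LINT s|lborel. LINT \<eta>|lborel. (c * std_normal_density \<eta> * cos ((c * (t - s)) * \<eta>)) *\<^sub>R f s)"
      unfolding P_def using lborel_pair.Fubini_integral[OF int2] by simp
    also have "\<dots> = (LINT s|lborel. (c * N (c * (t - s))) *\<^sub>R f s)"
    proof (rule Bochner_Integration.integral_cong[OF refl])
      fix s
      have "(LINT \<eta>|lborel. (c * std_normal_density \<eta> * cos ((c * (t - s)) * \<eta>)) *\<^sub>R f s) =
          (LINT \<eta>|lborel. c * (std_normal_density \<eta> * cos ((c * (t - s)) * \<eta>))) *\<^sub>R f s"
        using integrable_mult_right[OF integral_std_normal_cos(1)[of "c * (t - s)"], of c]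
        by (subst integral_scaleR_left) (simp_all only: mult.assoc)
      also have "(LINT \<eta>|lborel. c * (std_normal_density \<eta> * cos ((c * (t - s)) * \<eta>))) = c * N (c * (t - s))"
        unfolding N_def using integral_std_normal_cos(2)[of "c * (t - s)"] by simp
      finally show "(LINT \<eta>|lborel. (c * std_normal_density \<eta> * cos ((c * (t - s)) * \<eta>)) *\<^sub>R f s) =
          (c * N (c * (t - s))) *\<^sub>R f s" .
    qed
    also have "\<dots> = \<bar>1 / c\<bar> *\<^sub>R (LINT r|lborel. (c * N (c * (t - (t + 1 / c * r)))) *\<^sub>R f (t + 1 / c * r))"
      using c by (intro lborel_integral_real_affine) auto
    also have "\<dots> = (LINT r|lborel. N r *\<^sub>R f (t + r / c))"
      using c by (subst integral_scaleR_right[symmetric]) (auto simp: N_def)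
    finally have P_eq: "P = (LINT r|lborel. N r *\<^sub>R f (t + r / real n))" unfolding c_def .
    have int3: "integrable lborel (\<lambda>\<eta>. c * h (c * \<eta>) / sqrt (2 * pi))"
      using lborel_integrable_real_affine[OF h, of c 0] c by auto
    have "norm P \<le> (LINT \<eta>|lborel. c * h (c * \<eta>) / sqrt (2 * pi))"
      unfolding P_def
    proof (rule Bochner_Integration.integral_norm_bound_integral[OF _ int3])
      show "integrable lborel (\<lambda>\<eta>. LINT s|lborel. (c * std_normal_density \<eta> * cos ((c * (t - s)) * \<eta>)) *\<^sub>R f s)"
        using lborel_pair.integrable_fst'[OF int2] by simp
      fix \<eta> :: real
      have "(LINT s|lborel. (c * std_normal_density \<eta> * cos ((c * (t - s)) * \<eta>)) *\<^sub>R f s) =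
          (LINT s|lborel. (c * std_normal_density \<eta>) *\<^sub>R (cos ((c * \<eta>) * (t - s)) *\<^sub>R f s))"
        by (simp add: mult_ac)
      also have "\<dots> = (c * std_normal_density \<eta>) *\<^sub>R (LINT s|lborel. cos ((c * \<eta>) * (t - s)) *\<^sub>R f s)"
        by (simp only: integral_scaleR_right)
      finally have "norm (LINT s|lborel. (c * std_normal_density \<eta> * cos ((c * (t - s)) * \<eta>)) *\<^sub>R f s) \<le>
          (c * std_normal_density \<eta>) * h (c * \<eta>)"
        using c bound[of "c * \<eta>"] by (simp add: normal_density_nonneg abs_mult mult_left_mono)
      \<comment> \<open>The normal density is at most its value at 0; after rescaling \<eta> the
        bound no longer depends on \<open>n\<close>.\<close>
      also have "\<dots> \<le> (c * (1 / sqrt (2 * pi))) * h (c * \<eta>)"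
      proof (intro mult_right_mono mult_left_mono)
        show "0 \<le> h (c * \<eta>)" using bound[of "c * \<eta>"] norm_ge_zero order_trans by blast
        show "std_normal_density \<eta> \<le> 1 / sqrt (2 * pi)"
          by (simp add: std_normal_density_def field_simps)
      qed (use c in auto)
      finally show "norm (LINT s|lborel. (c * std_normal_density \<eta> * cos ((c * (t - s)) * \<eta>)) *\<^sub>R f s) \<le>
          c * h (c * \<eta>) / sqrt (2 * pi)" by simp
    qed
    also have "\<dots> = (c * (LINT \<eta>|lborel. h (c * \<eta>))) / sqrt (2 * pi)" by simp
    also have "c * (LINT \<eta>|lborel. h (c * \<eta>)) = (LINT \<eta>|lborel. h \<eta>)"
      using lborel_integral_real_affine[of c h 0] c by simp
    finally show ?thesis unfolding P_eq .
  qed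
  have "(\<lambda>n. LINT r|lborel. N r *\<^sub>R f (t + r / real n)) \<longlonglongrightarrow> (LINT r|lborel. N r *\<^sub>R f t)"
  proof (rule integral_dominated_convergence[where w = "\<lambda>r. B * N r"])
    show "integrable lborel (\<lambda>r. B * N r)" using N_int by simp
    show "AE r in lborel. (\<lambda>n. N r *\<^sub>R f (t + r / real n)) \<longlonglongrightarrow> N r *\<^sub>R f t"
    proof (intro AE_I2 tendsto_scaleR tendsto_const isCont_tendsto_compose[OF cont])
      show "(\<lambda>n. t + r / real n) \<longlonglongrightarrow> t" for r by real_asymp
    qed
    show "AE r in lborel. norm (N r *\<^sub>R f (t + r / real n)) \<le> B * N r" for n
      using B by (intro AE_I2) (auto simp: N_def mult.commute[of B])
  qed simp_all
  also have "(LINT r|lborel. N r *\<^sub>R f t) = sqrt (2 * pi) *\<^sub>R f t"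
    using N_int by simp
  finally have "norm (sqrt (2 * pi) *\<^sub>R f t) \<le> (LINT \<eta>|lborel. h \<eta>) / sqrt (2 * pi)"
    using main by (intro tendsto_upperbound[OF tendsto_norm]) (auto simp: eventually_sequentially intro!: exI[of _ 1])
  then have "sqrt (2 * pi) * (sqrt (2 * pi) * norm (f t)) \<le> (LINT \<eta>|lborel. h \<eta>)"
    by (simp add: field_simps)
  then show ?thesis by (simp add: mult.assoc[symmetric])
qed

section \<open>Semigroup estimates from the resolvent\<close>

text \<open>Sokal's gliding hump.\<close>

lemma uniform_boundedness_4_power:
  fixes L :: "nat \<Rightarrow> 'a::banach \<Rightarrow>\<^sub>L 'b::real_normed_vector"
  assumes "\<And>x. \<exists>B. \<forall>n. norm (L n x) \<le> B"
  shows "\<exists>n. norm (L n) < 4 ^ n"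
proof (rule ccontr)
  assume "\<not> ?thesis"
  then have big: "4 ^ n \<le> norm (L n)" for n by (simp add: not_less)
  \<comment> \<open>Take \<open>u\<close> of norm \<open>(1 / 3) ^ n\<close> on which
    \<open>L n\<close> nearly attains its norm. By the triangle inequality one of
    \<open>x + u\<close>, \<open>x - u\<close> has an image at least as large as that of
    \<open>u\<close>.\<close>
  have step: "\<exists>y. norm (y - x) \<le> (1 / 3) ^ n \<and> 2 / 3 * (1 / 3) ^ n * norm (L n) \<le> norm (L n y)" for x n
  proof -
    have "2 / 3 * norm (L n) < norm (L n)"
      using big[of n] zero_less_power[of "4::real" n] by linarith
    then have "\<not> (\<forall>x. norm (L n x) \<le> 2 / 3 * norm (L n) * norm x)"
      using norm_blinfun_bound[of "2 / 3 * norm (L n)" "L n"] by auto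
    then obtain v where v: "2 / 3 * norm (L n) * norm v < norm (L n v)" by (auto simp: not_le)
    then have v0: "norm v > 0" by (cases "v = 0") auto
    define u where "u = ((1 / 3) ^ n / norm v) *\<^sub>R v"
    have u: "norm u = (1 / 3) ^ n" using v0 by (simp add: u_def)
    have Lu: "2 / 3 * (1 / 3) ^ n * norm (L n) \<le> norm (L n u)"
    proof -
      have "(1 / 3) ^ n / norm v * (2 / 3 * norm (L n) * norm v) \<le> (1 / 3) ^ n / norm v * norm (L n v)"
        using v v0 by (intro mult_left_mono) auto
      then show ?thesis using v0 by (simp add: u_def blinfun.scaleR_right mult_ac)
    qed
    have "2 * norm (L n u) \<le> norm (L n (x + u)) + norm (L n (x - u))"
      using norm_triangle_ineq4[of "L n (x + u)" "L n (x - u)"]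
      by (simp add: blinfun.add_right blinfun.diff_right scaleR_2[symmetric])
    then have "norm (L n u) \<le> norm (L n (x + u)) \<or> norm (L n u) \<le> norm (L n (x - u))" by linarith
    then show ?thesis
    proof
      assume "norm (L n u) \<le> norm (L n (x + u))"
      then show ?thesis using Lu u by (intro exI[of _ "x + u"]) auto
    next
      assume "norm (L n u) \<le> norm (L n (x - u))"
      then show ?thesis using Lu u by (intro exI[of _ "x - u"]) auto
    qed
  qed
  define next_pt where "next_pt n x = (SOME y. norm (y - x) \<le> (1 / 3) ^ n \<and>
      2 / 3 * (1 / 3) ^ n * norm (L n) \<le> norm (L n y))" for n x
  have next_pt: "norm (next_pt n x - x) \<le> (1 / 3) ^ n"
    "2 / 3 * (1 / 3) ^ n * norm (L n) \<le> norm (L n (next_pt n x))" for n x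
    using someI_ex[OF step[of x n]] by (auto simp: next_pt_def)
  define X where "X = rec_nat 0 (\<lambda>n x. next_pt n x)"
  have X_Suc: "X (Suc n) = next_pt n (X n)" for n by (simp add: X_def)
  have dX: "norm (X (Suc n) - X n) \<le> (1 / 3) ^ n" for n
    unfolding X_Suc by (rule next_pt)
  have geo: "summable (\<lambda>n. (1 / 3 :: real) ^ n)" by (simp add: summable_geometric)
  have sumd: "summable (\<lambda>n. norm (X (Suc n) - X n))"
    using dX by (intro summable_comparison_test'[OF geo, of 0]) auto
  then have sd: "summable (\<lambda>n. X (Suc n) - X n)" by (rule summable_norm_cancel)
  define x where "x = X 0 + (\<Sum>n. X (Suc n) - X n)"
  have Xx: "norm (x - X (Suc n)) \<le> 1 / 2 * (1 / 3) ^ n" for n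
  proof -
    have "(\<Sum>k<m. X (Suc k) - X k) = X m - X 0" for m
      by (induction m) (auto simp: algebra_simps)
    then have "x - X (Suc n) = (\<Sum>k. X (Suc k) - X k) - (\<Sum>k<Suc n. X (Suc k) - X k)"
      by (simp add: x_def)
    also have "\<dots> = (\<Sum>k. X (Suc (k + Suc n)) - X (k + Suc n))"
      using suminf_minus_initial_segment[OF sd, of "Suc n"] by simp
    also have "norm \<dots> \<le> (\<Sum>k. norm (X (Suc (k + Suc n)) - X (k + Suc n)))"
      using summable_ignore_initial_segment[OF sumd, of "Suc n"] by (intro summable_norm) simp
    also have "\<dots> \<le> (\<Sum>k. (1 / 3) ^ (k + Suc n))"
      using summable_ignore_initial_segment[OF sumd, of "Suc n"]
        summable_ignore_initial_segment[OF geo, of "Suc n"]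
      by (intro suminf_le dX) simp_all
    also have "\<dots> = (\<Sum>k. (1 / 3) ^ k * (1 / 3) ^ Suc n)" by (simp add: power_add)
    also have "\<dots> = 1 / 2 * (1 / 3) ^ n"
      using geo by (subst suminf_mult2[symmetric]) (auto simp: suminf_geometric)
    finally show ?thesis .
  qed
  obtain B where B: "\<And>n. norm (L n x) \<le> B" using assms by blast
  \<comment> \<open>The \<open>n\<close>-th move gains \<open>2 / 3\<close> and all later moves
    together lose at most \<open>1 / 2\<close> of \<open>(1 / 3) ^ n * norm (L n)\<close>; with
    \<open>4 ^ n \<le> norm (L n)\<close> the rest, \<open>1 / 6\<close>, still grows
    geometrically.\<close>
  have low: "1 / 6 * (4 / 3) ^ n \<le> norm (L n x)" for n
  proof -
    have "norm (L n (X (Suc n))) \<le> norm (L n x) + norm (L n (x - X (Suc n)))"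
      using norm_triangle_ineq4[of "L n x" "L n (x - X (Suc n))"] by (simp add: blinfun.diff_right)
    moreover have "norm (L n (x - X (Suc n))) \<le> norm (L n) * (1 / 2 * (1 / 3) ^ n)"
      by (rule order_trans[OF norm_blinfun mult_left_mono[OF Xx]]) simp
    moreover have "2 / 3 * (1 / 3) ^ n * norm (L n) \<le> norm (L n (X (Suc n)))"
      unfolding X_Suc by (rule next_pt)
    ultimately have "1 / 6 * ((1 / 3) ^ n * norm (L n)) \<le> norm (L n x)" by (simp add: mult_ac)
    moreover have "(1 / 3) ^ n * 4 ^ n \<le> (1 / 3) ^ n * norm (L n)"
      using big by (intro mult_left_mono) auto
    ultimately show ?thesis by (simp add: power_divide)
  qed
  have "filterlim (\<lambda>n. 1 / 6 * (4 / 3 :: real) ^ n) at_top sequentially" by real_asymp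
  then have "\<forall>\<^sub>F n in sequentially. B + 1 \<le> 1 / 6 * (4 / 3 :: real) ^ n"
    unfolding filterlim_at_top by blast
  then obtain n where "B + 1 \<le> 1 / 6 * (4 / 3 :: real) ^ n"
    using eventually_sequentially by auto
  then show False using low[of n] B[of n] by linarith
qed

text \<open>The product norm is in general not invariant under complex rotations, hence the factor
  2.\<close>

lemma norm_cscale_le: "norm (cscale c p) \<le> 2 * cmod c * norm p"
proof -
  have eq: "cscale c p = Re c *\<^sub>R p + Im c *\<^sub>R (- snd p, fst p)"
    by (simp add: cscale_def plus_prod_def scaleR_prod_def)
  have "norm (- snd p, fst p) = norm p"
    by (cases p) (simp add: norm_Pair add.commute)
  then have "norm (cscale c p) \<le> \<bar>Re c\<bar> * norm p + \<bar>Im c\<bar> * norm p"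
    unfolding eq by (intro norm_triangle_le) (simp del: scaleR_Pair)
  also have "\<dots> \<le> cmod c * norm p + cmod c * norm p"
    by (intro add_mono mult_right_mono abs_Re_le_cmod abs_Im_le_cmod) auto
  finally show ?thesis by simp
qed

text \<open>Boundedness of the terms at radius \<open>r / 2\<close> dominates the tail from order 2
  on by a geometric series for \<open>\<bar>h\<bar> \<le> r / 4\<close>, so the remainder is
  quadratic.\<close>

lemma power_series_has_vector_derivative:
  fixes c :: "nat \<Rightarrow> 'a::banach"
  assumes r: "0 < r" and s: "\<And>h. \<bar>h\<bar> < r \<Longrightarrow> (\<lambda>n. h ^ n *\<^sub>R c n) sums f h"
  shows "(f has_vector_derivative c 1) (at 0)"
proof -
  define q where "q = r / 2"
  have q: "0 < q" "q < r" using r by (auto simp: q_def)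
  have "summable (\<lambda>n. q ^ n *\<^sub>R c n)" using s[of q] q by (auto simp: sums_iff)
  then have "convergent (\<lambda>n. q ^ n *\<^sub>R c n)"
    using summable_LIMSEQ_zero convergentI by blast
  then have "Bseq (\<lambda>n. q ^ n *\<^sub>R c n)" by (rule convergent_imp_Bseq)
  then obtain K where K: "K > 0" "\<And>n. norm (q ^ n *\<^sub>R c n) \<le> K" by (auto simp: Bseq_def)
  have f0: "f 0 = c 0"
  proof -
    have "(\<lambda>n. 0 ^ n *\<^sub>R c n) sums (\<Sum>n\<in>{0}. 0 ^ n *\<^sub>R c n)"
      by (rule sums_finite) auto
    then show ?thesis using s[of 0] r sums_unique2 by fastforce
  qed
  have est: "norm (f h - f 0 - h *\<^sub>R c 1) \<le> (2 * K / q\<^sup>2) * h\<^sup>2" if h: "\<bar>h\<bar> \<le> q / 2" for h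
  proof -
    have hs: "(\<lambda>n. h ^ n *\<^sub>R c n) sums f h" using h q by (intro s) auto
    have sm: "summable (\<lambda>n. h ^ (n + 2) *\<^sub>R c (n + 2))"
      using hs summable_ignore_initial_segment sums_summable by blast
    have "f h = (\<Sum>n. h ^ (n + 2) *\<^sub>R c (n + 2)) + (\<Sum>n<2. h ^ n *\<^sub>R c n)"
      using suminf_split_initial_segment[OF sums_summable[OF hs], of 2] sums_unique[OF hs] by simp
    then have eq: "f h - f 0 - h *\<^sub>R c 1 = (\<Sum>n. h ^ (n + 2) *\<^sub>R c (n + 2))"
      by (simp add: f0 numeral_2_eq_2)
    have term_le: "norm (h ^ (n + 2) *\<^sub>R c (n + 2)) \<le> (K * (h / q)\<^sup>2) * (1 / 2) ^ n" for n
    proof -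
      have "norm (h ^ (n + 2) *\<^sub>R c (n + 2)) = \<bar>h / q\<bar> ^ (n + 2) * norm (q ^ (n + 2) *\<^sub>R c (n + 2))"
        using q by (simp add: power_abs power_divide abs_mult)
      also have "\<dots> \<le> \<bar>h / q\<bar> ^ (n + 2) * K" by (intro mult_left_mono K) auto
      also have "\<dots> = (K * (h / q)\<^sup>2) * \<bar>h / q\<bar> ^ n" by (simp add: power_add power2_eq_square mult_ac)
      also have "\<dots> \<le> (K * (h / q)\<^sup>2) * (1 / 2) ^ n"
        using h q K by (intro mult_left_mono power_mono) (auto simp: field_simps)
      finally show ?thesis .
    qed
    have geo: "summable (\<lambda>n. (K * (h / q)\<^sup>2) * (1 / 2 :: real) ^ n)"
      by (intro summable_mult summable_geometric) simp
    have "norm (f h - f 0 - h *\<^sub>R c 1) \<le> (\<Sum>n. (K * (h / q)\<^sup>2) * (1 / 2 :: real) ^ n)"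
      unfolding eq by (rule norm_suminf_le[OF term_le geo])
    also have "\<dots> = (K * (h / q)\<^sup>2) * 2"
      by (subst suminf_mult) (auto simp: suminf_geometric summable_geometric)
    finally show ?thesis by (simp add: power_divide mult_ac)
  qed
  define C where "C = 2 * K / q\<^sup>2"
  have C: "C > 0" using K q by (simp add: C_def)
  show ?thesis
    unfolding has_vector_derivative_def has_derivative_at_alt
  proof (intro conjI allI impI bounded_linear_scaleR_left)
    fix e :: real assume e: "0 < e"
    show "\<exists>d>0. \<forall>y. norm (y - 0) < d \<longrightarrow> norm (f y - f 0 - (y - 0) *\<^sub>R c 1) \<le> e * norm (y - 0)"
    proof (intro exI[of _ "min (q / 2) (e / C)"] conjI allI impI)
      fix y :: real assume y: "norm (y - 0) < min (q / 2) (e / C)"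
      then have "norm (f y - f 0 - y *\<^sub>R c 1) \<le> C * y\<^sup>2" using est[of y] by (simp add: C_def)
      also have "C * y\<^sup>2 = (C * \<bar>y\<bar>) * \<bar>y\<bar>" by (simp add: power2_eq_square mult.assoc abs_mult_self_eq)
      also have "\<dots> \<le> e * \<bar>y\<bar>"
        using y C by (intro mult_right_mono) (auto simp: field_simps)
      finally show "norm (f y - f 0 - (y - 0) *\<^sub>R c 1) \<le> e * norm (y - 0)" by simp
    qed (use e C q in auto)
  qed
qed

section \<open>Local bounds, growth and differentiability of the semigroup\<close>

locale sectorial_generator =
  fixes D :: "'w::{banach,second_countable_topology} set" and A :: "'w \<Rightarrow> 'w"
    and S :: "real \<Rightarrow> 'w \<Rightarrow>\<^sub>L 'w"
  assumes sect: "sectorial D A" and res: "{c. 0 \<le> Re c} \<subseteq> resolvent_set D A"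
    and semi: "analytic_C0_semigroup S" and gen: "generates D A S"
begin

lemma S0: "S 0 x = x" and S_plus: "0 \<le> s \<Longrightarrow> 0 \<le> t \<Longrightarrow> S (s + t) = S s o\<^sub>L S t"
  and S_right: "((\<lambda>t. S t x) \<longlongrightarrow> x) (at_right 0)"
  using semi by (auto simp: analytic_C0_semigroup_def)

lemma S_plus_apply: "0 \<le> s \<Longrightarrow> 0 \<le> t \<Longrightarrow> S (s + t) x = S s (S t x)"
  by (simp add: S_plus)

lemma D_zero: "0 \<in> D" "A 0 = 0" and A_scale: "x \<in> D \<Longrightarrow> A (c *\<^sub>R x) = c *\<^sub>R A x"
proof -
  show "0 \<in> D" using sect by (auto simp: sectorial_def subspace_def)
  moreover have *: "\<forall>c. \<forall>x\<in>D. A (c *\<^sub>R x) = c *\<^sub>R A x" using sect by (simp add: sectorial_def)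
  ultimately show "A 0 = 0" by (metis scaleR_zero_left)
  show "x \<in> D \<Longrightarrow> A (c *\<^sub>R x) = c *\<^sub>R A x" using * by blast
qed

text \<open>Strong continuity is given only at 0. Otherwise there would be times tending to 0 with
  operator norms above \<open>4 ^ n\<close>, although every orbit stays bounded along them; the
  gliding hump excludes exactly this growth.\<close>

lemma S_bounded_near_0: "\<exists>d>0. \<exists>M. \<forall>t\<in>{0..d}. norm (S t) \<le> M"
proof (rule ccontr)
  assume neg: "\<not> ?thesis"
  have "\<exists>t. 0 \<le> t \<and> t \<le> 1 / real (Suc n) \<and> 4 ^ n < norm (S t)" for n
  proof -
    have "1 / real (Suc n) > 0" by simp
    then have "\<not> (\<forall>t\<in>{0..1 / real (Suc n)}. norm (S t) \<le> 4 ^ n)" using neg by blast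
    then show ?thesis by (auto simp: not_le)
  qed
  then obtain u where u: "\<And>n. 0 \<le> u n" "\<And>n. u n \<le> 1 / real (Suc n)" "\<And>n. 4 ^ n < norm (S (u n))"
    by metis
  have u0: "u \<longlonglongrightarrow> 0"
  proof (rule tendsto_sandwich[of "\<lambda>_. 0" u sequentially "\<lambda>n. 1 / real (Suc n)"])
    show "(\<lambda>n. 1 / real (Suc n)) \<longlonglongrightarrow> 0" by real_asymp
  qed (use u in auto)
  have "\<exists>B. \<forall>n. norm (S (u n) x) \<le> B" for x
  proof -
    have 1: "((\<lambda>t. S t x) \<longlongrightarrow> S 0 x) (at 0 within {0..})"
      using S_right[of x] by (simp add: at_within_Ici_at_right S0)
    have "(\<lambda>n. S (u n) x) \<longlonglongrightarrow> S 0 x"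
    proof (rule tendstoI)
      fix e :: real assume "e > 0"
      then have "\<forall>\<^sub>F t in at 0 within {0..}. dist (S t x) (S 0 x) < e" using 1 by (simp add: tendstoD)
      then obtain d where d: "d > 0" "\<And>t. t \<in> {0..} \<Longrightarrow> t \<noteq> 0 \<Longrightarrow> dist t 0 < d \<Longrightarrow> dist (S t x) (S 0 x) < e"
        by (auto simp: eventually_at)
      have "\<forall>\<^sub>F n in sequentially. dist (u n) 0 < d" using u0 d(1) by (rule tendstoD)
      then show "\<forall>\<^sub>F n in sequentially. dist (S (u n) x) (S 0 x) < e"
      proof eventually_elim
        fix n assume "dist (u n) 0 < d"
        then show "dist (S (u n) x) (S 0 x) < e"
          using d(2)[of "u n"] u(1)[of n] \<open>e > 0\<close> by (cases "u n = 0") auto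
      qed
    qed
    then have "Bseq (\<lambda>n. S (u n) x)" using convergentI convergent_imp_Bseq by blast
    then show ?thesis by (auto simp: Bseq_def)
  qed
  then obtain n where "norm (S (u n)) < 4 ^ n" using uniform_boundedness_4_power[of "\<lambda>n. S (u n)"] by blast
  then show False using u(3)[of n] by linarith
qed

lemma S_bounded: "\<exists>M\<ge>1. \<forall>t\<in>{0..R}. norm (S t) \<le> M"
proof -
  obtain d M where d: "d > 0" "\<forall>t\<in>{0..d}. norm (S t) \<le> M" using S_bounded_near_0 by blast
  define K where "K = max 1 M"
  have K: "1 \<le> K" "\<And>t. 0 \<le> t \<Longrightarrow> t \<le> d \<Longrightarrow> norm (S t) \<le> K" using d by (auto simp: K_def le_max_iff_disj)
  have "\<forall>t. 0 \<le> t \<and> t \<le> real n * d \<longrightarrow> norm (S t) \<le> K ^ (n + 1)" for n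
  proof (induction n)
    case 0
    then show ?case using K d(1) by auto
  next
    case (Suc n)
    show ?case
    proof (intro allI impI)
      fix t assume t: "0 \<le> t \<and> t \<le> real (Suc n) * d"
      show "norm (S t) \<le> K ^ (Suc n + 1)"
      proof (cases "t \<le> d")
        case True
        then have "norm (S t) \<le> K" using t K by auto
        also have "K \<le> K ^ (Suc n + 1)" using K(1) power_increasing[of 1 "Suc n + 1" K] by simp
        finally show ?thesis .
      next
        case False
        then have "norm (S (d + (t - d))) \<le> norm (S d) * norm (S (t - d))"
          using d(1) by (subst S_plus) (auto intro: norm_blinfun_compose)
        also have "\<dots> \<le> K * K ^ (n + 1)"
          using Suc t False K d(1) by (intro mult_mono) (auto simp: algebra_simps)
        finally show ?thesis by simp
      qed
    qed
  qed
  moreover obtain n where "R / d \<le> real n" using real_arch_simple by blast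
  moreover have "1 \<le> K ^ (n + 1)" for n using K(1) by (rule one_le_power)
  ultimately show ?thesis using d(1)
    by (intro exI[of _ "K ^ (n + 1)"]) (auto simp: field_simps)
qed

definition growth :: "real \<Rightarrow> bool" where
  "growth c \<longleftrightarrow> (\<exists>M. \<forall>t\<ge>0. norm (S t) \<le> M * exp (c * t))"

lemma growth_mono: "growth c \<Longrightarrow> c \<le> c' \<Longrightarrow> growth c'"
  unfolding growth_def
proof (elim exE)
  fix M assume M: "\<forall>t\<ge>0. norm (S t) \<le> M * exp (c * t)" and le: "c \<le> c'"
  have M0: "0 \<le> M" using M[rule_format, of 0] order_trans[OF norm_ge_zero[of "S 0"]] by simp
  have "norm (S t) \<le> M * exp (c' * t)" if "0 \<le> t" for t
  proof -
    have "norm (S t) \<le> M * exp (c * t)" using M that by blast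
    also have "\<dots> \<le> M * exp (c' * t)" using le that M0 by (intro mult_left_mono) (auto intro: mult_right_mono)
    finally show ?thesis .
  qed
  then show "\<exists>M. \<forall>t\<ge>0. norm (S t) \<le> M * exp (c' * t)" by blast
qed

text \<open>By submultiplicativity a single positive time decides the exponential rate. Negative
  \<open>c\<close> is allowed, which is how decay is obtained later.\<close>

lemma growth_from:
  assumes t1: "0 < t1" and le: "norm (S t1) \<le> exp (c * t1)"
  shows "growth c"
proof -
  obtain M where M: "1 \<le> M" "\<forall>t\<in>{0..t1}. norm (S t) \<le> M" using S_bounded by blast
  \<comment> \<open>The factor \<open>exp (\<bar>c\<bar> * t1)\<close> compensates
    \<open>exp (c * r)\<close> falling below 1 when \<open>c\<close> is negative.\<close>
  have M': "norm (S r) \<le> (M * exp (\<bar>c\<bar> * t1)) * exp (c * r)" if "0 \<le> r" "r \<le> t1" for r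
  proof -
    have "- (c * r) \<le> \<bar>c\<bar> * t1"
    proof -
      have "- (c * r) \<le> \<bar>c\<bar> * r" using that by (simp add: abs_if mult_right_mono)
      also have "\<dots> \<le> \<bar>c\<bar> * t1" using that by (intro mult_left_mono) auto
      finally show ?thesis .
    qed
    then have "1 \<le> exp (\<bar>c\<bar> * t1 + c * r)" by simp
    then have "M * 1 \<le> M * exp (\<bar>c\<bar> * t1 + c * r)" using M by (intro mult_left_mono) auto
    moreover have "norm (S r) \<le> M" using M that by simp
    ultimately show ?thesis by (simp add: exp_add mult.assoc)
  qed
  have "\<forall>t. 0 \<le> t \<and> t \<le> real (Suc n) * t1 \<longrightarrow> norm (S t) \<le> (M * exp (\<bar>c\<bar> * t1)) * exp (c * t)" for n
  proof (induction n)
    case 0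
    then show ?case using M' by simp
  next
    case (Suc n)
    show ?case
    proof (intro allI impI)
      fix t assume t: "0 \<le> t \<and> t \<le> real (Suc (Suc n)) * t1"
      show "norm (S t) \<le> (M * exp (\<bar>c\<bar> * t1)) * exp (c * t)"
      proof (cases "t \<le> t1")
        case False
        then have "norm (S (t1 + (t - t1))) \<le> norm (S t1) * norm (S (t - t1))"
          using t1 by (subst S_plus) (auto intro: norm_blinfun_compose)
        also have "\<dots> \<le> exp (c * t1) * ((M * exp (\<bar>c\<bar> * t1)) * exp (c * (t - t1)))"
        proof (intro mult_mono le)
          show "norm (S (t - t1)) \<le> (M * exp (\<bar>c\<bar> * t1)) * exp (c * (t - t1))"
            using Suc.IH[rule_format, of "t - t1"] t False by (simp add: distrib_right)
        qed auto
        also have "\<dots> = (M * exp (\<bar>c\<bar> * t1)) * exp (c * t)"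
          by (simp add: right_diff_distrib exp_diff)
        finally show ?thesis by simp
      qed (use t M' in auto)
    qed
  qed
  then have "norm (S t) \<le> (M * exp (\<bar>c\<bar> * t1)) * exp (c * t)" if "0 \<le> t" for t
  proof -
    obtain n where "t / t1 \<le> real n" using real_arch_simple by blast
    then have "t \<le> real (Suc n) * t1" using t1 by (simp add: field_simps)
    then show ?thesis using that \<open>\<And>n. \<forall>t. 0 \<le> t \<and> t \<le> real (Suc n) * t1 \<longrightarrow> _ t\<close> by blast
  qed
  then show ?thesis unfolding growth_def by blast
qed

lemma ex_growth: "\<exists>c\<ge>0. growth c"
proof -
  obtain M where M: "1 \<le> M" "\<forall>t\<in>{0..1}. norm (S t) \<le> M" using S_bounded by blast
  then have "growth (ln M)" by (intro growth_from[of 1]) auto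
  then show ?thesis using M by (intro exI[of _ "ln M"]) auto
qed

lemma S_continuous: "continuous_on {0..} (\<lambda>t. S t x)"
  unfolding continuous_on_iff
proof (intro ballI allI impI)
  fix s e :: real assume s: "s \<in> {0..}" and e: "0 < e"
  obtain M where M: "1 \<le> M" "\<forall>t\<in>{0..s + 1}. norm (S t) \<le> M" using S_bounded by blast
  have "\<forall>\<^sub>F t in at_right 0. dist (S t x) x < e / M" using S_right[of x] e M by (intro tendstoD) auto
  then obtain d where d: "d > 0" "\<And>t. 0 < t \<Longrightarrow> t < d \<Longrightarrow> dist (S t x) x < e / M"
    by (auto simp: eventually_at_right_field)
  have key: "dist (S (u + h) x) (S u x) < e" if "0 \<le> u" "u \<le> s + 1" "0 \<le> h" "h < d" for u h
  proof (cases "h = 0")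
    case False
    have "S (u + h) x - S u x = S u (S h x - x)"
      using that by (simp add: S_plus_apply blinfun.diff_right)
    then have "dist (S (u + h) x) (S u x) \<le> norm (S u) * norm (S h x - x)"
      by (simp add: dist_norm norm_blinfun)
    also have "\<dots> \<le> M * norm (S h x - x)" using M that by (intro mult_right_mono) auto
    also have "\<dots> < e" using d(2)[of h] that False M(1) by (simp add: dist_norm field_simps)
    finally show ?thesis .
  qed (use e in simp)
  show "\<exists>d>0. \<forall>t\<in>{0..}. dist t s < d \<longrightarrow> dist (S t x) (S s x) < e"
  proof (intro exI[of _ d] conjI ballI impI d)
    fix t :: real assume t: "t \<in> {0..}" "dist t s < d"
    show "dist (S t x) (S s x) < e"
    proof (cases "s \<le> t")
      case True
      then show ?thesis using key[of s "t - s"] t s by (auto simp: dist_real_def)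
    next
      case False
      then show ?thesis using key[of t "s - t"] t s by (auto simp: dist_real_def dist_commute)
    qed
  qed
qed

lemma generator_right: "x \<in> D \<Longrightarrow> ((\<lambda>h. (1 / h) *\<^sub>R (S h x - x)) \<longlongrightarrow> A x) (at_right 0)"
  and generatorI: "((\<lambda>h. (1 / h) *\<^sub>R (S h x - x)) \<longlongrightarrow> y) (at_right 0) \<Longrightarrow> x \<in> D \<and> A x = y"
  using gen unfolding generates_def by blast+

text \<open>Analyticity provides a two-sided derivative at \<open>t > 0\<close>, and its right-hand
  difference quotient is that of the generator at \<open>S t x\<close>. Thus orbits enter
  \<open>D\<close> at once, for every \<open>x\<close>.\<close>

lemma S_deriv:
  assumes t: "0 < t"
  shows "S t x \<in> D" "((\<lambda>t. S t x) has_vector_derivative A (S t x)) (at t)"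
    "x \<in> D \<Longrightarrow> A (S t x) = S t (A x)"
proof -
  obtain r c where r: "r > 0" "\<And>h. \<bar>h\<bar> < r \<Longrightarrow> (\<lambda>n. h ^ n *\<^sub>R c n) sums S (t + h) x"
    using semi t unfolding analytic_C0_semigroup_def by meson
  define y where "y = c 1"
  have "((\<lambda>h. S (t + h) x) has_vector_derivative y) (at 0)"
    unfolding y_def by (rule power_series_has_vector_derivative[OF r])
  note deriv = this
  have "((\<lambda>s. s - t) has_vector_derivative 1) (at t)"
    by (auto intro!: derivative_eq_intros simp: has_real_derivative_iff_has_vector_derivative[symmetric])
  then have "((\<lambda>h. S (t + h) x) \<circ> (\<lambda>s. s - t) has_vector_derivative 1 *\<^sub>R y) (at t)"
    using deriv by (intro vector_diff_chain_at) auto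
  then have deriv_t: "((\<lambda>s. S s x) has_vector_derivative y) (at t)" by (simp add: o_def)
  have "((\<lambda>h. norm (S (t + h) x - S t x - h *\<^sub>R y) / norm h) \<longlongrightarrow> 0) (at 0)"
    using deriv unfolding has_vector_derivative_def has_derivative_iff_norm by simp
  then have "((\<lambda>h. norm (S (t + h) x - S t x - h *\<^sub>R y) / norm h) \<longlongrightarrow> 0) (at_right 0)"
    by (rule tendsto_mono[OF at_le, rotated]) simp
  moreover have "\<forall>\<^sub>F h in at_right 0. norm (S (t + h) x - S t x - h *\<^sub>R y) / norm h =
      norm ((1 / h) *\<^sub>R (S (t + h) x - S t x) - y)"
  proof (rule eventually_mono[OF eventually_at_right_less])
    fix h :: real assume h: "0 < h"
    have "(1 / h) *\<^sub>R (S (t + h) x - S t x) - y = (1 / h) *\<^sub>R (S (t + h) x - S t x - h *\<^sub>R y)"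
      using h by (simp add: scaleR_diff_right)
    then show "norm (S (t + h) x - S t x - h *\<^sub>R y) / norm h = norm ((1 / h) *\<^sub>R (S (t + h) x - S t x) - y)"
      using h by simp
  qed
  ultimately have "((\<lambda>h. norm ((1 / h) *\<^sub>R (S (t + h) x - S t x) - y)) \<longlongrightarrow> 0) (at_right 0)"
    by (rule Lim_transform_eventually)
  then have right: "((\<lambda>h. (1 / h) *\<^sub>R (S (t + h) x - S t x)) \<longlongrightarrow> y) (at_right 0)"
    by (simp add: tendsto_norm_zero_iff LIM_zero_iff)
  have pos: "\<forall>\<^sub>F h in at_right (0::real). 0 < h" by (rule eventually_at_right_less)
  have "((\<lambda>h. (1 / h) *\<^sub>R (S h (S t x) - S t x)) \<longlongrightarrow> y) (at_right 0)"
    using t by (intro Lim_transform_eventually[OF right eventually_mono[OF pos]])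
      (simp add: S_plus_apply[symmetric] add.commute)
  then have D: "S t x \<in> D \<and> A (S t x) = y" by (rule generatorI)
  then show "S t x \<in> D" by simp
  show "((\<lambda>t. S t x) has_vector_derivative A (S t x)) (at t)" using deriv_t D by simp
  show "A (S t x) = S t (A x)" if x: "x \<in> D"
  proof -
    have "((\<lambda>h. S t ((1 / h) *\<^sub>R (S h x - x))) \<longlongrightarrow> S t (A x)) (at_right 0)"
      by (intro tendsto_intros generator_right x)
    then have "((\<lambda>h. (1 / h) *\<^sub>R (S (t + h) x - S t x)) \<longlongrightarrow> S t (A x)) (at_right 0)"
      using t by (rule_tac Lim_transform_eventually[OF _ eventually_mono[OF pos]])
        (auto simp: S_plus_apply blinfun.scaleR_right blinfun.diff_right)
    then show ?thesis using tendsto_unique[OF trivial_limit_at_right_real right] D by simp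
  qed
qed

text \<open>\<open>A\<^sup>-\<^sup>1\<close> is bounded because \<open>0\<close> is in the resolvent set; it makes \<open>A\<close> commute with integrals.\<close>

lemma ex_inverse: "\<exists>Q :: 'w \<Rightarrow>\<^sub>L 'w. (\<forall>y. Q y \<in> D \<and> A (Q y) = y) \<and> (\<forall>x\<in>D. Q (A x) = x)"
proof -
  have "0 \<in> resolvent_set D A" using res by auto
  then obtain R where R: "is_resolvent D A 0 R" by (auto simp: resolvent_set_def)
  have c0: "cscale 0 p = 0" for p :: "'w \<times> 'w" by (simp add: cscale_def zero_prod_def)
  \<comment> \<open>At the point 0 the resolvent equation reads \<open>- A (R p) = p\<close> in each
    component, so the first component with reversed sign inverts \<open>A\<close>.\<close>
  define f where "f y = - fst (R (y, 0))" for y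
  have bl: "bounded_linear f" unfolding f_def
    by (intro bounded_linear_minus bounded_linear_fst_comp blinfun.bounded_linear_right[THEN bounded_linear_compose]
        bounded_linear_Pair bounded_linear_ident bounded_linear_zero)
  have 1: "f y \<in> D \<and> A (f y) = y" for y
  proof -
    have r: "R (y, 0) \<in> D \<times> D" "cscale 0 (R (y, 0)) - map_prod A A (R (y, 0)) = (y, 0)"
      using R unfolding is_resolvent_def by blast+
    then have "fst (R (y, 0)) \<in> D" "A (fst (R (y, 0))) = - y"
      by (auto simp: c0 prod_eq_iff minus_equation_iff)
    moreover have "f y = (-1) *\<^sub>R fst (R (y, 0))" by (simp add: f_def)
    moreover have "subspace D" using sect by (simp add: sectorial_def)
    ultimately show ?thesis
      using A_scale[of "fst (R (y, 0))" "-1"] subspace_scale[of D "fst (R (y, 0))" "-1"] by simp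
  qed
  have 2: "f (A x) = x" if "x \<in> D" for x
  proof -
    have "R (cscale 0 (x, 0) - map_prod A A (x, 0)) = (x, 0)"
      using R that D_zero unfolding is_resolvent_def by blast
    then have "R (- (A x, 0)) = (x, 0)" by (simp add: c0 D_zero)
    then have "- R (A x, 0) = (x, 0)" by (simp only: blinfun.minus_right)
    then show ?thesis by (auto simp: f_def prod_eq_iff)
  qed
  show ?thesis
    using 1 2 by (intro exI[of _ "Blinfun f"]) (simp add: bounded_linear_Blinfun_apply[OF bl])
qed

text \<open>Far from the vertex the half-plane lies inside the sector and the sectorial estimate
  applies; the remaining part is compact and the resolvent is locally bounded there. The
  \<open>1 +\<close> in the denominator merges the two regimes.\<close>

lemma resolvent_bound:
  "\<exists>K\<ge>1. \<forall>c R. 0 \<le> Re c \<longrightarrow> is_resolvent D A c R \<longrightarrow> norm R \<le> K / (1 + cmod c)"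
proof -
  have unique: "R = R'" if R: "is_resolvent D A c R" and R': "is_resolvent D A c R'" for c R R'
  proof (rule blinfun_eqI)
    fix p
    have "R' p \<in> D \<times> D" "cscale c (R' p) - map_prod A A (R' p) = p"
      using R' unfolding is_resolvent_def by blast+
    then show "R p = R' p" using R unfolding is_resolvent_def by metis
  qed
  obtain a \<theta> M where sec: "pi / 2 < \<theta>" "\<theta> < pi"
    "\<And>c. c \<noteq> of_real a \<Longrightarrow> \<bar>Arg (c - of_real a)\<bar> < \<theta> \<Longrightarrow>
      \<exists>R. is_resolvent D A c R \<and> norm R \<le> M / cmod (c - of_real a)"
    using sect unfolding sectorial_def by metis
  have cos\<theta>: "cos \<theta> < 0"
    using sec(1,2) cos_monotone_0_pi[of "pi / 2" \<theta>] by simp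
  have a_div: "0 \<le> \<bar>a\<bar> / (- cos \<theta>)" using cos\<theta> by (intro divide_nonneg_nonneg) auto
  \<comment> \<open>If \<open>z = c - a\<close> had argument at least \<theta> in absolute value and
    modulus above \<open>\<bar>a\<bar> / (- cos \<theta>)\<close>, its real part would be below
    \<open>- \<bar>a\<bar>\<close>, impossible for \<open>c\<close> in the half-plane. The other
    summands make \<open>\<bar>z\<bar>\<close> comparable to
    \<open>1 + \<bar>c\<bar>\<close>.\<close>
  define \<rho> where "\<rho> = \<bar>a\<bar> / (- cos \<theta>) + 2 * \<bar>a\<bar> + 1"
  have far: "norm R \<le> (2 * \<bar>M\<bar> * (1 + 1 / 1)) / (1 + cmod c)"
    if c: "0 \<le> Re c" "\<rho> < cmod c" and R: "is_resolvent D A c R" for c R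
  proof -
    define z where "z = c - of_real a"
    have cmod_z: "cmod c - \<bar>a\<bar> \<le> cmod z"
      using norm_triangle_ineq2[of c "of_real a"] by (simp add: z_def)
    have cz: "\<bar>a\<bar> / (- cos \<theta>) < cmod z" "1 + \<bar>a\<bar> < cmod z" "0 < cmod z"
      using c(2) cmod_z a_div unfolding \<rho>_def by linarith+
    have "\<bar>Arg z\<bar> < \<theta>"
    proof (rule ccontr)
      assume "\<not> \<bar>Arg z\<bar> < \<theta>"
      then have "cos \<bar>Arg z\<bar> \<le> cos \<theta>"
        using sec Arg_bounded[of z] by (intro cos_monotone_0_pi_le) auto
      then have "cmod z * cos (Arg z) \<le> cmod z * cos \<theta>" by (intro mult_left_mono) auto
      moreover have "Re z = cmod z * cos (Arg z)"
        using arg_cong[OF rcis_cmod_Arg[of z], of Re] by simp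
      moreover have "cmod z * cos \<theta> < - \<bar>a\<bar>"
        using cz(1) cos\<theta> by (simp add: field_simps)
      moreover have "Re z \<ge> - \<bar>a\<bar>" using c(1) by (simp add: z_def)
      ultimately show False by linarith
    qed
    moreover have "c \<noteq> of_real a" using cz(3) by (auto simp: z_def)
    ultimately obtain R' where "is_resolvent D A c R'" "norm R' \<le> M / cmod z"
      using sec(3)[of c] by (auto simp: z_def)
    then have "norm R \<le> M / cmod z" using unique[OF R] by blast
    also have "\<dots> \<le> \<bar>M\<bar> / cmod z" using cz(3) by (intro divide_right_mono) auto
    also have "\<dots> \<le> \<bar>M\<bar> / ((1 + cmod c) / 4)"
    proof (rule divide_left_mono)
      show "(1 + cmod c) / 4 \<le> cmod z" using cz(2) cmod_z cz(3) by simp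
      show "0 < cmod z * ((1 + cmod c) / 4)"
        using cz(3) by (intro mult_pos_pos) (auto simp: add_pos_nonneg)
    qed simp
    also have "\<dots> = (2 * \<bar>M\<bar> * (1 + 1 / 1)) / (1 + cmod c)" by simp
    finally show ?thesis .
  qed
  have near: "\<exists>B. \<forall>c\<in>{c. 0 \<le> Re c \<and> cmod c \<le> \<rho>}. \<forall>R. is_resolvent D A c R \<longrightarrow> norm R \<le> B"
  proof -
    have "closed {c. 0 \<le> Re c}" by (rule closed_halfspace_Re_ge)
    moreover have "{c. 0 \<le> Re c \<and> cmod c \<le> \<rho>} = {c. 0 \<le> Re c} \<inter> cball 0 \<rho>" by auto
    ultimately have comp: "compact {c. 0 \<le> Re c \<and> cmod c \<le> \<rho>}" by auto
    have loc: "\<exists>d B. 0 < d \<and> (\<forall>c' R. dist c' c < d \<longrightarrow> is_resolvent D A c' R \<longrightarrow> norm R \<le> B)"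
      if c: "0 \<le> Re c" for c
    proof -
      obtain R0 where R0: "is_resolvent D A c R0" using res c by (auto simp: resolvent_set_def)
      \<comment> \<open>Small enough that the perturbation \<open>(c - c') q\<close>, estimated by
        \<open>norm_cscale_le\<close>, is absorbed with factor \<open>1 / 2\<close>; the
        \<open>+ 1\<close> guards against a vanishing norm.\<close>
      define d where "d = 1 / (4 * (norm R0 + 1))"
      have dpos: "0 < d" by (simp add: d_def add_nonneg_pos)
      have dR: "2 * d * norm R0 \<le> 1 / 2"
        using norm_ge_zero[of R0] by (simp add: d_def divide_simps del: norm_ge_zero)
      have "norm R \<le> 2 * norm R0" if c': "dist c' c < d" and R: "is_resolvent D A c' R" for c' R
      proof (rule norm_blinfun_bound)
        fix p
        define q where "q = R p"
        have q: "q \<in> D \<times> D" "cscale c' q - map_prod A A q = p"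
          using R unfolding is_resolvent_def q_def by blast+
        have "cscale c q - map_prod A A q = p + cscale (c - c') q"
          unfolding q(2)[symmetric] by (simp add: cscale_def prod_eq_iff algebra_simps)
        then have "q = R0 (p + cscale (c - c') q)"
          using R0 q(1) unfolding is_resolvent_def by metis
        then have "norm q \<le> norm R0 * norm (p + cscale (c - c') q)" by (metis norm_blinfun)
        also have "norm (p + cscale (c - c') q) \<le> norm p + 2 * d * norm q"
        proof (rule norm_triangle_le, rule add_left_mono)
          have "norm (cscale (c - c') q) \<le> 2 * cmod (c - c') * norm q" by (rule norm_cscale_le)
          also have "\<dots> \<le> 2 * d * norm q"
            using c' by (intro mult_right_mono) (auto simp: dist_norm norm_minus_commute)
          finally show "norm (cscale (c - c') q) \<le> 2 * d * norm q" .
        qed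
        finally have "norm q \<le> norm R0 * (norm p + 2 * d * norm q)"
          by (simp add: mult_left_mono)
        also have "\<dots> = norm R0 * norm p + (2 * d * norm R0) * norm q" by (simp add: algebra_simps)
        also have "\<dots> \<le> norm R0 * norm p + 1 / 2 * norm q"
          using dR by (intro add_left_mono mult_right_mono) auto
        finally show "norm (R p) \<le> 2 * norm R0 * norm p" unfolding q_def[symmetric] by simp
      qed simp
      then show ?thesis using dpos by blast
    qed
    then obtain d B where dB: "\<And>c. 0 \<le> Re c \<Longrightarrow> 0 < d c"
      "\<And>c c' R. 0 \<le> Re c \<Longrightarrow> dist c' c < d c \<Longrightarrow> is_resolvent D A c' R \<Longrightarrow> norm R \<le> B c"
      by metis
    let ?K = "{c. 0 \<le> Re c \<and> cmod c \<le> \<rho>}"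
    have "?K \<subseteq> (\<Union>c\<in>?K. ball c (d c))" using dB(1) by auto
    then obtain C where C: "C \<subseteq> ?K" "finite C" "?K \<subseteq> (\<Union>c\<in>C. ball c (d c))"
      using compactE_image[OF comp, of ?K "\<lambda>c. ball c (d c)"] by blast
    have "norm R \<le> (\<Sum>c\<in>C. \<bar>B c\<bar>)" if c: "c \<in> ?K" and R: "is_resolvent D A c R" for c R
    proof -
      obtain c0 where c0: "c0 \<in> C" "c \<in> ball c0 (d c0)" using C c by blast
      then have "norm R \<le> B c0" using dB(2)[of c0 c R] C R by (auto simp: dist_commute)
      also have "\<dots> \<le> (\<Sum>c\<in>C. \<bar>B c\<bar>)"
        using member_le_sum[OF c0(1), of "\<lambda>c. \<bar>B c\<bar>"] C(2) by auto
      finally show ?thesis .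
    qed
    then show ?thesis by blast
  qed
  then obtain B where B: "\<And>c R. 0 \<le> Re c \<Longrightarrow> cmod c \<le> \<rho> \<Longrightarrow> is_resolvent D A c R \<Longrightarrow> norm R \<le> B" by blast
  define K where "K = 1 + 4 * \<bar>M\<bar> + \<bar>B\<bar> * (1 + \<bar>\<rho>\<bar>)"
  have K1: "4 * \<bar>M\<bar> \<le> K" "\<bar>B\<bar> * (1 + \<bar>\<rho>\<bar>) \<le> K" "1 \<le> K" by (auto simp: K_def)
  have "norm R \<le> K / (1 + cmod c)" if c: "0 \<le> Re c" and R: "is_resolvent D A c R" for c R
  proof (cases "\<rho> < cmod c")
    case True
    then have "norm R \<le> 4 * \<bar>M\<bar> / (1 + cmod c)" using far[OF c True R] by simp
    also have "\<dots> \<le> K / (1 + cmod c)" using K1 by (intro divide_right_mono) auto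
    finally show ?thesis .
  next
    case False
    then have "norm R \<le> \<bar>B\<bar>" using B[OF c _ R] by simp
    then have "norm R * (1 + cmod c) \<le> \<bar>B\<bar> * (1 + \<bar>\<rho>\<bar>)" using False by (intro mult_mono) auto
    then show ?thesis using K1 by (simp add: pos_le_divide_eq add_pos_nonneg)
  qed
  then show ?thesis using K1 by blast
qed

section \<open>Laplace transforms and powers of the resolvent\<close>

text \<open>The rate is strictly faster than the growth exponent, so that
  \<open>\<phi> t *\<^sub>R S t x\<close> decays exponentially and is integrable together with its
  boundary term at infinity.\<close>

definition decaying :: "real \<Rightarrow> (real \<Rightarrow> real) \<Rightarrow> bool" where
  "decaying \<omega> \<phi> \<longleftrightarrow> continuous_on {0<..} \<phi> \<and> (\<exists>K d. \<omega> < d \<and> (\<forall>t>0. \<bar>\<phi> t\<bar> \<le> K * exp (- d * t)))"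

definition transform :: "(real \<Rightarrow> real) \<Rightarrow> 'w \<Rightarrow> 'w" where
  "transform \<phi> x = (LINT t:{0<..}|lborel. \<phi> t *\<^sub>R S t x)"

lemma S_continuous_pos: "continuous_on {0<..} (\<lambda>t. S t x)"
  by (rule continuous_on_subset[OF S_continuous]) auto

lemma decaying_bound:
  assumes "growth \<omega>" "decaying \<omega> \<phi>"
  shows "\<exists>K e. 0 < e \<and> 0 \<le> K \<and> (\<forall>t>0. norm (\<phi> t *\<^sub>R S t x) \<le> K * exp (- (t * e)))"
proof -
  obtain M where M: "\<And>t. 0 \<le> t \<Longrightarrow> norm (S t) \<le> M * exp (\<omega> * t)"
    using assms(1) unfolding growth_def by blast
  have M0: "0 \<le> M" using order_trans[OF norm_ge_zero M[of 0]] by simp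
  obtain K d where K: "\<omega> < d" "\<And>t. 0 < t \<Longrightarrow> \<bar>\<phi> t\<bar> \<le> K * exp (- d * t)"
    using assms(2) unfolding decaying_def by blast
  have "0 \<le> K * exp (- d * 1)" using K(2)[of 1] by linarith
  then have K0: "0 \<le> K" by (simp add: zero_le_mult_iff)
  have "norm (\<phi> t *\<^sub>R S t x) \<le> (K * M * norm x) * exp (- (t * (d - \<omega>)))" if t: "0 < t" for t
  proof -
    have "norm (\<phi> t *\<^sub>R S t x) \<le> \<bar>\<phi> t\<bar> * (norm (S t) * norm x)"
      by (simp add: norm_blinfun mult_left_mono)
    also have "\<dots> \<le> (K * exp (- d * t)) * ((M * exp (\<omega> * t)) * norm x)"
      using K(2)[OF t] M[of t] t K0 by (intro mult_mono mult_right_mono) auto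
    also have "\<dots> = (K * M * norm x) * (exp (- d * t) * exp (\<omega> * t))" by (simp add: mult_ac)
    also have "exp (- d * t) * exp (\<omega> * t) = exp (- (t * (d - \<omega>)))"
      by (simp add: exp_add[symmetric] algebra_simps)
    finally show ?thesis .
  qed
  then show ?thesis using K(1) K0 M0 by (intro exI[of _ "K * M * norm x"] exI[of _ "d - \<omega>"]) auto
qed

lemma transform_integrable:
  assumes "growth \<omega>" "decaying \<omega> \<phi>"
  shows "set_integrable lborel {0<..} (\<lambda>t. \<phi> t *\<^sub>R S t x)"
proof -
  obtain K e where K: "0 < e" "0 \<le> K" "\<And>t. 0 < t \<Longrightarrow> norm (\<phi> t *\<^sub>R S t x) \<le> K * exp (- (t * e))"
    using decaying_bound[OF assms, of x] by blast
  have "continuous_on {0<..} \<phi>" using assms(2) by (simp add: decaying_def)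
  then have cont: "continuous_on {0<..} (\<lambda>t. \<phi> t *\<^sub>R S t x)"
    by (intro continuous_on_scaleR S_continuous_pos)
  have int: "set_integrable lborel {0<..} (\<lambda>t. K * exp (- (t * e)))"
    by (rule set_integrable_mult_right[OF integrable_I0i_exp_mscale[OF K(1)]])
  show ?thesis
    by (rule set_integrable_continuous_bound[OF cont _ int]) (use K(3) in simp_all)
qed

lemma transform_linear:
  assumes "growth \<omega>" "decaying \<omega> \<phi>" "decaying \<omega> \<psi>"
  shows "transform (\<lambda>t. a * \<phi> t + b * \<psi> t) x = a *\<^sub>R transform \<phi> x + b *\<^sub>R transform \<psi> x"
proof -
  have "transform (\<lambda>t. a * \<phi> t + b * \<psi> t) x = (LINT t:{0<..}|lborel. a *\<^sub>R (\<phi> t *\<^sub>R S t x) + b *\<^sub>R (\<psi> t *\<^sub>R S t x))"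
    by (simp add: transform_def scaleR_add_left)
  also have "\<dots> = (LINT t:{0<..}|lborel. a *\<^sub>R (\<phi> t *\<^sub>R S t x)) + (LINT t:{0<..}|lborel. b *\<^sub>R (\<psi> t *\<^sub>R S t x))"
    by (intro set_integral_add set_integrable_scaleR_right transform_integrable[OF assms(1)] assms)
  also have "\<dots> = a *\<^sub>R transform \<phi> x + b *\<^sub>R transform \<psi> x"
    by (simp add: transform_def del: scaleR_scaleR)
  finally show ?thesis .
qed

lemma decaying_linear:
  assumes "decaying \<omega> \<phi>" "decaying \<omega> \<psi>"
  shows "decaying \<omega> (\<lambda>t. a * \<phi> t + b * \<psi> t)"
proof -
  obtain K d where K: "\<omega> < d" "\<And>t. 0 < t \<Longrightarrow> \<bar>\<phi> t\<bar> \<le> K * exp (- d * t)"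
    using assms(1) unfolding decaying_def by blast
  obtain K' d' where K': "\<omega> < d'" "\<And>t. 0 < t \<Longrightarrow> \<bar>\<psi> t\<bar> \<le> K' * exp (- d' * t)"
    using assms(2) unfolding decaying_def by blast
  have le: "\<bar>f\<bar> * (k * exp (- e * t)) \<le> \<bar>f\<bar> * (\<bar>k\<bar> * exp (- min d d' * t))"
    if "0 < t" "min d d' \<le> e" for f k e t
    using that by (intro mult_left_mono mult_mono) (auto simp: mult_right_mono)
  have "\<bar>a * \<phi> t + b * \<psi> t\<bar> \<le> (\<bar>a\<bar> * \<bar>K\<bar> + \<bar>b\<bar> * \<bar>K'\<bar>) * exp (- min d d' * t)" if t: "0 < t" for t
  proof -
    have "\<bar>a * \<phi> t + b * \<psi> t\<bar> \<le> \<bar>a\<bar> * \<bar>\<phi> t\<bar> + \<bar>b\<bar> * \<bar>\<psi> t\<bar>"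
      by (metis abs_mult abs_triangle_ineq)
    also have "\<dots> \<le> \<bar>a\<bar> * (K * exp (- d * t)) + \<bar>b\<bar> * (K' * exp (- d' * t))"
      using K(2)[OF t] K'(2)[OF t] by (intro add_mono mult_left_mono) auto
    also have "\<dots> \<le> \<bar>a\<bar> * (\<bar>K\<bar> * exp (- min d d' * t)) + \<bar>b\<bar> * (\<bar>K'\<bar> * exp (- min d d' * t))"
      using t by (intro add_mono le) auto
    finally show ?thesis by (simp add: distrib_right mult.assoc)
  qed
  moreover have "\<omega> < min d d'" using K K' by simp
  moreover have "continuous_on {0<..} (\<lambda>t. a * \<phi> t + b * \<psi> t)"
    using assms unfolding decaying_def by (intro continuous_intros) auto
  ultimately show ?thesis unfolding decaying_def by blast
qed

text \<open>Integration by parts of \<open>\<phi> t *\<^sub>R S t x\<close> over the half-line. That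
  \<open>A\<close> may be taken out of the integral comes from the bounded inverse \<open>Q\<close>:
  the integrand is \<open>Q\<close> of an integrable function.\<close>

lemma transform_parts:
  assumes gr: "growth \<omega>" and x: "x \<in> D" and dec: "decaying \<omega> \<phi>" "decaying \<omega> \<phi>'"
    and der: "\<And>t. 0 < t \<Longrightarrow> (\<phi> has_real_derivative \<phi>' t) (at t)"
    and lim: "(\<phi> \<longlongrightarrow> \<phi>0) (at_right 0)"
  shows "transform \<phi> (A x) + transform \<phi>' x = - \<phi>0 *\<^sub>R x"
    and "transform \<phi> x \<in> D" and "A (transform \<phi> x) = transform \<phi> (A x)"
proof -
  have int1: "set_integrable lborel {0<..} (\<lambda>t. \<phi> t *\<^sub>R S t (A x))"
    and int2: "set_integrable lborel {0<..} (\<lambda>t. \<phi>' t *\<^sub>R S t x)"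
    by (intro transform_integrable[OF gr] dec)+
  have "(LINT t:{0<..}|lborel. \<phi> t *\<^sub>R S t (A x) + \<phi>' t *\<^sub>R S t x) = - (\<phi>0 *\<^sub>R x)"
  proof (rule lborel_FTC_Ioi)
    show "continuous_on {0<..} (\<lambda>t. \<phi> t *\<^sub>R S t (A x) + \<phi>' t *\<^sub>R S t x)"
      using dec unfolding decaying_def
      by (intro continuous_on_add continuous_on_scaleR S_continuous_pos) auto
    show "set_integrable lborel {0<..} (\<lambda>t. \<phi> t *\<^sub>R S t (A x) + \<phi>' t *\<^sub>R S t x)"
      by (intro set_integral_add int1 int2)
    show "((\<lambda>t. \<phi> t *\<^sub>R S t x) has_vector_derivative \<phi> t *\<^sub>R S t (A x) + \<phi>' t *\<^sub>R S t x) (at t)"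
      if t: "0 < t" for t
      using has_vector_derivative_scaleR[OF der[OF t] S_deriv(2)[OF t, of x]] S_deriv(3)[OF t x] by simp
    show "((\<lambda>t. \<phi> t *\<^sub>R S t x) \<longlongrightarrow> \<phi>0 *\<^sub>R x) (at_right 0)"
      by (intro tendsto_scaleR lim S_right)
    obtain K e where K: "0 < e" "0 \<le> K" "\<And>t. 0 < t \<Longrightarrow> norm (\<phi> t *\<^sub>R S t x) \<le> K * exp (- (t * e))"
      using decaying_bound[OF gr dec(1), of x] by blast
    show "((\<lambda>t. \<phi> t *\<^sub>R S t x) \<longlongrightarrow> 0) at_top"
    proof (rule Lim_null_comparison)
      show "\<forall>\<^sub>F t in at_top. norm (\<phi> t *\<^sub>R S t x) \<le> K * exp (- (t * e))"
        using eventually_gt_at_top[of 0] by eventually_elim (rule K)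
      show "((\<lambda>t. K * exp (- (t * e))) \<longlongrightarrow> 0) at_top" using K(1) by real_asymp
    qed
  qed
  then show "transform \<phi> (A x) + transform \<phi>' x = - \<phi>0 *\<^sub>R x"
    unfolding transform_def using set_integral_add(2)[OF int1 int2] by simp
  obtain Q :: "'w \<Rightarrow>\<^sub>L 'w" where Q: "\<And>y. Q y \<in> D" "\<And>y. A (Q y) = y" "\<And>x. x \<in> D \<Longrightarrow> Q (A x) = x"
    using ex_inverse by blast
  have "transform \<phi> x = (LINT t:{0<..}|lborel. Q (\<phi> t *\<^sub>R S t (A x)))"
    unfolding transform_def
  proof (rule set_lebesgue_integral_cong)
    show "\<forall>t. t \<in> {0<..} \<longrightarrow> \<phi> t *\<^sub>R S t x = Q (\<phi> t *\<^sub>R S t (A x))"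
      using S_deriv(1,3) x Q(3) by (simp add: blinfun.scaleR_right) (metis Q(3) S_deriv(1,3))
  qed simp
  also have "\<dots> = Q (transform \<phi> (A x))"
    unfolding transform_def by (rule set_integral_blinfun[OF int1])
  finally show "transform \<phi> x \<in> D" "A (transform \<phi> x) = transform \<phi> (A x)" using Q by auto
qed

text \<open>With this normalisation differentiation lowers the index by one, matching multiplication
  of a resolvent power by \<open>c + i \<eta> - A\<close>.\<close>

definition wt :: "nat \<Rightarrow> real \<Rightarrow> real" where
  "wt k t = t ^ k / fact k"

lemma wt_le:
  assumes "0 < e" "0 \<le> t"
  shows "\<bar>wt k t\<bar> \<le> (1 / e ^ k) * exp (e * t)"
proof -
  have "(e * t) ^ k / fact k = (\<Sum>n\<in>{k}. inverse (fact n) *\<^sub>R (e * t) ^ n)" by (simp add: divide_inverse)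
  also have "\<dots> \<le> (\<Sum>n. inverse (fact n) *\<^sub>R (e * t) ^ n)"
    using assms by (intro sum_le_suminf summable_exp_generic) auto
  also have "\<dots> = exp (e * t)" by (simp add: exp_def)
  finally show ?thesis using assms by (simp add: wt_def power_mult_distrib field_simps)
qed

lemma wt_deriv: "(wt (Suc k) has_real_derivative wt k t) (at t)"
proof -
  have "((\<lambda>t. t ^ Suc k / fact (Suc k)) has_real_derivative (real (Suc k) * t ^ k) / fact (Suc k)) (at t)"
    by (intro DERIV_cdivide) (use DERIV_pow[of "Suc k" t] in simp)
  then show ?thesis by (simp add: wt_def[abs_def] del: power_Suc of_nat_Suc)
qed

lemma decaying_wt:
  assumes "\<omega> < c" "\<And>t. \<bar>g t\<bar> \<le> 1" "continuous_on UNIV g"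
  shows "decaying \<omega> (\<lambda>t. wt k t * exp (- c * t) * g t)"
proof -
  define e where "e = (c - \<omega>) / 2"
  have e: "0 < e" "\<omega> < c - e" using assms(1) by (auto simp: e_def field_simps)
  have "\<bar>wt k t * exp (- c * t) * g t\<bar> \<le> (1 / e ^ k) * exp (- (c - e) * t)" if "0 < t" for t
  proof -
    have "\<bar>wt k t * exp (- c * t) * g t\<bar> \<le> ((1 / e ^ k) * exp (e * t)) * exp (- c * t) * 1"
      unfolding abs_mult using that assms(2) wt_le[OF e(1), of t k] e by (intro mult_mono) auto
    also have "\<dots> = (1 / e ^ k) * exp (- (c - e) * t)"
      by (simp add: exp_add[symmetric] algebra_simps)
    finally show ?thesis .
  qed
  moreover have "continuous_on {0<..} (\<lambda>t. wt k t * exp (- c * t) * g t)"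
    unfolding wt_def by (intro continuous_intros continuous_on_subset[OF assms(3)]) auto
  ultimately show ?thesis unfolding decaying_def using e(2) by blast
qed

definition lap :: "nat \<Rightarrow> real \<Rightarrow> real \<Rightarrow> 'w \<Rightarrow> 'w \<times> 'w" where
  "lap k c \<eta> x = (transform (\<lambda>t. wt k t * exp (- c * t) * cos (\<eta> * t)) x,
                 - transform (\<lambda>t. wt k t * exp (- c * t) * sin (\<eta> * t)) x)"

text \<open>\<open>lap k c \<eta> x\<close> is the Laplace transform of \<open>t\<^sup>k S(t) x / k!\<close> at \<open>c + i \<eta>\<close>, that is,
  \<open>R(c + i \<eta>)\<^sup>k\<^sup>+\<^sup>1 x\<close>.\<close>

lemma lap_resolvent:
  assumes gr: "growth \<omega>" "\<omega> < c" and x: "x \<in> D" and R: "is_resolvent D A (Complex c \<eta>) R"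
  shows "lap 0 c \<eta> x = R (x, 0)" and "lap (Suc k) c \<eta> x = R (lap k c \<eta> x)"
proof -
  \<comment> \<open>\<open>C k\<close> is the real part and \<open>E k\<close> minus the imaginary
    part of \<open>wt k t * exp (- (c + i \<eta>) t)\<close>.\<close>
  define C where "C k t = wt k t * exp (- c * t) * cos (\<eta> * t)" for k t
  define E where "E k t = wt k t * exp (- c * t) * sin (\<eta> * t)" for k t
  have dec: "decaying \<omega> (C k)" "decaying \<omega> (E k)" for k
    unfolding C_def[abs_def] E_def[abs_def]
    by (rule decaying_wt[OF gr(2)]; auto intro!: continuous_intros abs_cos_le_one abs_sin_le_one)+
  have lap: "lap k c \<eta> x = (transform (C k) x, - transform (E k) x)" for k
    by (simp add: lap_def C_def[abs_def] E_def[abs_def])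
  have der: "((\<lambda>t. exp (- c * t) * cos (\<eta> * t)) has_real_derivative
        - c * (exp (- c * t) * cos (\<eta> * t)) - \<eta> * (exp (- c * t) * sin (\<eta> * t))) (at t)"
      "((\<lambda>t. exp (- c * t) * sin (\<eta> * t)) has_real_derivative
        - c * (exp (- c * t) * sin (\<eta> * t)) + \<eta> * (exp (- c * t) * cos (\<eta> * t))) (at t)" for t
    by (auto intro!: derivative_eq_intros simp: algebra_simps)
  \<comment> \<open>\<open>R\<close> is a left inverse on \<open>D \<times> D\<close>, so it
    suffices to check the resolvent equation in both components.\<close>
  have resolve: "lap k c \<eta> x = R p"
    if "A (transform (C k) x) = c *\<^sub>R transform (C k) x + \<eta> *\<^sub>R transform (E k) x - fst p"
      "A (transform (E k) x) = c *\<^sub>R transform (E k) x - \<eta> *\<^sub>R transform (C k) x + snd p"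
      "transform (C k) x \<in> D" "transform (E k) x \<in> D" for k p
  proof -
    have "subspace D" using sect by (simp add: sectorial_def)
    then have mD: "- transform (E k) x \<in> D" "A (- transform (E k) x) = - A (transform (E k) x)"
      using that(4) A_scale[OF that(4), of "-1"] subspace_scale[of D "transform (E k) x" "-1"] by auto
    have "cscale (Complex c \<eta>) (lap k c \<eta> x) - map_prod A A (lap k c \<eta> x) = p"
      by (simp add: lap cscale_def mD(2) that(1,2) prod_eq_iff)
    moreover have "lap k c \<eta> x \<in> D \<times> D" using that(3) mD by (simp add: lap)
    ultimately show ?thesis using R unfolding is_resolvent_def by metis
  qed
  have C0: "(C 0 \<longlongrightarrow> 1) (at_right 0)" "(E 0 \<longlongrightarrow> 0) (at_right 0)"
    "(C (Suc k) \<longlongrightarrow> 0) (at_right 0)" "(E (Suc k) \<longlongrightarrow> 0) (at_right 0)" for k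
  proof -
    have "isCont (C k) 0" "isCont (E k) 0" for k
      unfolding C_def[abs_def] E_def[abs_def] wt_def by (intro continuous_intros; simp)+
    then have "(C k \<longlongrightarrow> C k 0) (at_right 0)" "(E k \<longlongrightarrow> E k 0) (at_right 0)" for k
      unfolding isCont_def by (blast intro: Lim_at_imp_Lim_at_within)+
    from this[of 0] this[of "Suc k"] show "(C 0 \<longlongrightarrow> 1) (at_right 0)" "(E 0 \<longlongrightarrow> 0) (at_right 0)"
      "(C (Suc k) \<longlongrightarrow> 0) (at_right 0)" "(E (Suc k) \<longlongrightarrow> 0) (at_right 0)"
      by (simp_all add: C_def E_def wt_def)
  qed
  have dC0: "(C 0 has_real_derivative (- c) * C 0 t + (- \<eta>) * E 0 t) (at t)"
    and dE0: "(E 0 has_real_derivative (- c) * E 0 t + \<eta> * C 0 t) (at t)" for t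
    using der[of t] by (simp_all add: C_def[abs_def] E_def[abs_def] wt_def)
  note pC0 = transform_parts[OF gr(1) x dec(1) decaying_linear[OF dec(1) dec(2)] dC0 C0(1)]
  note pE0 = transform_parts[OF gr(1) x dec(2) decaying_linear[OF dec(2) dec(1)] dE0 C0(2)]
  have tr: "transform (\<lambda>t. a * C k t + b * E k t) x = a *\<^sub>R transform (C k) x + b *\<^sub>R transform (E k) x"
    "transform (\<lambda>t. a * E k t + b * C k t) x = a *\<^sub>R transform (E k) x + b *\<^sub>R transform (C k) x" for a b k
    by (intro transform_linear[OF gr(1)] dec)+
  show "lap 0 c \<eta> x = R (x, 0)"
  proof (rule resolve)
    show "A (transform (C 0) x) = c *\<^sub>R transform (C 0) x + \<eta> *\<^sub>R transform (E 0) x - fst (x, 0)"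
      using pC0(1) unfolding pC0(3) tr by (simp add: algebra_simps eq_neg_iff_add_eq_0)
    show "A (transform (E 0) x) = c *\<^sub>R transform (E 0) x - \<eta> *\<^sub>R transform (C 0) x + snd (x, 0)"
      using pE0(1) unfolding pE0(3) tr by (simp add: algebra_simps eq_neg_iff_add_eq_0)
  qed (rule pC0 pE0)+
  \<comment> \<open>Relative to index 0 the product rule yields the additional terms
    \<open>C k\<close> and \<open>E k\<close>, while the boundary value at 0 vanishes; they become
    the right side \<open>lap k c \<eta> x\<close>.\<close>
  have dC: "(C (Suc k) has_real_derivative 1 * C k t + 1 * ((- c) * C (Suc k) t + (- \<eta>) * E (Suc k) t)) (at t)"
    and dE: "(E (Suc k) has_real_derivative 1 * E k t + 1 * ((- c) * E (Suc k) t + \<eta> * C (Suc k) t)) (at t)" for t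
    using DERIV_mult[OF wt_deriv[of k t] der(1)[of t]] DERIV_mult[OF wt_deriv[of k t] der(2)[of t]]
    by (simp_all add: C_def[abs_def] E_def[abs_def] algebra_simps)
  note pC = transform_parts[OF gr(1) x dec(1) decaying_linear[OF dec(1) decaying_linear[OF dec(1) dec(2)]] dC C0(3)]
  note pE = transform_parts[OF gr(1) x dec(2) decaying_linear[OF dec(2) decaying_linear[OF dec(2) dec(1)]] dE C0(4)]
  have tr': "transform (\<lambda>t. 1 * C k t + 1 * (a * C l t + b * E l t)) x =
      transform (C k) x + (a *\<^sub>R transform (C l) x + b *\<^sub>R transform (E l) x)"
    "transform (\<lambda>t. 1 * E k t + 1 * (a * E l t + b * C l t)) x =
      transform (E k) x + (a *\<^sub>R transform (E l) x + b *\<^sub>R transform (C l) x)" for a b k l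
    by (subst transform_linear[OF gr(1)]; (intro dec decaying_linear)?; simp only: tr scaleR_one)+
  show "lap (Suc k) c \<eta> x = R (lap k c \<eta> x)"
  proof (rule resolve)
    show "A (transform (C (Suc k)) x) = c *\<^sub>R transform (C (Suc k)) x + \<eta> *\<^sub>R transform (E (Suc k)) x - fst (lap k c \<eta> x)"
      using pC(1) unfolding pC(3) tr' lap by (simp add: algebra_simps eq_neg_iff_add_eq_0)
    show "A (transform (E (Suc k)) x) = c *\<^sub>R transform (E (Suc k)) x - \<eta> *\<^sub>R transform (C (Suc k)) x + snd (lap k c \<eta> x)"
      using pE(1) unfolding pE(3) tr' lap by (simp add: algebra_simps eq_neg_iff_add_eq_0)
  qed (rule pC pE)+
qed

text \<open>\<open>fourier_bound\<close> is applied to the weighted orbit, extended by 0 to negative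
  times. By the addition formula its cosine transform combines the two components of
  \<open>lap\<close>, hence the factor 2.\<close>

lemma fourier_S:
  assumes gr: "growth \<omega>" "\<omega> < c" and t: "0 < t" and h: "integrable lborel h"
    and le: "\<And>\<eta>. 2 * norm (lap k c \<eta> x) \<le> h \<eta>"
  shows "2 * pi * (wt k t * exp (- c * t) * norm (S t x)) \<le> (LINT \<eta>|lborel. h \<eta>)"
proof -
  define \<phi> where "\<phi> s = wt k s * exp (- c * s) * 1" for s
  define f where "f s = indicator {0<..} s *\<^sub>R (\<phi> s *\<^sub>R S s x)" for s
  have dec: "decaying \<omega> \<phi>" unfolding \<phi>_def[abs_def]
    by (rule decaying_wt[OF gr(2)]) auto
  have int: "integrable lborel f"
    using transform_integrable[OF gr(1) dec, of x] unfolding set_integrable_def f_def[abs_def] .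
  obtain K e where K: "0 < e" "0 \<le> K" "\<And>t. 0 < t \<Longrightarrow> norm (\<phi> t *\<^sub>R S t x) \<le> K * exp (- (t * e))"
    using decaying_bound[OF gr(1) dec, of x] by blast
  have fB: "norm (f s) \<le> K" for s
  proof (cases "0 < s")
    case True
    then have "norm (f s) \<le> K * exp (- (s * e))" using K(3)[of s] by (simp add: f_def)
    also have "\<dots> \<le> K * 1" using K True by (intro mult_left_mono) auto
    finally show ?thesis by simp
  qed (use K in \<open>simp add: f_def\<close>)
  have "isCont (\<lambda>s. \<phi> s *\<^sub>R S s x) t"
  proof -
    have "continuous_on {0<..} (\<lambda>s. \<phi> s *\<^sub>R S s x)"
      using dec unfolding decaying_def by (intro continuous_on_scaleR S_continuous_pos) auto
    then show ?thesis using t by (simp add: continuous_on_eq_continuous_at)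
  qed
  moreover have "\<forall>\<^sub>F s in nhds t. f s = \<phi> s *\<^sub>R S s x"
    using eventually_nhds_in_open[of "{0<..}" t] t by (auto elim!: eventually_mono simp: f_def)
  ultimately have cont: "isCont f t" using isCont_cong[of f "\<lambda>s. \<phi> s *\<^sub>R S s x" t] by simp
  have four: "norm (LINT s|lborel. cos (\<eta> * (t - s)) *\<^sub>R f s) \<le> h \<eta>" for \<eta>
  proof -
    define C where "C s = wt k s * exp (- c * s) * cos (\<eta> * s)" for s
    define E where "E s = wt k s * exp (- c * s) * sin (\<eta> * s)" for s
    have dec: "decaying \<omega> C" "decaying \<omega> E"
      unfolding C_def[abs_def] E_def[abs_def]
      by (rule decaying_wt[OF gr(2)]; auto intro!: continuous_intros abs_cos_le_one abs_sin_le_one)+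
    have "(LINT s|lborel. cos (\<eta> * (t - s)) *\<^sub>R f s) =
        (LINT s|lborel. indicator {0<..} s *\<^sub>R ((cos (\<eta> * t) * C s + sin (\<eta> * t) * E s) *\<^sub>R S s x))"
      by (intro Bochner_Integration.integral_cong)
        (auto simp: f_def \<phi>_def C_def E_def right_diff_distrib cos_diff indicator_def algebra_simps)
    also have "\<dots> = transform (\<lambda>s. cos (\<eta> * t) * C s + sin (\<eta> * t) * E s) x"
      by (simp add: transform_def set_lebesgue_integral_def)
    also have "\<dots> = cos (\<eta> * t) *\<^sub>R transform C x + sin (\<eta> * t) *\<^sub>R transform E x"
      by (rule transform_linear[OF gr(1) dec])
    also have "norm \<dots> \<le> norm (transform C x) + norm (transform E x)"
      by (intro norm_triangle_le add_mono) (auto intro!: mult_left_le_one_le abs_cos_le_one abs_sin_le_one)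
    also have "\<dots> \<le> norm (lap k c \<eta> x) + norm (lap k c \<eta> x)"
    proof -
      have "lap k c \<eta> x = (transform C x, - transform E x)"
        by (simp add: lap_def C_def[abs_def] E_def[abs_def])
      then show ?thesis
        using norm_fst_le[of "transform C x" "- transform E x"] norm_snd_le[of "- transform E x" "transform C x"]
        by simp
    qed
    finally show ?thesis using le[of \<eta>] by simp
  qed
  have "norm (f t) = wt k t * exp (- c * t) * norm (S t x)"
    using t by (simp add: f_def \<phi>_def wt_def)
  then show ?thesis using fourier_bound[OF int fB cont h four] by simp
qed

lemma integral_inverse_square:
  assumes c: "0 < c"
  shows "integrable lborel (\<lambda>\<eta>::real. 1 / (c\<^sup>2 + \<eta>\<^sup>2))" "(LINT \<eta>|lborel. 1 / (c\<^sup>2 + \<eta>\<^sup>2)) = pi / c"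
proof -
  have 1: "integrable lborel (\<lambda>\<eta>::real. inverse (1 + \<eta>\<^sup>2))" "(LINT \<eta>|lborel. inverse (1 + \<eta>\<^sup>2)) = pi"
    using integrable_inverse_1_plus_square LBINT_inverse_1_plus_square
    by (simp_all add: set_integrable_def interval_lebesgue_integral_def set_lebesgue_integral_def einterval_def)
  have eq: "1 / (c\<^sup>2 + \<eta>\<^sup>2) = (1 / c\<^sup>2) * inverse (1 + (0 + (1 / c) * \<eta>)\<^sup>2)" for \<eta>
    using c by (simp add: field_simps power_divide)
  show "integrable lborel (\<lambda>\<eta>::real. 1 / (c\<^sup>2 + \<eta>\<^sup>2))"
    unfolding eq using c by (intro integrable_mult_right lborel_integrable_real_affine[OF 1(1)]) auto
  have "pi = \<bar>1 / c\<bar> *\<^sub>R (LINT \<eta>|lborel. inverse (1 + (0 + (1 / c) * \<eta>)\<^sup>2))"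
    using lborel_integral_real_affine[of "1 / c" "\<lambda>\<eta>. inverse (1 + \<eta>\<^sup>2)" 0] c 1(2) by simp
  then have "(LINT \<eta>|lborel. inverse (1 + (0 + (1 / c) * \<eta>)\<^sup>2)) = c * pi" using c by (simp add: field_simps)
  then have "(LINT \<eta>|lborel. (1 / c\<^sup>2) * inverse (1 + (0 + (1 / c) * \<eta>)\<^sup>2)) = (1 / c\<^sup>2) * (c * pi)"
    by (simp only: integral_mult_right_zero)
  then show "(LINT \<eta>|lborel. 1 / (c\<^sup>2 + \<eta>\<^sup>2)) = pi / c"
    unfolding eq using c by (simp add: power2_eq_square)
qed

lemma S_dense_limit: "(\<lambda>n. S (1 / real (Suc n)) x) \<longlonglongrightarrow> x"
proof -
  have "filterlim (\<lambda>n. 1 / real (Suc n)) (at_right 0) sequentially" by real_asymp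
  then show ?thesis by (rule filterlim_compose[OF S_right])
qed

text \<open>The square of the resolvent, that is \<open>k = 1\<close>, is the first power whose
  bound is integrable along a vertical line. Since the resolvent bound is uniform on the half-plane,
  the constant does not depend on \<open>c\<close>, which is what \<open>S_decay\<close>
  exploits.\<close>

lemma S_decay_aux:
  "\<exists>K\<ge>1. \<forall>\<omega> c t x. growth \<omega> \<longrightarrow> \<omega> < c \<longrightarrow> 0 \<le> c \<longrightarrow> 0 < t \<longrightarrow> t * norm (S t x) \<le> K * exp (c * t) * norm x"
proof -
  obtain K where K: "1 \<le> K" "\<And>c R. 0 \<le> Re c \<Longrightarrow> is_resolvent D A c R \<Longrightarrow> norm R \<le> K / (1 + cmod c)"
    using resolvent_bound by blast
  have inD: "t * norm (S t x) \<le> K\<^sup>2 * exp (c * t) * norm x"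
    if gr: "growth \<omega>" "\<omega> < c" and c: "0 \<le> c" and t: "0 < t" and x: "x \<in> D" for \<omega> c t x
  proof -
    have "2 * norm (lap 1 c \<eta> x) \<le> 2 * K\<^sup>2 * norm x * (1 / (1\<^sup>2 + \<eta>\<^sup>2))" for \<eta>
    proof -
      obtain R where R: "is_resolvent D A (Complex c \<eta>) R"
        using res[THEN subsetD, of "Complex c \<eta>"] c by (auto simp: resolvent_set_def)
      let ?k = "K / (1 + cmod (Complex c \<eta>))"
      have Rk: "norm R \<le> ?k" using K(2) R c by simp
      have k0: "0 \<le> ?k" using K(1) by (intro divide_nonneg_nonneg) auto
      have "lap 1 c \<eta> x = R (R (x, 0))"
        using lap_resolvent(1)[OF gr x R] lap_resolvent(2)[OF gr x R, of 0] by simp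
      also have "norm \<dots> \<le> norm R * (norm R * norm (x, 0::'w))"
        by (intro order_trans[OF norm_blinfun] mult_left_mono norm_blinfun) auto
      also have "\<dots> \<le> ?k * (?k * norm (x, 0::'w))"
        using Rk k0 by (intro mult_mono) auto
      also have "\<dots> = K\<^sup>2 * norm x * (1 / (1 + cmod (Complex c \<eta>))\<^sup>2)"
        by (simp add: norm_Pair power2_eq_square)
      also have "\<dots> \<le> K\<^sup>2 * norm x * (1 / (1\<^sup>2 + \<eta>\<^sup>2))"
      proof (intro mult_left_mono divide_left_mono)
        have "\<eta>\<^sup>2 \<le> (cmod (Complex c \<eta>))\<^sup>2" by (simp add: cmod_power2)
        then show "1\<^sup>2 + \<eta>\<^sup>2 \<le> (1 + cmod (Complex c \<eta>))\<^sup>2"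
          using norm_ge_zero[of "Complex c \<eta>"] unfolding power2_sum by (simp del: norm_ge_zero)
        have "0 < 1 + cmod (Complex c \<eta>)" by (simp add: add_pos_nonneg)
        then show "0 < (1 + cmod (Complex c \<eta>))\<^sup>2 * (1\<^sup>2 + \<eta>\<^sup>2)"
          by (intro mult_pos_pos zero_less_power) (auto simp: add_pos_nonneg)
      qed auto
      finally show ?thesis by simp
    qed
    then have "2 * pi * (wt 1 t * exp (- c * t) * norm (S t x)) \<le>
        (LINT \<eta>|lborel. 2 * K\<^sup>2 * norm x * (1 / (1\<^sup>2 + \<eta>\<^sup>2)))"
      by (intro fourier_S[OF gr t] integrable_mult_right integral_inverse_square(1)) auto
    also have "\<dots> = 2 * K\<^sup>2 * norm x * pi"
      using integral_inverse_square(2)[of 1] unfolding integral_mult_right_zero by simp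
    finally have "t * exp (- c * t) * norm (S t x) \<le> K\<^sup>2 * norm x" by (simp add: wt_def)
    then have le: "exp (c * t) * (t * exp (- c * t) * norm (S t x)) \<le> exp (c * t) * (K\<^sup>2 * norm x)"
      by (intro mult_left_mono) auto
    have "exp (c * t) * exp (- c * t) = 1" by (simp add: exp_add[symmetric])
    then have "exp (c * t) * (t * exp (- c * t) * norm (S t x)) = t * norm (S t x)"
      by (metis mult.assoc mult.left_commute mult_1)
    then show ?thesis using le by (simp only: mult_ac)
  qed
  \<comment> \<open>The restriction to \<open>D\<close> is removed by applying the estimate to
    \<open>S (1 / (n + 1)) x\<close>, which lies in \<open>D\<close> and tends to
    \<open>x\<close>.\<close>
  have all: "t * norm (S t x) \<le> K\<^sup>2 * exp (c * t) * norm x"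
    if "growth \<omega>" "\<omega> < c" "0 \<le> c" "0 < t" for \<omega> c t x
  proof (rule LIMSEQ_le)
    show "(\<lambda>n. t * norm (S t (S (1 / real (Suc n)) x))) \<longlonglongrightarrow> t * norm (S t x)"
      by (intro tendsto_intros S_dense_limit)
    show "(\<lambda>n. K\<^sup>2 * exp (c * t) * norm (S (1 / real (Suc n)) x)) \<longlonglongrightarrow> K\<^sup>2 * exp (c * t) * norm x"
      by (intro tendsto_intros S_dense_limit)
    show "\<exists>N. \<forall>n\<ge>N. t * norm (S t (S (1 / real (Suc n)) x)) \<le> K\<^sup>2 * exp (c * t) * norm (S (1 / real (Suc n)) x)"
      using inD[OF that] S_deriv(1) by auto
  qed
  moreover have "1 \<le> K\<^sup>2" using K(1) by simp
  ultimately show ?thesis by blast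
qed

text \<open>Let \<open>c0\<close> be the infimum of the nonnegative growth exponents. At a suitable
  time the bound of \<open>S_decay_aux\<close> lowers \<open>c0\<close> by a fixed amount, so
  \<open>c0\<close> cannot be positive; the same gain at \<open>c0 = 0\<close> is a negative
  exponent.\<close>

lemma S_decay: "\<exists>\<nu>>0. growth (- \<nu>)"
proof -
  obtain K where K: "1 \<le> K" "\<And>\<omega> c t x. growth \<omega> \<Longrightarrow> \<omega> < c \<Longrightarrow> 0 \<le> c \<Longrightarrow> 0 < t \<Longrightarrow>
      t * norm (S t x) \<le> K * exp (c * t) * norm x"
    using S_decay_aux by blast
  define c0 where "c0 = Inf {c. 0 \<le> c \<and> growth c}"
  have ne: "{c. 0 \<le> c \<and> growth c} \<noteq> {}" using ex_growth by auto
  have bdd: "bdd_below {c. 0 \<le> c \<and> growth c}" by (intro bdd_belowI[of _ 0]) auto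
  have c0: "0 \<le> c0" unfolding c0_def using ne by (intro cInf_greatest) auto
  have above: "growth c" if "c0 < c" for c
    using cInf_lessD[OF ne, of c] that growth_mono unfolding c0_def by force
  \<comment> \<open>Chosen so that \<open>K / t1 = exp (- 1)\<close>.\<close>
  define t1 where "t1 = K * exp 1"
  have t1: "0 < t1" using K(1) by (simp add: t1_def)
  have "norm (S t1 x) \<le> exp ((c0 - 1 / t1) * t1) * norm x" for x
  proof -
    \<comment> \<open>The estimate needs an exponent strictly above a growth rate, so
      \<open>c0\<close> itself is reached as a limit from the right.\<close>
    have "t1 * norm (S t1 x) \<le> K * exp (c0 * t1) * norm x"
    proof (rule tendsto_lowerbound)
      show "((\<lambda>c. K * exp (c * t1) * norm x) \<longlongrightarrow> K * exp (c0 * t1) * norm x) (at_right c0)"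
        by (intro tendsto_intros)
      show "\<forall>\<^sub>F c in at_right c0. t1 * norm (S t1 x) \<le> K * exp (c * t1) * norm x"
        using eventually_at_right_less[of c0]
      proof eventually_elim
        fix c assume c: "c0 < c"
        have "growth ((c0 + c) / 2)" using c by (intro above) (simp add: field_simps)
        then show "t1 * norm (S t1 x) \<le> K * exp (c * t1) * norm x"
          using c c0 t1 by (intro K(2)[of "(c0 + c) / 2"]) auto
      qed
    qed simp
    then have "norm (S t1 x) \<le> (K / t1) * exp (c0 * t1) * norm x" using t1 by (simp add: field_simps)
    also have "K / t1 = exp (- 1)" using K(1) by (simp add: t1_def exp_minus field_simps)
    also have "exp (- 1) * exp (c0 * t1) = exp ((c0 - 1 / t1) * t1)"
      using t1 by (simp add: exp_add[symmetric] left_diff_distrib)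
    finally show ?thesis .
  qed
  then have "norm (S t1) \<le> exp ((c0 - 1 / t1) * t1)" by (intro norm_blinfun_bound) auto
  then have gr: "growth (c0 - 1 / t1)" by (rule growth_from[OF t1])
  have "c0 = 0"
  proof (rule ccontr)
    assume "c0 \<noteq> 0"
    then have less: "max 0 (c0 - 1 / t1) < c0" using c0 t1 by auto
    have "growth (max 0 (c0 - 1 / t1))" using gr by (rule growth_mono) simp
    then have "c0 \<le> max 0 (c0 - 1 / t1)"
      using cInf_lower[OF _ bdd, of "max 0 (c0 - 1 / t1)"] by (simp add: c0_def[symmetric])
    then show False using less by linarith
  qed
  then show ?thesis using gr t1 by (intro exI[of _ "1 / t1"]) simp
qed

text \<open>The weight \<open>t\<^sup>2 / 2\<close> corresponds to the cube of the resolvent. One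
  factor is spent on \<open>R A = (c + i \<eta>) R - Id\<close>, which is bounded, and the other two
  are integrable along the line. This replaces a contour integral.\<close>

lemma AS_bound: "\<exists>K\<ge>1. \<forall>t>0. \<forall>x. norm (A (S t x)) \<le> K / t * norm x"
proof -
  obtain K where K: "1 \<le> K" "\<And>c R. 0 \<le> Re c \<Longrightarrow> is_resolvent D A c R \<Longrightarrow> norm R \<le> K / (1 + cmod c)"
    using resolvent_bound by blast
  obtain \<nu> where \<nu>: "0 < \<nu>" "growth (- \<nu>)" using S_decay by blast
  define K' where "K' = 2 * exp 1 * K\<^sup>2 * (2 * K + 1)"
  have inD: "norm (S t (A x)) \<le> K' / t * norm x" if t: "0 < t" and x: "x \<in> D" "A x \<in> D" for t x
  proof -
    \<comment> \<open>On the line at \<open>1 / t\<close> the exponential weight is the constant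
      \<open>exp (- 1)\<close> and the integral equals \<open>pi * t\<close>; divided by
      \<open>t\<^sup>2\<close> this leaves the rate \<open>1 / t\<close>.\<close>
    define c where "c = 1 / t"
    have c: "0 < c" "- \<nu> < c" using t \<nu> by (auto simp: c_def intro: less_trans[of _ 0])
    have "2 * norm (lap 2 c \<eta> (A x)) \<le> 2 * K\<^sup>2 * (2 * K + 1) * norm x * (1 / (c\<^sup>2 + \<eta>\<^sup>2))" for \<eta>
    proof -
      obtain R where R: "is_resolvent D A (Complex c \<eta>) R"
        using res[THEN subsetD, of "Complex c \<eta>"] c by (auto simp: resolvent_set_def)
      let ?m = "cmod (Complex c \<eta>)"
      let ?k = "K / (1 + ?m)"
      have Rk: "norm R \<le> ?k" using K(2) R c by simp
      have k0: "0 \<le> ?k" using K(1) by (intro divide_nonneg_nonneg) auto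
      have "R (cscale (Complex c \<eta>) (x, 0) - map_prod A A (x, 0)) = (x, 0)"
        using R x D_zero unfolding is_resolvent_def by blast
      then have "R (cscale (Complex c \<eta>) (x, 0)) - R (A x, 0) = (x, 0)"
        by (simp add: D_zero blinfun.diff_right)
      then have RA: "R (A x, 0) = R (cscale (Complex c \<eta>) (x, 0)) - (x, 0)" by (simp add: algebra_simps)
      have "norm (R (A x, 0)) \<le> norm (R (cscale (Complex c \<eta>) (x, 0))) + norm (x, 0::'w)"
        unfolding RA by (rule norm_triangle_ineq4)
      also have "norm (R (cscale (Complex c \<eta>) (x, 0))) \<le> ?k * (2 * ?m * norm (x, 0::'w))"
        using Rk k0 by (intro order_trans[OF norm_blinfun] mult_mono norm_cscale_le) auto
      also have "\<dots> = 2 * (K * (?m / (1 + ?m))) * norm x" by (simp add: norm_Pair)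
      also have "\<dots> \<le> 2 * (K * 1) * norm x"
        using K(1) by (intro mult_right_mono mult_left_mono) (auto simp: divide_le_eq_1 add_pos_nonneg)
      finally have RA_le: "norm (R (A x, 0)) \<le> (2 * K + 1) * norm x" by (simp add: norm_Pair distrib_right)
      have "lap 2 c \<eta> (A x) = R (R (R (A x, 0)))"
        using lap_resolvent(1)[OF \<nu>(2) c(2) x(2) R] lap_resolvent(2)[OF \<nu>(2) c(2) x(2) R]
        by (simp add: numeral_2_eq_2)
      also have "norm \<dots> \<le> norm R * (norm R * norm (R (A x, 0)))"
        by (intro order_trans[OF norm_blinfun] mult_left_mono norm_blinfun) auto
      also have "\<dots> \<le> ?k * (?k * ((2 * K + 1) * norm x))"
        using Rk k0 RA_le by (intro mult_mono) auto
      also have "\<dots> = K\<^sup>2 * (2 * K + 1) * norm x * (1 / (1 + ?m)\<^sup>2)"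
        by (simp add: power2_eq_square)
      also have "\<dots> \<le> K\<^sup>2 * (2 * K + 1) * norm x * (1 / (c\<^sup>2 + \<eta>\<^sup>2))"
      proof (intro mult_left_mono divide_left_mono)
        have "c\<^sup>2 + \<eta>\<^sup>2 = ?m\<^sup>2" by (simp add: cmod_power2)
        also have "\<dots> \<le> (1 + ?m)\<^sup>2" by (intro power_mono) auto
        finally show "c\<^sup>2 + \<eta>\<^sup>2 \<le> (1 + ?m)\<^sup>2" .
        have "0 < 1 + ?m" by (simp add: add_pos_nonneg)
        then show "0 < (1 + ?m)\<^sup>2 * (c\<^sup>2 + \<eta>\<^sup>2)"
          using c by (intro mult_pos_pos zero_less_power) (auto simp: add_pos_nonneg)
      qed (use K in auto)
      finally show ?thesis by simp
    qed
    then have "2 * pi * (wt 2 t * exp (- c * t) * norm (S t (A x))) \<le>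
        (LINT \<eta>|lborel. 2 * K\<^sup>2 * (2 * K + 1) * norm x * (1 / (c\<^sup>2 + \<eta>\<^sup>2)))"
      using c by (intro fourier_S[OF \<nu>(2) c(2) t] integrable_mult_right integral_inverse_square(1)) auto
    also have "\<dots> = 2 * K\<^sup>2 * (2 * K + 1) * norm x * (pi / c)"
      using integral_inverse_square(2)[of c] c unfolding integral_mult_right_zero by simp
    finally have "2 * pi * (t\<^sup>2 / 2 * exp (- 1) * norm (S t (A x))) \<le> 2 * K\<^sup>2 * (2 * K + 1) * norm x * (pi * t)"
      using t by (simp add: wt_def c_def fact_2)
    then have "pi * t * (t * exp (- 1) * norm (S t (A x))) \<le> pi * t * (2 * K\<^sup>2 * (2 * K + 1) * norm x)"
      by (simp add: power2_eq_square mult_ac)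
    then have "t * exp (- 1) * norm (S t (A x)) \<le> 2 * K\<^sup>2 * (2 * K + 1) * norm x"
      using t by (simp add: mult_le_cancel_left)
    then show ?thesis using t by (simp add: K'_def exp_minus field_simps)
  qed
  have "norm (A (S t x)) \<le> K' / t * norm x" if t: "0 < t" for t x
  proof -
    have comm: "A (S (r + s) y) = S r (A (S s y))" if "0 < r" "0 < s" for r s y
      using S_deriv(3)[OF that(1) S_deriv(1)[OF that(2)]] that by (simp add: S_plus_apply)
    \<comment> \<open>For \<open>e > 0\<close> the point \<open>S e x\<close> satisfies both domain
      conditions of \<open>inD\<close>; afterwards \<open>e\<close> tends to 0.\<close>
    have *: "norm (S t (A (S e x))) \<le> K' / t * norm (S e x)" if e: "0 < e" for e
    proof (rule inD[OF t S_deriv(1)[OF e]])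
      have "A (S (e / 2 + e / 2) x) = S (e / 2) (A (S (e / 2) x))" using e by (intro comm) auto
      then show "A (S e x) \<in> D" using S_deriv(1)[of "e / 2"] e by simp
    qed
    show ?thesis
    proof (rule LIMSEQ_le)
      show "(\<lambda>n. norm (S (1 / real (Suc n)) (A (S t x)))) \<longlonglongrightarrow> norm (A (S t x))"
        by (intro tendsto_norm S_dense_limit)
      show "(\<lambda>n. K' / t * norm (S (1 / real (Suc n)) x)) \<longlonglongrightarrow> K' / t * norm x"
        by (intro tendsto_intros S_dense_limit)
      show "\<exists>N. \<forall>n\<ge>N. norm (S (1 / real (Suc n)) (A (S t x))) \<le> K' / t * norm (S (1 / real (Suc n)) x)"
      proof (intro exI allI impI)
        fix n :: nat
        have "S (1 / real (Suc n)) (A (S t x)) = S t (A (S (1 / real (Suc n)) x))"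
          using comm[of "1 / real (Suc n)" t x] comm[of t "1 / real (Suc n)" x] t by (simp add: add.commute)
        then show "norm (S (1 / real (Suc n)) (A (S t x))) \<le> K' / t * norm (S (1 / real (Suc n)) x)"
          using *[of "1 / real (Suc n)"] by simp
      qed
    qed
  qed
  moreover have "1 \<le> K'"
  proof -
    have "1 * 1 * 1 * 1 \<le> 2 * exp 1 * K\<^sup>2 * (2 * K + 1)"
      using K(1) exp_ge_add_one_self[of "1::real"] by (intro mult_mono) auto
    then show ?thesis by (simp add: K'_def)
  qed
  ultimately show ?thesis by blast
qed

end

section \<open>Integrals of powers\<close>

lemma lborel_nonneg_has_integral:
  fixes f :: "real \<Rightarrow> real"
  assumes f: "(f has_integral I) A" and A: "A \<in> sets borel" and cont: "continuous_on A f"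
    and nn: "\<And>x. x \<in> A \<Longrightarrow> 0 \<le> f x"
  shows "set_integrable lborel A f" "(LINT x:A|lborel. f x) = I"
proof -
  define g where "g x = indicator A x *\<^sub>R f x" for x
  have g: "g \<in> borel_measurable borel"
    unfolding g_def[abs_def] by (rule borel_measurable_continuous_on_indicator[OF A cont])
  have g0: "0 \<le> g x" for x using nn by (simp add: g_def indicator_def)
  have "(g has_integral I) UNIV"
  proof -
    have "g = (\<lambda>x. if x \<in> A then f x else 0)" by (auto simp: g_def indicator_def)
    then show ?thesis using f by (simp add: has_integral_restrict_UNIV)
  qed
  then have nn: "(\<integral>\<^sup>+ x. g x \<partial>lborel) = I" by (rule nn_integral_has_integral_lborel[OF g g0])
  have "0 \<le> I" using has_integral_nonneg[OF f] assms(4) by blast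
  then have "has_bochner_integral lborel g I"
    using g0 g nn by (intro has_bochner_integral_nn_integral) auto
  then show "set_integrable lborel A f" "(LINT x:A|lborel. f x) = I"
    by (auto simp: set_integrable_def set_lebesgue_integral_def g_def[abs_def] has_bochner_integral_iff)
qed

lemma powr_integral_right:
  fixes a s t :: real
  assumes "0 < a" "s \<le> t"
  shows "set_integrable lborel {s<..<t} (\<lambda>r. (t - r) powr (a - 1))"
    "(LINT r:{s<..<t}|lborel. (t - r) powr (a - 1)) = (t - s) powr a / a"
proof -
  have "((\<lambda>r. (t - r) powr (a - 1)) has_integral - ((t - t) powr a / a) - - ((t - s) powr a / a)) {s..t}"
  proof (rule fundamental_theorem_of_calculus_interior[OF assms(2)])
    show "continuous_on {s..t} (\<lambda>r. - ((t - r) powr a / a))"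
      using assms by (intro continuous_intros continuous_on_powr') auto
    fix r assume "r \<in> {s<..<t}"
    then show "((\<lambda>r. - ((t - r) powr a / a)) has_vector_derivative (t - r) powr (a - 1)) (at r)"
      unfolding has_real_derivative_iff_has_vector_derivative[symmetric]
      using assms by (auto intro!: derivative_eq_intros)
  qed
  then have *: "((\<lambda>r. (t - r) powr (a - 1)) has_integral (t - s) powr a / a) {s<..<t}"
    using assms by (simp add: has_integral_Icc_iff_Ioo)
  have "continuous_on {s<..<t} (\<lambda>r. (t - r) powr (a - 1))"
    by (intro continuous_intros) auto
  with * show "set_integrable lborel {s<..<t} (\<lambda>r. (t - r) powr (a - 1))"
    "(LINT r:{s<..<t}|lborel. (t - r) powr (a - 1)) = (t - s) powr a / a"
    by (intro lborel_nonneg_has_integral; simp)+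
qed

lemma powr_integral_left:
  fixes a s t :: real
  assumes "0 < a" "s \<le> t"
  shows "set_integrable lborel {s<..<t} (\<lambda>r. (r - s) powr (a - 1))"
    "(LINT r:{s<..<t}|lborel. (r - s) powr (a - 1)) = (t - s) powr a / a"
proof -
  have "((\<lambda>r. (r - s) powr (a - 1)) has_integral (t - s) powr a / a - (s - s) powr a / a) {s..t}"
  proof (rule fundamental_theorem_of_calculus_interior[OF assms(2)])
    show "continuous_on {s..t} (\<lambda>r. (r - s) powr a / a)"
      using assms by (intro continuous_intros continuous_on_powr') auto
    fix r assume "r \<in> {s<..<t}"
    then show "((\<lambda>r. (r - s) powr a / a) has_vector_derivative (r - s) powr (a - 1)) (at r)"
      unfolding has_real_derivative_iff_has_vector_derivative[symmetric]
      using assms by (auto intro!: derivative_eq_intros)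
  qed
  then have *: "((\<lambda>r. (r - s) powr (a - 1)) has_integral (t - s) powr a / a) {s<..<t}"
    using assms by (simp add: has_integral_Icc_iff_Ioo)
  have "continuous_on {s<..<t} (\<lambda>r. (r - s) powr (a - 1))"
    by (intro continuous_intros) auto
  with * show "set_integrable lborel {s<..<t} (\<lambda>r. (r - s) powr (a - 1))"
    "(LINT r:{s<..<t}|lborel. (r - s) powr (a - 1)) = (t - s) powr a / a"
    by (intro lborel_nonneg_has_integral; simp)+
qed

lemma powr_integral_to_inf:
  fixes e h :: real
  assumes "e < -1" "0 < h"
  shows "set_integrable lborel {h..} (\<lambda>r. r powr e)"
    "(LINT r:{h..}|lborel. r powr e) = - (h powr (e + 1)) / (e + 1)"
proof -
  have "continuous_on {h..} (\<lambda>r. r powr e)"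
    using assms by (intro continuous_intros) auto
  with has_integral_powr_to_inf[OF assms] show "set_integrable lborel {h..} (\<lambda>r. r powr e)"
    "(LINT r:{h..}|lborel. r powr e) = - (h powr (e + 1)) / (e + 1)"
    by (intro lborel_nonneg_has_integral; simp)+
qed

text \<open>The substitution \<open>t = q u\<close> produces a Beta integral. The exponents add up
  to -1, so the value is independent of \<open>q\<close>.\<close>

lemma powr_convolution:
  fixes b q :: real
  assumes b: "0 < b" "b < 1" and q: "0 < q"
  shows "set_integrable lborel {0<..<q} (\<lambda>t. t powr (- b) * (q - t) powr (b - 1))"
    "(LINT t:{0<..<q}|lborel. t powr (- b) * (q - t) powr (b - 1)) = Beta (1 - b) b"
proof -
  let ?g = "\<lambda>t. t powr ((1 - b) - 1) * (1 - t) powr (b - 1)"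
  have "(?g has_integral Beta (1 - b) b) {0<..<1}"
    using has_integral_Beta_real[of "1 - b" b] b by (simp add: has_integral_Icc_iff_Ioo)
  moreover have "continuous_on {0<..<1} ?g" by (intro continuous_intros) auto
  ultimately have g: "set_integrable lborel {0<..<1} ?g" "(LINT t:{0<..<1}|lborel. ?g t) = Beta (1 - b) b"
    by (intro lborel_nonneg_has_integral; simp)+
  define f where "f t = indicat_real {0<..<q} t *\<^sub>R (t powr (- b) * (q - t) powr (b - 1))" for t
  have eq: "indicat_real {0<..<1} u *\<^sub>R ?g u = q * f (0 + q * u)" for u
  proof (cases "0 < u \<and> u < 1")
    case True
    then have "q - q * u = q * (1 - u)" by (simp add: algebra_simps)
    moreover have "q powr (- b) * q powr (b - 1) * q = 1"
      using q powr_mult_base[of q "b - 1"] by (simp add: powr_minus_divide mult.commute)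
    ultimately show ?thesis using True q b
      by (simp add: f_def powr_mult mult_ac zero_less_mult_iff)
  next
    case False
    then have "u \<le> 0 \<or> 1 \<le> u" by auto
    then show ?thesis using q by (auto simp: f_def mult_le_0_iff zero_less_mult_iff)
  qed
  have "integrable lborel (\<lambda>u. f (0 + q * u))"
    using integrable_mult_right[OF g(1)[unfolded set_integrable_def eq], of "1 / q"] q by simp
  then have "integrable lborel f" using lborel_integrable_real_affine_iff[of q f 0] q by simp
  then show "set_integrable lborel {0<..<q} (\<lambda>t. t powr (- b) * (q - t) powr (b - 1))"
    by (simp add: set_integrable_def f_def[abs_def])
  have "(LINT t|lborel. f t) = q * (LINT u|lborel. f (0 + q * u))"
    using lborel_integral_real_affine[of q f 0] q by simp
  also have "\<dots> = (LINT t:{0<..<1}|lborel. ?g t)"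
    unfolding set_lebesgue_integral_def eq by simp
  finally show "(LINT t:{0<..<q}|lborel. t powr (- b) * (q - t) powr (b - 1)) = Beta (1 - b) b"
    using g(2) by (simp add: set_lebesgue_integral_def f_def[abs_def])
qed

section \<open>Analytic semigroups\<close>

text \<open>\<open>AS t\<close> stands for the bounded operator \<open>A S(t)\<close>. Working with
  it instead of the unbounded generator keeps all integrands within bounded operators.\<close>

locale analytic_semigroup = bounded_semigroup S M
  for S :: "real \<Rightarrow> 'a::{banach,second_countable_topology} \<Rightarrow>\<^sub>L 'a" and M +
  fixes AS :: "real \<Rightarrow> 'a \<Rightarrow>\<^sub>L 'a"
  assumes S_cont: "continuous_on {0..} (\<lambda>t. S t x)"
    and S_deriv: "0 < t \<Longrightarrow> ((\<lambda>t. S t x) has_vector_derivative AS t x) (at t)"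
    and AS_norm: "0 < t \<Longrightarrow> norm (AS t) \<le> M / t"
    and S_AS: "0 \<le> s \<Longrightarrow> 0 < t \<Longrightarrow> S s (AS t x) = AS (s + t) x"
    and AS_S: "0 \<le> s \<Longrightarrow> 0 < t \<Longrightarrow> AS t (S s x) = AS (s + t) x"
begin

text \<open>For \<open>0 < b < 1\<close> this says that the seminorm of \<open>x\<close> in the
  Favard space of order \<open>b\<close>, a real interpolation space between the whole space and the
  domain of the generator, is at most \<open>N\<close>.\<close>

definition favard :: "real \<Rightarrow> 'a \<Rightarrow> real \<Rightarrow> bool" where
  "favard b x N \<longleftrightarrow> (\<forall>h\<ge>0. norm (S h x - x) \<le> N * h powr b)"

lemma favardD: "favard b x N \<Longrightarrow> 0 \<le> h \<Longrightarrow> norm (S h x - x) \<le> N * h powr b"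
  by (simp add: favard_def)

lemma favard_diff: "favard b x N \<Longrightarrow> favard b y N' \<Longrightarrow> favard b (x - y) (N + N')"
  unfolding favard_def
proof (intro allI impI)
  fix h :: real assume *: "\<forall>h\<ge>0. norm (S h x - x) \<le> N * h powr b" "\<forall>h\<ge>0. norm (S h y - y) \<le> N' * h powr b" "0 \<le> h"
  have "S h (x - y) - (x - y) = (S h x - x) - (S h y - y)" by (simp add: blinfun.diff_right)
  then have "norm (S h (x - y) - (x - y)) \<le> norm (S h x - x) + norm (S h y - y)"
    by (metis norm_triangle_ineq4)
  also have "\<dots> \<le> N * h powr b + N' * h powr b" using * by (intro add_mono) auto
  finally show "norm (S h (x - y) - (x - y)) \<le> (N + N') * h powr b" by (simp add: distrib_right)
qed

lemma norm_AS: "0 < t \<Longrightarrow> norm (AS t x) \<le> M / t * norm x"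
  by (meson AS_norm mult_right_mono norm_blinfun norm_ge_zero order_trans)

lemma S_diff_bound:
  assumes s: "0 < s" "s \<le> t" and B: "\<And>r. s \<le> r \<Longrightarrow> r \<le> t \<Longrightarrow> norm (AS r x) \<le> B"
  shows "norm (S t x - S s x) \<le> B * (t - s)"
proof -
  have "norm (S t x - S s x) \<le> B * norm (t - s)"
  proof (rule differentiable_bound[of "{s..t}" "\<lambda>t. S t x" "\<lambda>r h. h *\<^sub>R AS r x"])
    show "((\<lambda>t. S t x) has_derivative (\<lambda>h. h *\<^sub>R AS r x)) (at r within {s..t})" if "r \<in> {s..t}" for r
      using has_vector_derivative_at_within[OF S_deriv[of r x]] s that
      by (simp add: has_vector_derivative_def)
    show "onorm (\<lambda>h. h *\<^sub>R AS r x) \<le> B" if "r \<in> {s..t}" for r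
      using mult_left_mono[OF B[of r]] that by (intro onorm_le) (auto simp: mult.commute[of B])
  qed (use s in auto)
  then show ?thesis using s by simp
qed

lemma norm_S_diff: "0 < s \<Longrightarrow> s \<le> t \<Longrightarrow> norm (S t x - S s x) \<le> M / s * norm x * (t - s)"
proof (rule S_diff_bound)
  fix r assume "0 < s" "s \<le> r"
  then have "norm (AS r x) \<le> M / r * norm x" by (intro norm_AS) auto
  also have "\<dots> \<le> M / s * norm x"
    using \<open>0 < s\<close> \<open>s \<le> r\<close> M_ge_1 by (intro mult_right_mono divide_left_mono) auto
  finally show "norm (AS r x) \<le> M / s * norm x" .
qed

text \<open>Away from 0 both families are locally Lipschitz in operator norm; for \<open>AS\<close>
  this follows by writing \<open>AS t - AS s\<close> as
  \<open>(S (t - s / 2) - S (s / 2)) (AS (s / 2))\<close>.\<close>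

lemma continuous_on_S: "continuous_on {0<..} S"
  and continuous_on_AS: "continuous_on {0<..} AS"
proof -
  have S: "norm (S t - S s) \<le> M / s * (t - s)" if "0 < s" "s \<le> t" for s t
    using norm_S_diff[OF that] that M_ge_1
    by (intro norm_blinfun_bound) (auto simp: blinfun.diff_left mult_ac)
  have AS: "norm (AS t - AS s) \<le> M / (s / 2) * (t - s) * (M / (s / 2))" if "0 < s" "s \<le> t" for s t
  proof (rule norm_blinfun_bound)
    fix x
    have "AS t x - AS s x = (S (t - s / 2) - S (s / 2)) (AS (s / 2) x)"
      using that by (simp add: blinfun.diff_left S_AS)
    also have "norm \<dots> \<le> norm (S (t - s / 2) - S (s / 2)) * norm (AS (s / 2) x)" by (rule norm_blinfun)
    also have "\<dots> \<le> (M / (s / 2) * (t - s)) * (M / (s / 2) * norm x)"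
      using S[of "s / 2" "t - s / 2"] norm_AS[of "s / 2" x] that M_ge_1 by (intro mult_mono) auto
    finally show "norm ((AS t - AS s) x) \<le> M / (s / 2) * (t - s) * (M / (s / 2)) * norm x"
      by (simp add: blinfun.diff_left mult_ac)
  qed (use that M_ge_1 in auto)
  have lip: "continuous_on {0<..} F"
    if F: "\<And>s t. 0 < s \<Longrightarrow> s \<le> t \<Longrightarrow> norm (F t - F s) \<le> c s * (t - s)" and c: "\<And>s t. 0 < s \<Longrightarrow> s \<le> t \<Longrightarrow> 0 \<le> c t \<and> c t \<le> c s"
    for F :: "real \<Rightarrow> 'a \<Rightarrow>\<^sub>L 'a" and c
    unfolding continuous_on_iff
  proof (intro ballI allI impI)
    fix s e :: real assume s: "s \<in> {0<..}" and e: "0 < e"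
    define K where "K = c (s / 2) + 1"
    have K: "0 < K" using c[of "s / 2" "s / 2"] s by (simp add: K_def add_nonneg_pos)
    show "\<exists>d>0. \<forall>t\<in>{0<..}. dist t s < d \<longrightarrow> dist (F t) (F s) < e"
    proof (intro exI[of _ "min (s / 2) (e / K)"] conjI ballI impI)
      fix t assume t: "t \<in> {0<..}" "dist t s < min (s / 2) (e / K)"
      have half: "s / 2 \<le> min s t" "\<bar>t - s\<bar> < e / K"
      proof -
        have "\<bar>t - s\<bar> < s / 2" "\<bar>t - s\<bar> < e / K" using t by (auto simp: dist_real_def)
        moreover from this(1) have "s - t < s / 2" by (simp only: abs_less_iff) linarith
        ultimately show "s / 2 \<le> min s t" "\<bar>t - s\<bar> < e / K" using s by auto
      qed
      have "norm (F t - F s) \<le> c (min s t) * \<bar>t - s\<bar>"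
        using F[of s t] F[of t s] s t by (cases "s \<le> t") (auto simp: norm_minus_commute min_def)
      also have "\<dots> \<le> K * \<bar>t - s\<bar>"
        using c[of "s / 2" "min s t"] half s by (intro mult_right_mono) (auto simp: K_def)
      also have "\<dots> < e" using half K by (simp add: field_simps)
      finally show "dist (F t) (F s) < e" by (simp add: dist_norm)
    qed (use s e K in auto)
  qed
  show "continuous_on {0<..} S"
    using M_ge_1 by (intro lip[of S "\<lambda>s. M / s"] S) (auto intro: divide_left_mono)
  show "continuous_on {0<..} AS"
  proof (rule lip[of AS "\<lambda>s. M / (s / 2) * (M / (s / 2))"])
    show "norm (AS t - AS s) \<le> M / (s / 2) * (M / (s / 2)) * (t - s)" if "0 < s" "s \<le> t" for s t
      using AS[OF that] by (simp add: mult_ac)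
    show "0 \<le> M / (t / 2) * (M / (t / 2)) \<and> M / (t / 2) * (M / (t / 2)) \<le> M / (s / 2) * (M / (s / 2))"
      if "0 < s" "s \<le> t" for s t
      using that M_ge_1 by (intro conjI mult_mono mult_nonneg_nonneg divide_left_mono divide_nonneg_nonneg) auto
  qed
qed

lemma continuous_on_S_comp [continuous_intros]:
  "continuous_on I g \<Longrightarrow> continuous_on I f \<Longrightarrow> (\<And>r. r \<in> I \<Longrightarrow> 0 < g r) \<Longrightarrow> continuous_on I (\<lambda>r. S (g r) (f r))"
  by (intro blinfun.continuous_on continuous_on_compose2[OF continuous_on_S]) auto

lemma continuous_on_AS_comp [continuous_intros]:
  "continuous_on I g \<Longrightarrow> continuous_on I f \<Longrightarrow> (\<And>r. r \<in> I \<Longrightarrow> 0 < g r) \<Longrightarrow> continuous_on I (\<lambda>r. AS (g r) (f r))"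
  by (intro blinfun.continuous_on continuous_on_compose2[OF continuous_on_AS]) auto

lemma integral_AS_backward:
  assumes "s \<le> u" "u < t"
  shows "set_integrable lborel {s<..<u} (\<lambda>r. AS (t - r) x)"
    "(LINT r:{s<..<u}|lborel. AS (t - r) x) = S (t - s) x - S (t - u) x"
proof -
  have c: "continuous_on {s..u} (\<lambda>r. AS (t - r) x)" using assms by (intro continuous_intros) auto
  show "set_integrable lborel {s<..<u} (\<lambda>r. AS (t - r) x)"
    using borel_integrable_atLeastAtMost'[OF c] by (simp add: set_integral_Icc_Ioo)
  have "((\<lambda>r. - S (t - r) x) has_vector_derivative AS (t - r) x) (at r within {s..u})" if "r \<in> {s..u}" for r
  proof -
    have "((\<lambda>r. t - r) has_vector_derivative -1) (at r within {s..u})"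
      by (auto intro!: derivative_eq_intros simp: has_real_derivative_iff_has_vector_derivative[symmetric])
    then have "((\<lambda>t. S t x) \<circ> (\<lambda>r. t - r) has_vector_derivative -1 *\<^sub>R AS (t - r) x) (at r within {s..u})"
      using that assms by (intro vector_diff_chain_within has_vector_derivative_at_within[OF S_deriv]) auto
    from has_vector_derivative_minus[OF this] show ?thesis by (simp add: o_def)
  qed
  then have "(LINT r:{s..u}|lborel. AS (t - r) x) = - S (t - u) x - - S (t - s) x"
    by (intro lborel_FTC_Icc assms c) auto
  then show "(LINT r:{s<..<u}|lborel. AS (t - r) x) = S (t - s) x - S (t - u) x"
    by (simp add: set_integral_Icc_Ioo)
qed

lemma integral_AS_forward:
  assumes "s < m" "m \<le> t"
  shows "set_integrable lborel {m<..<t} (\<lambda>r. AS (r - s) x)"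
    "(LINT r:{m<..<t}|lborel. AS (r - s) x) = S (t - s) x - S (m - s) x"
proof -
  have c: "continuous_on {m..t} (\<lambda>r. AS (r - s) x)" using assms by (intro continuous_intros) auto
  show "set_integrable lborel {m<..<t} (\<lambda>r. AS (r - s) x)"
    using borel_integrable_atLeastAtMost'[OF c] by (simp add: set_integral_Icc_Ioo)
  have "((\<lambda>r. S (r - s) x) has_vector_derivative AS (r - s) x) (at r within {m..t})" if "r \<in> {m..t}" for r
  proof -
    have "((\<lambda>r. r - s) has_vector_derivative 1) (at r within {m..t})"
      by (auto intro!: derivative_eq_intros simp: has_real_derivative_iff_has_vector_derivative[symmetric])
    then have "((\<lambda>t. S t x) \<circ> (\<lambda>r. r - s) has_vector_derivative 1 *\<^sub>R AS (r - s) x) (at r within {m..t})"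
      using that assms by (intro vector_diff_chain_within has_vector_derivative_at_within[OF S_deriv]) auto
    then show ?thesis by (simp add: o_def)
  qed
  then have "(LINT r:{m..t}|lborel. AS (r - s) x) = S (t - s) x - S (m - s) x"
    by (intro lborel_FTC_Icc assms c) auto
  then show "(LINT r:{m<..<t}|lborel. AS (r - s) x) = S (t - s) x - S (m - s) x"
    by (simp add: set_integral_Icc_Ioo)
qed

text \<open>For \<open>h \<le> \<rho>\<close> the derivative bound gives \<open>h / \<rho>\<close>,
  otherwise boundedness gives a constant; both are dominated by the power \<open>b\<close> of
  \<open>h / \<rho>\<close>.\<close>

lemma smoothing:
  assumes "0 \<le> h" "0 < \<rho>" "0 \<le> b" "b \<le> 1"
  shows "norm (S h (S \<rho> x) - S \<rho> x) \<le> 2 * M * norm x * (h / \<rho>) powr b"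
proof (cases "h \<le> \<rho>")
  case True
  have "norm (S (h + \<rho>) x - S \<rho> x) \<le> M / \<rho> * norm x * (h + \<rho> - \<rho>)"
    using assms by (intro norm_S_diff) auto
  also have "\<dots> = M * norm x * (h / \<rho>)" by simp
  also have "h / \<rho> \<le> (h / \<rho>) powr b"
  proof (cases "h = 0")
    case False
    then have "(h / \<rho>) powr 1 \<le> (h / \<rho>) powr b"
      using True assms by (intro powr_mono') auto
    then show ?thesis using False assms by simp
  qed simp
  finally have "norm (S (h + \<rho>) x - S \<rho> x) \<le> M * norm x * (h / \<rho>) powr b"
    using M_ge_1 by (simp add: mult_left_mono)
  also have "\<dots> \<le> 2 * M * norm x * (h / \<rho>) powr b" using M_ge_1 by (intro mult_right_mono) auto
  finally show ?thesis using assms by (simp add: S_comp)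
next
  case False
  have "norm (S (h + \<rho>) x - S \<rho> x) \<le> M * norm x + M * norm x"
    using assms by (intro norm_triangle_le_diff add_mono norm_S) auto
  also have "\<dots> = 2 * M * norm x * 1" by simp
  also have "\<dots> \<le> 2 * M * norm x * (h / \<rho>) powr b"
    using False assms M_ge_1 by (intro mult_left_mono ge_one_powr_ge_zero) auto
  finally show ?thesis using assms by (simp add: S_comp)
qed

text \<open>\<open>M\<close> times the geometric series with ratio
  \<open>2 powr (b - 1)\<close>.\<close>

definition fav_const :: "real \<Rightarrow> real" where
  "fav_const b = M / (1 - 2 powr (b - 1))"

lemma fav_const_ge: "b < 1 \<Longrightarrow> M \<le> fav_const b"
proof -
  assume "b < 1"
  then have "2 powr (b - 1) < (2::real) powr 0" by (intro powr_less_mono) auto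
  then have "2 powr (b - 1) < (1::real)" by simp
  then show ?thesis using M_ge_1 powr_gt_zero[of "2::real" "b - 1"]
    by (simp add: fav_const_def field_simps)
qed

text \<open>The identity \<open>AS r x = AS (2 * r) x - AS r (S r x - x)\<close> is iterated along
  the times \<open>2 ^ n * \<rho>\<close>. The corrections form a geometric series, and the leading
  term vanishes in the limit because \<open>|AS t| \<le> M / t\<close> for all times.\<close>

lemma favard_AS:
  assumes fav: "favard b x N" and b: "b < 1" and \<rho>: "0 < \<rho>" and N: "0 \<le> N"
  shows "norm (AS \<rho> x) \<le> fav_const b * N * \<rho> powr (b - 1)"
proof -
  define q where "q = (2::real) powr (b - 1)"
  have q: "0 < q" "q < 1"
  proof -
    have "2 powr (b - 1) < (2::real) powr 0" using b by (intro powr_less_mono) auto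
    then show "q < 1" "0 < q" by (simp_all add: q_def)
  qed
  have step: "AS r x = AS (2 * r) x - AS r (S r x - x)" if "0 < r" for r
    using that AS_S[of r r x] by (simp add: blinfun.diff_right)
  have step_le: "norm (AS r (S r x - x)) \<le> M * N * r powr (b - 1)" if "0 < r" for r
  proof -
    have "norm (AS r (S r x - x)) \<le> M / r * norm (S r x - x)" using that by (rule norm_AS)
    also have "\<dots> \<le> M / r * (N * r powr b)"
      using favardD[OF fav, of r] that M_ge_1 by (intro mult_left_mono) auto
    also have "\<dots> = M * N * r powr (b - 1)" using that by (simp add: powr_diff)
    finally show ?thesis .
  qed
  have "norm (AS \<rho> x) \<le> M * norm x / (2 ^ n * \<rho>) + M * N * \<rho> powr (b - 1) * (\<Sum>k<n. q ^ k)" for n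
  proof -
    have "norm (AS \<rho> x) \<le> norm (AS (2 ^ n * \<rho>) x) + (\<Sum>k<n. M * N * (2 ^ k * \<rho>) powr (b - 1))"
    proof (induction n)
      case (Suc n)
      have "norm (AS (2 ^ n * \<rho>) x) \<le> norm (AS (2 ^ Suc n * \<rho>) x) + M * N * (2 ^ n * \<rho>) powr (b - 1)"
        using step[of "2 ^ n * \<rho>"] step_le[of "2 ^ n * \<rho>"] \<rho>
          norm_triangle_ineq4[of "AS (2 * (2 ^ n * \<rho>)) x" "AS (2 ^ n * \<rho>) (S (2 ^ n * \<rho>) x - x)"]
        by (simp add: mult.assoc)
      then show ?case using Suc by simp
    qed simp
    also have "norm (AS (2 ^ n * \<rho>) x) \<le> M / (2 ^ n * \<rho>) * norm x" using \<rho> by (intro norm_AS) auto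
    also have "(\<Sum>k<n. M * N * (2 ^ k * \<rho>) powr (b - 1)) = M * N * \<rho> powr (b - 1) * (\<Sum>k<n. q ^ k)"
    proof -
      have "(2 ^ k * \<rho>) powr (b - 1) = \<rho> powr (b - 1) * q ^ k" for k :: nat
      proof -
        have "((2::real) ^ k) powr (b - 1) = q ^ k"
          by (simp add: q_def powr_realpow[symmetric] powr_powr mult.commute)
        then show ?thesis using \<rho> by (simp add: powr_mult)
      qed
      then show ?thesis by (simp add: sum_distrib_left mult.assoc)
    qed
    finally show ?thesis by (simp only: times_divide_eq_left)
  qed
  moreover have "(\<Sum>k<n. q ^ k) \<le> 1 / (1 - q)" for n
    using q by (simp add: sum_gp_strict field_simps)
  ultimately have le: "norm (AS \<rho> x) \<le> M * norm x / (2 ^ n * \<rho>) + M * N * \<rho> powr (b - 1) * (1 / (1 - q))" for n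
    using M_ge_1 N by (meson add_left_mono mult_left_mono mult_nonneg_nonneg order_trans powr_ge_zero zero_le_one)
  have "(\<lambda>n. M * norm x / (2 ^ n * \<rho>) + M * N * \<rho> powr (b - 1) * (1 / (1 - q))) \<longlonglongrightarrow>
      0 + M * N * \<rho> powr (b - 1) * (1 / (1 - q))"
  proof (intro tendsto_add tendsto_const)
    have "(\<lambda>n. M * norm x / \<rho> * (1 / 2) ^ n) \<longlonglongrightarrow> M * norm x / \<rho> * 0"
      by (intro tendsto_intros LIMSEQ_power_zero) auto
    then show "(\<lambda>n. M * norm x / (2 ^ n * \<rho>)) \<longlonglongrightarrow> 0" by (simp add: power_divide mult.commute)
  qed
  then have "norm (AS \<rho> x) \<le> 0 + M * N * \<rho> powr (b - 1) * (1 / (1 - q))"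
    by (rule LIMSEQ_le_const) (use le in auto)
  then show ?thesis by (simp add: fav_const_def q_def mult_ac)
qed

text \<open>Regularity \<open>b\<close> of \<open>x\<close> and smoothing over time \<rho> together
  give order \<open>2 * b\<close> in \<open>h\<close>. For \<open>h \<le> \<rho>\<close> one
  integrates \<open>favard_AS\<close> and trades \<open>h powr (1 - 2 * b)\<close> for the same
  power of \<rho>; for \<open>h > \<rho>\<close> the Favard bound is already stronger.\<close>

lemma favard_smoothing:
  assumes fav: "favard b x N" and b: "0 \<le> b" "2 * b \<le> 1" and h: "0 \<le> h" and \<rho>: "0 < \<rho>" and N: "0 \<le> N"
  shows "norm (S h (S \<rho> x) - S \<rho> x) \<le> fav_const b * N * h powr (2 * b) * \<rho> powr (- b)"
proof -
  have C0: "0 \<le> fav_const b" using fav_const_ge[of b] b M_ge_1 by simp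
  consider "h = 0" | "0 < h" "h \<le> \<rho>" | "\<rho> < h" using h by linarith
  then show ?thesis
  proof cases
    case 1
    then show ?thesis by simp
  next
    case 2
    have "norm (S (h + \<rho>) x - S \<rho> x) \<le> (fav_const b * N * \<rho> powr (b - 1)) * (h + \<rho> - \<rho>)"
    proof (rule S_diff_bound)
      fix r assume r: "\<rho> \<le> r"
      have "norm (AS r x) \<le> fav_const b * N * r powr (b - 1)"
        using r \<rho> b N by (intro favard_AS fav) auto
      also have "\<dots> \<le> fav_const b * N * \<rho> powr (b - 1)"
        using r \<rho> b N C0 by (intro mult_left_mono powr_mono2') auto
      finally show "norm (AS r x) \<le> fav_const b * N * \<rho> powr (b - 1)" .
    qed (use \<rho> h in auto)
    also have "\<dots> = fav_const b * N * (\<rho> powr (b - 1) * h)" by simp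
    also have "\<rho> powr (b - 1) * h \<le> h powr (2 * b) * \<rho> powr (- b)"
    proof -
      have "h powr (1 - 2 * b) \<le> \<rho> powr (1 - 2 * b)" using 2 b by (intro powr_mono2) auto
      then have "h powr (1 - 2 * b) * (h powr (2 * b) * \<rho> powr (b - 1)) \<le>
          \<rho> powr (1 - 2 * b) * (h powr (2 * b) * \<rho> powr (b - 1))" by (intro mult_right_mono) auto
      moreover have "h powr (1 - 2 * b) * (h powr (2 * b) * \<rho> powr (b - 1)) = \<rho> powr (b - 1) * h"
      proof -
        have "h powr (1 - 2 * b) * h powr (2 * b) = h powr ((1 - 2 * b) + 2 * b)" by (rule powr_add[symmetric])
        also have "\<dots> = h" using 2 by simp
        finally have e: "h powr (1 - 2 * b) * h powr (2 * b) = h" .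
        show ?thesis by (simp only: mult.assoc[symmetric] e) (rule mult.commute)
      qed
      moreover have "\<rho> powr (1 - 2 * b) * (h powr (2 * b) * \<rho> powr (b - 1)) = h powr (2 * b) * \<rho> powr (- b)"
      proof -
        have "\<rho> powr (1 - 2 * b) * \<rho> powr (b - 1) = \<rho> powr ((1 - 2 * b) + (b - 1))" by (rule powr_add[symmetric])
        then show ?thesis by (simp add: mult.left_commute)
      qed
      ultimately show ?thesis by simp
    qed
    finally show ?thesis using h \<rho> C0 N by (simp add: S_comp mult_left_mono mult.assoc)
  next
    case 3
    have "S h (S \<rho> x) - S \<rho> x = S \<rho> (S h x - x)"
      using h \<rho> by (simp add: S_comp blinfun.diff_right add.commute)
    then have "norm (S h (S \<rho> x) - S \<rho> x) \<le> M * (N * h powr b)"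
      using norm_S_le[OF _ favardD[OF fav h], of \<rho>] \<rho> by simp
    also have "h powr b \<le> h powr (2 * b) * \<rho> powr (- b)"
    proof -
      have "h powr b = h powr (2 * b) * h powr (- b)"
        using powr_add[of h "2 * b" "- b"] by simp
      also have "\<dots> \<le> h powr (2 * b) * \<rho> powr (- b)"
        using 3 \<rho> b by (intro mult_left_mono powr_mono2') auto
      finally show ?thesis .
    qed
    also have "M * (N * (h powr (2 * b) * \<rho> powr (- b))) \<le> fav_const b * (N * (h powr (2 * b) * \<rho> powr (- b)))"
      using fav_const_ge[of b] b N by (intro mult_right_mono) auto
    finally show ?thesis using M_ge_1 N by (simp add: mult_left_mono mult.assoc)
  qed
qed

text \<open>Sum of \<open>(1 / 2) powr (d * k)\<close> over \<open>k \<ge> 1\<close>.\<close>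

definition dyadic_const :: "real \<Rightarrow> real" where
  "dyadic_const d = (1 / 2) powr d / (1 - (1 / 2) powr d)"

lemma dyadic_const_nonneg: "0 < d \<Longrightarrow> 0 \<le> dyadic_const d"
  using powr_mono2[of d "1 / 2" 1] unfolding dyadic_const_def
  by (intro divide_nonneg_nonneg) auto

text \<open>Regularity of \<open>x\<^sub>u\<close> from its increments, telescoping along \<open>u - (u - s) 2\<^sup>-\<^sup>k\<close>: each increment
  is smoothed by the semigroup over a time comparable to its length.\<close>

lemma dyadic_regularity:
  assumes su: "s < u" and x0: "x s = 0" and d: "0 < d" and h: "0 \<le> h" and a: "0 < a" and b: "0 \<le> b"
    and tail: "\<And>m. s \<le> m \<Longrightarrow> m < u \<Longrightarrow> norm (x u - S (u - m) (x m)) \<le> N * (u - m) powr a"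
    and incr: "\<And>m \<rho>. s \<le> m \<Longrightarrow> 0 < \<rho> \<Longrightarrow> m + 2 * \<rho> = u \<Longrightarrow>
      norm (S h (S \<rho> (x (m + \<rho>) - S \<rho> (x m))) - S \<rho> (x (m + \<rho>) - S \<rho> (x m))) \<le> b * \<rho> powr d"
  shows "norm (S h (x u) - x u) \<le> dyadic_const d * b * (u - s) powr d"
proof -
  define q where "q = (1 / 2 :: real) powr d"
  have q: "0 < q" "q < 1" using d powr_less_mono2[of d "1 / 2" 1] by (auto simp: q_def)
  define l where "l n = (u - s) * (1 / 2) ^ n" for n :: nat
  have l: "0 < l n" "l n \<le> u - s" "l n = 2 * l (Suc n)" "l 0 = u - s" for n
  proof -
    show "0 < l n" "l n = 2 * l (Suc n)" "l 0 = u - s" using su by (auto simp: l_def)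
    have "(1 / 2 :: real) ^ n \<le> 1" by (rule power_le_one) auto
    then show "l n \<le> u - s" using su mult_left_mono[of "(1/2)^n" 1 "u - s"] by (simp add: l_def)
  qed
  \<comment> \<open>\<open>y 0 = S (u - s) (x s) = 0\<close>, and by \<open>tail\<close> the
    sequence converges to \<open>x u\<close>.\<close>
  define y where "y n = S (l n) (x (u - l n))" for n
  have "norm (S h (y n) - y n) \<le> (\<Sum>k<n. b * l (Suc k) powr d)" for n
  proof (induction n)
    case 0
    then show ?case using x0 l(4) by (simp add: y_def)
  next
    case (Suc n)
    define \<rho> where "\<rho> = l (Suc n)"
    have \<rho>: "0 < \<rho>" "l n = \<rho> + \<rho>" "s \<le> u - l n" using l(1)[of "Suc n"] l(2,3)[of n] by (auto simp: \<rho>_def)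
    define z where "z = x (u - l n + \<rho>) - S \<rho> (x (u - l n))"
    \<comment> \<open>Consecutive terms differ by the increment of \<open>x\<close> over
      \<open>[u - 2 \<rho>, u - \<rho>]\<close>, smoothed over the remaining time \<rho>.\<close>
    have y_eq: "y (Suc n) = S \<rho> z + y n"
    proof -
      have "S (l n) (x (u - l n)) = S \<rho> (S \<rho> (x (u - l n)))"
        using \<rho> by (simp add: S_comp)
      moreover have "y (Suc n) = S \<rho> (x (u - \<rho>))" by (simp add: y_def \<rho>_def)
      moreover have "u - \<rho> = u - l n + \<rho>" using \<rho> by simp
      ultimately show ?thesis by (simp only: y_def z_def blinfun.diff_right diff_add_cancel)
    qed
    have "S h (y (Suc n)) - y (Suc n) = (S h (S \<rho> z) - S \<rho> z) + (S h (y n) - y n)"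
      by (simp add: y_eq blinfun.add_right)
    then have "norm (S h (y (Suc n)) - y (Suc n)) \<le> norm (S h (S \<rho> z) - S \<rho> z) + norm (S h (y n) - y n)"
      by (metis norm_triangle_ineq)
    also have "norm (S h (S \<rho> z) - S \<rho> z) \<le> b * \<rho> powr d"
      unfolding z_def using \<rho> by (intro incr) auto
    finally show ?case using Suc by (simp add: \<rho>_def)
  qed
  also have "(\<Sum>k<n. b * l (Suc k) powr d) \<le> dyadic_const d * b * (u - s) powr d" for n
  proof -
    have "l (Suc k) powr d = (u - s) powr d * (q * q ^ k)" for k
    proof -
      have "((1 / 2 :: real) ^ Suc k) powr d = q ^ Suc k"
        by (simp add: q_def powr_realpow[symmetric] powr_powr mult.commute del: power_Suc)
      then show ?thesis using su by (simp add: l_def powr_mult del: power_Suc) simp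
    qed
    then have "(\<Sum>k<n. b * l (Suc k) powr d) = b * (u - s) powr d * (q * (\<Sum>k<n. q ^ k))"
      by (simp add: sum_distrib_left mult_ac)
    also have "\<dots> \<le> b * (u - s) powr d * (q * (1 / (1 - q)))"
      using q b by (intro mult_left_mono) (auto simp: sum_gp_strict field_simps)
    finally show ?thesis by (simp add: dyadic_const_def q_def mult_ac)
  qed
  finally have yn: "norm (S h (y n) - y n) \<le> dyadic_const d * b * (u - s) powr d" for n .
  have "(\<lambda>n. (u - s) * (1 / 2) ^ n) \<longlonglongrightarrow> (u - s) * 0"
    by (intro tendsto_intros LIMSEQ_power_zero) auto
  then have "l \<longlonglongrightarrow> 0" by (simp add: l_def[abs_def])
  then have "(\<lambda>n. l n powr a) \<longlonglongrightarrow> 0"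
    by (rule tendsto_zero_powrI[OF _ tendsto_const _ a]) (use l(1) in \<open>simp add: less_imp_le\<close>)
  from tendsto_mult_left[OF this, of N] have lim0: "(\<lambda>n. N * l n powr a) \<longlonglongrightarrow> 0" by simp
  have "norm (x u - y n) \<le> N * l n powr a" for n
    using tail[of "u - l n"] l(1,2)[of n] by (simp add: y_def)
  then have "(\<lambda>n. x u - y n) \<longlonglongrightarrow> 0" by (intro Lim_null_comparison[OF _ lim0]) auto
  then have "(\<lambda>n. x u - (x u - y n)) \<longlonglongrightarrow> x u - 0" by (intro tendsto_diff tendsto_const)
  then have "y \<longlonglongrightarrow> x u" by simp
  then have "(\<lambda>n. norm (S h (y n) - y n)) \<longlonglongrightarrow> norm (S h (x u) - x u)" by (intro tendsto_intros)
  then show ?thesis by (rule LIMSEQ_le_const2) (use yn in auto)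
qed

end

section \<open>Fractional powers\<close>

context sectorial_generator
begin

lemma ex_analytic_semigroup: "\<exists>M. analytic_semigroup S M (\<lambda>t. Blinfun (\<lambda>x. A (S t x)))
    \<and> (\<forall>t>0. \<forall>x. Blinfun (\<lambda>x. A (S t x)) x = A (S t x))"
proof -
  obtain K where K: "1 \<le> K" "\<And>t x. 0 < t \<Longrightarrow> norm (A (S t x)) \<le> K / t * norm x" using AS_bound by blast
  obtain \<nu> where \<nu>: "0 < \<nu>" "growth (- \<nu>)" using S_decay by blast
  then obtain M0 where M0: "\<And>t. 0 \<le> t \<Longrightarrow> norm (S t) \<le> M0 * exp (- \<nu> * t)" unfolding growth_def by blast
  have M00: "0 \<le> M0" using order_trans[OF norm_ge_zero M0[of 0]] by simp
  define M where "M = max K M0"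
  have bl: "bounded_linear (\<lambda>x. A (S t x))" if t: "0 < t" for t
  proof (rule bounded_linear_intro)
    show "A (S t (x + y)) = A (S t x) + A (S t y)" for x y
      using sect S_deriv(1)[OF t] by (simp add: sectorial_def blinfun.add_right)
    show "A (S t (c *\<^sub>R x)) = c *\<^sub>R A (S t x)" for c x
      using A_scale[OF S_deriv(1)[OF t]] by (simp add: blinfun.scaleR_right)
    show "norm (A (S t x)) \<le> norm x * (K / t)" for x using K(2)[OF t, of x] by (simp add: mult.commute)
  qed
  then have app: "Blinfun (\<lambda>x. A (S t x)) x = A (S t x)" if "0 < t" for t x
    using that by (simp add: bounded_linear_Blinfun_apply)
  have "analytic_semigroup S M (\<lambda>t. Blinfun (\<lambda>x. A (S t x)))"
  proof
    show "S 0 = id_blinfun" by (rule blinfun_eqI) (simp add: S0)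
    show "norm (S t) \<le> M" if "0 \<le> t" for t
    proof -
      have "M0 * exp (- \<nu> * t) \<le> M0 * 1" using \<nu> that M00 by (intro mult_left_mono) auto
      then show ?thesis using M0[OF that] by (simp add: M_def)
    qed
    show "1 \<le> M" using K by (simp add: M_def)
    show "((\<lambda>t. S t x) has_vector_derivative Blinfun (\<lambda>x. A (S t x)) x) (at t)" if "0 < t" for t x
      using S_deriv(2)[OF that] that by (simp add: app)
    show "norm (Blinfun (\<lambda>x. A (S t x))) \<le> M / t" if t: "0 < t" for t
    proof (rule norm_blinfun_bound)
      show "norm (Blinfun (\<lambda>x. A (S t x)) x) \<le> M / t * norm x" for x
      proof -
        have "K / t * norm x \<le> M / t * norm x"
          using t by (intro mult_right_mono divide_right_mono) (auto simp: M_def)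
        then show ?thesis using K(2)[OF t, of x] t by (simp add: app)
      qed
    qed (use t K in \<open>auto simp: M_def\<close>)
    show "S s (Blinfun (\<lambda>x. A (S t x)) x) = Blinfun (\<lambda>x. A (S (s + t) x)) x" if "0 \<le> s" "0 < t" for s t x
    proof (cases "s = 0")
      case False
      then have "A (S (s + t) x) = S s (A (S t x))"
        using that S_deriv(3)[of s "S t x"] S_deriv(1)[OF that(2)] by (simp add: S_plus_apply)
      then show ?thesis using that app[of "s + t" x] app[of t x] by simp
    qed (use that in \<open>simp add: S0\<close>)
    show "Blinfun (\<lambda>x. A (S t x)) (S s x) = Blinfun (\<lambda>x. A (S (s + t) x)) x" if "0 \<le> s" "0 < t" for s t x
      using that S_plus_apply[of t s x] by (simp add: app add.commute)
  qed (auto simp: S_plus intro: S_continuous)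
  then show ?thesis using app by blast
qed

lemma decaying_powr:
  assumes "0 < b" "b < 1" "growth (- \<nu>)" "0 < \<nu>"
  shows "set_integrable lborel {0<..} (\<lambda>t. t powr (b - 1) *\<^sub>R S t w)"
proof -
  obtain M where M: "\<And>t. 0 \<le> t \<Longrightarrow> norm (S t) \<le> M * exp (- \<nu> * t)"
    using assms(3) unfolding growth_def by blast
  have M0: "0 \<le> M" using order_trans[OF norm_ge_zero M[of 0]] by simp
  define h where "h t = M * norm w * (indicator {0<..<1} t * t powr (b - 1) + exp (- (t * \<nu>)))" for t
  have i1: "set_integrable lborel {0<..} (\<lambda>t. indicat_real {0<..<1} t * t powr (b - 1))"
  proof -
    have "indicat_real {0<..} t *\<^sub>R (indicat_real {0<..<1} t * t powr (b - 1)) =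
        indicat_real {0<..<1} t *\<^sub>R (t - 0) powr (b - 1)" for t :: real
      by (auto simp: indicator_def)
    then show ?thesis
      using powr_integral_left(1)[OF assms(1), of 0 1] unfolding set_integrable_def by (simp only: zero_le_one)
  qed
  have hi: "set_integrable lborel {0<..} h"
    unfolding h_def using i1 integrable_I0i_exp_mscale[OF assms(4)]
    by (intro set_integrable_mult_right set_integral_add(1))
  have cont: "continuous_on {0<..} (\<lambda>t. t powr (b - 1) *\<^sub>R S t w)"
    by (intro continuous_on_scaleR S_continuous_pos continuous_intros) auto
  show ?thesis
  proof (rule set_integrable_continuous_bound[OF cont _ hi])
    fix t :: real assume t: "t \<in> {0<..}"
    have "norm (t powr (b - 1) *\<^sub>R S t w) \<le> t powr (b - 1) * ((M * exp (- \<nu> * t)) * norm w)"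
    proof -
      have "norm (S t w) \<le> (M * exp (- \<nu> * t)) * norm w"
        using M[of t] t by (intro order_trans[OF norm_blinfun] mult_right_mono) auto
      then show ?thesis by (simp add: mult_left_mono)
    qed
    also have "\<dots> = M * norm w * (t powr (b - 1) * exp (- (t * \<nu>)))" by (simp add: mult_ac)
    also have "\<dots> \<le> h t" unfolding h_def
    proof (rule mult_left_mono)
      show "t powr (b - 1) * exp (- (t * \<nu>)) \<le> indicator {0<..<1} t * t powr (b - 1) + exp (- (t * \<nu>))"
      proof (cases "t < 1")
        case True
        have "t powr (b - 1) * exp (- (t * \<nu>)) \<le> t powr (b - 1) * 1"
          using t assms by (intro mult_left_mono) auto
        then show ?thesis using True t by (simp add: add_increasing2)
      next
        case False
        then have "t powr (b - 1) \<le> 1 powr (b - 1)" using assms by (intro powr_mono2') auto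
        then have "t powr (b - 1) * exp (- (t * \<nu>)) \<le> 1 * exp (- (t * \<nu>))" by (intro mult_right_mono) auto
        then show ?thesis using False by simp
      qed
    qed (use M0 in auto)
    finally show "norm (t powr (b - 1) *\<^sub>R S t w) \<le> h t" .
  qed simp
qed

lemma neg_frac_power_integrable:
  assumes "0 < b" "b < 1"
  shows "set_integrable lborel {0<..} (\<lambda>t. t powr (b - 1) *\<^sub>R S t w)"
  using decaying_powr[OF assms] S_decay by blast

lemma neg_frac_power_linear:
  assumes "0 < b" "b < 1"
  shows "neg_frac_power S b (x - y) = neg_frac_power S b x - neg_frac_power S b y"
  unfolding neg_frac_power_def
  using set_integral_diff(2)[OF neg_frac_power_integrable[OF assms] neg_frac_power_integrable[OF assms]]
  by (simp add: blinfun.diff_right scaleR_diff_right)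

text \<open>The integral of \<open>r powr (b - 1) * |S h (S r w) - S r w|\<close> is split at
  \<open>r = h\<close>. Below, the trivial bound is used, above, the smoothing bound
  \<open>h / r\<close>; each part is of order \<open>h powr b\<close>.\<close>

lemma neg_frac_power_favard:
  assumes b: "0 < b" "b < 1"
  shows "\<exists>C\<ge>0. \<forall>w. \<forall>h\<ge>0. norm (S h (neg_frac_power S b w) - neg_frac_power S b w) \<le> C * norm w * h powr b"
proof -
  obtain M where "analytic_semigroup S M (\<lambda>t. Blinfun (\<lambda>x. A (S t x)))" using ex_analytic_semigroup by blast
  then interpret an: analytic_semigroup S M "\<lambda>t. Blinfun (\<lambda>x. A (S t x))" .
  define C where "C = \<bar>1 / Gamma b\<bar> * (2 * M * (1 / b + 1 / (1 - b)))"
  have C0: "0 \<le> C" unfolding C_def using b an.M_ge_1 by (intro mult_nonneg_nonneg) auto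
  have "norm (S h (neg_frac_power S b w) - neg_frac_power S b w) \<le> C * norm w * h powr b" if h: "0 < h" for w h
  proof -
    note int = neg_frac_power_integrable[OF b, of w]
    define f where "f r = r powr (b - 1) *\<^sub>R (S h (S r w) - S r w)" for r
    have feq: "f r = S h (r powr (b - 1) *\<^sub>R S r w) - r powr (b - 1) *\<^sub>R S r w" for r
      by (simp add: f_def blinfun.scaleR_right scaleR_diff_right)
    have fint: "set_integrable lborel {0<..} f"
      unfolding feq[abs_def] by (intro set_integral_diff(1) set_integral_blinfun(2) int)
    have "S h (neg_frac_power S b w) - neg_frac_power S b w = (1 / Gamma b) *\<^sub>R (LINT r:{0<..}|lborel. f r)"
      unfolding neg_frac_power_def feq set_integral_diff(2)[OF set_integral_blinfun(2)[OF int] int]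
        set_integral_blinfun(1)[OF int]
      by (simp add: blinfun.scaleR_right scaleR_diff_right)
    moreover have "norm (LINT r:{0<..}|lborel. f r) \<le> 2 * M * norm w * (h powr b * (1 / b + 1 / (1 - b)))"
    proof -
      have sm: "norm (S h (S r w) - S r w) \<le> 2 * M * norm w" "norm (S h (S r w) - S r w) \<le> 2 * M * norm w * (h / r)"
        if "0 < r" for r
        using an.smoothing[of h r 0 w] an.smoothing[of h r 1 w] h that by auto
      have split: "(LINT r:{0<..}|lborel. f r) = (LINT r:{0<..<h}|lborel. f r) + (LINT r:{h..}|lborel. f r)"
      proof -
        have "{0<..} = {0<..<h} \<union> {h..}" using h by auto
        moreover have "(LINT r:{0<..<h} \<union> {h..}|lborel. f r) = (LINT r:{0<..<h}|lborel. f r) + (LINT r:{h..}|lborel. f r)"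
          using h by (intro set_integral_Un set_integrable_subset[OF fint]) auto
        ultimately show ?thesis by simp
      qed
      have "norm (LINT r:{0<..<h}|lborel. f r) \<le> (LINT r:{0<..<h}|lborel. 2 * M * norm w * (r - 0) powr (b - 1))"
      proof (rule set_integral_norm_le)
        show "set_integrable lborel {0<..<h} f" by (rule set_integrable_subset[OF fint]) auto
        show "set_integrable lborel {0<..<h} (\<lambda>r. 2 * M * norm w * (r - 0) powr (b - 1))"
          by (intro set_integrable_mult_right powr_integral_left(1)) (use b h in auto)
        show "norm (f r) \<le> 2 * M * norm w * (r - 0) powr (b - 1)" if "r \<in> {0<..<h}" for r
          using mult_left_mono[OF sm(1)[of r], of "r powr (b - 1)"] that by (simp add: f_def mult.commute)
      qed
      also have "\<dots> = 2 * M * norm w * (h powr b / b)"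
        using powr_integral_left(2)[of b 0 h] b h by simp
      finally have 1: "norm (LINT r:{0<..<h}|lborel. f r) \<le> 2 * M * norm w * (h powr b / b)" .
      have "norm (LINT r:{h..}|lborel. f r) \<le> (LINT r:{h..}|lborel. 2 * M * norm w * h * r powr (b - 2))"
      proof (rule set_integral_norm_le)
        show "set_integrable lborel {h..} f" by (rule set_integrable_subset[OF fint]) (use h in auto)
        show "set_integrable lborel {h..} (\<lambda>r. 2 * M * norm w * h * r powr (b - 2))"
          by (intro set_integrable_mult_right powr_integral_to_inf(1)) (use b h in auto)
        show "norm (f r) \<le> 2 * M * norm w * h * r powr (b - 2)" if "r \<in> {h..}" for r
        proof -
          have r: "0 < r" using h that by auto
          have "norm (f r) \<le> r powr (b - 1) * (2 * M * norm w * (h / r))"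
            using mult_left_mono[OF sm(2)[OF r], of "r powr (b - 1)"] by (simp add: f_def)
          also have "r powr (b - 1) = r powr (b - 2) * r"
            using r powr_mult_base[of r "b - 2"] by (simp add: mult.commute)
          finally show ?thesis using r by (simp add: mult_ac)
        qed
      qed
      also have "\<dots> = 2 * M * norm w * h * (- (h powr (b - 2 + 1)) / (b - 2 + 1))"
        using powr_integral_to_inf(2)[of "b - 2" h] b h by simp
      also have "\<dots> = 2 * M * norm w * (h powr b / (1 - b))"
      proof -
        have "h * h powr (b - 2 + 1) = h powr b" using h powr_mult_base[of h "b - 1"] by simp
        moreover have "- (h powr (b - 2 + 1)) / (b - 2 + 1) = h powr (b - 2 + 1) / (1 - b)"
          using minus_divide_right[of "h powr (b - 2 + 1)" "b - 2 + 1"] by (simp add: algebra_simps)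
        ultimately show ?thesis by (simp add: mult.assoc)
      qed
      finally have 2: "norm (LINT r:{h..}|lborel. f r) \<le> 2 * M * norm w * (h powr b / (1 - b))" .
      show ?thesis unfolding split using norm_triangle_mono[OF 1 2]
        by (simp add: distrib_left divide_inverse)
    qed
    ultimately have "norm (S h (neg_frac_power S b w) - neg_frac_power S b w) \<le>
        \<bar>1 / Gamma b\<bar> * (2 * M * norm w * (h powr b * (1 / b + 1 / (1 - b))))"
      by (simp add: mult_left_mono divide_right_mono)
    then show ?thesis by (simp add: C_def mult_ac)
  qed
  then have "norm (S h (neg_frac_power S b w) - neg_frac_power S b w) \<le> C * norm w * h powr b" if "0 \<le> h" for w h
    using that by (cases "h = 0") (auto simp: S0)
  then show ?thesis using C0 by blast
qed

text \<open>Applying the Abel kernel \<open>t\<^sup>-\<^sup>\<beta>\<close> to \<open>t \<mapsto> S(t) (-A)\<^sup>-\<^sup>\<beta> w\<close> recovers \<open>\<integral> S(q) w dq = -A\<^sup>-\<^sup>1 w\<close>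
  up to a positive factor.\<close>

lemma neg_frac_power_inj:
  assumes b: "0 < b" "b < 1" and 0: "neg_frac_power S b w = 0"
  shows "w = 0"
proof -
  obtain \<nu> where \<nu>: "0 < \<nu>" "growth (- \<nu>)" using S_decay by blast
  have one: "decaying (- \<nu>) (\<lambda>t. 1)"
    unfolding decaying_def using \<nu> by (intro conjI exI[of _ 1] exI[of _ 0]) auto
  have Sint: "set_integrable lborel {0<..} (\<lambda>t. S t w)"
    using transform_integrable[OF \<nu>(2) one, of w] by simp
  define B where "B = Beta (1 - b) b"
  have B: "0 < B" unfolding B_def Beta_def using b by (intro divide_pos_pos mult_pos_pos Gamma_real_pos) auto
  have "0 < Gamma b" using b by (intro Gamma_real_pos)
  then have "Gamma b \<noteq> 0" by simp
  then have int0: "(LINT r:{0<..}|lborel. r powr (b - 1) *\<^sub>R S r w) = 0"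
    using 0 by (simp add: neg_frac_power_def)
  \<comment> \<open>The substitution \<open>q = t + r\<close> makes the integral over
    \<open>q\<close> a multiple of \<open>S t\<close> applied to the vanishing fractional integral
    of \<open>w\<close>; integrating over \<open>t\<close> first gives a Beta value times
    \<open>S q w\<close>.\<close>
  define F where "F = (\<lambda>t q. indicator {0<..} t *\<^sub>R (indicator {t<..} q *\<^sub>R ((t powr (- b) * (q - t) powr (b - 1)) *\<^sub>R S q w)))"
  define g where "g q = indicator {0<..} q *\<^sub>R S q w" for q :: real
  have g_meas [measurable]: "g \<in> borel_measurable borel"
    using Sint unfolding set_integrable_def g_def[abs_def] by (auto dest: borel_measurable_integrable)
  have F_eq: "F t q = (indicator {0<..<q} t * (t powr (- b) * (q - t) powr (b - 1))) *\<^sub>R g q" for t q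
    by (auto simp: F_def g_def indicator_def)
  have inner: "(LINT q|lborel. F t q) = 0" for t
  proof (cases "0 < t")
    case True
    have "(LINT q|lborel. F t q) = \<bar>1\<bar> *\<^sub>R (LINT r|lborel. F t (t + 1 * r))"
      by (rule lborel_integral_real_affine) simp
    also have "\<dots> = (LINT r|lborel. t powr (- b) *\<^sub>R S t (indicator {0<..} r *\<^sub>R (r powr (b - 1) *\<^sub>R S r w)))"
      using True by (auto intro!: Bochner_Integration.integral_cong simp: F_def indicator_def blinfun.scaleR_right S_plus_apply)
    also have "\<dots> = t powr (- b) *\<^sub>R S t (LINT r:{0<..}|lborel. r powr (b - 1) *\<^sub>R S r w)"
      using integral_bounded_linear[OF blinfun.bounded_linear_right neg_frac_power_integrable[OF b, of w, unfolded set_integrable_def], of "S t"]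
      by (simp add: set_lebesgue_integral_def)
    finally show ?thesis by (simp add: int0)
  qed (simp add: F_def)
  have outer_int: "integrable lborel (\<lambda>t. indicat_real {0<..<q} t * (t powr (- b) * (q - t) powr (b - 1)))"
    and outer: "(LINT t|lborel. indicat_real {0<..<q} t * (t powr (- b) * (q - t) powr (b - 1))) = B" if "0 < q" for q
    using powr_convolution[OF b that] by (simp_all add: set_integrable_def set_lebesgue_integral_def B_def)
  have Fint: "integrable (lborel \<Otimes>\<^sub>M lborel) (\<lambda>(q, t). F t q)"
  proof (rule lborel_pair.Fubini_integrable)
    show "AE q in lborel. integrable lborel (\<lambda>t. case (q, t) of (q, t) \<Rightarrow> F t q)"
    proof (rule AE_I2)
      fix q :: real
      show "integrable lborel (\<lambda>t. case (q, t) of (q, t) \<Rightarrow> F t q)"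
        unfolding F_eq prod.case by (cases "0 < q") (auto simp: g_def intro!: integrable_scaleR_left outer_int)
    qed
    have "(LINT t|lborel. norm (F t q)) = B * norm (g q)" for q
    proof (cases "0 < q")
      case True
      have "(LINT t|lborel. norm (F t q)) = (LINT t|lborel. (indicat_real {0<..<q} t * (t powr (- b) * (q - t) powr (b - 1))) * norm (g q))"
        by (intro Bochner_Integration.integral_cong) (auto simp: F_eq abs_mult)
      then show ?thesis using outer[OF True] by simp
    qed (simp add: F_eq g_def)
    moreover have "integrable lborel (\<lambda>q. B * norm (g q))"
      using Sint unfolding set_integrable_def g_def[abs_def] by (intro integrable_mult_right integrable_norm)
    ultimately show "integrable lborel (\<lambda>q. LINT t|lborel. norm (case (q, t) of (q, t) \<Rightarrow> F t q))" by simp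
    show "(\<lambda>(q, t). F t q) \<in> borel_measurable (lborel \<Otimes>\<^sub>M lborel)"
    proof -
      have "(\<lambda>(q, t). (if 0 < t \<and> t < q then t powr (- b) * (q - t) powr (b - 1) else 0) *\<^sub>R g q)
          \<in> borel_measurable (borel \<Otimes>\<^sub>M borel)" by measurable
      moreover have "(\<lambda>(q, t). F t q) = (\<lambda>(q, t). (if 0 < t \<and> t < q then t powr (- b) * (q - t) powr (b - 1) else 0) *\<^sub>R g q)"
        by (auto simp: F_eq indicator_def fun_eq_iff)
      ultimately show ?thesis by (simp only: lborel_prod measurable_lborel2 borel_prod)
    qed
  qed
  have "(LINT t|lborel. LINT q|lborel. F t q) = (LINT q|lborel. LINT t|lborel. F t q)"
    using lborel_pair.Fubini_integral[of "\<lambda>q t. F t q"] Fint by simp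
  also have "\<dots> = (LINT q|lborel. B *\<^sub>R g q)"
  proof (rule Bochner_Integration.integral_cong[OF refl])
    fix q
    show "(LINT t|lborel. F t q) = B *\<^sub>R g q"
      unfolding F_eq using outer outer_int by (cases "0 < q") (auto simp: g_def integral_scaleR_left)
  qed
  finally have "B *\<^sub>R (LINT q|lborel. g q) = 0" using inner by simp
  then have T0: "transform (\<lambda>t. 1) w = 0" using B by (simp add: transform_def set_lebesgue_integral_def g_def[abs_def])
  obtain Q :: "'w \<Rightarrow>\<^sub>L 'w" where Q: "\<And>y. Q y \<in> D" "\<And>y. A (Q y) = y" using ex_inverse by blast
  have "decaying (- \<nu>) (\<lambda>t. 0)"
    unfolding decaying_def using \<nu> by (intro conjI exI[of _ 1] exI[of _ 0]) auto
  \<comment> \<open>With constant kernel 1 integration by parts says that the integral of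
    \<open>S t w\<close> equals \<open>- Q w\<close>.\<close>
  then have "transform (\<lambda>t. 1) (A (Q w)) + transform (\<lambda>t. 0) (Q w) = - 1 *\<^sub>R Q w"
    by (intro transform_parts(1)[OF \<nu>(2) Q(1) one]) auto
  then have "Q w = 0" using T0 Q(2) by (simp add: transform_def)
  then show "w = 0" using Q(2)[of w] D_zero(2) by simp
qed

text \<open>Injectivity makes \<open>frac_power\<close> the genuine inverse of
  \<open>neg_frac_power\<close>, so values and differences of \<open>G\<close> are negative
  fractional powers of vectors controlled by the hypothesis, and
  \<open>neg_frac_power_favard\<close> applies.\<close>

lemma lipschitz_favard:
  fixes G :: "'w \<Rightarrow> 'v::real_normed_vector \<Rightarrow>\<^sub>L 'w"
  assumes b: "0 < b" "b < 1" and lip: "lipschitz_into_frac S b G"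
  shows "\<exists>C\<ge>0. (\<forall>x y v. \<forall>h\<ge>0. norm (S h ((G x - G y) v) - (G x - G y) v) \<le> (C * norm (x - y) * norm v) * h powr b)
      \<and> (\<forall>x v. \<forall>h\<ge>0. norm (S h (G x v) - G x v) \<le> (C * (1 + norm x) * norm v) * h powr b)"
proof -
  obtain C0 where C0: "0 \<le> C0" "\<And>w h. 0 \<le> h \<Longrightarrow> norm (S h (neg_frac_power S b w) - neg_frac_power S b w) \<le> C0 * norm w * h powr b"
    using neg_frac_power_favard[OF b] by blast
  have frac: "frac_power S b (neg_frac_power S b w) = w" for w
    unfolding frac_power_def
  proof (rule the_equality)
    fix w' assume "neg_frac_power S b w' = neg_frac_power S b w"
    then have "neg_frac_power S b (w' - w) = 0" by (simp add: neg_frac_power_linear[OF b])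
    then show "w' = w" using neg_frac_power_inj[OF b] by fastforce
  qed simp
  obtain L where dom: "\<And>x. range (G x) \<subseteq> frac_dom S b" and bl: "\<And>x. bounded_linear (\<lambda>v. frac_power S b (G x v))"
    and L: "\<And>x y. onorm (\<lambda>v. frac_power S b ((G x - G y) v)) \<le> L * norm (x - y)"
    using lip unfolding lipschitz_into_frac_def by blast
  have G_eq: "G x v = neg_frac_power S b (frac_power S b (G x v))" for x v
  proof -
    have "G x v \<in> range (neg_frac_power S b)" using dom[of x] unfolding frac_dom_def by blast
    then show ?thesis by (auto simp: frac)
  qed
  have diff: "(G x - G y) v = neg_frac_power S b (frac_power S b (G x v) - frac_power S b (G y v))" for x y v
    by (simp only: neg_frac_power_linear[OF b] G_eq[symmetric] blinfun.diff_left)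
  have diff': "frac_power S b ((G x - G y) v) = frac_power S b (G x v) - frac_power S b (G y v)" for x y v
    by (simp only: diff frac)
  have dl: "norm (frac_power S b (G x v) - frac_power S b (G y v)) \<le> \<bar>L\<bar> * norm (x - y) * norm v" for x y v
  proof -
    have "bounded_linear (\<lambda>v. frac_power S b ((G x - G y) v))"
      unfolding diff' by (intro bounded_linear_sub bl)
    then have "norm (frac_power S b ((G x - G y) v)) \<le> onorm (\<lambda>v. frac_power S b ((G x - G y) v)) * norm v"
      by (rule onorm)
    also have "\<dots> \<le> (\<bar>L\<bar> * norm (x - y)) * norm v"
    proof (rule mult_right_mono)
      have "L * norm (x - y) \<le> \<bar>L\<bar> * norm (x - y)" by (intro mult_right_mono) auto
      then show "onorm (\<lambda>v. frac_power S b ((G x - G y) v)) \<le> \<bar>L\<bar> * norm (x - y)" using L[of x y] by linarith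
    qed simp
    finally show ?thesis by (simp add: diff')
  qed
  obtain K where K: "0 < K" "\<And>v. norm (frac_power S b (G 0 v)) \<le> norm v * K"
    using bounded_linear.pos_bounded[OF bl[of 0]] by blast
  define C where "C = C0 * (\<bar>L\<bar> + K)"
  have C: "0 \<le> C" using C0 K by (simp add: C_def)
  have 1: "norm (S h ((G x - G y) v) - (G x - G y) v) \<le> (C * norm (x - y) * norm v) * h powr b" if "0 \<le> h" for x y v h
  proof -
    have "norm (S h ((G x - G y) v) - (G x - G y) v) \<le>
        C0 * norm (frac_power S b (G x v) - frac_power S b (G y v)) * h powr b"
      unfolding diff by (rule C0(2)[OF that])
    also have "\<dots> \<le> C0 * ((\<bar>L\<bar> + K) * norm (x - y) * norm v) * h powr b"
    proof (intro mult_right_mono mult_left_mono)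
      have "\<bar>L\<bar> * norm (x - y) * norm v \<le> (\<bar>L\<bar> + K) * norm (x - y) * norm v"
        using K by (intro mult_right_mono) auto
      then show "norm (frac_power S b (G x v) - frac_power S b (G y v)) \<le> (\<bar>L\<bar> + K) * norm (x - y) * norm v"
        using dl[of x v y] by linarith
    qed (use C0 in auto)
    finally show ?thesis by (simp add: C_def mult_ac)
  qed
  have 2: "norm (S h (G x v) - G x v) \<le> (C * (1 + norm x) * norm v) * h powr b" if "0 \<le> h" for x v h
  proof -
    have "norm (S h (G x v) - G x v) \<le> C0 * norm (frac_power S b (G x v)) * h powr b"
      using C0(2)[OF that, of "frac_power S b (G x v)"] by (simp only: G_eq[symmetric])
    also have "\<dots> \<le> C0 * ((\<bar>L\<bar> + K) * (1 + norm x) * norm v) * h powr b"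
    proof (intro mult_right_mono mult_left_mono)
      have "norm (frac_power S b (G x v)) \<le> norm (frac_power S b (G x v) - frac_power S b (G 0 v)) + norm (frac_power S b (G 0 v))"
        by (metis diff_add_cancel norm_triangle_ineq)
      also have "\<dots> \<le> \<bar>L\<bar> * norm x * norm v + norm v * K"
        using dl[of x v 0] K(2)[of v] by (intro add_mono) auto
      also have "\<dots> \<le> (\<bar>L\<bar> + K) * (1 + norm x) * norm v"
      proof -
        have "0 \<le> \<bar>L\<bar> * norm v + K * norm x * norm v" using K by auto
        then show ?thesis by (simp add: algebra_simps)
      qed
      finally show "norm (frac_power S b (G x v)) \<le> (\<bar>L\<bar> + K) * (1 + norm x) * norm v" .
    qed (use C0 in auto)
    finally show ?thesis by (simp add: C_def mult_ac)
  qed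
  show ?thesis using C 1 2 by blast
qed

end

section \<open>The lift to the projective tensor product\<close>

lemma tsum_append: "tsum T (xs @ ys) = tsum T xs + tsum T ys"
  by (simp add: tsum_def)

lemma tsum_Cons: "tsum T ((v, w) # xs) = T v w + tsum T xs"
  by (simp add: tsum_def)

lemma tsum_scale:
  assumes "bounded_bilinear T"
  shows "tsum T (map (\<lambda>(v, w). (c *\<^sub>R v, w)) xs) = c *\<^sub>R tsum T xs"
  by (induction xs) (auto simp: tsum_def scaleR_add_right bounded_bilinear.scaleR_left[OF assms])

text \<open>All first factors are expanded in one finite basis, the shape in which the independence
  condition of \<open>projective_tensor\<close> can be used.\<close>

lemma tsum_basis:
  assumes T: "bounded_bilinear T" and B: "finite B" "independent B" and xs: "fst ` set xs \<subseteq> span B"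
  shows "tsum T xs = (\<Sum>b\<in>B. T b (\<Sum>(v, w)\<leftarrow>xs. representation B v b *\<^sub>R w))"
  using xs
proof (induction xs)
  case Nil
  then show ?case by (simp add: tsum_def bounded_bilinear.zero_right[OF T])
next
  case (Cons p xs)
  obtain v w where p: "p = (v, w)" by (cases p)
  have v: "v \<in> span B" using Cons p by auto
  have "T v w = T (\<Sum>b\<in>B. representation B v b *\<^sub>R b) w"
    using real_vector.sum_representation_eq[OF B(2) v B(1)] by simp
  also have "\<dots> = (\<Sum>b\<in>B. T b (representation B v b *\<^sub>R w))"
    by (simp add: bounded_bilinear.sum_left[OF T] bounded_bilinear.scaleR_left[OF T] bounded_bilinear.scaleR_right[OF T])
  finally show ?case
    using Cons by (simp add: p tsum_Cons bounded_bilinear.add_right[OF T] sum.distrib)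
qed

text \<open>Vanishing of the tensor forces every coefficient vector in the basis expansion to
  vanish; these coefficients do not depend on the bilinear map, so the sum for \<open>T\<close>
  vanishes too.\<close>

lemma tsum_well_defined:
  assumes tens: "projective_tensor tens" and T: "bounded_bilinear T" and z: "tsum tens xs = 0"
  shows "tsum T xs = 0"
proof -
  obtain B where B: "B \<subseteq> fst ` set xs" "independent B" "fst ` set xs \<subseteq> span B"
    by (rule maximal_independent_subset[of "fst ` set xs"])
  have fin: "finite B" using B(1) by (rule finite_subset) simp
  have bb: "bounded_bilinear tens" using tens by (simp add: projective_tensor_def)
  let ?f = "\<lambda>b. \<Sum>(v, w)\<leftarrow>xs. representation B v b *\<^sub>R w"
  have "(\<Sum>b\<in>B. tens b (?f b)) = 0" using z tsum_basis[OF bb fin B(2,3)] by simp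
  moreover have "\<forall>B f. finite B \<and> independent B \<and> (\<Sum>b\<in>B. tens b (f b)) = 0 \<longrightarrow> (\<forall>b\<in>B. f b = 0)"
    using tens by (simp add: projective_tensor_def)
  ultimately have "\<forall>b\<in>B. ?f b = 0" using fin B(2) by (elim allE[of _ B] allE[of _ ?f] mp) simp
  then show ?thesis using tsum_basis[OF T fin B(2,3)] by (simp add: bounded_bilinear.zero_right[OF T])
qed

text \<open>The map is defined on finite sums, bounded there because the projective norm is an
  infimum over representations, and extended to the closure by uniform continuity.\<close>

lemma tensor_lift_exists:
  fixes tens :: "'a::real_normed_vector \<Rightarrow> 'b::real_normed_vector \<Rightarrow> 'c::banach"
    and B :: "'a \<Rightarrow>\<^sub>L 'b \<Rightarrow>\<^sub>L 'd::banach"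
  assumes tens: "projective_tensor tens"
  shows "\<exists>L. (\<forall>v w. blinfun_apply L (tens v w) = B v w) \<and> (\<forall>x. norm (L x) \<le> norm B * norm x)"
proof -
  have bb: "bounded_bilinear tens" using tens by (simp add: projective_tensor_def)
  define T where "T v w = blinfun_apply (B v) w" for v w
  have Tb: "norm (T v w) \<le> norm B * (norm v * norm w)" for v w
  proof -
    have "norm (T v w) \<le> norm (B v) * norm w" unfolding T_def by (rule norm_blinfun)
    also have "\<dots> \<le> (norm B * norm v) * norm w" by (intro mult_right_mono norm_blinfun) auto
    finally show ?thesis by (simp add: mult.assoc)
  qed
  have T: "bounded_bilinear T"
  proof
    show "\<exists>K. \<forall>a b. norm (T a b) \<le> norm a * norm b * K"
      using Tb by (intro exI[of _ "norm B"]) (simp add: mult.commute)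
  qed (auto simp: T_def blinfun.add_left blinfun.add_right blinfun.scaleR_left blinfun.scaleR_right)
  define X where "X = range (tsum tens)"
  \<comment> \<open>An arbitrary representation is chosen; \<open>tsum_well_defined\<close> makes
    the value independent of it.\<close>
  define f where "f x = tsum T (SOME xs. tsum tens xs = x)" for x
  have f: "f (tsum tens xs) = tsum T xs" for xs
  proof -
    define ys where "ys = (SOME ys. tsum tens ys = tsum tens xs)"
    have "tsum tens ys = tsum tens xs" unfolding ys_def by (rule someI_ex) blast
    then have "tsum tens (ys @ map (\<lambda>(v, w). (- 1 *\<^sub>R v, w)) xs) = 0"
      by (simp only: tsum_append tsum_scale[OF bb]) simp
    then have "tsum T (ys @ map (\<lambda>(v, w). (- 1 *\<^sub>R v, w)) xs) = 0"
      by (rule tsum_well_defined[OF tens T])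
    then have "tsum T ys = tsum T xs" by (simp only: tsum_append tsum_scale[OF T]) simp
    then show ?thesis by (simp add: f_def ys_def)
  qed
  have f_le: "norm (f (tsum tens xs)) \<le> norm B * norm (tsum tens xs)" for xs
  proof -
    have 1: "norm (tsum T ys) \<le> norm B * (\<Sum>(v, w)\<leftarrow>ys. norm v * norm w)" for ys
      by (induction ys) (auto simp: tsum_def distrib_left intro!: norm_triangle_le add_mono Tb)
    have nrm: "norm (tsum tens xs) = (INF ys\<in>{ys. tsum tens ys = tsum tens xs}. \<Sum>(v, w)\<leftarrow>ys. norm v * norm w)"
      using tens unfolding projective_tensor_def by blast
    show ?thesis
    \<comment> \<open>The positive case divides by \<open>norm B\<close> in order to pass to the
      infimum.\<close>
    proof (cases "norm B = 0")
      case True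
      then show ?thesis using 1[of xs] f by simp
    next
      case False
      then have B0: "0 < norm B" by simp
      have "norm (f (tsum tens xs)) / norm B \<le> (INF ys\<in>{ys. tsum tens ys = tsum tens xs}. \<Sum>(v, w)\<leftarrow>ys. norm v * norm w)"
      proof (rule cINF_greatest)
        fix ys assume "ys \<in> {ys. tsum tens ys = tsum tens xs}"
        then have "f (tsum tens xs) = tsum T ys" using f[of ys] by simp
        then show "norm (f (tsum tens xs)) / norm B \<le> (\<Sum>(v, w)\<leftarrow>ys. norm v * norm w)"
          using 1[of ys] B0 by (simp add: field_simps)
      qed blast
      then show ?thesis using B0 nrm by (simp add: field_simps)
    qed
  qed
  have add: "f (x + y) = f x + f y" "x + y \<in> X" if xy: "x \<in> X" "y \<in> X" for x y
  proof -
    obtain xs ys where "x = tsum tens xs" "y = tsum tens ys" using xy unfolding X_def by blast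
    then have "x + y = tsum tens (xs @ ys)" "f x = tsum T xs" "f y = tsum T ys" by (auto simp: tsum_append f)
    then show "f (x + y) = f x + f y" "x + y \<in> X"
      using f[of "xs @ ys"] by (auto simp: tsum_append[of T] X_def)
  qed
  have scale: "f (c *\<^sub>R x) = c *\<^sub>R f x" "c *\<^sub>R x \<in> X" if x: "x \<in> X" for c x
  proof -
    obtain xs where xs: "x = tsum tens xs" using x by (auto simp: X_def)
    then have *: "c *\<^sub>R x = tsum tens (map (\<lambda>(v, w). (c *\<^sub>R v, w)) xs)" by (simp only: tsum_scale[OF bb])
    show "c *\<^sub>R x \<in> X" unfolding * X_def by blast
    show "f (c *\<^sub>R x) = c *\<^sub>R f x"
      using f[of "map (\<lambda>(v, w). (c *\<^sub>R v, w)) xs"] by (simp only: * tsum_scale[OF T]) (simp only: xs f)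
  qed
  have f_X: "norm (f x) \<le> norm B * norm x" if "x \<in> X" for x using that f_le by (auto simp: X_def)
  have f_lip: "norm (f x - f y) \<le> norm B * norm (x - y)" if "x \<in> X" "y \<in> X" for x y
  proof -
    have "f (x + (-1) *\<^sub>R y) = f x - f y" "x + (-1) *\<^sub>R y \<in> X"
      using add[OF that(1) scale(2)[OF that(2), of "-1"]] scale(1)[OF that(2), of "-1"] by auto
    then show ?thesis using f_X[of "x + (-1) *\<^sub>R y"] by simp
  qed
  have "uniformly_continuous_on X f"
    unfolding uniformly_continuous_on_def
  proof (intro allI impI)
    fix e :: real assume e: "0 < e"
    have B1: "0 < norm B + 1" by (simp add: add_nonneg_pos)
    show "\<exists>d>0. \<forall>x\<in>X. \<forall>x'\<in>X. dist x' x < d \<longrightarrow> dist (f x') (f x) < e"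
    proof (intro exI[of _ "e / (norm B + 1)"] conjI ballI impI)
      fix x x' assume x: "x \<in> X" "x' \<in> X" "dist x' x < e / (norm B + 1)"
      have "norm (f x' - f x) \<le> norm B * norm (x' - x)" by (rule f_lip[OF x(2,1)])
      also have "\<dots> \<le> (norm B + 1) * norm (x' - x)" by (intro mult_right_mono) auto
      also have "\<dots> < e" using x(3) B1 by (simp add: dist_norm field_simps)
      finally show "dist (f x') (f x) < e" by (simp add: dist_norm)
    qed (use e B1 in auto)
  qed
  then obtain g where g: "uniformly_continuous_on (closure X) g" "\<And>x. x \<in> X \<Longrightarrow> f x = g x"
    using uniformly_continuous_on_extension_on_closure by metis
  have cl: "closure X = UNIV" using tens by (simp add: projective_tensor_def X_def)
  have cont: "isCont g x" for x
    using uniformly_continuous_imp_continuous[OF g(1)] cl by (simp add: continuous_on_eq_continuous_at)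
  have seq: "\<exists>s. (\<forall>n. s n \<in> X) \<and> s \<longlonglongrightarrow> x" for x
    using cl closure_sequential[of x X] by auto
  have g_add: "g (x + y) = g x + g y" for x y
  proof -
    obtain s t where s: "\<And>n. s n \<in> X" "s \<longlonglongrightarrow> x" and t: "\<And>n. t n \<in> X" "t \<longlonglongrightarrow> y" using seq by metis
    have "(\<lambda>n. g (s n + t n)) \<longlonglongrightarrow> g (x + y)" by (intro isCont_tendsto_compose[OF cont] tendsto_add s t)
    moreover have "g (s n + t n) = g (s n) + g (t n)" for n
      using add[OF s(1) t(1), of n n] g(2) s(1) t(1) by metis
    moreover have "(\<lambda>n. g (s n) + g (t n)) \<longlonglongrightarrow> g x + g y"
      by (intro tendsto_add isCont_tendsto_compose[OF cont] s t)
    ultimately show ?thesis by (simp add: LIMSEQ_unique)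
  qed
  have g_scale: "g (c *\<^sub>R x) = c *\<^sub>R g x" for c x
  proof -
    obtain s where s: "\<And>n. s n \<in> X" "s \<longlonglongrightarrow> x" using seq by metis
    have "(\<lambda>n. g (c *\<^sub>R s n)) \<longlonglongrightarrow> g (c *\<^sub>R x)" by (intro isCont_tendsto_compose[OF cont] tendsto_scaleR tendsto_const s)
    moreover have "g (c *\<^sub>R s n) = c *\<^sub>R g (s n)" for n
      using scale[OF s(1), of c n] g(2) s(1) by metis
    moreover have "(\<lambda>n. c *\<^sub>R g (s n)) \<longlonglongrightarrow> c *\<^sub>R g x"
      by (intro tendsto_scaleR tendsto_const isCont_tendsto_compose[OF cont] s)
    ultimately show ?thesis by (simp add: LIMSEQ_unique)
  qed
  have g_le: "norm (g x) \<le> norm B * norm x" for x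
  proof -
    obtain s where s: "\<And>n. s n \<in> X" "s \<longlonglongrightarrow> x" using seq by metis
    show ?thesis
    proof (rule LIMSEQ_le)
      show "(\<lambda>n. norm (g (s n))) \<longlonglongrightarrow> norm (g x)" by (intro tendsto_norm isCont_tendsto_compose[OF cont] s)
      show "(\<lambda>n. norm B * norm (s n)) \<longlonglongrightarrow> norm B * norm x" by (intro tendsto_intros s)
      show "\<exists>N. \<forall>n\<ge>N. norm (g (s n)) \<le> norm B * norm (s n)" using f_X g(2) s(1) by metis
    qed
  qed
  have bl: "bounded_linear g"
    by (rule bounded_linear_intro[of _ "norm B"]) (auto simp: g_add g_scale mult.commute intro: order_trans[OF g_le])
  have "g (tens v w) = B v w" for v w
  proof -
    have tv: "tens v w = tsum tens [(v, w)]" by (simp add: tsum_def)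
    have "tens v w \<in> X" unfolding X_def tv by blast
    moreover have "f (tens v w) = B v w" using f[of "[(v, w)]"] by (simp add: tsum_def T_def)
    ultimately show ?thesis using g(2)[of "tens v w"] by simp
  qed
  then show ?thesis
    using g_le by (intro exI[of _ "Blinfun g"]) (simp add: bounded_linear_Blinfun_apply[OF bl])
qed

lemma tensor_lift_unique:
  assumes tens: "projective_tensor tens"
    and "\<And>v w. blinfun_apply L (tens v w) = blinfun_apply L' (tens v w)"
  shows "L = L'"
proof (rule blinfun_eqI)
  fix x
  have sums: "L (tsum tens xs) = L' (tsum tens xs)" for xs
    by (induction xs) (auto simp: tsum_def blinfun.add_right assms(2))
  have "x \<in> closure (range (tsum tens))" using tens by (simp add: projective_tensor_def)
  moreover have "closed {x. L x = L' x}"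
    by (intro closed_Collect_eq continuous_intros)
  then have "closure (range (tsum tens)) \<subseteq> {x. L x = L' x}"
    by (intro closure_minimal) (auto simp: sums)
  ultimately show "L x = L' x" by blast
qed

lemma tensor_lift_apply:
  assumes tens: "projective_tensor tens"
  shows "tensor_lift tens B (tens v w) = B v w" and "norm (tensor_lift tens B x) \<le> norm B * norm x"
proof -
  obtain L where L: "\<And>v w. blinfun_apply L (tens v w) = B v w" "\<And>x. norm (L x) \<le> norm B * norm x"
    using tensor_lift_exists[OF tens] by blast
  have "tensor_lift tens B = L"
    unfolding tensor_lift_def
  proof (rule the_equality)
    fix L' assume "\<forall>v w. blinfun_apply L' (tens v w) = B v w"
    then show "L' = L" by (intro tensor_lift_unique[OF tens]) (simp add: L)
  qed (use L in auto)
  then show "tensor_lift tens B (tens v w) = B v w" "norm (tensor_lift tens B x) \<le> norm B * norm x"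
    using L by auto
qed

lemma tensor_lift_diff:
  assumes tens: "projective_tensor tens"
  shows "tensor_lift tens (B - B') = tensor_lift tens B - tensor_lift tens B'"
  by (rule tensor_lift_unique[OF tens]) (simp add: tensor_lift_apply[OF tens] blinfun.diff_left)

section \<open>Second-order increments of smooth maps\<close>

lemma bounded_derivative_lipschitz:
  fixes F :: "'a::real_normed_vector \<Rightarrow> 'b::real_normed_vector"
  assumes "\<And>x. (F has_derivative blinfun_apply (D x)) (at x)" "\<And>x. norm (D x) \<le> L"
  shows "norm (F x - F y) \<le> L * norm (x - y)"
  using assms by (intro differentiable_bound[of UNIV F "\<lambda>x. blinfun_apply (D x)"])
    (auto simp: norm_blinfun.rep_eq[symmetric])

text \<open>First the same increment \<open>p\<close> is compared at \<open>a\<close> and at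
  \<open>b\<close>, by the mean value inequality for \<open>x \<mapsto> F (x + p) - F x\<close>,
  whose derivative has norm at most \<open>L * norm p\<close>; then \<open>p\<close> is replaced by
  \<open>q\<close>.\<close>

lemma second_increment:
  fixes F :: "'a::real_normed_vector \<Rightarrow> 'b::real_normed_vector"
  assumes D: "\<And>x. (F has_derivative blinfun_apply (D x)) (at x)" and L: "\<And>x. norm (D x) \<le> L"
    and L': "\<And>x y. norm (D x - D y) \<le> L * norm (x - y)"
  shows "norm (F (a + p) - F a - (F (b + q) - F b)) \<le> L * (norm (p - q) + norm p * norm (a - b))"
proof -
  have "norm ((F (a + p) - F a) - (F (b + p) - F b)) \<le> (L * norm p) * norm (a - b)"
  proof (rule bounded_derivative_lipschitz[of "\<lambda>x. F (x + p) - F x" "\<lambda>x. D (x + p) - D x"])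
    fix x
    have "((\<lambda>x. x + p) has_derivative (\<lambda>h. h)) (at x)"
      by (auto intro!: derivative_eq_intros)
    from has_derivative_compose[OF this D]
    have "((\<lambda>x. F (x + p)) has_derivative blinfun_apply (D (x + p))) (at x)" .
    then show "((\<lambda>x. F (x + p) - F x) has_derivative blinfun_apply (D (x + p) - D x)) (at x)"
      using has_derivative_diff[OF _ D[of x]] by (simp add: blinfun.diff_left[abs_def])
    show "norm (D (x + p) - D x) \<le> L * norm p" using L'[of "x + p" x] by simp
  qed
  moreover have "norm (F (b + p) - F (b + q)) \<le> L * norm (p - q)"
    using bounded_derivative_lipschitz[OF D L, of "b + p" "b + q"] by simp
  ultimately have "norm (((F (a + p) - F a) - (F (b + p) - F b)) + (F (b + p) - F (b + q)))
      \<le> (L * norm p) * norm (a - b) + L * norm (p - q)"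
    by (rule norm_triangle_mono)
  moreover have "((F (a + p) - F a) - (F (b + p) - F b)) + (F (b + p) - F (b + q)) =
      F (a + p) - F a - (F (b + q) - F b)" by simp
  ultimately have "norm (F (a + p) - F a - (F (b + q) - F b)) \<le> (L * norm p) * norm (a - b) + L * norm (p - q)"
    by (simp only:)
  then show ?thesis by (simp add: algebra_simps)
qed

text \<open>Besides Lipschitz bounds, uniqueness requires differences of increments and of Taylor
  remainders. The third derivative enters as the Lipschitz constant of \<open>D2\<close> in the
  second increment of \<open>D1\<close>.\<close>

lemma C3_estimates:
  fixes G :: "'a::real_normed_vector \<Rightarrow> 'b::real_normed_vector"
  assumes "C3_bounded_derivs G"
  shows "\<exists>L\<ge>0. (\<forall>x y. norm (G x - G y) \<le> L * norm (x - y)) \<and> (\<forall>x. norm (Dop G x) \<le> L) \<and>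
    (\<forall>x y. norm (Dop G x - Dop G y) \<le> L * norm (x - y)) \<and>
    (\<forall>a p b q. norm (G (a + p) - G a - (G (b + q) - G b)) \<le> L * (norm (p - q) + norm p * norm (a - b))) \<and>
    (\<forall>a p b q. norm (Dop G (a + p) - Dop G a - (Dop G (b + q) - Dop G b)) \<le> L * (norm (p - q) + norm p * norm (a - b))) \<and>
    (\<forall>a p b q. norm ((G (a + p) - G a - Dop G a p) - (G (b + q) - G b - Dop G b q))
        \<le> L * (norm (p - q) * (norm p + norm q) + norm (a - b) * (norm p)\<^sup>2))"
proof -
  obtain D1 D2 D3 where D1: "\<And>x. (G has_derivative blinfun_apply (D1 x)) (at x)"
    and D2: "\<And>x. (D1 has_derivative blinfun_apply (D2 x)) (at x)"
    and D3: "\<And>x. (D2 has_derivative blinfun_apply (D3 x)) (at x)"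
    and bdd: "bounded (range D1)" "bounded (range D2)" "bounded (range D3)"
    using assms unfolding C3_bounded_derivs_def by blast
  obtain L1 L2 L3 where L123: "\<And>x. norm (D1 x) \<le> L1" "\<And>x. norm (D2 x) \<le> L2" "\<And>x. norm (D3 x) \<le> L3"
    using bdd unfolding bounded_iff by (metis rangeI)
  define L where "L = max L1 (max L2 L3)"
  have L: "norm (D1 x) \<le> L" "norm (D2 x) \<le> L" "norm (D3 x) \<le> L" for x
    using L123[of x] by (auto simp: L_def le_max_iff_disj)
  have L0: "0 \<le> L" using order_trans[OF norm_ge_zero L(1)] .
  have Dop: "Dop G x = D1 x" for x
  proof -
    have "frechet_derivative G (at x) = blinfun_apply (D1 x)"
      using frechet_derivative_at[OF D1] by simp
    then show ?thesis by (simp add: Dop_def blinfun_apply_inverse)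
  qed
  have lip1: "norm (D1 x - D1 y) \<le> L * norm (x - y)" for x y by (rule bounded_derivative_lipschitz[OF D2 L(2)])
  have lip2: "norm (D2 x - D2 y) \<le> L * norm (x - y)" for x y by (rule bounded_derivative_lipschitz[OF D3 L(3)])
  note inc2 = second_increment[OF D2 L(2) lip2]
  have rem: "norm ((G (a + p) - G a - D1 a p) - (G (b + q) - G b - D1 b q))
        \<le> L * (norm (p - q) * (norm p + norm q) + norm (a - b) * (norm p)\<^sup>2)" for a p b q
  proof -
    \<comment> \<open>The difference of the two Taylor remainders along the segments. Its derivative
      contains a second increment of \<open>D1\<close> applied to \<open>p\<close> and an increment
      of \<open>D1\<close> applied to \<open>p - q\<close>.\<close>
    define \<phi> where "\<phi> t = (G (a + t *\<^sub>R p) - G a - t *\<^sub>R D1 a p) - (G (b + t *\<^sub>R q) - G b - t *\<^sub>R D1 b q)" for t :: real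
    define \<phi>' where "\<phi>' t = (D1 (a + t *\<^sub>R p) p - D1 a p) - (D1 (b + t *\<^sub>R q) q - D1 b q)" for t :: real
    define K where "K = L * (norm (p - q) * (norm p + norm q) + norm (a - b) * (norm p)\<^sup>2)"
    have line: "((\<lambda>t. G (c + t *\<^sub>R r)) has_derivative (\<lambda>h. h *\<^sub>R D1 (c + t *\<^sub>R r) r)) (at t within {0..1})" for c r and t :: real
    proof -
      have "((\<lambda>t. c + t *\<^sub>R r) has_derivative (\<lambda>h. h *\<^sub>R r)) (at t within {0..1})"
        by (auto intro!: derivative_eq_intros)
      then have "((\<lambda>t. G (c + t *\<^sub>R r)) has_derivative (\<lambda>h. D1 (c + t *\<^sub>R r) (h *\<^sub>R r))) (at t within {0..1})"
        by (rule has_derivative_compose[OF _ D1])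
      then show ?thesis by (simp add: blinfun.scaleR_right)
    qed
    have "norm (\<phi> 1 - \<phi> 0) \<le> K * norm (1 - 0 :: real)"
    proof (rule differentiable_bound[of "{0..1}" \<phi> "\<lambda>t h. h *\<^sub>R \<phi>' t"])
      fix t :: real assume t: "t \<in> {0..1}"
      show "(\<phi> has_derivative (\<lambda>h. h *\<^sub>R \<phi>' t)) (at t within {0..1})"
        unfolding \<phi>_def[abs_def] \<phi>'_def
        by (auto intro!: derivative_eq_intros line simp: scaleR_diff_right)
      have "\<phi>' t = ((D1 (a + t *\<^sub>R p) - D1 a) - (D1 (b + t *\<^sub>R q) - D1 b)) p + (D1 (b + t *\<^sub>R q) - D1 b) (p - q)"
        by (simp add: \<phi>'_def blinfun.diff_left blinfun.diff_right)
      then have "norm (\<phi>' t) \<le> norm ((D1 (a + t *\<^sub>R p) - D1 a) - (D1 (b + t *\<^sub>R q) - D1 b)) * norm p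
          + norm (D1 (b + t *\<^sub>R q) - D1 b) * norm (p - q)"
        by (simp add: norm_triangle_le add_mono norm_blinfun)
      also have "\<dots> \<le> (L * (norm (p - q) + norm p * norm (a - b))) * norm p + (L * norm q) * norm (p - q)"
      proof (intro add_mono mult_right_mono)
        have "norm ((D1 (a + t *\<^sub>R p) - D1 a) - (D1 (b + t *\<^sub>R q) - D1 b)) \<le>
            L * (norm (t *\<^sub>R p - t *\<^sub>R q) + norm (t *\<^sub>R p) * norm (a - b))" by (rule inc2)
        also have "\<dots> \<le> L * (norm (p - q) + norm p * norm (a - b))"
        proof (intro mult_left_mono add_mono mult_right_mono)
          show "norm (t *\<^sub>R p - t *\<^sub>R q) \<le> norm (p - q)"
            using t mult_right_mono[of t 1 "norm (p - q)"] by (simp add: scaleR_diff_right[symmetric])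
          show "norm (t *\<^sub>R p) \<le> norm p" using t mult_right_mono[of t 1 "norm p"] by simp
        qed (use L0 in auto)
        finally show "norm ((D1 (a + t *\<^sub>R p) - D1 a) - (D1 (b + t *\<^sub>R q) - D1 b)) \<le> L * (norm (p - q) + norm p * norm (a - b))" .
        have "norm (D1 (b + t *\<^sub>R q) - D1 b) \<le> L * norm (t *\<^sub>R q)" using lip1[of "b + t *\<^sub>R q" b] by simp
        also have "\<dots> \<le> L * norm q" using t L0 mult_right_mono[of t 1 "norm q"] by (intro mult_left_mono) auto
        finally show "norm (D1 (b + t *\<^sub>R q) - D1 b) \<le> L * norm q" .
      qed auto
      also have "\<dots> = K" by (simp add: K_def algebra_simps power2_eq_square)
      finally show "onorm (\<lambda>h. h *\<^sub>R \<phi>' t) \<le> K"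
        using mult_left_mono by (intro onorm_le) (fastforce simp: mult.commute[of K])
    qed auto
    then show ?thesis by (simp add: \<phi>_def K_def)
  qed
  show ?thesis
    unfolding Dop
    using L0 L(1) lip1 bounded_derivative_lipschitz[OF D1 L(1)] second_increment[OF D1 L(1) lip1] inc2 rem
    by blast
qed

section \<open>Rough convolutions\<close>

lemma holder_continuous_on:
  fixes f :: "real \<Rightarrow> 'b::real_normed_vector"
  assumes "\<And>s t. s \<in> I \<Longrightarrow> t \<in> I \<Longrightarrow> s < t \<Longrightarrow> norm (f t - f s) \<le> C * (t - s) powr a" "0 < a"
  shows "continuous_on I f"
  unfolding continuous_on_iff
proof (intro ballI allI impI)
  fix s e :: real assume s: "s \<in> I" and e: "0 < e"
  define d where "d = (e / (\<bar>C\<bar> + 1)) powr (1 / a)"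
  have d: "0 < d" using e by (simp add: d_def add_nonneg_pos)
  have "dist (f t) (f s) < e" if t: "t \<in> I" "dist t s < d" for t
  proof (cases "t = s")
    case False
    have "norm (f t - f s) \<le> C * \<bar>t - s\<bar> powr a"
      using assms(1)[of s t] assms(1)[of t s] s t False
      by (cases "s < t") (auto simp: norm_minus_commute)
    also have "\<dots> \<le> (\<bar>C\<bar> + 1) * \<bar>t - s\<bar> powr a" by (intro mult_right_mono) auto
    also have "\<dots> < (\<bar>C\<bar> + 1) * d powr a"
      using t assms(2) by (intro mult_strict_left_mono powr_less_mono2) (auto simp: dist_real_def)
    also have "d powr a = e / (\<bar>C\<bar> + 1)" using assms(2) e by (simp add: d_def powr_powr)
    also have "(\<bar>C\<bar> + 1) * (e / (\<bar>C\<bar> + 1)) = e" by (simp add: add_nonneg_pos less_imp_neq[symmetric])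
    finally show ?thesis by (simp add: dist_norm)
  qed (use e in simp)
  then show "\<exists>d>0. \<forall>t\<in>I. dist t s < d \<longrightarrow> dist (f t) (f s) < e" using d by blast
qed

lemma integral_powr_right_bound:
  fixes f :: "real \<Rightarrow> 'b::{banach, second_countable_topology}"
  assumes "continuous_on {s<..<t} f" "0 < a" "s \<le> t"
    and le: "\<And>r. s < r \<Longrightarrow> r < t \<Longrightarrow> norm (f r) \<le> B * (t - r) powr (a - 1)"
  shows "set_integrable lborel {s<..<t} f" "norm (LINT r:{s<..<t}|lborel. f r) \<le> B * ((t - s) powr a / a)"
proof -
  have i: "set_integrable lborel {s<..<t} (\<lambda>r. B * (t - r) powr (a - 1))"
    by (intro set_integrable_mult_right powr_integral_right(1) assms)
  show f: "set_integrable lborel {s<..<t} f"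
    by (rule set_integrable_continuous_bound[OF assms(1) _ i]) (use le in auto)
  have "norm (LINT r:{s<..<t}|lborel. f r) \<le> (LINT r:{s<..<t}|lborel. B * (t - r) powr (a - 1))"
    by (rule set_integral_norm_le[OF f i]) (use le in auto)
  then show "norm (LINT r:{s<..<t}|lborel. f r) \<le> B * ((t - s) powr a / a)"
    using powr_integral_right(2)[OF assms(2,3)] by simp
qed

lemma integral_powr_left_bound:
  fixes f :: "real \<Rightarrow> 'b::{banach, second_countable_topology}"
  assumes "continuous_on {s<..<t} f" "0 < a" "s \<le> t"
    and le: "\<And>r. s < r \<Longrightarrow> r < t \<Longrightarrow> norm (f r) \<le> B * (r - s) powr (a - 1)"
  shows "set_integrable lborel {s<..<t} f" "norm (LINT r:{s<..<t}|lborel. f r) \<le> B * ((t - s) powr a / a)"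
proof -
  have i: "set_integrable lborel {s<..<t} (\<lambda>r. B * (r - s) powr (a - 1))"
    by (intro set_integrable_mult_right powr_integral_left(1) assms)
  show f: "set_integrable lborel {s<..<t} f"
    by (rule set_integrable_continuous_bound[OF assms(1) _ i]) (use le in auto)
  have "norm (LINT r:{s<..<t}|lborel. f r) \<le> (LINT r:{s<..<t}|lborel. B * (r - s) powr (a - 1))"
    by (rule set_integral_norm_le[OF f i]) (use le in auto)
  then show "norm (LINT r:{s<..<t}|lborel. f r) \<le> B * ((t - s) powr a / a)"
    using powr_integral_left(2)[OF assms(2,3)] by simp
qed

lemma norm_blinfun_le: "norm x \<le> B \<Longrightarrow> norm (blinfun_apply f x) \<le> norm f * B"
  by (rule order_trans[OF norm_blinfun]) (simp add: mult_left_mono)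

lemma norm_diff_le: "norm x \<le> a \<Longrightarrow> norm y \<le> b \<Longrightarrow> norm (x - y) \<le> a + b"
  for x :: "'a::real_normed_vector"
  by (rule order_trans[OF norm_triangle_ineq4 add_mono])

lemma sew_sum_diff_fun:
  "sew_sum S (\<lambda>v u. \<Xi> v u - \<Psi> v u) t = (\<lambda>p. sew_sum S \<Xi> t p - sew_sum S \<Psi> t p)"
  by (rule ext) (rule sew_sum_diff)

lemma sew_sum_add_fun:
  "sew_sum S (\<lambda>v u. \<Xi> v u + \<Psi> v u) t = (\<lambda>p. sew_sum S \<Xi> t p + sew_sum S \<Psi> t p)"
  by (rule ext) (rule sew_sum_add)

locale rough_setup = analytic_semigroup S M AS
  for S :: "real \<Rightarrow> 'w::{banach,second_countable_topology} \<Rightarrow>\<^sub>L 'w" and M AS +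
  fixes tens :: "'v::real_normed_vector \<Rightarrow> 'v \<Rightarrow> 't::banach"
    and \<omega> :: "real \<Rightarrow> 'v" and \<omega>2 :: "real \<Rightarrow> real \<Rightarrow> 't" and \<alpha> \<beta> T H :: real
  assumes tens: "projective_tensor tens"
    and expo: "1 / 3 < \<beta>" "\<beta> < \<alpha>" "\<alpha> \<le> 1 / 2" "\<alpha> + 2 * \<beta> > 1" and T: "0 < T" and H: "1 \<le> H"
    and om: "\<And>s t. 0 \<le> s \<Longrightarrow> s \<le> t \<Longrightarrow> t \<le> T \<Longrightarrow> norm (\<omega> t - \<omega> s) \<le> H * (t - s) powr \<alpha>"
    and om2: "\<And>s t. 0 \<le> s \<Longrightarrow> s \<le> t \<Longrightarrow> t \<le> T \<Longrightarrow> norm (\<omega>2 t s) \<le> H * (t - s) powr (2 * \<alpha>)"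
    and chen: "\<And>s u t. 0 \<le> s \<Longrightarrow> s \<le> u \<Longrightarrow> u \<le> t \<Longrightarrow> t \<le> T \<Longrightarrow>
      \<omega>2 t s - \<omega>2 u s - \<omega>2 t u = tens (\<omega> u - \<omega> s) (\<omega> t - \<omega> u)"
    and tens_le: "\<And>v w. norm (tens v w) \<le> H * (norm v * norm w)"
begin

lemma ab0: "0 < \<alpha>" "0 < \<beta>" "\<beta> < 1" "2 * \<beta> < 1" "\<alpha> < 1"
  using expo by auto

lemma M0: "0 \<le> M" and H0: "0 \<le> H"
  using M_ge_1 H by auto

lemma continuous_om: "continuous_on {0..T} \<omega>"
  by (rule holder_continuous_on[of _ _ H \<alpha>]) (use om ab0 in auto)

section \<open>The convolution of the semigroup with the path\<close>

text \<open>This is \<open>omS\<close> with \<open>A\<close> taken under the integral, where the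
  Hoelder bound on \<omega> makes the kernel of size \<open>1 / (t - r)\<close> integrable.\<close>

definition W :: "real \<Rightarrow> real \<Rightarrow> ('v \<Rightarrow>\<^sub>L 'w) \<Rightarrow> 'w" where
  "W t s K = S (t - s) (K (\<omega> t - \<omega> s)) - (LINT r:{s<..<t}|lborel. AS (t - r) (K (\<omega> t - \<omega> r)))"

lemma W_integrand:
  fixes K :: "'v \<Rightarrow>\<^sub>L 'w"
  assumes st: "0 \<le> s" "s \<le> t" "t \<le> T"
  shows "set_integrable lborel {s<..<t} (\<lambda>r. AS (t - r) (K (\<omega> t - \<omega> r)))"
    "norm (LINT r:{s<..<t}|lborel. AS (t - r) (K (\<omega> t - \<omega> r))) \<le> M * norm K * H * ((t - s) powr \<alpha> / \<alpha>)"
proof -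
  have c: "continuous_on {s<..<t} (\<lambda>r. AS (t - r) (K (\<omega> t - \<omega> r)))"
    using st by (intro continuous_intros continuous_on_subset[OF continuous_om]) auto
  have le: "norm (AS (t - r) (K (\<omega> t - \<omega> r))) \<le> M * norm K * H * (t - r) powr (\<alpha> - 1)" if "s < r" "r < t" for r
  proof -
    have "norm (AS (t - r) (K (\<omega> t - \<omega> r))) \<le> M / (t - r) * (norm K * (H * (t - r) powr \<alpha>))"
      using that st om[of r t] M0
      by (intro order_trans[OF norm_AS] mult_left_mono order_trans[OF norm_blinfun]) auto
    also have "\<dots> = M * norm K * H * (t - r) powr (\<alpha> - 1)" using that by (simp add: powr_diff)
    finally show ?thesis .
  qed
  show "set_integrable lborel {s<..<t} (\<lambda>r. AS (t - r) (K (\<omega> t - \<omega> r)))"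
    "norm (LINT r:{s<..<t}|lborel. AS (t - r) (K (\<omega> t - \<omega> r))) \<le> M * norm K * H * ((t - s) powr \<alpha> / \<alpha>)"
    by (rule integral_powr_right_bound[OF c ab0(1) st(2) le]; assumption)+
qed

definition CW :: real where
  "CW = M * H * (1 + 1 / \<alpha>)"

lemma CW0: "0 \<le> CW"
  using M0 H0 ab0 by (simp add: CW_def)

lemma W_bound:
  assumes "0 \<le> s" "s \<le> t" "t \<le> T"
  shows "norm (W t s K) \<le> CW * norm K * (t - s) powr \<alpha>"
proof -
  have "norm (W t s K) \<le> M * (norm K * (H * (t - s) powr \<alpha>)) + M * norm K * H * ((t - s) powr \<alpha> / \<alpha>)"
    unfolding W_def using assms om[of s t]
    by (intro norm_diff_le norm_S_le W_integrand norm_blinfun_le) auto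
  then show ?thesis by (simp add: CW_def algebra_simps)
qed

lemma W_refl [simp]: "W s s K = 0"
  by (simp add: W_def set_lebesgue_integral_def)

lemma W_add: "0 \<le> s \<Longrightarrow> s \<le> t \<Longrightarrow> t \<le> T \<Longrightarrow> W t s (K + K') = W t s K + W t s K'"
  and W_scale: "W t s (c *\<^sub>R K) = c *\<^sub>R W t s K"
proof -
  show "W t s (K + K') = W t s K + W t s K'" if "0 \<le> s" "s \<le> t" "t \<le> T"
    unfolding W_def using set_integral_add(2)[OF W_integrand(1)[OF that, of K] W_integrand(1)[OF that, of K']]
    by (simp add: blinfun.add_left blinfun.add_right)
  show "W t s (c *\<^sub>R K) = c *\<^sub>R W t s K"
    by (simp add: W_def blinfun.scaleR_left blinfun.scaleR_right scaleR_diff_right)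
qed

lemma W_diff: "0 \<le> s \<Longrightarrow> s \<le> t \<Longrightarrow> t \<le> T \<Longrightarrow> W t s (K - K') = W t s K - W t s K'"
  using W_add[of s t K "(-1) *\<^sub>R K'"] W_scale[of t s "-1" K'] by simp

text \<open>\<open>W\<close> as an element of the operator space, so that continuity in the time
  variable can be stated in norm and used inside integrands.\<close>

definition Wb :: "real \<Rightarrow> real \<Rightarrow> ('v \<Rightarrow>\<^sub>L 'w) \<Rightarrow>\<^sub>L 'w" where
  "Wb t s = Blinfun (W t s)"

lemma Wb_apply: "0 \<le> s \<Longrightarrow> s \<le> t \<Longrightarrow> t \<le> T \<Longrightarrow> blinfun_apply (Wb t s) K = W t s K"
proof -
  assume *: "0 \<le> s" "s \<le> t" "t \<le> T"
  have "bounded_linear (W t s)"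
    using W_bound[OF *] by (intro bounded_linear_intro[of _ "CW * (t - s) powr \<alpha>"])
      (auto simp: W_add[OF *] W_scale mult_ac)
  then show ?thesis by (simp add: Wb_def bounded_linear_Blinfun_apply)
qed

lemma W_chen:
  assumes "0 \<le> s" "s \<le> u" "u \<le> t" "t \<le> T"
  shows "W t s K = W t u K + S (t - u) (W u s K)"
proof (cases "u = t")
  case False
  then have ut: "u < t" using assms by simp
  have st: "s \<le> t" "u \<le> T" using assms by auto
  note i1 = W_integrand(1)[OF assms(1) st(1) assms(4), of K]
  note i2 = W_integrand(1)[OF assms(1,2) st(2), of K]
  note i3 = integral_AS_backward[OF assms(2) ut, of "K (\<omega> t - \<omega> u)"]
  have i4: "set_integrable lborel {s<..<u} (\<lambda>r. S (t - u) (AS (u - r) (K (\<omega> u - \<omega> r))))"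
    by (rule set_integral_blinfun(2)[OF i2])
  \<comment> \<open>Before \<open>u\<close> the increment of \<omega> up to \<open>t\<close> is the
    one up to \<open>u\<close> plus a part independent of \<open>r\<close>, whose integral is
    computed in closed form.\<close>
  have split: "(LINT r:{s<..<u}|lborel. AS (t - r) (K (\<omega> t - \<omega> r))) =
      S (t - u) (LINT r:{s<..<u}|lborel. AS (u - r) (K (\<omega> u - \<omega> r))) +
      (S (t - s) (K (\<omega> t - \<omega> u)) - S (t - u) (K (\<omega> t - \<omega> u)))"
  proof -
    have "(LINT r:{s<..<u}|lborel. AS (t - r) (K (\<omega> t - \<omega> r))) =
        (LINT r:{s<..<u}|lborel. S (t - u) (AS (u - r) (K (\<omega> u - \<omega> r))) + AS (t - r) (K (\<omega> t - \<omega> u)))"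
    proof (rule set_lebesgue_integral_cong)
      show "\<forall>r. r \<in> {s<..<u} \<longrightarrow> AS (t - r) (K (\<omega> t - \<omega> r)) =
          S (t - u) (AS (u - r) (K (\<omega> u - \<omega> r))) + AS (t - r) (K (\<omega> t - \<omega> u))"
        using ut by (auto simp: S_AS blinfun.diff_right)
    qed simp
    also have "\<dots> = (LINT r:{s<..<u}|lborel. S (t - u) (AS (u - r) (K (\<omega> u - \<omega> r)))) +
        (LINT r:{s<..<u}|lborel. AS (t - r) (K (\<omega> t - \<omega> u)))"
      by (rule set_integral_add(2)[OF i4 i3(1)])
    finally show ?thesis by (simp only: set_integral_blinfun(1)[OF i2] i3(2))
  qed
  have "S (t - u) (S (u - s) (K (\<omega> u - \<omega> s))) = S (t - s) (K (\<omega> u - \<omega> s))"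
    using assms by (simp add: S_comp)
  moreover have "K (\<omega> t - \<omega> s) = K (\<omega> t - \<omega> u) + K (\<omega> u - \<omega> s)"
    by (simp add: blinfun.diff_right)
  ultimately show ?thesis
    unfolding W_def set_integral_Ioo_split[OF i1 assms(2,3)] split
    by (simp add: blinfun.diff_right blinfun.add_right)
qed simp

lemma W_comm:
  assumes "0 \<le> s" "s \<le> t" "t \<le> T" "0 \<le> h"
  shows "S h (W t s K) = W t s (S h o\<^sub>L K)"
proof -
  have "S h (LINT r:{s<..<t}|lborel. AS (t - r) (K (\<omega> t - \<omega> r))) =
      (LINT r:{s<..<t}|lborel. AS (t - r) (S h (K (\<omega> t - \<omega> r))))"
    unfolding set_integral_blinfun(1)[OF W_integrand(1)[OF assms(1-3)], symmetric]
    by (rule set_lebesgue_integral_cong) (use assms in \<open>auto simp: S_AS AS_S add.commute\<close>)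
  then show ?thesis using assms by (simp add: W_def blinfun.diff_right S_comp add.commute)
qed

text \<open>\<open>K\<close> maps boundedly into the Favard space of order \<beta>; this replaces
  bounded operators into the domain of the fractional power.\<close>

definition fav :: "('v \<Rightarrow>\<^sub>L 'w) \<Rightarrow> real \<Rightarrow> bool" where
  "fav K N \<longleftrightarrow> 0 \<le> N \<and> (\<forall>v. favard \<beta> (K v) (N * norm v))"

lemma fav_diff: "fav K N \<Longrightarrow> fav K' N' \<Longrightarrow> fav (K - K') (N + N')"
  unfolding fav_def using favard_diff by (fastforce simp: blinfun.diff_left distrib_right)

lemma fav_const0: "0 \<le> fav_const \<beta>"
  using fav_const_ge[of \<beta>] ab0 M0 by simp

definition C1 :: real where
  "C1 = H + fav_const \<beta> * H / (\<alpha> + \<beta>)"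

lemma C1_nonneg: "0 \<le> C1"
  using H0 fav_const0 ab0 by (simp add: C1_def)

text \<open>Both \<open>S (t - s) - Id\<close> and the kernel \<open>AS (t - r)\<close> gain the
  factor of order \<beta> from the Favard regularity of the range of \<open>K\<close>.\<close>

lemma W_first_order:
  assumes K: "fav K N" and st: "0 \<le> s" "s \<le> t" "t \<le> T"
  shows "norm (W t s K - K (\<omega> t - \<omega> s)) \<le> C1 * N * (t - s) powr (\<alpha> + \<beta>)"
proof -
  have N: "0 \<le> N" "\<And>v. favard \<beta> (K v) (N * norm v)" using K by (auto simp: fav_def)
  have c: "continuous_on {s<..<t} (\<lambda>r. AS (t - r) (K (\<omega> t - \<omega> r)))"
    using st by (intro continuous_intros continuous_on_subset[OF continuous_om]) auto
  have le: "norm (AS (t - r) (K (\<omega> t - \<omega> r))) \<le> fav_const \<beta> * N * H * (t - r) powr (\<alpha> + \<beta> - 1)"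
    if "s < r" "r < t" for r
  proof -
    have "norm (AS (t - r) (K (\<omega> t - \<omega> r))) \<le> fav_const \<beta> * (N * norm (\<omega> t - \<omega> r)) * (t - r) powr (\<beta> - 1)"
      using that N ab0 by (intro favard_AS) auto
    also have "\<dots> \<le> fav_const \<beta> * (N * (H * (t - r) powr \<alpha>)) * (t - r) powr (\<beta> - 1)"
      using om[of r t] st that N fav_const0 by (intro mult_right_mono mult_left_mono) auto
    also have "\<dots> = fav_const \<beta> * N * H * ((t - r) powr \<alpha> * (t - r) powr (\<beta> - 1))" by simp
    also have "(t - r) powr \<alpha> * (t - r) powr (\<beta> - 1) = (t - r) powr (\<alpha> + \<beta> - 1)"
      by (simp add: powr_add[symmetric] algebra_simps)
    finally show ?thesis .
  qed
  have I: "norm (LINT r:{s<..<t}|lborel. AS (t - r) (K (\<omega> t - \<omega> r))) \<le>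
      fav_const \<beta> * N * H * ((t - s) powr (\<alpha> + \<beta>) / (\<alpha> + \<beta>))"
    by (rule integral_powr_right_bound(2)[OF c _ st(2) le]) (use ab0 in auto)
  have "norm (S (t - s) (K (\<omega> t - \<omega> s)) - K (\<omega> t - \<omega> s)) \<le> (N * norm (\<omega> t - \<omega> s)) * (t - s) powr \<beta>"
    using st by (intro favardD[OF N(2)]) auto
  also have "\<dots> \<le> (N * (H * (t - s) powr \<alpha>)) * (t - s) powr \<beta>"
    using om[OF st] N by (intro mult_right_mono mult_left_mono) auto
  also have "\<dots> = N * H * (t - s) powr (\<alpha> + \<beta>)" by (simp add: powr_add)
  finally have II: "norm (S (t - s) (K (\<omega> t - \<omega> s)) - K (\<omega> t - \<omega> s)) \<le> N * H * (t - s) powr (\<alpha> + \<beta>)" .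
  have "W t s K - K (\<omega> t - \<omega> s) = (S (t - s) (K (\<omega> t - \<omega> s)) - K (\<omega> t - \<omega> s)) -
      (LINT r:{s<..<t}|lborel. AS (t - r) (K (\<omega> t - \<omega> r)))" by (simp add: W_def)
  then have "norm (W t s K - K (\<omega> t - \<omega> s)) \<le> N * H * (t - s) powr (\<alpha> + \<beta>) +
      fav_const \<beta> * N * H * ((t - s) powr (\<alpha> + \<beta>) / (\<alpha> + \<beta>))"
    using norm_diff_le[OF II I] by (simp only:)
  then show ?thesis by (simp add: C1_def algebra_simps)
qed

definition C2 :: real where
  "C2 = dyadic_const (\<alpha> - \<beta>) * (2 * M * CW)"

definition C3 :: real where
  "C3 = dyadic_const (\<alpha> - \<beta>) * (CW * fav_const \<beta>)"

lemma C2_nonneg: "0 \<le> C2" and C3_nonneg: "0 \<le> C3"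
  using dyadic_const_nonneg[of "\<alpha> - \<beta>"] expo M0 CW0 fav_const0 by (auto simp: C2_def C3_def)

text \<open>Smoothing an increment of size \<open>\<rho> powr \<alpha>\<close> over time \<rho>
  yields \<open>h powr \<beta>\<close> at the cost of \<open>\<rho> powr (- \<beta>)\<close>. Since
  \<alpha> > \<beta>, the dyadic sum converges.\<close>

lemma path_regularity:
  assumes su: "s < u" and x0: "x s = 0" and h: "0 \<le> h" and N: "0 \<le> N"
    and incr: "\<And>m v. s \<le> m \<Longrightarrow> m < v \<Longrightarrow> v \<le> u \<Longrightarrow> norm (x v - S (v - m) (x m)) \<le> N * (v - m) powr \<alpha>"
  shows "norm (S h (x u) - x u) \<le> dyadic_const (\<alpha> - \<beta>) * (2 * M * N * h powr \<beta>) * (u - s) powr (\<alpha> - \<beta>)"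
proof (rule dyadic_regularity[where x = x, OF su x0 _ h ab0(1)])
  show "norm (x u - S (u - m) (x m)) \<le> N * (u - m) powr \<alpha>" if "s \<le> m" "m < u" for m
    using incr that by simp
  fix m \<rho> assume m: "s \<le> m" "0 < \<rho>" "m + 2 * \<rho> = u"
  let ?y = "x (m + \<rho>) - S \<rho> (x m)"
  have "norm (S h (S \<rho> ?y) - S \<rho> ?y) \<le> 2 * M * norm ?y * (h / \<rho>) powr \<beta>"
    using h m ab0 by (intro smoothing) auto
  also have "\<dots> \<le> 2 * M * (N * \<rho> powr \<alpha>) * (h / \<rho>) powr \<beta>"
    using incr[of m "m + \<rho>"] m M0 by (intro mult_right_mono mult_left_mono) auto
  also have "\<dots> = 2 * M * N * h powr \<beta> * \<rho> powr (\<alpha> - \<beta>)"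
    using h m by (simp add: powr_divide powr_diff)
  finally show "norm (S h (S \<rho> ?y) - S \<rho> ?y) \<le> 2 * M * N * h powr \<beta> * \<rho> powr (\<alpha> - \<beta>)" .
qed (use expo M0 N in auto)

lemma W_regularity:
  assumes su: "0 \<le> s" "s \<le> u" "u \<le> T" and h: "0 \<le> h"
  shows "norm (S h (W u s K) - W u s K) \<le> C2 * norm K * h powr \<beta> * (u - s) powr (\<alpha> - \<beta>)"
proof (cases "s = u")
  case False
  then have lt: "s < u" using su by simp
  have "norm (S h (W u s K) - W u s K) \<le>
      dyadic_const (\<alpha> - \<beta>) * (2 * M * (CW * norm K) * h powr \<beta>) * (u - s) powr (\<alpha> - \<beta>)"
  proof (rule path_regularity[OF lt _ h, where x = "\<lambda>r. W r s K"])
    fix m v assume m: "s \<le> m" "m < v" "v \<le> u"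
    then have "W v s K - S (v - m) (W m s K) = W v m K" using W_chen[of s m v K] su by simp
    then show "norm (W v s K - S (v - m) (W m s K)) \<le> CW * norm K * (v - m) powr \<alpha>"
      using W_bound[of m v K] m su by simp
  qed (use CW0 in auto)
  then show ?thesis by (simp add: C2_def mult_ac)
qed simp

text \<open>\<open>S h - Id\<close> commutes past the convolution onto \<open>K\<close>, where
  \<open>favard_smoothing\<close> gives order \<open>2 * \<beta>\<close> for the same loss
  \<open>\<rho> powr (- \<beta>)\<close>. This doubled order brings the germ of \<open>b\<close> to
  order \<alpha> + 2 \<beta> > 1.\<close>

lemma W_regularity_fav:
  assumes K: "fav K N" and su: "0 \<le> s" "s \<le> u" "u \<le> T" and h: "0 \<le> h"
  shows "norm (S h (W u s K) - W u s K) \<le> C3 * N * h powr (2 * \<beta>) * (u - s) powr (\<alpha> - \<beta>)"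
proof (cases "s = u")
  case False
  then have lt: "s < u" using su by simp
  have N: "0 \<le> N" "\<And>v. favard \<beta> (K v) (N * norm v)" using K by (auto simp: fav_def)
  have hat: "W v s K - S (v - m) (W m s K) = W v m K" if "s \<le> m" "m \<le> v" "v \<le> u" for m v
    using W_chen[of s m v K] su that by simp
  have "norm (S h (W u s K) - W u s K) \<le>
      dyadic_const (\<alpha> - \<beta>) * (CW * fav_const \<beta> * N * h powr (2 * \<beta>)) * (u - s) powr (\<alpha> - \<beta>)"
  proof (rule dyadic_regularity[OF lt _ _ h ab0(1), where x = "\<lambda>r. W r s K" and N = "CW * norm K"])
    show "norm (W u s K - S (u - m) (W m s K)) \<le> CW * norm K * (u - m) powr \<alpha>" if "s \<le> m" "m < u" for m
      using hat[of m u] W_bound[of m u K] that su by simp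
    fix m \<rho> assume m: "s \<le> m" "0 < \<rho>" "m + 2 * \<rho> = u"
    have mT: "0 \<le> m" "m \<le> m + \<rho>" "m + \<rho> \<le> T" using m su by auto
    define P where "P = (S h o\<^sub>L (S \<rho> o\<^sub>L K)) - (S \<rho> o\<^sub>L K)"
    have "norm P \<le> fav_const \<beta> * N * h powr (2 * \<beta>) * \<rho> powr (- \<beta>)"
    proof (rule norm_blinfun_bound)
      fix v
      have "norm (S h (S \<rho> (K v)) - S \<rho> (K v)) \<le> fav_const \<beta> * (N * norm v) * h powr (2 * \<beta>) * \<rho> powr (- \<beta>)"
        using m h N ab0 by (intro favard_smoothing) auto
      then show "norm (P v) \<le> fav_const \<beta> * N * h powr (2 * \<beta>) * \<rho> powr (- \<beta>) * norm v"
        by (simp add: P_def blinfun.diff_left mult_ac)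
    qed (use fav_const0 N in auto)
    then have "CW * norm P * (m + \<rho> - m) powr \<alpha> \<le>
        CW * (fav_const \<beta> * N * h powr (2 * \<beta>) * \<rho> powr (- \<beta>)) * (m + \<rho> - m) powr \<alpha>"
      using CW0 by (intro mult_right_mono mult_left_mono) auto
    moreover have "S h (S \<rho> (W (m + \<rho>) m K)) - S \<rho> (W (m + \<rho>) m K) = W (m + \<rho>) m P"
      using m h by (simp add: P_def W_comm[OF mT] W_diff[OF mT])
    moreover have "\<rho> powr (- \<beta>) * \<rho> powr \<alpha> = \<rho> powr (\<alpha> - \<beta>)" by (simp add: powr_add[symmetric])
    moreover have "W (m + \<rho>) s K - S \<rho> (W m s K) = W (m + \<rho>) m K" using hat[of m "m + \<rho>"] m by simp
    ultimately show "norm (S h (S \<rho> (W (m + \<rho>) s K - S \<rho> (W m s K))) - S \<rho> (W (m + \<rho>) s K - S \<rho> (W m s K)))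
        \<le> CW * fav_const \<beta> * N * h powr (2 * \<beta>) * \<rho> powr (\<alpha> - \<beta>)"
      using W_bound[OF mT, of P] by (simp add: mult.assoc)
  qed (use CW0 fav_const0 N expo in auto)
  then show ?thesis by (simp add: C3_def mult_ac)
qed simp

lemma continuous_on_Wb:
  assumes s: "0 \<le> s"
  shows "continuous_on {s..T} (\<lambda>t. Wb t s)"
proof (rule holder_continuous_on[OF _ ab0(2)])
  fix r t assume rt: "r \<in> {s..T}" "t \<in> {s..T}" "r < t"
  have pow: "(t - r) powr \<alpha> \<le> T powr (\<alpha> - \<beta>) * (t - r) powr \<beta>" "(r - s) powr (\<alpha> - \<beta>) \<le> T powr (\<alpha> - \<beta>)"
  proof -
    have "(t - r) powr (\<alpha> - \<beta>) \<le> T powr (\<alpha> - \<beta>)" using rt s expo by (intro powr_mono2) auto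
    then have "(t - r) powr (\<alpha> - \<beta>) * (t - r) powr \<beta> \<le> T powr (\<alpha> - \<beta>) * (t - r) powr \<beta>" by (rule mult_right_mono) simp
    then show "(t - r) powr \<alpha> \<le> T powr (\<alpha> - \<beta>) * (t - r) powr \<beta>" by (simp add: powr_add[symmetric])
    show "(r - s) powr (\<alpha> - \<beta>) \<le> T powr (\<alpha> - \<beta>)" using rt s expo by (intro powr_mono2) auto
  qed
  show "norm (Wb t s - Wb r s) \<le> (CW * T powr (\<alpha> - \<beta>) + C2 * T powr (\<alpha> - \<beta>)) * (t - r) powr \<beta>"
  proof (rule norm_blinfun_bound)
    fix K
    have "(Wb t s - Wb r s) K = W t r K + (S (t - r) (W r s K) - W r s K)"
      using rt s W_chen[of s r t K] by (simp add: blinfun.diff_left Wb_apply)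
    also have "norm \<dots> \<le> CW * norm K * (t - r) powr \<alpha> + C2 * norm K * (t - r) powr \<beta> * (r - s) powr (\<alpha> - \<beta>)"
      using rt s by (intro norm_triangle_mono W_bound W_regularity) auto
    also have "\<dots> \<le> CW * norm K * (T powr (\<alpha> - \<beta>) * (t - r) powr \<beta>) + C2 * norm K * (t - r) powr \<beta> * T powr (\<alpha> - \<beta>)"
      using pow CW0 C2_nonneg by (intro add_mono mult_left_mono) auto
    also have "\<dots> = (CW * T powr (\<alpha> - \<beta>) + C2 * T powr (\<alpha> - \<beta>)) * (t - r) powr \<beta> * norm K" by (simp add: algebra_simps)
    finally show "norm ((Wb t s - Wb r s) K) \<le> (CW * T powr (\<alpha> - \<beta>) + C2 * T powr (\<alpha> - \<beta>)) * (t - r) powr \<beta> * norm K" .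
  qed (use CW0 C2_nonneg in auto)
qed

section \<open>The process a\<close>

text \<open>Arises from the improper integral by inserting
  \<open>W t r = W t s - S (t - r) (W r s)\<close>. The first part integrates exactly; in the second
  \<open>W r s\<close> is of order \<open>(r - s) powr \<alpha>\<close>, which makes the singularity
  at \<open>r = s\<close> integrable.\<close>

definition pa :: "real \<Rightarrow> real \<Rightarrow> ('w \<Rightarrow>\<^sub>L 'v \<Rightarrow>\<^sub>L 'w) \<Rightarrow> 'w \<Rightarrow> 'w" where
  "pa t s E x = W t s (E (S (t - s) x)) - (LINT r:{s<..<t}|lborel. S (t - r) (Wb r s (E (AS (r - s) x))))"

lemma pa_integrand_cont:
  fixes E :: "'w \<Rightarrow>\<^sub>L 'v \<Rightarrow>\<^sub>L 'w"
  assumes "0 \<le> s" "t \<le> T"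
  shows "continuous_on {s<..<t} (\<lambda>r. S (t - r) (Wb r s (E (AS (r - s) x))))"
  using assms by (intro continuous_intros continuous_on_subset[OF continuous_on_Wb]) auto

text \<open>The exponent is left in the form \<open>a - 1\<close> expected by
  \<open>integral_powr_left_bound\<close>.\<close>

lemma pa_integrand_le:
  fixes E :: "'w \<Rightarrow>\<^sub>L 'v \<Rightarrow>\<^sub>L 'w"
  assumes st: "0 \<le> s" "s < r" "r < t" "t \<le> T" and le: "norm (AS (r - s) x) \<le> B * (r - s) powr d"
  shows "norm (S (t - r) (Wb r s (E (AS (r - s) x)))) \<le> M * CW * norm E * B * (r - s) powr (\<alpha> + d + 1 - 1)"
proof -
  have "norm (Wb r s (E (AS (r - s) x))) \<le> CW * norm (E (AS (r - s) x)) * (r - s) powr \<alpha>"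
    using st by (simp add: Wb_apply W_bound)
  also have "\<dots> \<le> CW * (norm E * (B * (r - s) powr d)) * (r - s) powr \<alpha>"
    using CW0 norm_blinfun_le[OF le, of E] by (intro mult_right_mono mult_left_mono) auto
  finally have "norm (S (t - r) (Wb r s (E (AS (r - s) x)))) \<le> M * (CW * (norm E * (B * (r - s) powr d)) * (r - s) powr \<alpha>)"
    using st by (intro norm_S_le) auto
  then show ?thesis by (simp add: powr_add mult_ac)
qed

lemma pa_integrable:
  fixes E :: "'w \<Rightarrow>\<^sub>L 'v \<Rightarrow>\<^sub>L 'w"
  assumes st: "0 \<le> s" "s \<le> t" "t \<le> T"
  shows "set_integrable lborel {s<..<t} (\<lambda>r. S (t - r) (Wb r s (E (AS (r - s) x))))"
    "norm (LINT r:{s<..<t}|lborel. S (t - r) (Wb r s (E (AS (r - s) x)))) \<le> M * CW * norm E * (M * norm x) * ((t - s) powr \<alpha> / \<alpha>)"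
proof -
  have le: "norm (S (t - r) (Wb r s (E (AS (r - s) x)))) \<le> M * CW * norm E * (M * norm x) * (r - s) powr (\<alpha> - 1)"
    if "s < r" "r < t" for r
    using pa_integrand_le[of s r t x "M * norm x" "-1" E] norm_AS[of "r - s" x] st that
    by (simp add: powr_minus_divide)
  show "set_integrable lborel {s<..<t} (\<lambda>r. S (t - r) (Wb r s (E (AS (r - s) x))))"
    "norm (LINT r:{s<..<t}|lborel. S (t - r) (Wb r s (E (AS (r - s) x)))) \<le> M * CW * norm E * (M * norm x) * ((t - s) powr \<alpha> / \<alpha>)"
    by (rule integral_powr_left_bound[OF pa_integrand_cont[OF st(1,3)] ab0(1) st(2) le]; assumption)+
qed

lemma pa_refl [simp]: "pa s s E x = 0"
  by (simp add: pa_def set_lebesgue_integral_def)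

lemma pa_diff:
  assumes st: "0 \<le> s" "s \<le> t" "t \<le> T"
  shows "pa t s E (x - y) = pa t s E x - pa t s E y"
  unfolding pa_def
  using set_integral_diff(2)[OF pa_integrable(1)[OF st, of E x] pa_integrable(1)[OF st, of E y]]
  by (simp add: blinfun.diff_right W_diff[OF st])

definition Ca :: real where
  "Ca = CW * M + M * CW * M / \<alpha>"

lemma Ca_nonneg: "0 \<le> Ca"
  using CW0 M0 ab0 by (simp add: Ca_def)

lemma pa_bound:
  assumes st: "0 \<le> s" "s \<le> t" "t \<le> T"
  shows "norm (pa t s E x) \<le> Ca * norm E * norm x * (t - s) powr \<alpha>"
proof -
  have "norm (W t s (E (S (t - s) x))) \<le> CW * (norm E * (M * norm x)) * (t - s) powr \<alpha>"
    using st CW0 by (intro order_trans[OF W_bound[OF st]] mult_right_mono mult_left_mono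
        order_trans[OF norm_blinfun] norm_S) auto
  then have "norm (pa t s E x) \<le> CW * (norm E * (M * norm x)) * (t - s) powr \<alpha> +
      M * CW * norm E * (M * norm x) * ((t - s) powr \<alpha> / \<alpha>)"
    unfolding pa_def using pa_integrable(2)[OF st, of E x] by (intro norm_triangle_le_diff add_mono)
  then show ?thesis by (simp add: Ca_def algebra_simps)
qed

text \<open>Freezing \<open>S (r - s) x\<close> at \<open>x\<close> costs the regularity
  \<open>d\<close> of \<open>x\<close>. It is used with \<open>d = 1\<close> for smoothed points and
  with \<open>d = \<beta>\<close> for points of the Favard space.\<close>

lemma pa_minus_W:
  fixes E :: "'w \<Rightarrow>\<^sub>L 'v \<Rightarrow>\<^sub>L 'w"
  assumes st: "0 \<le> s" "s \<le> t" "t \<le> T" and S: "norm (S (t - s) x - x) \<le> B * (t - s) powr d"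
    and AS: "\<And>r. s < r \<Longrightarrow> r < t \<Longrightarrow> norm (AS (r - s) x) \<le> B * (r - s) powr (d - 1)"
    and d: "0 < \<alpha> + d" and B: "0 \<le> B"
  shows "norm (pa t s E x - W t s (E x)) \<le> (CW + M * CW / (\<alpha> + d)) * norm E * B * (t - s) powr (\<alpha> + d)"
proof -
  have le: "norm (S (t - r) (Wb r s (E (AS (r - s) x)))) \<le> M * CW * norm E * B * (r - s) powr (\<alpha> + d - 1)"
    if "s < r" "r < t" for r
    using pa_integrand_le[of s r t x B "d - 1" E] AS[OF that] st that by (simp add: algebra_simps)
  have I: "norm (LINT r:{s<..<t}|lborel. S (t - r) (Wb r s (E (AS (r - s) x)))) \<le>
      M * CW * norm E * B * ((t - s) powr (\<alpha> + d) / (\<alpha> + d))"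
    by (rule integral_powr_left_bound(2)[OF pa_integrand_cont[OF st(1,3)] d st(2) le])
  have "pa t s E x - W t s (E x) = W t s (E (S (t - s) x - x)) -
      (LINT r:{s<..<t}|lborel. S (t - r) (Wb r s (E (AS (r - s) x))))"
    by (simp add: pa_def blinfun.diff_right W_diff[OF st])
  moreover have "norm (W t s (E (S (t - s) x - x))) \<le> CW * (norm E * (B * (t - s) powr d)) * (t - s) powr \<alpha>"
    using CW0 S by (intro order_trans[OF W_bound[OF st]] mult_right_mono mult_left_mono order_trans[OF norm_blinfun]) auto
  ultimately have "norm (pa t s E x - W t s (E x)) \<le> CW * (norm E * (B * (t - s) powr d)) * (t - s) powr \<alpha> +
      M * CW * norm E * B * ((t - s) powr (\<alpha> + d) / (\<alpha> + d))"
    using norm_diff_le[OF _ I] by (simp only:)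
  then show ?thesis by (simp add: powr_add algebra_simps)
qed

lemma pa_chen:
  assumes "0 \<le> s" "s \<le> m" "m \<le> t" "t \<le> T"
  shows "pa t s E x = pa t m E (S (m - s) x) + S (t - m) (pa m s E x)"
proof (cases "s = m")
  case False
  then have sm: "s < m" using assms by simp
  have st: "s \<le> t" "m \<le> T" "0 \<le> m" using assms by auto
  note i1 = pa_integrable(1)[OF assms(1) st(1) assms(4), of E x]
  note i2 = pa_integrable(1)[OF assms(1,2) st(2), of E x]
  note i3 = pa_integrable(1)[OF st(3) assms(3,4), of E "S (m - s) x"]
  note i4 = integral_AS_forward[OF sm assms(3), of x]
  define L where "L = (S (t - m) o\<^sub>L Wb m s) o\<^sub>L E"
  have L: "L y = S (t - m) (W m s (E y))" for y
    using assms st by (simp add: L_def Wb_apply)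
  have first: "(LINT r:{s<..<m}|lborel. S (t - r) (Wb r s (E (AS (r - s) x)))) =
      S (t - m) (LINT r:{s<..<m}|lborel. S (m - r) (Wb r s (E (AS (r - s) x))))"
    unfolding set_integral_blinfun(1)[OF i2, symmetric]
    by (rule set_lebesgue_integral_cong) (use assms in \<open>auto simp: S_comp\<close>)
  have second: "(LINT r:{m<..<t}|lborel. S (t - r) (Wb r s (E (AS (r - s) x)))) =
      (LINT r:{m<..<t}|lborel. S (t - r) (Wb r m (E (AS (r - m) (S (m - s) x))))) + L (S (t - s) x - S (m - s) x)"
  proof -
    have "(LINT r:{m<..<t}|lborel. S (t - r) (Wb r s (E (AS (r - s) x)))) =
        (LINT r:{m<..<t}|lborel. S (t - r) (Wb r m (E (AS (r - m) (S (m - s) x)))) + L (AS (r - s) x))"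
    proof (rule set_lebesgue_integral_cong)
      show "\<forall>r. r \<in> {m<..<t} \<longrightarrow> S (t - r) (Wb r s (E (AS (r - s) x))) =
          S (t - r) (Wb r m (E (AS (r - m) (S (m - s) x)))) + L (AS (r - s) x)"
      proof (intro allI impI)
        fix r assume r: "r \<in> {m<..<t}"
        have "AS (r - m) (S (m - s) x) = AS (r - s) x" using r sm by (simp add: AS_S)
        moreover have "W r s K = W r m K + S (r - m) (W m s K)" for K
          using W_chen[of s m r K] assms r by simp
        ultimately show "S (t - r) (Wb r s (E (AS (r - s) x))) =
          S (t - r) (Wb r m (E (AS (r - m) (S (m - s) x)))) + L (AS (r - s) x)"
          using assms r st by (simp add: L Wb_apply blinfun.add_right S_comp)
      qed
    qed simp
    also have "\<dots> = (LINT r:{m<..<t}|lborel. S (t - r) (Wb r m (E (AS (r - m) (S (m - s) x))))) +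
        (LINT r:{m<..<t}|lborel. L (AS (r - s) x))"
      by (rule set_integral_add(2)[OF i3 set_integral_blinfun(2)[OF i4(1)]])
    finally show ?thesis by (simp only: set_integral_blinfun(1)[OF i4(1)] i4(2))
  qed
  have "W t s (E (S (t - s) x)) = W t m (E (S (t - s) x)) + S (t - m) (W m s (E (S (t - s) x)))"
    by (rule W_chen[OF assms])
  moreover have "S (t - m) (S (m - s) x) = S (t - s) x" using assms by (simp add: S_comp)
  ultimately show ?thesis
    unfolding pa_def set_integral_Ioo_split[OF i1 assms(2,3)] first second
    using W_diff[OF assms(1,2) st(2)] by (simp add: L blinfun.diff_right)
qed simp

lemma pa_limit:
  fixes E :: "'w \<Rightarrow>\<^sub>L 'v \<Rightarrow>\<^sub>L 'w"
  assumes mt: "0 \<le> m" "m \<le> t" "t \<le> T"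
  shows "(sew_sum S (\<lambda>v u. W v u (E (S (u - m) x))) t \<longlongrightarrow> pa t m E x) (mesh_filter m t)"
proof -
  define J where "J v u = pa v u E (S (u - m) x)" for v u
  define B where "B = 2 * ((CW + M * CW / (\<alpha> + 1)) * norm E * (2 * M * norm x) + (Ca + CW) * norm E * (M * norm x))"
  have B0: "0 \<le> (CW + M * CW / (\<alpha> + 1)) * norm E * (2 * M * norm x)" "0 \<le> (Ca + CW) * norm E * (M * norm x)"
    using CW0 M0 ab0 Ca_nonneg by auto
  have sumJ: "sew_sum S J t p = pa t m E x" if "p \<in> partitions m t" for p
  proof -
    have "sew_sum S J t p = J t m"
    proof (rule sew_sum_eq_additive[OF that])
      show "J n n = 0" for n by (simp add: J_def)
      show "J v u = J v n + S (v - n) (J n u)" if "m \<le> u" "u < n" "n < v" "v \<le> t" for u n v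
        using pa_chen[of u n v E "S (u - m) x"] that mt by (simp add: J_def S_comp)
    qed
    then show ?thesis by (simp add: J_def)
  qed
  have "(sew_sum S (\<lambda>v u. J v u - W v u (E (S (u - m) x))) t \<longlongrightarrow> 0) (mesh_filter m t)"
  proof (rule weight_sew_zero[OF mt(2) order_refl ab0(1), where b = 1 and B = B])
    fix u v assume uv: "m \<le> u" "u < v" "v \<le> t"
    let ?y = "S (u - m) x"
    have uvT: "0 \<le> u" "u \<le> v" "v \<le> T" using uv mt by auto
    have y: "norm ?y \<le> M * norm x" using uv by (intro norm_S) auto
    have pos: "0 \<le> (v - u) powr \<alpha>" by simp
    show "norm (J v u - W v u (E ?y)) \<le> B * weight \<alpha> 1 (v - m) (u - m)"
    \<comment> \<open>Away from \<open>m\<close> the point \<open>S (u - m) x\<close> has been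
      smoothed for a time comparable to \<open>v - m\<close>. On intervals adjacent or close to
      \<open>m\<close> the ratio \<open>(v - u) / (v - m)\<close> is at least \<open>1 / 2\<close>,
      so crude bounds suffice.\<close>
    proof (cases "v - m \<le> 2 * (u - m)")
      case True
      define \<rho> where "\<rho> = u - m"
      have \<rho>: "0 < \<rho>" "v - m \<le> 2 * \<rho>" using True uv by (auto simp: \<rho>_def)
      have "norm (J v u - W v u (E ?y)) \<le>
          (CW + M * CW / (\<alpha> + 1)) * norm E * (2 * M * norm x / \<rho>) * (v - u) powr (\<alpha> + 1)"
        unfolding J_def
      proof (rule pa_minus_W[OF uvT])
        show "norm (S (v - u) ?y - ?y) \<le> 2 * M * norm x / \<rho> * (v - u) powr 1"
          using smoothing[of "v - u" \<rho> 1 x] uv \<rho> by (simp add: \<rho>_def)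
        show "norm (AS (r - u) ?y) \<le> 2 * M * norm x / \<rho> * (r - u) powr (1 - 1)" if "u < r" "r < v" for r
        proof -
          have "AS (r - u) ?y = AS (r - m) x" using that uv by (simp add: AS_S)
          then have "norm (AS (r - u) ?y) \<le> M / (r - m) * norm x" using norm_AS[of "r - m" x] that uv by simp
          also have "\<dots> \<le> M / \<rho> * norm x"
            using M0 \<rho> that uv by (intro mult_right_mono divide_left_mono) (auto simp: \<rho>_def)
          also have "\<dots> \<le> 2 * M * norm x / \<rho>" using M0 \<rho> by (simp add: field_simps)
          finally show ?thesis using that by simp
        qed
      qed (use ab0 M0 \<rho> in auto)
      also have "\<dots> = (CW + M * CW / (\<alpha> + 1)) * norm E * (2 * M * norm x) * ((v - u) powr \<alpha> * ((v - u) / \<rho>))"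
        using uv by (simp add: powr_add)
      also have "\<dots> \<le> (CW + M * CW / (\<alpha> + 1)) * norm E * (2 * M * norm x) * ((v - u) powr \<alpha> * (2 * ((v - u) / (v - m))))"
      proof -
        have "(v - u) / \<rho> \<le> (v - u) / ((v - m) / 2)"
          using \<rho> uv by (intro divide_left_mono) auto
        then have "(v - u) / \<rho> \<le> 2 * ((v - u) / (v - m))"
          by (metis divide_divide_eq_right mult.commute times_divide_eq_right)
        then show ?thesis using B0 by (intro mult_left_mono) auto
      qed
      also have "\<dots> = 2 * ((CW + M * CW / (\<alpha> + 1)) * norm E * (2 * M * norm x)) * weight \<alpha> 1 (v - m) (u - m)"
        using uv by (simp add: weight_def)
      also have "\<dots> \<le> B * weight \<alpha> 1 (v - m) (u - m)"
        unfolding B_def using B0 by (intro mult_right_mono weight_nonneg) auto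
      finally show ?thesis .
    next
      case False
      have "norm (J v u - W v u (E ?y)) \<le> Ca * norm E * norm ?y * (v - u) powr \<alpha> + CW * norm (E ?y) * (v - u) powr \<alpha>"
        unfolding J_def by (intro norm_triangle_le_diff add_mono pa_bound[OF uvT] W_bound[OF uvT])
      also have "\<dots> \<le> Ca * norm E * (M * norm x) * (v - u) powr \<alpha> + CW * (norm E * (M * norm x)) * (v - u) powr \<alpha>"
        using Ca_nonneg CW0 y norm_blinfun_le[OF y, of E] by (intro add_mono mult_right_mono mult_left_mono) auto
      also have "\<dots> = (Ca + CW) * norm E * (M * norm x) * ((v - u) powr \<alpha> * 1)" by (simp add: algebra_simps)
      also have "\<dots> \<le> (Ca + CW) * norm E * (M * norm x) * ((v - u) powr \<alpha> * (2 * ((v - u) / (v - m))))"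
        using B0 False uv by (intro mult_left_mono) (auto simp: field_simps)
      also have "\<dots> = 2 * ((Ca + CW) * norm E * (M * norm x)) * weight \<alpha> 1 (v - m) (u - m)"
        using uv by (simp add: weight_def)
      also have "\<dots> \<le> B * weight \<alpha> 1 (v - m) (u - m)"
        unfolding B_def using B0 by (intro mult_right_mono weight_nonneg) auto
      finally show ?thesis .
    qed
  qed (use ab0 B0 in \<open>auto simp: B_def\<close>)
  then have "((\<lambda>p. sew_sum S J t p - sew_sum S (\<lambda>v u. W v u (E (S (u - m) x))) t p) \<longlongrightarrow> 0) (mesh_filter m t)"
    by (simp only: sew_sum_diff_fun)
  then have "((\<lambda>p. pa t m E x - sew_sum S (\<lambda>v u. W v u (E (S (u - m) x))) t p) \<longlongrightarrow> 0) (mesh_filter m t)"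
    by (rule Lim_transform_eventually) (auto simp: eventually_mesh_filter sumJ intro!: exI[of _ 1])
  from tendsto_diff[OF tendsto_const[of "pa t m E x"] this] show ?thesis by simp
qed

section \<open>The process c\<close>

text \<open>By Chen's relation the argument of the lift inside the integral is
  \<open>\<omega>2 t s - \<omega>2 r s\<close>. It is of order \<alpha> in \<open>t - r\<close>,
  which makes the kernel \<open>AS (t - r)\<close> integrable.\<close>

definition pc :: "real \<Rightarrow> real \<Rightarrow> ('w \<Rightarrow>\<^sub>L 'v \<Rightarrow>\<^sub>L 'w) \<Rightarrow> ('v \<Rightarrow>\<^sub>L 'w) \<Rightarrow> 'w" where
  "pc t s E K = S (t - s) (tensor_lift tens (E o\<^sub>L K) (\<omega>2 t s)) -
     (LINT r:{s<..<t}|lborel. AS (t - r) (tensor_lift tens (E o\<^sub>L K) (\<omega>2 t r + tens (\<omega> r - \<omega> s) (\<omega> t - \<omega> r))))"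

lemma tens_bilinear: "bounded_bilinear tens"
  using tens by (simp add: projective_tensor_def)

lemma lift_le: "norm (tensor_lift tens (E o\<^sub>L K) x) \<le> norm E * norm K * norm x"
  by (meson mult_right_mono norm_blinfun_compose norm_ge_zero order_trans tensor_lift_apply(2)[OF tens])

lemma om2_refl: "0 \<le> s \<Longrightarrow> s \<le> T \<Longrightarrow> \<omega>2 s s = 0"
  using om2[of s s] by simp

lemma continuous_om2:
  assumes "t \<le> T"
  shows "continuous_on {0..t} (\<lambda>r. \<omega>2 t r)"
proof (rule holder_continuous_on[OF _ ab0(1)])
  fix r r' assume r: "r \<in> {0..t}" "r' \<in> {0..t}" "r < r'"
  have "\<omega>2 t r' - \<omega>2 t r = - (\<omega>2 r' r) - tens (\<omega> r' - \<omega> r) (\<omega> t - \<omega> r')"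
    using chen[of r r' t] r assms by (simp add: algebra_simps)
  then have "norm (\<omega>2 t r' - \<omega>2 t r) \<le> norm (\<omega>2 r' r) + norm (tens (\<omega> r' - \<omega> r) (\<omega> t - \<omega> r'))"
    by (metis norm_minus_cancel norm_triangle_ineq4)
  also have "\<dots> \<le> H * (r' - r) powr (2 * \<alpha>) + H * ((H * (r' - r) powr \<alpha>) * (H * T powr \<alpha>))"
  proof (intro add_mono om2 order_trans[OF tens_le] mult_left_mono mult_mono)
    have "(t - r') powr \<alpha> \<le> T powr \<alpha>" using r assms ab0 by (intro powr_mono2) auto
    then have "H * (t - r') powr \<alpha> \<le> H * T powr \<alpha>" using H0 by (intro mult_left_mono) auto
    then show "norm (\<omega> t - \<omega> r') \<le> H * T powr \<alpha>" using om[of r' t] r assms by auto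
  qed (use r assms H0 om in auto)
  also have "\<dots> \<le> H * (T powr \<alpha> * (r' - r) powr \<alpha>) + H * ((H * (r' - r) powr \<alpha>) * (H * T powr \<alpha>))"
  proof (intro add_right_mono mult_left_mono H0)
    have "(r' - r) powr \<alpha> * (r' - r) powr \<alpha> \<le> T powr \<alpha> * (r' - r) powr \<alpha>"
      using r assms ab0 by (intro mult_right_mono powr_mono2) auto
    then show "(r' - r) powr (2 * \<alpha>) \<le> T powr \<alpha> * (r' - r) powr \<alpha>" by (simp add: powr_add[symmetric])
  qed
  finally show "norm (\<omega>2 t r' - \<omega>2 t r) \<le> (H * T powr \<alpha> + H * H * H * T powr \<alpha>) * (r' - r) powr \<alpha>"
    by (simp add: algebra_simps)
qed

definition Cc :: real where
  "Cc = M * H + M * (H + H * H * H) / \<alpha>"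

lemma Cc_nonneg: "0 \<le> Cc"
  using M0 H0 ab0 by (simp add: Cc_def)

lemma pc_integrable:
  assumes st: "0 \<le> s" "s \<le> t" "t \<le> T"
  shows "set_integrable lborel {s<..<t} (\<lambda>r. AS (t - r) (tensor_lift tens (E o\<^sub>L K) (\<omega>2 t r + tens (\<omega> r - \<omega> s) (\<omega> t - \<omega> r))))"
    "norm (LINT r:{s<..<t}|lborel. AS (t - r) (tensor_lift tens (E o\<^sub>L K) (\<omega>2 t r + tens (\<omega> r - \<omega> s) (\<omega> t - \<omega> r)))) \<le>
      M * (norm E * norm K) * (H + H * H * H) * (t - s) powr \<alpha> * ((t - s) powr \<alpha> / \<alpha>)"
proof -
  have c: "continuous_on {s<..<t} (\<lambda>r. AS (t - r) (tensor_lift tens (E o\<^sub>L K) (\<omega>2 t r + tens (\<omega> r - \<omega> s) (\<omega> t - \<omega> r))))"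
    using st by (intro continuous_intros bounded_bilinear.continuous_on[OF tens_bilinear]
        continuous_on_subset[OF continuous_om] continuous_on_subset[OF continuous_om2[OF st(3)]]) auto
  have le: "norm (AS (t - r) (tensor_lift tens (E o\<^sub>L K) (\<omega>2 t r + tens (\<omega> r - \<omega> s) (\<omega> t - \<omega> r)))) \<le>
      M * (norm E * norm K) * (H + H * H * H) * (t - s) powr \<alpha> * (t - r) powr (\<alpha> - 1)" if r: "s < r" "r < t" for r
  proof -
    \<comment> \<open>One factor of order \<alpha> is frozen at its value for the whole interval and
      leaves the integrand; the other one pays for the kernel. Together they give order
      \<open>2 * \<alpha>\<close>.\<close>
    have p: "(t - r) powr \<alpha> \<le> (t - s) powr \<alpha>" "(r - s) powr \<alpha> \<le> (t - s) powr \<alpha>"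
      using r ab0 by (auto intro!: powr_mono2)
    have "norm (\<omega>2 t r + tens (\<omega> r - \<omega> s) (\<omega> t - \<omega> r)) \<le>
        H * (t - r) powr (2 * \<alpha>) + H * ((H * (r - s) powr \<alpha>) * (H * (t - r) powr \<alpha>))"
      using r st H0 by (intro norm_triangle_mono om2 order_trans[OF tens_le] mult_left_mono mult_mono om) auto
    also have "(t - r) powr (2 * \<alpha>) = (t - r) powr \<alpha> * (t - r) powr \<alpha>" by (simp add: powr_add[symmetric])
    also have "H * ((t - r) powr \<alpha> * (t - r) powr \<alpha>) + H * ((H * (r - s) powr \<alpha>) * (H * (t - r) powr \<alpha>)) \<le>
        H * ((t - s) powr \<alpha> * (t - r) powr \<alpha>) + H * ((H * (t - s) powr \<alpha>) * (H * (t - r) powr \<alpha>))"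
      using p H0 by (intro add_mono mult_left_mono mult_right_mono) auto
    also have "\<dots> = (H + H * H * H) * (t - s) powr \<alpha> * (t - r) powr \<alpha>" by (simp add: algebra_simps)
    finally have "norm (AS (t - r) (tensor_lift tens (E o\<^sub>L K) (\<omega>2 t r + tens (\<omega> r - \<omega> s) (\<omega> t - \<omega> r)))) \<le>
        M / (t - r) * (norm E * norm K * ((H + H * H * H) * (t - s) powr \<alpha> * (t - r) powr \<alpha>))"
      using r M0 by (intro order_trans[OF norm_AS] mult_left_mono order_trans[OF lift_le]) auto
    also have "\<dots> = M * (norm E * norm K) * (H + H * H * H) * (t - s) powr \<alpha> * (t - r) powr (\<alpha> - 1)"
      using r by (simp add: powr_diff)
    finally show ?thesis .
  qed
  show "set_integrable lborel {s<..<t} (\<lambda>r. AS (t - r) (tensor_lift tens (E o\<^sub>L K) (\<omega>2 t r + tens (\<omega> r - \<omega> s) (\<omega> t - \<omega> r))))"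
    "norm (LINT r:{s<..<t}|lborel. AS (t - r) (tensor_lift tens (E o\<^sub>L K) (\<omega>2 t r + tens (\<omega> r - \<omega> s) (\<omega> t - \<omega> r)))) \<le>
      M * (norm E * norm K) * (H + H * H * H) * (t - s) powr \<alpha> * ((t - s) powr \<alpha> / \<alpha>)"
    by (rule integral_powr_right_bound[OF c ab0(1) st(2) le]; assumption)+
qed

lemma pc_bound:
  assumes st: "0 \<le> s" "s \<le> t" "t \<le> T"
  shows "norm (pc t s E K) \<le> Cc * norm E * norm K * (t - s) powr (2 * \<alpha>)"
proof -
  have e: "(t - s) powr \<alpha> * ((t - s) powr \<alpha> / \<alpha>) = (t - s) powr (2 * \<alpha>) / \<alpha>" by (simp add: powr_add[symmetric])
  have "norm (S (t - s) (tensor_lift tens (E o\<^sub>L K) (\<omega>2 t s))) \<le> M * (norm E * norm K * (H * (t - s) powr (2 * \<alpha>)))"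
    using st om2[OF st] by (intro norm_S_le order_trans[OF lift_le] mult_left_mono) auto
  then have "norm (pc t s E K) \<le> M * (norm E * norm K * (H * (t - s) powr (2 * \<alpha>))) +
      M * (norm E * norm K) * (H + H * H * H) * (t - s) powr \<alpha> * ((t - s) powr \<alpha> / \<alpha>)"
    unfolding pc_def using pc_integrable(2)[OF st, of E K] by (intro norm_triangle_le_diff add_mono)
  also have "\<dots> = M * (norm E * norm K * (H * (t - s) powr (2 * \<alpha>))) +
      M * (norm E * norm K) * (H + H * H * H) * ((t - s) powr (2 * \<alpha>) / \<alpha>)" by (simp only: mult.assoc e)
  finally show ?thesis by (simp add: Cc_def algebra_simps add_divide_distrib)
qed

lemma lift_diff: "tensor_lift tens (E o\<^sub>L (K - K')) = tensor_lift tens (E o\<^sub>L K) - tensor_lift tens (E o\<^sub>L K')"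
proof -
  have "E o\<^sub>L (K - K') = (E o\<^sub>L K) - (E o\<^sub>L K')" by (rule blinfun_eqI) (simp add: blinfun.diff_left blinfun.diff_right)
  then show ?thesis by (simp add: tensor_lift_diff[OF tens])
qed

lemma pc_diff:
  assumes st: "0 \<le> s" "s \<le> t" "t \<le> T"
  shows "pc t s E (K - K') = pc t s E K - pc t s E K'"
  unfolding pc_def lift_diff
  using set_integral_diff(2)[OF pc_integrable(1)[OF st, of E K] pc_integrable(1)[OF st, of E K']]
  by (simp add: blinfun.diff_left blinfun.diff_right)

text \<open>Chen's relation for \<open>\<omega>2\<close> carries over through the integral; the term
  in \<open>W\<close> is the convolution counterpart of the elementary tensor in it.\<close>

lemma pc_chen:
  assumes "0 \<le> s" "s \<le> m" "m \<le> t" "t \<le> T"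
  shows "pc t s E K = pc t m E K + S (t - m) (pc m s E K) + W t m (E (K (\<omega> m - \<omega> s)))"
proof (cases "m = t")
  case True
  then show ?thesis using om2_refl[of t] assms
    by (simp add: pc_def set_lebesgue_integral_def)
next
  case False
  then have mt: "m < t" using assms by simp
  have st: "s \<le> t" "m \<le> T" "0 \<le> m" using assms by auto
  define L where "L = tensor_lift tens (E o\<^sub>L K)"
  have Lt: "L (tens v w) = E (K v) w" for v w by (simp add: L_def tensor_lift_apply[OF tens])
  note i1 = pc_integrable(1)[OF assms(1) st(1) assms(4), of E K, folded L_def]
  note i2 = pc_integrable(1)[OF assms(1,2) st(2), of E K, folded L_def]
  note i3 = pc_integrable(1)[OF st(3) assms(3,4), of E K, folded L_def]
  note i5 = W_integrand(1)[OF st(3) assms(3,4), of "E (K (\<omega> m - \<omega> s))"]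
  \<comment> \<open>The part of the integrand on \<open>[s, m]\<close> that no longer depends on
    \<open>r\<close> once Chen's relation has been applied at \<open>m\<close>.\<close>
  define X where "X = L (\<omega>2 t m + tens (\<omega> m - \<omega> s) (\<omega> t - \<omega> m))"
  note i4 = integral_AS_backward[OF assms(2) mt, of X]
  have tens_simps: "tens (a - b) c = tens a c - tens b c" "tens a (b - c) = tens a b - tens a c" for a b c
    by (simp_all add: bounded_bilinear.diff_left[OF tens_bilinear] bounded_bilinear.diff_right[OF tens_bilinear])
  have first: "(LINT r:{s<..<m}|lborel. AS (t - r) (L (\<omega>2 t r + tens (\<omega> r - \<omega> s) (\<omega> t - \<omega> r)))) =
      S (t - m) (LINT r:{s<..<m}|lborel. AS (m - r) (L (\<omega>2 m r + tens (\<omega> r - \<omega> s) (\<omega> m - \<omega> r)))) +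
      (S (t - s) X - S (t - m) X)"
  proof -
    have "(LINT r:{s<..<m}|lborel. AS (t - r) (L (\<omega>2 t r + tens (\<omega> r - \<omega> s) (\<omega> t - \<omega> r)))) =
      (LINT r:{s<..<m}|lborel. S (t - m) (AS (m - r) (L (\<omega>2 m r + tens (\<omega> r - \<omega> s) (\<omega> m - \<omega> r)))) + AS (t - r) X)"
    proof (rule set_lebesgue_integral_cong)
      show "\<forall>r. r \<in> {s<..<m} \<longrightarrow> AS (t - r) (L (\<omega>2 t r + tens (\<omega> r - \<omega> s) (\<omega> t - \<omega> r))) =
        S (t - m) (AS (m - r) (L (\<omega>2 m r + tens (\<omega> r - \<omega> s) (\<omega> m - \<omega> r)))) + AS (t - r) X"
      proof (intro allI impI)
        fix r assume r: "r \<in> {s<..<m}"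
        have "\<omega>2 t r = \<omega>2 m r + \<omega>2 t m + tens (\<omega> m - \<omega> r) (\<omega> t - \<omega> m)"
          using chen[of r m t] r assms by (simp add: algebra_simps)
        then have "\<omega>2 t r + tens (\<omega> r - \<omega> s) (\<omega> t - \<omega> r) =
            (\<omega>2 m r + tens (\<omega> r - \<omega> s) (\<omega> m - \<omega> r)) + (\<omega>2 t m + tens (\<omega> m - \<omega> s) (\<omega> t - \<omega> m))"
          by (simp add: tens_simps)
        then show "AS (t - r) (L (\<omega>2 t r + tens (\<omega> r - \<omega> s) (\<omega> t - \<omega> r))) =
          S (t - m) (AS (m - r) (L (\<omega>2 m r + tens (\<omega> r - \<omega> s) (\<omega> m - \<omega> r)))) + AS (t - r) X"
          using r mt by (simp only: X_def) (simp add: S_AS blinfun.add_right)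
      qed
    qed simp
    also have "\<dots> = (LINT r:{s<..<m}|lborel. S (t - m) (AS (m - r) (L (\<omega>2 m r + tens (\<omega> r - \<omega> s) (\<omega> m - \<omega> r))))) +
        (LINT r:{s<..<m}|lborel. AS (t - r) X)"
      by (rule set_integral_add(2)[OF set_integral_blinfun(2)[OF i2] i4(1)])
    finally show ?thesis by (simp only: set_integral_blinfun(1)[OF i2] i4(2))
  qed
  have second: "(LINT r:{m<..<t}|lborel. AS (t - r) (L (\<omega>2 t r + tens (\<omega> r - \<omega> s) (\<omega> t - \<omega> r)))) =
      (LINT r:{m<..<t}|lborel. AS (t - r) (L (\<omega>2 t r + tens (\<omega> r - \<omega> m) (\<omega> t - \<omega> r)))) +
      (LINT r:{m<..<t}|lborel. AS (t - r) (E (K (\<omega> m - \<omega> s)) (\<omega> t - \<omega> r)))"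
  proof -
    have "L (\<omega>2 t r + tens (\<omega> r - \<omega> s) (\<omega> t - \<omega> r)) =
        L (\<omega>2 t r + tens (\<omega> r - \<omega> m) (\<omega> t - \<omega> r)) + E (K (\<omega> m - \<omega> s)) (\<omega> t - \<omega> r)" for r
      unfolding Lt[symmetric] blinfun.add_right[symmetric] by (simp add: tens_simps algebra_simps)
    then show ?thesis
      using set_integral_add(2)[OF i3 i5] by (simp add: blinfun.add_right add.assoc)
  qed
  have \<omega>ts: "\<omega>2 t s = \<omega>2 m s + (\<omega>2 t m + tens (\<omega> m - \<omega> s) (\<omega> t - \<omega> m))"
    using chen[of s m t] assms by (simp add: algebra_simps)
  have "S (t - s) (L (\<omega>2 t s)) = S (t - m) (S (m - s) (L (\<omega>2 m s))) + S (t - s) X"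
    unfolding \<omega>ts X_def using assms by (simp add: blinfun.add_right S_comp)
  moreover have "S (t - m) X = S (t - m) (L (\<omega>2 t m)) + S (t - m) (E (K (\<omega> m - \<omega> s)) (\<omega> t - \<omega> m))"
    by (simp add: X_def blinfun.add_right Lt)
  ultimately show ?thesis
    unfolding pc_def L_def[symmetric] W_def set_integral_Ioo_split[OF i1 assms(2,3)] first second
    by (simp add: blinfun.diff_right)
qed

section \<open>The process b\<close>

definition Th :: "real \<Rightarrow> ('w \<Rightarrow>\<^sub>L 'v \<Rightarrow>\<^sub>L 'w) \<Rightarrow> ('v \<Rightarrow>\<^sub>L 'w) \<Rightarrow> real \<Rightarrow> real \<Rightarrow> 'w" where
  "Th s E K v u = W v u (E (W u s K)) + pc v u E K"

definition pb :: "real \<Rightarrow> real \<Rightarrow> ('w \<Rightarrow>\<^sub>L 'v \<Rightarrow>\<^sub>L 'w) \<Rightarrow> ('v \<Rightarrow>\<^sub>L 'w) \<Rightarrow> 'w" where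
  "pb t s E K = Lim (mesh_filter s t) (sew_sum S (Th s E K) t)"

text \<open>The increment of \<open>W u s K\<close> over \<open>[u, m]\<close> differs from \<open>K (\<omega>\<^sub>m - \<omega>\<^sub>u)\<close> by terms of order
  \<open>\<alpha> + \<beta>\<close> and \<open>2 \<beta>\<close>; with the outer integral both exceed order \<open>1\<close>.\<close>

lemma Th_defect:
  assumes K: "fav K N" and u: "0 \<le> s" "s \<le> u" "u < m" "m < v" "v \<le> t" "t \<le> T"
  shows "norm (Th s E K v u - Th s E K v m - S (v - m) (Th s E K m u)) \<le>
    (CW * norm E * (C1 + C3) * N * (t - s) powr (\<alpha> - \<beta>)) * weight (\<alpha> + 2 * \<beta>) 0 (v - s) (u - s)"
proof -
  have N: "0 \<le> N" using K by (simp add: fav_def)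
  have le: "0 \<le> u" "u \<le> m" "m \<le> v" "v \<le> T" "0 \<le> m" "m \<le> T" "s \<le> m" "u \<le> T" "s \<le> v" using u by auto
  have "Th s E K v u - Th s E K v m - S (v - m) (Th s E K m u) =
      W v u (E (W u s K)) - W v m (E (W m s K)) - S (v - m) (W m u (E (W u s K))) + W v m (E (K (\<omega> m - \<omega> u)))"
    using pc_chen[OF le(1-4), of E K] by (simp add: Th_def blinfun.add_right)
  also have "\<dots> = W v m (E (W u s K)) - W v m (E (W m s K)) + W v m (E (K (\<omega> m - \<omega> u)))"
    using W_chen[OF le(1-4), of "E (W u s K)"] by simp
  also have "\<dots> = - W v m (E (W m s K - W u s K - K (\<omega> m - \<omega> u)))"
    by (simp add: blinfun.diff_right W_diff[OF le(5,3,4)])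
  finally have eq: "Th s E K v u - Th s E K v m - S (v - m) (Th s E K m u) =
      - W v m (E (W m s K - W u s K - K (\<omega> m - \<omega> u)))" .
  have "W m s K - W u s K - K (\<omega> m - \<omega> u) = (W m u K - K (\<omega> m - \<omega> u)) + (S (m - u) (W u s K) - W u s K)"
    using W_chen[OF u(1,2) le(2,6), of K] by simp
  then have "norm (W m s K - W u s K - K (\<omega> m - \<omega> u)) \<le>
      C1 * N * (m - u) powr (\<alpha> + \<beta>) + C3 * N * (m - u) powr (2 * \<beta>) * (u - s) powr (\<alpha> - \<beta>)"
    using le u by (simp only:) (intro norm_triangle_mono W_first_order[OF K] W_regularity_fav[OF K]; simp)
  also have "\<dots> \<le> C1 * N * ((v - u) powr (2 * \<beta>) * (t - s) powr (\<alpha> - \<beta>)) + C3 * N * (v - u) powr (2 * \<beta>) * (t - s) powr (\<alpha> - \<beta>)"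
  proof (intro add_mono mult_left_mono mult_mono)
    have "(m - u) powr (\<alpha> + \<beta>) = (m - u) powr (2 * \<beta>) * (m - u) powr (\<alpha> - \<beta>)"
      by (simp add: powr_add[symmetric] algebra_simps)
    also have "\<dots> \<le> (v - u) powr (2 * \<beta>) * (t - s) powr (\<alpha> - \<beta>)"
      using u ab0 expo by (intro mult_mono powr_mono2) auto
    finally show "(m - u) powr (\<alpha> + \<beta>) \<le> (v - u) powr (2 * \<beta>) * (t - s) powr (\<alpha> - \<beta>)" .
    show "(m - u) powr (2 * \<beta>) \<le> (v - u) powr (2 * \<beta>)" using u ab0 by (intro powr_mono2) auto
    show "(u - s) powr (\<alpha> - \<beta>) \<le> (t - s) powr (\<alpha> - \<beta>)" using u expo by (intro powr_mono2) auto
  qed (use C1_nonneg C3_nonneg N in auto)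
  finally have R: "norm (W m s K - W u s K - K (\<omega> m - \<omega> u)) \<le> (C1 + C3) * N * (v - u) powr (2 * \<beta>) * (t - s) powr (\<alpha> - \<beta>)"
    by (simp add: algebra_simps)
  have "norm (W v m (E (W m s K - W u s K - K (\<omega> m - \<omega> u)))) \<le>
      CW * (norm E * ((C1 + C3) * N * (v - u) powr (2 * \<beta>) * (t - s) powr (\<alpha> - \<beta>))) * (v - m) powr \<alpha>"
    using R CW0 by (intro order_trans[OF W_bound[OF le(5,3,4)]] mult_right_mono mult_left_mono order_trans[OF norm_blinfun]) auto
  also have "\<dots> \<le> CW * (norm E * ((C1 + C3) * N * (v - u) powr (2 * \<beta>) * (t - s) powr (\<alpha> - \<beta>))) * (v - u) powr \<alpha>"
    using u ab0 CW0 C1_nonneg C3_nonneg N by (intro mult_left_mono powr_mono2) auto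
  also have "\<dots> = (CW * norm E * (C1 + C3) * N * (t - s) powr (\<alpha> - \<beta>)) * ((v - u) powr \<alpha> * (v - u) powr (2 * \<beta>))"
    by (simp add: mult_ac)
  also have "(v - u) powr \<alpha> * (v - u) powr (2 * \<beta>) = weight (\<alpha> + 2 * \<beta>) 0 (v - s) (u - s)"
    using u by (simp add: weight_def powr_add[symmetric])
  finally show ?thesis by (simp add: eq)
qed

lemma pb_limit:
  assumes K: "fav K N" and st: "0 \<le> s" "s \<le> t" "t \<le> T"
  shows "(sew_sum S (Th s E K) t \<longlongrightarrow> pb t s E K) (mesh_filter s t)"
proof -
  have N: "0 \<le> N" using K by (simp add: fav_def)
  obtain L where L: "(sew_sum S (Th s E K) t \<longlongrightarrow> L) (mesh_filter s t)"
  proof (rule weight_sew_exists[OF st(2) order_refl, of "\<alpha> + 2 * \<beta>" 0 "CW * norm E * (C1 + C3) * N * (t - s) powr (\<alpha> - \<beta>)"])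
    show "norm (Th s E K v u - Th s E K v m - S (v - m) (Th s E K m u)) \<le>
        CW * norm E * (C1 + C3) * N * (t - s) powr (\<alpha> - \<beta>) * weight (\<alpha> + 2 * \<beta>) 0 (v - s) (u - s)"
      if "s \<le> u" "u < m" "m < v" "v \<le> t" for u m v
      by (rule Th_defect[OF K st(1) that st(3)])
  qed (use expo ab0 CW0 C1_nonneg C3_nonneg N in auto)
  then show ?thesis unfolding pb_def using tendsto_Lim[OF mesh_filter_nontrivial[OF st(2)] L] by simp
qed

definition Cb :: real where
  "Cb = wsew_const M (\<alpha> + 2 * \<beta>) 0 * (CW * (C1 + C3))"

lemma wsew_const_nonneg: "0 < a \<Longrightarrow> 0 \<le> b \<Longrightarrow> 1 < a + b \<Longrightarrow> 0 \<le> wsew_const M a b"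
  using M0 sew_const_nonneg[of "a + b"] by (simp add: wsew_const_def)

lemma Cb_nonneg: "0 \<le> Cb"
  using wsew_const_nonneg[of "\<alpha> + 2 * \<beta>" 0] expo ab0 CW0 C1_nonneg C3_nonneg by (simp add: Cb_def)

text \<open>On the whole interval the germ reduces to \<open>pc t s E K\<close>, since
  \<open>W s s K = 0\<close>. Only the sewing error involves the Favard bound \<open>N\<close>, with
  the additional order \<beta>.\<close>

lemma pb_bound:
  assumes K: "fav K N" and st: "0 \<le> s" "s < t" "t \<le> T"
  shows "norm (pb t s E K) \<le> norm E * (Cc * norm K * (t - s) powr (2 * \<alpha>) + Cb * N * (t - s) powr (2 * \<alpha> + \<beta>))"
proof -
  have N: "0 \<le> N" using K by (simp add: fav_def)
  have st': "s \<le> t" using st by simp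
  have "norm (pb t s E K - Th s E K t s) \<le> wsew_const M (\<alpha> + 2 * \<beta>) 0 *
      (CW * norm E * (C1 + C3) * N * (t - s) powr (\<alpha> - \<beta>)) * weight (\<alpha> + 2 * \<beta>) 0 (t - s) (s - s)"
  proof (rule weight_sew_bound[OF pb_limit[OF K st(1) st' st(3)] st(2) order_refl])
    show "norm (Th s E K v u - Th s E K v m - S (v - m) (Th s E K m u)) \<le>
        CW * norm E * (C1 + C3) * N * (t - s) powr (\<alpha> - \<beta>) * weight (\<alpha> + 2 * \<beta>) 0 (v - s) (u - s)"
      if "s \<le> u" "u < m" "m < v" "v \<le> t" for u m v
      by (rule Th_defect[OF K st(1) that st(3)])
  qed (use expo ab0 CW0 C1_nonneg C3_nonneg N in auto)
  also have "\<dots> = norm E * (Cb * N * ((t - s) powr (\<alpha> - \<beta>) * (t - s) powr (\<alpha> + 2 * \<beta>)))"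
    using st by (simp add: weight_def Cb_def mult_ac)
  also have "(t - s) powr (\<alpha> - \<beta>) * (t - s) powr (\<alpha> + 2 * \<beta>) = (t - s) powr (2 * \<alpha> + \<beta>)"
    by (simp add: powr_add[symmetric] algebra_simps)
  finally have 1: "norm (pb t s E K - Th s E K t s) \<le> norm E * (Cb * N * (t - s) powr (2 * \<alpha> + \<beta>))" .
  have "E 0 = 0" by (rule blinfun.zero_right)
  moreover have "W t s 0 = 0" using W_scale[of t s 0 0] by simp
  ultimately have Th: "Th s E K t s = pc t s E K" by (simp add: Th_def)
  have "norm (pb t s E K) \<le> norm (pb t s E K - Th s E K t s) + norm (Th s E K t s)"
    by (metis diff_add_cancel norm_triangle_ineq)
  also have "\<dots> \<le> norm E * (Cb * N * (t - s) powr (2 * \<alpha> + \<beta>)) + Cc * norm E * norm K * (t - s) powr (2 * \<alpha>)"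
    using 1 pc_bound[OF st(1) st' st(3), of E K] by (intro add_mono) (simp_all only: Th)
  finally show ?thesis by (simp add: algebra_simps)
qed

lemma sew_sum_cong:
  assumes "p \<in> partitions s t" "\<And>u v. s \<le> u \<Longrightarrow> u < v \<Longrightarrow> v \<le> t \<Longrightarrow> \<Xi> v u = \<Psi> v u"
  shows "sew_sum S \<Xi> t p = sew_sum S \<Psi> t p"
  using assms by (induction rule: partitions_induct) (auto simp: sew_sum_Cons2)

lemma tendsto_sew_sum_cong:
  assumes "\<And>u v. s \<le> u \<Longrightarrow> u < v \<Longrightarrow> v \<le> t \<Longrightarrow> \<Xi> v u = \<Psi> v u"
  shows "(sew_sum S \<Xi> t \<longlongrightarrow> L) (mesh_filter s t) \<longleftrightarrow> (sew_sum S \<Psi> t \<longlongrightarrow> L) (mesh_filter s t)"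
  by (rule tendsto_cong) (use sew_sum_cong[OF _ assms] in \<open>auto simp: eventually_mesh_filter intro!: exI[of _ 1]\<close>)

lemma pb_diff:
  assumes K: "fav K N" "fav K' N'" and st: "0 \<le> s" "s \<le> t" "t \<le> T"
  shows "pb t s E (K - K') = pb t s E K - pb t s E K'"
proof -
  have "(sew_sum S (\<lambda>v u. Th s E K v u - Th s E K' v u) t \<longlongrightarrow> pb t s E K - pb t s E K') (mesh_filter s t)"
    using tendsto_diff[OF pb_limit[OF K(1) st, of E] pb_limit[OF K(2) st, of E]] by (simp only: sew_sum_diff_fun)
  moreover have "Th s E (K - K') v u = Th s E K v u - Th s E K' v u" if "s \<le> u" "u < v" "v \<le> t" for u v
    using that st by (simp add: Th_def pc_diff W_diff blinfun.diff_right)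
  ultimately have "(sew_sum S (Th s E (K - K')) t \<longlongrightarrow> pb t s E K - pb t s E K') (mesh_filter s t)"
    using tendsto_sew_sum_cong[of s t "Th s E (K - K')" "\<lambda>v u. Th s E K v u - Th s E K' v u"] by blast
  then show ?thesis
    unfolding pb_def by (rule tendsto_Lim[OF mesh_filter_nontrivial[OF st(2)]])
qed

text \<open>From \<open>m\<close> on, \<open>W u s K = W u m K + S (u - m) (W m s K)\<close>. The
  first summand reproduces the germ started at \<open>m\<close>, the second is the germ of
  \<open>pa\<close> at \<open>x = W m s K\<close>.\<close>

lemma pb_chen:
  assumes K: "fav K N" and s: "0 \<le> s" "s \<le> m" "m \<le> t" "t \<le> T"
  shows "pb t s E K = pb t m E K + pa t m E (W m s K) + S (t - m) (pb m s E K)"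
proof (rule sew_limit_split[OF s(2,3)])
  show "(sew_sum S (Th s E K) t \<longlongrightarrow> pb t s E K) (mesh_filter s t)"
    using s by (intro pb_limit[OF K]) auto
  show "(sew_sum S (Th s E K) m \<longlongrightarrow> pb m s E K) (mesh_filter s m)"
    using s by (intro pb_limit[OF K]) auto
  have m0: "0 \<le> m" using s by simp
  have "(sew_sum S (\<lambda>v u. Th m E K v u + W v u (E (S (u - m) (W m s K)))) t \<longlongrightarrow> pb t m E K + pa t m E (W m s K)) (mesh_filter m t)"
    using tendsto_add[OF pb_limit[OF K m0 s(3,4), of E] pa_limit[OF m0 s(3,4), of E "W m s K"]] by (simp only: sew_sum_add_fun)
  moreover have "Th s E K v u = Th m E K v u + W v u (E (S (u - m) (W m s K)))" if "m \<le> u" "u < v" "v \<le> t" for u v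
    using W_chen[of s m u K] W_add[of u v "E (W u m K)" "E (S (u - m) (W m s K))"] that s
    by (simp add: Th_def blinfun.add_right)
  ultimately show "(sew_sum S (Th s E K) t \<longlongrightarrow> pb t m E K + pa t m E (W m s K)) (mesh_filter m t)"
    using tendsto_sew_sum_cong[of m t "Th s E K" "\<lambda>v u. Th m E K v u + W v u (E (S (u - m) (W m s K)))"] by blast
qed

end

section \<open>Fixed points as solutions\<close>

locale rough_generator = rough_setup S M AS tens \<omega> \<omega>2 \<alpha> \<beta> T H
  for S :: "real \<Rightarrow> 'w::{banach,second_countable_topology} \<Rightarrow>\<^sub>L 'w" and M AS
    and tens :: "'v::real_normed_vector \<Rightarrow> 'v \<Rightarrow> 't::banach"
    and \<omega> :: "real \<Rightarrow> 'v" and \<omega>2 :: "real \<Rightarrow> real \<Rightarrow> 't" and \<alpha> \<beta> T H +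
  fixes A :: "'w \<Rightarrow> 'w" and Q :: "'w \<Rightarrow>\<^sub>L 'w"
  assumes AS_A: "0 < t \<Longrightarrow> AS t x = A (S t x)" and A_Q: "A (Q y) = y" and Q_AS: "0 < t \<Longrightarrow> Q (AS t x) = S t x"
begin

text \<open>Since \<open>S (t - r) = Q (AS (t - r))\<close> for \<open>r < t\<close>, the bounded
  operator \<open>Q\<close> can be pulled out and is then cancelled by \<open>A\<close>.\<close>

lemma A_integral:
  assumes "set_integrable lborel {s<..<t} (\<lambda>r. AS (t - r) (y r))"
  shows "A (LINT r:{s..t}|lborel. S (t - r) (y r)) = (LINT r:{s<..<t}|lborel. AS (t - r) (y r))"
proof -
  have "(LINT r:{s..t}|lborel. S (t - r) (y r)) = (LINT r:{s<..<t}|lborel. Q (AS (t - r) (y r)))"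
    unfolding set_integral_Icc_Ioo(1) by (rule set_lebesgue_integral_cong) (auto simp: Q_AS)
  also have "\<dots> = Q (LINT r:{s<..<t}|lborel. AS (t - r) (y r))" by (rule set_integral_blinfun(1)[OF assms])
  finally show ?thesis by (simp add: A_Q)
qed

lemma omS_eq: "0 \<le> s \<Longrightarrow> s \<le> t \<Longrightarrow> t \<le> T \<Longrightarrow> omS S A \<omega> t s K = W t s K"
  unfolding omS_def W_def by (simp add: A_integral[OF W_integrand(1)])

lemma proc_c_eq: "proc_c tens S A \<omega> \<omega>2 t s E K = pc t s E K"
proof -
  let ?f = "\<lambda>r. tensor_lift tens (E o\<^sub>L K) (\<omega>2 t r + tens (\<omega> r - \<omega> s) (\<omega> t - \<omega> r))"
  have "(LINT r:{s..t}|lborel. A (S (t - r) (?f r))) = (LINT r:{s<..<t}|lborel. AS (t - r) (?f r))"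
    unfolding set_integral_Icc_Ioo(1) by (rule set_lebesgue_integral_cong) (auto simp: AS_A)
  then show ?thesis by (simp add: proc_c_def pc_def)
qed

lemma proc_a_eq:
  assumes st: "0 \<le> s" "s < t" "t \<le> T"
  shows "proc_a S A \<omega> t s E x = pa t s E x"
proof -
  define g where "g r = S (t - r) (Wb r s (E (AS (r - s) x)))" for r
  have st': "s \<le> t" using st by simp
  note gi = pa_integrable(1)[OF st(1) st' st(3), of E x, folded g_def]
  define L where "L = Wb t s o\<^sub>L E"
  have L: "L y = W t s (E y)" for y using st by (simp add: L_def Wb_apply)
  \<comment> \<open>For \<open>q > s\<close> the integrand is an exact derivative, bounded operator
    \<open>L\<close> applied to \<open>AS (r - s) x\<close>, minus a function integrable up to
    \<open>s\<close>; so the improper limit exists.\<close>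
  have eq: "(LINT r:{q..t}|lborel. omS S A \<omega> t r (E (A (S (r - s) x)))) =
      L (S (t - s) x - S (q - s) x) - (LINT r:{q..t}|lborel. g r)" if q: "s < q" "q < t" for q
  proof -
    note i4 = integral_AS_forward[of s q t x]
    have gi': "set_integrable lborel {q<..<t} g" by (rule set_integrable_subset[OF gi]) (use q in auto)
    have "(LINT r:{q<..<t}|lborel. omS S A \<omega> t r (E (A (S (r - s) x)))) = (LINT r:{q<..<t}|lborel. L (AS (r - s) x) - g r)"
    proof (rule set_lebesgue_integral_cong)
      show "\<forall>r. r \<in> {q<..<t} \<longrightarrow> omS S A \<omega> t r (E (A (S (r - s) x))) = L (AS (r - s) x) - g r"
      proof (intro allI impI)
        fix r assume r: "r \<in> {q<..<t}"
        then show "omS S A \<omega> t r (E (A (S (r - s) x))) = L (AS (r - s) x) - g r"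
          using W_chen[of s r t "E (AS (r - s) x)"] q st
          by (simp add: omS_eq L g_def Wb_apply AS_A[symmetric])
      qed
    qed simp
    also have "\<dots> = (LINT r:{q<..<t}|lborel. L (AS (r - s) x)) - (LINT r:{q<..<t}|lborel. g r)"
      using q by (intro set_integral_diff(2) set_integral_blinfun(2) i4(1) gi') auto
    also have "(LINT r:{q<..<t}|lborel. L (AS (r - s) x)) = L (S (t - s) x - S (q - s) x)"
      using set_integral_blinfun(1)[OF i4(1), of L] i4(2) q by simp
    finally show ?thesis by (simp only: set_integral_Icc_Ioo(1))
  qed
  have lim: "((\<lambda>q. L (S (t - s) x - S (q - s) x) - (LINT r:{q..t}|lborel. g r)) \<longlongrightarrow>
      L (S (t - s) x - x) - (LINT r:{s<..t}|lborel. g r)) (at_right s)"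
  proof (intro tendsto_diff blinfun.tendsto tendsto_const)
    have "((\<lambda>t. S t x) \<longlongrightarrow> S 0 x) (at_right 0)"
      using S_cont[of x] by (auto simp: continuous_on_def at_within_Ici_at_right dest!: bspec[of _ _ 0])
    then have "((\<lambda>t. S t x) \<longlongrightarrow> x) (at_right 0)" by simp
    moreover have "filterlim (\<lambda>q. q - s) (at_right 0) (at_right s)"
      by (simp add: at_right_to_0[of s] filterlim_filtermap add.commute) (simp add: filterlim_def filtermap_ident)
    ultimately show "((\<lambda>q. S (q - s) x) \<longlongrightarrow> x) (at_right s)" by (rule filterlim_compose)
    show "((\<lambda>q. LINT r:{q..t}|lborel. g r) \<longlongrightarrow> (LINT r:{s<..t}|lborel. g r)) (at_right s)"
      using gi by (intro tendsto_set_lebesgue_integral_at_right st) (auto simp: set_integral_Icc_Ioo)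
  qed
  have "\<forall>\<^sub>F q in at_right s. q < t" using st by (intro eventually_at_right_real[THEN eventually_mono]) auto
  then have ev: "\<forall>\<^sub>F q in at_right s. L (S (t - s) x - S (q - s) x) - (LINT r:{q..t}|lborel. g r) =
      (LINT r:{q..t}|lborel. omS S A \<omega> t r (E (A (S (r - s) x))))"
    using eventually_at_right_less[of s] by eventually_elim (simp add: eq)
  have "Lim (at_right s) (\<lambda>q. LINT r:{q..t}|lborel. omS S A \<omega> t r (E (A (S (r - s) x)))) =
      L (S (t - s) x - x) - (LINT r:{s<..t}|lborel. g r)"
    by (rule tendsto_Lim[OF trivial_limit_at_right_real Lim_transform_eventually[OF lim ev]])
  then show ?thesis
    using st by (simp add: proc_a_def omS_eq pa_def g_def[abs_def] set_integral_Icc_Ioo(2) L blinfun.diff_right W_diff)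
qed

lemma proc_b_eq:
  assumes K: "fav K N" and st: "0 \<le> s" "s < t" "t \<le> T"
  shows "proc_b tens S A \<omega> \<omega>2 t s E K = pb t s E K"
proof -
  have "(sew_sum S (\<lambda>v u. omS S A \<omega> v u (E (omS S A \<omega> u s K)) + proc_c tens S A \<omega> \<omega>2 v u E K) t \<longlongrightarrow> pb t s E K) (mesh_filter s t)"
  proof (subst tendsto_sew_sum_cong)
    show "(sew_sum S (Th s E K) t \<longlongrightarrow> pb t s E K) (mesh_filter s t)"
      using st by (intro pb_limit[OF K]) auto
    show "omS S A \<omega> v u (E (omS S A \<omega> u s K)) + proc_c tens S A \<omega> \<omega>2 v u E K = Th s E K v u"
      if "s \<le> u" "u < v" "v \<le> t" for u v
      using that st by (simp add: Th_def omS_eq proc_c_eq)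
  qed
  then show ?thesis
    unfolding proc_b_def using st by (intro tendsto_Lim mesh_filter_nontrivial) auto
qed

lemma sewing_cong:
  assumes "\<And>u v. 0 \<le> u \<Longrightarrow> u < v \<Longrightarrow> v \<le> T \<Longrightarrow> \<Xi> v u = \<Psi> v u"
  shows "sewing S T \<Xi> = sewing S T \<Psi>"
proof -
  have "(sew_sum S \<Xi> t \<longlongrightarrow> L) (mesh_filter s t) \<longleftrightarrow> (sew_sum S \<Psi> t \<longlongrightarrow> L) (mesh_filter s t)"
    if "0 \<le> s \<and> s \<le> t \<and> t \<le> T" for s t L
    using that by (intro tendsto_sew_sum_cong assms) auto
  then have "(\<lambda>I. I 0 = 0 \<and> (\<forall>t. t \<notin> {0..T} \<longrightarrow> I t = 0) \<and> (\<forall>s t. 0 \<le> s \<and> s \<le> t \<and> t \<le> T \<longrightarrow>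
        (sew_sum S \<Xi> t \<longlongrightarrow> I t - S (t - s) (I s)) (mesh_filter s t))) =
     (\<lambda>I. I 0 = 0 \<and> (\<forall>t. t \<notin> {0..T} \<longrightarrow> I t = 0) \<and> (\<forall>s t. 0 \<le> s \<and> s \<le> t \<and> t \<le> T \<longrightarrow>
        (sew_sum S \<Psi> t \<longlongrightarrow> I t - S (t - s) (I s)) (mesh_filter s t)))"
    by (auto simp: fun_eq_iff)
  then show ?thesis unfolding sewing_def by (rule arg_cong)
qed

text \<open>Up to constants the minimum of 1 and \<open>((t - s) / s) powr \<beta>\<close>, so a
  single bound by \<open>qp\<close> expresses the unweighted and the weighted norm and makes sense
  at \<open>s = 0\<close>.\<close>

definition qp :: "real \<Rightarrow> real \<Rightarrow> real" where
  "qp t s = ((t - s) / t) powr \<beta>"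

lemma qp_nonneg: "0 \<le> qp t s"
  by (simp add: qp_def)

lemma qp_le_1: "0 \<le> s \<Longrightarrow> s < t \<Longrightarrow> qp t s \<le> 1"
  unfolding qp_def using ab0 by (intro powr_le1) auto

lemma qp_mono:
  assumes "0 \<le> u" "u < m" "m < v"
  shows "qp m u \<le> qp v u" "qp v m \<le> qp v u"
proof -
  have "u / v \<le> u / m" using assms by (intro divide_left_mono) auto
  then have "(m - u) / m \<le> (v - u) / v" using assms by (simp add: diff_divide_distrib)
  then show "qp m u \<le> qp v u" unfolding qp_def using assms ab0 by (intro powr_mono2) auto
  show "qp v m \<le> qp v u" unfolding qp_def using assms ab0 by (intro powr_mono2 divide_right_mono) auto
qed

lemma weight_ab: "weight \<alpha> \<beta> t s = (t - s) powr \<alpha> * qp t s"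
  and weight_2ab: "weight (2 * \<alpha>) \<beta> t s = (t - s) powr \<alpha> * (t - s) powr \<alpha> * qp t s"
  and weight_a2b: "weight \<alpha> (2 * \<beta>) t s = (t - s) powr \<alpha> * (qp t s * qp t s)"
  by (simp_all add: weight_def qp_def powr_add[symmetric])

lemma powr_le_T:
  assumes "0 \<le> x" "x \<le> T" "0 \<le> c" "c \<le> 1"
  shows "x powr c \<le> 1 + T"
proof (cases "x \<le> 1")
  case True
  then have "x powr c \<le> 1" using assms by (intro powr_le1) auto
  then show ?thesis using T by simp
next
  case False
  then have "x powr c \<le> x powr 1" using assms by (intro powr_mono) auto
  then show ?thesis using False assms by simp
qed

text \<open>Converts a plain gain of order \<beta> into the weight, at the cost of a constant
  depending only on \<open>T\<close>.\<close>

lemma powr_le_qp: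
  assumes "0 \<le> s" "s < t" "t \<le> T"
  shows "(t - s) powr \<beta> \<le> (1 + T) * qp t s"
proof -
  have "(t - s) powr \<beta> = t powr \<beta> * qp t s" using assms by (simp add: qp_def powr_divide)
  also have "\<dots> \<le> (1 + T) * qp t s"
    using assms ab0 by (intro mult_right_mono powr_le_T qp_nonneg) auto
  finally show ?thesis .
qed

text \<open>The unweighted bound serves when \<open>t - s \<ge> s\<close>, where
  \<open>(t - s) / t \<ge> 1 / 2\<close>, and the weighted one otherwise, where \<open>s\<close> and
  \<open>t\<close> are comparable. The factor 2 covers \<open>2 powr \<beta>\<close>.\<close>

lemma qp_interpolate:
  assumes st: "0 \<le> s" "s < t" and 1: "X \<le> c" and 2: "0 < s \<Longrightarrow> X \<le> c' * ((t - s) / s) powr \<beta>"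
    and c: "0 \<le> c" "0 \<le> c'"
  shows "X \<le> 2 * (c + c') * qp t s"
proof -
  have two: "(2::real) powr \<beta> \<le> 2"
    using powr_mono[of \<beta> 1 "2::real"] ab0 by simp
  show ?thesis
  proof (cases "t - s < s")
    case False
    then have "1 / 2 \<le> (t - s) / t" using st by (simp add: field_simps)
    then have "(1 / 2) powr \<beta> \<le> qp t s" unfolding qp_def using ab0 by (intro powr_mono2) auto
    then have "1 \<le> 2 powr \<beta> * qp t s" by (simp add: powr_divide field_simps)
    also have "\<dots> \<le> 2 * qp t s" using two qp_nonneg by (intro mult_right_mono) auto
    finally have "c * 1 \<le> c * (2 * qp t s)" using c by (intro mult_left_mono)
    also have "\<dots> \<le> 2 * (c + c') * qp t s" using c qp_nonneg[of t s] by (simp add: algebra_simps)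
    finally show ?thesis using 1 by simp
  next
    case True
    then have s: "0 < s" using st by linarith
    have "(t - s) / s \<le> 2 * ((t - s) / t)"
    proof -
      have "(t - s) / s \<le> (t - s) / (t / 2)" using True s st by (intro divide_left_mono) auto
      then show ?thesis by (metis divide_divide_eq_right mult.commute times_divide_eq_right)
    qed
    then have "((t - s) / s) powr \<beta> \<le> (2 * ((t - s) / t)) powr \<beta>" using s st ab0 by (intro powr_mono2) auto
    also have "\<dots> = 2 powr \<beta> * qp t s" unfolding qp_def using st by (subst powr_mult) auto
    also have "\<dots> \<le> 2 * qp t s" using two qp_nonneg by (intro mult_right_mono) auto
    finally have "c' * ((t - s) / s) powr \<beta> \<le> c' * (2 * qp t s)" using c by (intro mult_left_mono)
    also have "\<dots> \<le> 2 * (c + c') * qp t s" using c qp_nonneg[of t s] by (simp add: algebra_simps)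
    finally show ?thesis using 2[OF s] by simp
  qed
qed

end

locale rough_equation = rough_generator S M AS tens \<omega> \<omega>2 \<alpha> \<beta> T H A Q
  for S :: "real \<Rightarrow> 'w::{banach,second_countable_topology} \<Rightarrow>\<^sub>L 'w" and M AS
    and tens :: "'v::real_normed_vector \<Rightarrow> 'v \<Rightarrow> 't::banach"
    and \<omega> :: "real \<Rightarrow> 'v" and \<omega>2 :: "real \<Rightarrow> real \<Rightarrow> 't" and \<alpha> \<beta> T H A Q +
  fixes G :: "'w \<Rightarrow> 'v \<Rightarrow>\<^sub>L 'w" and \<xi> :: 'w and L :: real
  assumes L0: "0 \<le> L"
    and G_lip: "norm (G x - G x') \<le> L * norm (x - x')"
    and DG_bound: "norm (Dop G x) \<le> L"
    and DG_lip: "norm (Dop G x - Dop G x') \<le> L * norm (x - x')"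
    and G_inc: "norm (G (a + p) - G a - (G (b + q) - G b)) \<le> L * (norm (p - q) + norm p * norm (a - b))"
    and DG_inc: "norm (Dop G (a + p) - Dop G a - (Dop G (b + q) - Dop G b)) \<le> L * (norm (p - q) + norm p * norm (a - b))"
    and G_rem: "norm ((G (a + p) - G a - Dop G a p) - (G (b + q) - G b - Dop G b q))
        \<le> L * (norm (p - q) * (norm p + norm q) + norm (a - b) * (norm p)\<^sup>2)"
    and G_fav_diff: "fav (G x - G x') (L * norm (x - x'))"
    and G_fav: "\<exists>N. fav (G x) N"
begin

definition XiY :: "(real \<Rightarrow> 'w) \<Rightarrow> (real \<Rightarrow> real \<Rightarrow> ('w \<Rightarrow>\<^sub>L 'v \<Rightarrow>\<^sub>L 'w) \<Rightarrow>\<^sub>L 'w) \<Rightarrow> real \<Rightarrow> real \<Rightarrow> 'w" where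
  "XiY y z v u = W v u (G (y u)) + z v u (Dop G (y u))"

definition XiZ :: "(real \<Rightarrow> 'w) \<Rightarrow> ('w \<Rightarrow>\<^sub>L 'v \<Rightarrow>\<^sub>L 'w) \<Rightarrow> real \<Rightarrow> real \<Rightarrow> 'w" where
  "XiZ y E v u = pb v u E (G (y u)) + pa v u E (y u)"

definition rem :: "'w \<Rightarrow> 'w \<Rightarrow> 'v \<Rightarrow>\<^sub>L 'w" where
  "rem x x' = G x' - G x - Dop G x (x' - x)"

lemma rem_diff:
  "norm (rem a a' - rem b b') \<le> L * (norm ((a' - a) - (b' - b)) * (norm (a' - a) + norm (b' - b)) + norm (a - b) * (norm (a' - a))\<^sup>2)"
  using G_rem[of a "a' - a" b "b' - b"] by (simp add: rem_def)

lemma rem_bound: "norm (rem a a') \<le> L * (norm (a' - a))\<^sup>2"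
  using rem_diff[of a a' a a] by (simp add: rem_def blinfun.zero_right power2_eq_square)

end

text \<open>Collects what the estimates use about a fixed point, with the processes in their
  integrated form. The constant \<open>C\<close> is a parameter so that two fixed points can share
  it.\<close>

locale solution = rough_equation S M AS tens \<omega> \<omega>2 \<alpha> \<beta> T H A Q G \<xi> L
  for S :: "real \<Rightarrow> 'w::{banach,second_countable_topology} \<Rightarrow>\<^sub>L 'w" and M AS
    and tens :: "'v::real_normed_vector \<Rightarrow> 'v \<Rightarrow> 't::banach"
    and \<omega> :: "real \<Rightarrow> 'v" and \<omega>2 :: "real \<Rightarrow> real \<Rightarrow> 't" and \<alpha> \<beta> T H A Q
    and G :: "'w \<Rightarrow> 'v \<Rightarrow>\<^sub>L 'w" and \<xi> :: 'w and L +
  fixes y :: "real \<Rightarrow> 'w" and z :: "real \<Rightarrow> real \<Rightarrow> ('w \<Rightarrow>\<^sub>L 'v \<Rightarrow>\<^sub>L 'w) \<Rightarrow>\<^sub>L 'w" and C :: real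
  assumes C0: "0 \<le> C"
    and y_bound: "\<And>t. 0 \<le> t \<Longrightarrow> t \<le> T \<Longrightarrow> norm (y t) \<le> C"
    and y_holder: "\<And>s t. 0 \<le> s \<Longrightarrow> s < t \<Longrightarrow> t \<le> T \<Longrightarrow> norm (y t - y s) \<le> C * qp t s"
    and z_holder: "\<And>s t. 0 \<le> s \<Longrightarrow> s < t \<Longrightarrow> t \<le> T \<Longrightarrow> norm (z t s) \<le> C * weight \<alpha> \<beta> t s"
    and z_chen: "\<And>s m t E. 0 \<le> s \<Longrightarrow> s < m \<Longrightarrow> m < t \<Longrightarrow> t \<le> T \<Longrightarrow>
      z t s E - z t m E - S (t - m) (z m s E) = W t m (E (y m - y s))"
    and y_eq: "\<And>t. 0 \<le> t \<Longrightarrow> t \<le> T \<Longrightarrow> y t = S t \<xi> + sewing S T (XiY y z) t"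
    and z_eq: "\<And>s t E. 0 \<le> s \<Longrightarrow> s < t \<Longrightarrow> t \<le> T \<Longrightarrow>
      z t s E = sewing S T (XiZ y E) t - S (t - s) (sewing S T (XiZ y E) s) - W t s (E (y s))"
begin

text \<open>The Chen relation of \<open>z\<close> supplies \<open>W v m\<close> of the linear term
  \<open>Dop G (y u) (y m - y u)\<close>. It cancels the first-order part of
  \<open>G (y m) - G (y u)\<close> and leaves the quadratic remainder; this cancellation is the
  purpose of carrying \<open>z\<close>.\<close>

lemma XiY_defect_eq:
  assumes u: "0 \<le> u" "u < m" "m < v" "v \<le> T"
  shows "XiY y z v u - XiY y z v m - S (v - m) (XiY y z m u) =
    - (W v m (rem (y u) (y m)) + z v m (Dop G (y m) - Dop G (y u)))"
proof -
  have le: "u \<le> m" "m \<le> v" "0 \<le> m" "u \<le> v" using u by auto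
  have "z v u (Dop G (y u)) = z v m (Dop G (y u)) + S (v - m) (z m u (Dop G (y u))) + W v m (Dop G (y u) (y m - y u))"
    using z_chen[OF u, of "Dop G (y u)"] by (simp add: algebra_simps)
  then show ?thesis
    using W_chen[OF u(1) le(1,2) u(4), of "G (y u)"]
    by (simp add: XiY_def rem_def W_diff[OF le(3,2) u(4)] blinfun.add_right blinfun.diff_right)
qed

text \<open>The term \<open>pa v m E (W m u (G (y u)))\<close> from \<open>pb_chen\<close> combines
  with the defect of \<open>pa\<close>, so that only the remainder in the first-order expansion of
  \<open>y\<close> enters.\<close>

lemma XiZ_defect_eq:
  assumes u: "0 \<le> u" "u < m" "m < v" "v \<le> T"
  shows "XiZ y E v u - XiZ y E v m - S (v - m) (XiZ y E m u) =
    - (pa v m E (y m - S (m - u) (y u) - W m u (G (y u))) + pb v m E (G (y m) - G (y u)))"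
proof -
  have le: "u \<le> m" "m \<le> v" "0 \<le> m" "u \<le> v" using u by auto
  obtain N where N: "fav (G (y u)) N" using G_fav by blast
  obtain N' where N': "fav (G (y m)) N'" using G_fav by blast
  show ?thesis
    using pb_chen[OF N u(1) le(1,2) u(4), of E] pa_chen[OF u(1) le(1,2) u(4), of E "y u"]
      pb_diff[OF N' N le(3,2) u(4), of E]
    unfolding XiZ_def pa_diff[OF le(3,2) u(4)] blinfun.add_right by (simp add: algebra_simps)
qed

definition cY :: real where
  "cY = CW * L * C * C + C * L * C"

lemma cY0: "0 \<le> cY"
  using CW0 L0 C0 by (simp add: cY_def)

text \<open>Each product contains two increments weighted by \<open>qp\<close>, hence the exponent
  \<open>2 * \<beta>\<close>; the germ is sewable because \<alpha> + 2 \<beta> > 1.\<close>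

lemma XiY_defect:
  assumes u: "0 \<le> u" "u < m" "m < v" "v \<le> T"
  shows "norm (XiY y z v u - XiY y z v m - S (v - m) (XiY y z m u)) \<le> cY * weight \<alpha> (2 * \<beta>) v u"
proof -
  have le: "0 \<le> m" "m \<le> v" "m \<le> T" using u by auto
  have p: "(v - m) powr \<alpha> \<le> (v - u) powr \<alpha>" using u ab0 by (intro powr_mono2) auto
  have dy: "norm (y m - y u) \<le> C * qp v u"
    using y_holder[OF u(1,2) le(3)] mult_left_mono[OF qp_mono(1)[OF u(1-3)] C0] by linarith
  have "(norm (y m - y u))\<^sup>2 \<le> (C * qp v u)\<^sup>2" using dy by (intro power_mono) auto
  then have "norm (rem (y u) (y m)) \<le> L * (C * qp v u)\<^sup>2"
    using rem_bound[of "y u" "y m"] mult_left_mono[OF _ L0] order_trans by blast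
  then have "norm (W v m (rem (y u) (y m))) \<le> CW * (L * (C * qp v u)\<^sup>2) * (v - u) powr \<alpha>"
    using p CW0 L0 by (intro order_trans[OF W_bound[OF le(1,2) u(4)]] mult_mono) auto
  moreover have "norm (z v m (Dop G (y m) - Dop G (y u))) \<le> (C * ((v - u) powr \<alpha> * qp v u)) * (L * (C * qp v u))"
  proof -
    have "norm (z v m) \<le> C * ((v - u) powr \<alpha> * qp v u)"
      using z_holder[OF le(1) u(3,4)] p qp_mono(2)[OF u(1-3)] C0 qp_nonneg
      unfolding weight_ab by (elim order_trans) (intro mult_left_mono mult_mono; simp)
    moreover have "norm (Dop G (y m) - Dop G (y u)) \<le> L * (C * qp v u)"
      using DG_lip[of "y m" "y u"] mult_left_mono[OF dy L0] by linarith
    ultimately show ?thesis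
      using C0 qp_nonneg by (intro order_trans[OF norm_blinfun] mult_mono) auto
  qed
  ultimately have "norm (W v m (rem (y u) (y m)) + z v m (Dop G (y m) - Dop G (y u))) \<le>
      CW * (L * (C * qp v u)\<^sup>2) * (v - u) powr \<alpha> + (C * ((v - u) powr \<alpha> * qp v u)) * (L * (C * qp v u))"
    by (rule norm_triangle_mono)
  then show ?thesis
    unfolding XiY_defect_eq[OF u] norm_minus_cancel weight_a2b cY_def by (simp add: algebra_simps power2_eq_square)
qed

text \<open>The contribution of \<xi> cancels in \<open>y t - S (t - s) (y s)\<close> by the
  semigroup law.\<close>

lemma sewing_Y:
  assumes st: "0 \<le> s" "s \<le> t" "t \<le> T"
  shows "(sew_sum S (XiY y z) t \<longlongrightarrow> y t - S (t - s) (y s)) (mesh_filter s t)"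
proof -
  have "\<exists>L. (sew_sum S (XiY y z) t \<longlongrightarrow> L) (mesh_filter s t)" if "0 \<le> s" "s \<le> t" "t \<le> T" for s t
  proof (rule weight_sew_exists[OF that(2,1) ab0(1), of "2 * \<beta>" cY "XiY y z"])
    show "norm (XiY y z v u - XiY y z v m - S (v - m) (XiY y z m u)) \<le> cY * weight \<alpha> (2 * \<beta>) (v - 0) (u - 0)"
      if "s \<le> u" "u < m" "m < v" "v \<le> t" for u m v
      using XiY_defect[of u m v] that \<open>0 \<le> s\<close> \<open>t \<le> T\<close> by simp
  qed (use expo ab0 cY0 in auto)
  from sewing_eqI(2)[OF less_imp_le[OF T] this st]
  have "(sew_sum S (XiY y z) t \<longlongrightarrow> sewing S T (XiY y z) t - S (t - s) (sewing S T (XiY y z) s)) (mesh_filter s t)" .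
  moreover have "y t - S (t - s) (y s) = sewing S T (XiY y z) t - S (t - s) (sewing S T (XiY y z) s)"
    using st by (simp add: y_eq blinfun.add_right S_comp)
  ultimately show ?thesis by simp
qed

definition cR :: real where
  "cR = wsew_const M \<alpha> (2 * \<beta>) * cY"

lemma cR0: "0 \<le> cR"
  using wsew_const_nonneg[of \<alpha> "2 * \<beta>"] ab0 expo cY0 by (simp add: cR_def)

lemma y_remainder:
  assumes st: "0 \<le> s" "s < t" "t \<le> T"
  shows "norm ((y t - S (t - s) (y s)) - XiY y z t s) \<le> cR * weight \<alpha> (2 * \<beta>) t s"
  using weight_sew_bound[OF sewing_Y[OF st(1) less_imp_le[OF st(2)] st(3)] st(2,1) ab0(1), of "2 * \<beta>" cY]
    XiY_defect st expo ab0 cY0 by (simp add: cR_def)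

definition cA :: real where
  "cA = C * L + cR"

lemma y_first_order:
  assumes st: "0 \<le> s" "s < t" "t \<le> T"
  shows "norm (y t - S (t - s) (y s) - W t s (G (y s))) \<le> cA * ((t - s) powr \<alpha> * qp t s)"
proof -
  have "y t - S (t - s) (y s) - W t s (G (y s)) = ((y t - S (t - s) (y s)) - XiY y z t s) + z t s (Dop G (y s))"
    by (simp add: XiY_def)
  moreover have "norm (z t s (Dop G (y s))) \<le> (C * ((t - s) powr \<alpha> * qp t s)) * L"
    using z_holder[OF st] DG_bound C0 qp_nonneg unfolding weight_ab
    by (intro order_trans[OF norm_blinfun] mult_mono) auto
  moreover have "norm ((y t - S (t - s) (y s)) - XiY y z t s) \<le> cR * ((t - s) powr \<alpha> * qp t s)"
  proof -
    have "qp t s * qp t s \<le> qp t s * 1" using qp_nonneg qp_le_1[OF st(1,2)] by (intro mult_left_mono) auto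
    then have "cR * ((t - s) powr \<alpha> * (qp t s * qp t s)) \<le> cR * ((t - s) powr \<alpha> * qp t s)"
      using cR0 by (intro mult_left_mono) auto
    then show ?thesis using y_remainder[OF st] unfolding weight_a2b by linarith
  qed
  ultimately have "norm (y t - S (t - s) (y s) - W t s (G (y s))) \<le>
      cR * ((t - s) powr \<alpha> * qp t s) + (C * ((t - s) powr \<alpha> * qp t s)) * L"
    by (simp only:) (rule norm_triangle_mono)
  then show ?thesis by (simp add: cA_def algebra_simps)
qed

lemma cA0: "0 \<le> cA"
  using C0 L0 cR0 by (simp add: cA_def)

text \<open>Increments corrected by the semigroup do not see the roughness of the initial value:
  order \<alpha> holds without weight up to time 0. This supplies the initial \<open>N\<close> of
  the iteration.\<close>

lemma y_hat_bound: "\<exists>c\<ge>0. \<forall>s t. 0 \<le> s \<longrightarrow> s < t \<longrightarrow> t \<le> T \<longrightarrow> norm (y t - S (t - s) (y s)) \<le> c * (t - s) powr \<alpha>"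
proof -
  define c where "c = cA + CW * (norm (G 0) + L * C)"
  have "norm (y t - S (t - s) (y s)) \<le> c * (t - s) powr \<alpha>" if st: "0 \<le> s" "s < t" "t \<le> T" for s t
  proof -
    have "norm (G (y s)) \<le> norm (G 0) + L * C"
    proof -
      have "norm (G (y s)) \<le> norm (G 0) + norm (G (y s) - G 0)" by (rule norm_triangle_sub)
      also have "norm (G (y s) - G 0) \<le> L * C"
        using G_lip[of "y s" 0] mult_left_mono[OF y_bound[of s] L0] st by simp
      finally show ?thesis by simp
    qed
    then have "norm (W t s (G (y s))) \<le> CW * (norm (G 0) + L * C) * (t - s) powr \<alpha>"
      using st CW0 by (intro order_trans[OF W_bound] mult_right_mono mult_left_mono) auto
    moreover have "cA * ((t - s) powr \<alpha> * qp t s) \<le> cA * ((t - s) powr \<alpha> * 1)"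
      using cA0 qp_le_1[OF st(1,2)] by (intro mult_left_mono) auto
    ultimately have "norm ((y t - S (t - s) (y s) - W t s (G (y s))) + W t s (G (y s))) \<le>
        cA * ((t - s) powr \<alpha> * 1) + CW * (norm (G 0) + L * C) * (t - s) powr \<alpha>"
      using y_first_order[OF st] by (intro norm_triangle_mono) auto
    then show ?thesis by (simp add: c_def algebra_simps)
  qed
  moreover have "0 \<le> c" using cA0 CW0 L0 C0 by (simp add: c_def)
  ultimately show ?thesis by blast
qed

text \<open>Here two factors of order \<alpha> meet a single weight of order \<beta>, and 2 \<alpha>
  + \<beta> > 1.\<close>

lemma XiZ_defect:
  "\<exists>c\<ge>0. \<forall>E u m v. 0 \<le> u \<longrightarrow> u < m \<longrightarrow> m < v \<longrightarrow> v \<le> T \<longrightarrow>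
    norm (XiZ y E v u - XiZ y E v m - S (v - m) (XiZ y E m u)) \<le> c * norm E * weight (2 * \<alpha>) \<beta> v u"
proof -
  define c where "c = Ca * cA + (Cc * (L * C) + Cb * (L * C) * (1 + T))"
  have c0: "0 \<le> c" using Ca_nonneg cA0 Cc_nonneg Cb_nonneg L0 C0 T by (simp add: c_def)
  have "norm (XiZ y E v u - XiZ y E v m - S (v - m) (XiZ y E m u)) \<le> c * norm E * weight (2 * \<alpha>) \<beta> v u"
    if u: "0 \<le> u" "u < m" "m < v" "v \<le> T" for E u m v
  proof -
    have le: "0 \<le> m" "m \<le> v" "m \<le> T" using u by auto
    define P where "P = (v - u) powr \<alpha>"
    have P: "0 \<le> P" "(v - m) powr \<alpha> \<le> P" "(m - u) powr \<alpha> \<le> P"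
      using u ab0 unfolding P_def by (auto intro!: powr_mono2)
    define q where "q = qp v u"
    have q: "0 \<le> q" "qp m u \<le> q" using qp_nonneg qp_mono[OF u(1-3)] by (auto simp: q_def)
    have "norm (y m - S (m - u) (y u) - W m u (G (y u))) \<le> cA * ((m - u) powr \<alpha> * qp m u)"
      by (rule y_first_order[OF u(1,2) le(3)])
    also have "\<dots> \<le> cA * (P * q)"
      using cA0 P q qp_nonneg by (intro mult_left_mono mult_mono) auto
    finally have \<rho>: "norm (y m - S (m - u) (y u) - W m u (G (y u))) \<le> cA * (P * q)" .
    have a: "norm (pa v m E (y m - S (m - u) (y u) - W m u (G (y u)))) \<le> Ca * norm E * (cA * (P * q)) * P"
      using P Ca_nonneg \<rho> cA0 q by (intro order_trans[OF pa_bound[OF le(1,2) u(4)]] mult_mono) auto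
    have dy: "norm (y m - y u) \<le> C * q"
      using y_holder[OF u(1,2) le(3)] mult_left_mono[OF q(2) C0] by linarith
    have K: "norm (G (y m) - G (y u)) \<le> L * (C * q)" "L * norm (y m - y u) \<le> L * (C * q)"
      using G_lip[of "y m" "y u"] mult_left_mono[OF dy L0] by linarith+
    have p2: "(v - m) powr (2 * \<alpha>) \<le> P * P" "(v - m) powr (2 * \<alpha> + \<beta>) \<le> P * P * (1 + T)"
    proof -
      have "(v - m) powr (2 * \<alpha>) = (v - m) powr \<alpha> * (v - m) powr \<alpha>" by (simp add: powr_add[symmetric])
      also have "\<dots> \<le> P * P" using P by (intro mult_mono) auto
      finally show p: "(v - m) powr (2 * \<alpha>) \<le> P * P" .
      have "(v - m) powr \<beta> \<le> 1 + T" using u ab0 by (intro powr_le_T) auto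
      then show "(v - m) powr (2 * \<alpha> + \<beta>) \<le> P * P * (1 + T)"
        unfolding powr_add using p P by (intro mult_mono) auto
    qed
    have "norm (pb v m E (G (y m) - G (y u))) \<le> norm E * (Cc * norm (G (y m) - G (y u)) * (v - m) powr (2 * \<alpha>) +
        Cb * (L * norm (y m - y u)) * (v - m) powr (2 * \<alpha> + \<beta>))"
      by (rule pb_bound[OF G_fav_diff le(1) u(3,4)])
    also have "\<dots> \<le> norm E * (Cc * (L * (C * q)) * (P * P) + Cb * (L * (C * q)) * (P * P * (1 + T)))"
      using K dy p2 Cc_nonneg Cb_nonneg L0 C0 q P by (intro mult_left_mono add_mono mult_mono) auto
    finally have b: "norm (pb v m E (G (y m) - G (y u))) \<le>
        norm E * (Cc * (L * (C * q)) * (P * P) + Cb * (L * (C * q)) * (P * P * (1 + T)))" .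
    show ?thesis
      unfolding XiZ_defect_eq[OF u] norm_minus_cancel
      using norm_triangle_mono[OF a b] unfolding weight_2ab P_def[symmetric] q_def[symmetric] c_def
      by (simp add: algebra_simps)
  qed
  then show ?thesis using c0 by blast
qed

lemma two_ab: "0 < 2 * \<alpha>" "1 < 2 * \<alpha> + \<beta>"
  using expo ab0 by auto

lemma sewing_Z:
  assumes st: "0 \<le> s" "s < t" "t \<le> T"
  shows "(sew_sum S (XiZ y E) t \<longlongrightarrow> z t s E + W t s (E (y s))) (mesh_filter s t)"
proof -
  obtain c where c: "0 \<le> c" "\<And>E u m v. 0 \<le> u \<Longrightarrow> u < m \<Longrightarrow> m < v \<Longrightarrow> v \<le> T \<Longrightarrow>
    norm (XiZ y E v u - XiZ y E v m - S (v - m) (XiZ y E m u)) \<le> c * norm E * weight (2 * \<alpha>) \<beta> v u"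
    using XiZ_defect by blast
  have "\<exists>L. (sew_sum S (XiZ y E) t \<longlongrightarrow> L) (mesh_filter s t)" if "0 \<le> s" "s \<le> t" "t \<le> T" for s t
  proof (rule weight_sew_exists[OF that(2,1) two_ab(1), of \<beta> "c * norm E" "XiZ y E"])
    show "norm (XiZ y E v u - XiZ y E v m - S (v - m) (XiZ y E m u)) \<le> c * norm E * weight (2 * \<alpha>) \<beta> (v - 0) (u - 0)"
      if "s \<le> u" "u < m" "m < v" "v \<le> t" for u m v
      using c(2)[of u m v E] that \<open>0 \<le> s\<close> \<open>t \<le> T\<close> by simp
  qed (use c two_ab ab0 in auto)
  from sewing_eqI(2)[OF less_imp_le[OF T] this st(1) less_imp_le[OF st(2)] st(3)]
  show ?thesis using z_eq[OF st, of E] by simp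
qed

end

section \<open>The difference of two solutions\<close>

locale two_solutions = rough_equation S M AS tens \<omega> \<omega>2 \<alpha> \<beta> T H A Q G \<xi> L +
    s1: solution S M AS tens \<omega> \<omega>2 \<alpha> \<beta> T H A Q G \<xi> L y1 z1 C +
    s2: solution S M AS tens \<omega> \<omega>2 \<alpha> \<beta> T H A Q G \<xi> L y2 z2 C
  for S :: "real \<Rightarrow> 'w::{banach,second_countable_topology} \<Rightarrow>\<^sub>L 'w" and M AS
    and tens :: "'v::real_normed_vector \<Rightarrow> 'v \<Rightarrow> 't::banach"
    and \<omega> :: "real \<Rightarrow> 'v" and \<omega>2 :: "real \<Rightarrow> real \<Rightarrow> 't" and \<alpha> \<beta> T H A Q
    and G :: "'w \<Rightarrow> 'v \<Rightarrow>\<^sub>L 'w" and \<xi> :: 'w and L y1 z1 y2 z2 C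
begin

definition Y :: "real \<Rightarrow> 'w" where
  "Y t = y1 t - y2 t"

text \<open>Constant in the Favard bound of \<open>Y\<close>. Like all constants that follow it is
  independent of \<tau>, \<open>h\<close>, \<open>N\<close> and \<eta>, which makes the step length
  uniform.\<close>

definition k1 :: real where
  "k1 = 1 + dyadic_const (\<alpha> - \<beta>) * (2 * M)"

definition k2 :: real where
  "k2 = (1 + k1) * (1 + T)"

definition kY :: real where
  "kY = CW * (L * k2 * (2 * C + C * C)) + C * (L * k2 * (1 + C)) + L * C"

definition k\<rho> :: real where
  "k\<rho> = wsew_const M \<alpha> (2 * \<beta>) * kY + C * (L * k2) + L"

definition kA :: real where
  "kA = CW * (L * k2) + k\<rho>"

definition kZ :: real where
  "kZ = Ca * (2 * k\<rho>) + (Cc * (L * k2 * (1 + C)) + Cb * (2 * L * k2) * (1 + T))"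

definition kB :: real where
  "kB = (CW + M * CW / (\<alpha> + \<beta>)) * ((1 + fav_const \<beta>) * k1) * (1 + T)"

definition kE :: real where
  "kE = wsew_const M (2 * \<alpha>) \<beta> * kZ + (Cc + Cb) * (L * k2) * (1 + T) + kB"

lemma constants_nonneg:
  "1 \<le> k1" "k1 \<le> k2" "1 \<le> k2" "0 \<le> kY" "0 \<le> k\<rho>" "0 \<le> kA" "0 \<le> kZ" "0 \<le> kB" "0 \<le> kE"
proof -
  show k1: "1 \<le> k1" using dyadic_const_nonneg[of "\<alpha> - \<beta>"] expo M0 by (simp add: k1_def)
  have "1 * k1 \<le> (1 + T) * (1 + k1)" using T k1 by (intro mult_mono) auto
  then show k12: "k1 \<le> k2" by (simp add: k2_def mult.commute)
  then show k2: "1 \<le> k2" using k1 by simp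
  have p: "0 \<le> C" "0 \<le> L" "0 \<le> k2" "0 \<le> k1" "0 \<le> 1 + T" using s1.C0 L0 k1 k2 T by auto
  show kY: "0 \<le> kY" using p CW0 by (simp add: kY_def)
  show kr: "0 \<le> k\<rho>"
    using p kY wsew_const_nonneg[of \<alpha> "2 * \<beta>"] ab0 expo by (simp add: k\<rho>_def)
  show "0 \<le> kA" using p kr CW0 by (simp add: kA_def)
  show kZ: "0 \<le> kZ" using p kr Ca_nonneg Cc_nonneg Cb_nonneg by (simp add: kZ_def)
  show kB: "0 \<le> kB" using p CW0 M0 ab0 fav_const0 by (simp add: kB_def)
  show "0 \<le> kE"
    using p kZ kB wsew_const_nonneg[of "2 * \<alpha>" \<beta>] ab0 s1.two_ab Cc_nonneg Cb_nonneg by (simp add: kE_def)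
qed

text \<open>\<open>Y\<close> is controlled through increments corrected by the semigroup, without
  weight, while \<open>Z\<close> keeps the weight attached to time 0. The two units \<open>N\<close>
  and \<eta> N are what the iteration balances.\<close>

definition close_on :: "real \<Rightarrow> real \<Rightarrow> real \<Rightarrow> real \<Rightarrow> bool" where
  "close_on \<tau> h N \<eta> \<longleftrightarrow> (\<forall>s t. \<tau> \<le> s \<longrightarrow> s < t \<longrightarrow> t \<le> \<tau> + h \<longrightarrow> t \<le> T \<longrightarrow>
     norm (Y t - S (t - s) (Y s)) \<le> N * (t - s) powr \<alpha> \<and>
     norm (z1 t s - z2 t s) \<le> \<eta> * N * weight \<alpha> \<beta> t s)"

definition eps :: "real \<Rightarrow> real" where
  "eps h = h powr (\<alpha> - \<beta>)"

section \<open>Improvement of the bounds on one window\<close>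

context
  fixes \<tau> h N \<eta> :: real
  assumes \<tau>: "0 \<le> \<tau>" and h: "0 < h" "h \<le> 1" and N: "0 \<le> N" and \<eta>: "0 \<le> \<eta>" "\<eta> \<le> 1"
    and Y\<tau>: "Y \<tau> = 0" and close: "close_on \<tau> h N \<eta>"
begin

abbreviation e :: real where
  "e \<equiv> eps h"

lemma e: "0 < e" "e \<le> 1" "h powr \<alpha> \<le> e"
proof -
  show "0 < e" using h by (simp add: eps_def)
  show "e \<le> 1" unfolding eps_def using h expo by (intro powr_le1) auto
  show "h powr \<alpha> \<le> e" unfolding eps_def using h ab0 by (intro powr_mono') auto
qed

lemma hat_Y: "\<tau> \<le> s \<Longrightarrow> s < t \<Longrightarrow> t \<le> \<tau> + h \<Longrightarrow> t \<le> T \<Longrightarrow> norm (Y t - S (t - s) (Y s)) \<le> N * (t - s) powr \<alpha>"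
  and Z_bound: "\<tau> \<le> s \<Longrightarrow> s < t \<Longrightarrow> t \<le> \<tau> + h \<Longrightarrow> t \<le> T \<Longrightarrow> norm (z1 t s - z2 t s) \<le> \<eta> * N * weight \<alpha> \<beta> t s"
  using close by (auto simp: close_on_def)

lemma Y_bound':
  assumes s: "\<tau> \<le> s" "s \<le> \<tau> + h" "s \<le> T"
  shows "norm (Y s) \<le> N * e"
proof (cases "s = \<tau>")
  case True
  then show ?thesis using Y\<tau> N e by simp
next
  case False
  then have "norm (Y s) \<le> N * (s - \<tau>) powr \<alpha>" using hat_Y[of \<tau> s] s Y\<tau> by (simp add: blinfun.zero_right)
  also have "\<dots> \<le> N * h powr \<alpha>" using s N ab0 by (intro mult_left_mono powr_mono2) auto
  also have "\<dots> \<le> N * e" using e N by (intro mult_left_mono)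
  finally show ?thesis .
qed

lemma Y_bound: "\<tau> \<le> s \<Longrightarrow> s \<le> \<tau> + h \<Longrightarrow> s \<le> T \<Longrightarrow> norm (Y s) \<le> k2 * (N * e)"
  using Y_bound'[of s] mult_right_mono[of 1 k2 "N * e"] constants_nonneg(3) N e by simp

lemma Y_favard:
  assumes s: "\<tau> \<le> s" "s \<le> \<tau> + h" "s \<le> T"
  shows "favard \<beta> (Y s) (k1 * (N * e))"
proof (cases "s = \<tau>")
  case True
  then show ?thesis using Y\<tau> N e constants_nonneg(1) by (simp add: favard_def blinfun.zero_right)
next
  case False
  then have lt: "\<tau> < s" using s by simp
  have d: "0 \<le> dyadic_const (\<alpha> - \<beta>)" using expo by (intro dyadic_const_nonneg) auto
  have "norm (S r (Y s) - Y s) \<le> k1 * (N * e) * r powr \<beta>" if r: "0 \<le> r" for r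
  proof -
    have "norm (S r (Y s) - Y s) \<le> dyadic_const (\<alpha> - \<beta>) * (2 * M * N * r powr \<beta>) * (s - \<tau>) powr (\<alpha> - \<beta>)"
      using s by (intro path_regularity lt Y\<tau> r N hat_Y) auto
    also have "\<dots> \<le> dyadic_const (\<alpha> - \<beta>) * (2 * M * N * r powr \<beta>) * e"
      unfolding eps_def using s lt d M0 N expo by (intro mult_left_mono powr_mono2) auto
    also have "\<dots> = dyadic_const (\<alpha> - \<beta>) * (2 * M) * (N * e * r powr \<beta>)" by simp
    also have "\<dots> \<le> k1 * (N * e * r powr \<beta>)"
      unfolding k1_def using N e by (intro mult_right_mono) auto
    finally show ?thesis by (simp only: mult.assoc)
  qed
  then show ?thesis by (simp add: favard_def)
qed

lemma powr_alpha_le: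
  assumes "s < t" "t - s \<le> h"
  shows "(t - s) powr \<alpha> \<le> e * (t - s) powr \<beta>" "(t - s) powr \<alpha> \<le> e" "(t - s) powr \<alpha> \<le> (t - s) powr \<beta>"
proof -
  have "(t - s) powr \<alpha> = (t - s) powr (\<alpha> - \<beta>) * (t - s) powr \<beta>" by (simp add: powr_add[symmetric])
  also have "\<dots> \<le> e * (t - s) powr \<beta>"
    unfolding eps_def using assms expo by (intro mult_right_mono powr_mono2) auto
  finally show "(t - s) powr \<alpha> \<le> e * (t - s) powr \<beta>" .
  have "(t - s) powr \<alpha> \<le> h powr \<alpha>" using assms ab0 by (intro powr_mono2) auto
  then show "(t - s) powr \<alpha> \<le> e" using e by simp
  show "(t - s) powr \<alpha> \<le> (t - s) powr \<beta>" using assms h expo by (intro powr_mono') auto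
qed

text \<open>The corrected increment is of order \<alpha> and yields \<open>e\<close> times order
  \<beta>; the rest, \<open>S (t - s) (Y s) - Y s\<close>, is of order \<beta> by
  \<open>Y_favard\<close>, again with factor \<open>e\<close>.\<close>

lemma Y_increment:
  assumes s: "\<tau> \<le> s" "s < t" "t \<le> \<tau> + h" "t \<le> T"
  shows "norm (Y t - Y s) \<le> k2 * (N * e) * qp t s"
proof -
  have "norm ((Y t - S (t - s) (Y s)) + (S (t - s) (Y s) - Y s)) \<le> N * (t - s) powr \<alpha> + k1 * (N * e) * (t - s) powr \<beta>"
    using s by (intro norm_triangle_mono hat_Y favardD Y_favard) auto
  also have "\<dots> \<le> N * (e * (t - s) powr \<beta>) + k1 * (N * e) * (t - s) powr \<beta>"
    using powr_alpha_le(1)[of s t] s \<tau> N by (intro add_right_mono mult_left_mono) auto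
  also have "\<dots> = (1 + k1) * (N * e) * (t - s) powr \<beta>" by (simp add: algebra_simps)
  also have "\<dots> \<le> (1 + k1) * (N * e) * ((1 + T) * qp t s)"
    using powr_le_qp[of s t] s \<tau> N e constants_nonneg(1) by (intro mult_left_mono) auto
  finally show ?thesis by (simp add: k2_def mult_ac)
qed

text \<open>Every difference is linear in \<open>Y\<close> or its increments, which carry
  \<open>N * e\<close>, with coefficients bounded a priori through \<open>C\<close>. The last bound
  concerns one solution only; it will be multiplied by \<open>z1 - z2\<close>.\<close>

lemma increments:
  assumes u: "\<tau> \<le> u" "u < m" "m \<le> \<tau> + h" "m \<le> T" and q: "qp m u \<le> q"
  shows "norm (rem (y1 u) (y1 m) - rem (y2 u) (y2 m)) \<le> L * k2 * (2 * C + C * C) * (N * e) * (q * q)"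
    and "norm (G (y1 m) - G (y1 u) - (G (y2 m) - G (y2 u))) \<le> L * k2 * (1 + C) * (N * e) * q"
    and "norm (Dop G (y1 m) - Dop G (y1 u) - (Dop G (y2 m) - Dop G (y2 u))) \<le> L * k2 * (1 + C) * (N * e) * q"
    and "norm (Dop G (y2 m) - Dop G (y2 u)) \<le> L * C * q"
proof -
  have um: "0 \<le> u" using u \<tau> by simp
  have q0: "0 \<le> q" using q qp_nonneg order_trans by blast
  have d: "norm (y1 m - y1 u) \<le> C * q" "norm (y2 m - y2 u) \<le> C * q"
    using s1.y_holder[OF um u(2,4)] s2.y_holder[OF um u(2,4)] mult_left_mono[OF q s1.C0] by linarith+
  have k: "0 \<le> k2 * (N * e)" using constants_nonneg(3) N e by simp
  have "Y m - Y u = (y1 m - y1 u) - (y2 m - y2 u)" by (simp add: Y_def)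
  then have dY: "norm ((y1 m - y1 u) - (y2 m - y2 u)) \<le> k2 * (N * e) * q"
    using Y_increment[OF u] mult_left_mono[OF q k] by simp
  have Yu: "norm (y1 u - y2 u) \<le> k2 * (N * e)" using Y_bound[of u] u by (simp add: Y_def)
  have "norm (rem (y1 u) (y1 m) - rem (y2 u) (y2 m)) \<le>
      L * (norm ((y1 m - y1 u) - (y2 m - y2 u)) * (norm (y1 m - y1 u) + norm (y2 m - y2 u)) + norm (y1 u - y2 u) * (norm (y1 m - y1 u))\<^sup>2)"
    by (rule rem_diff)
  also have "\<dots> \<le> L * ((k2 * (N * e) * q) * (C * q + C * q) + k2 * (N * e) * (C * q)\<^sup>2)"
    using d dY Yu k q0 L0 s1.C0 by (intro mult_left_mono add_mono mult_mono power_mono) auto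
  finally show "norm (rem (y1 u) (y1 m) - rem (y2 u) (y2 m)) \<le> L * k2 * (2 * C + C * C) * (N * e) * (q * q)"
    by (simp add: algebra_simps power2_eq_square)
  have *: "L * (norm ((y1 m - y1 u) - (y2 m - y2 u)) + norm (y1 m - y1 u) * norm (y1 u - y2 u)) \<le> L * k2 * (1 + C) * (N * e) * q"
  proof -
    have "L * (norm ((y1 m - y1 u) - (y2 m - y2 u)) + norm (y1 m - y1 u) * norm (y1 u - y2 u)) \<le>
        L * (k2 * (N * e) * q + C * q * (k2 * (N * e)))"
      using d dY Yu k q0 L0 s1.C0 by (intro mult_left_mono add_mono mult_mono) auto
    then show ?thesis by (simp add: algebra_simps)
  qed
  show "norm (G (y1 m) - G (y1 u) - (G (y2 m) - G (y2 u))) \<le> L * k2 * (1 + C) * (N * e) * q"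
    using order_trans[OF G_inc[of "y1 u" "y1 m - y1 u" "y2 u" "y2 m - y2 u"] *] by simp
  show "norm (Dop G (y1 m) - Dop G (y1 u) - (Dop G (y2 m) - Dop G (y2 u))) \<le> L * k2 * (1 + C) * (N * e) * q"
    using order_trans[OF DG_inc[of "y1 u" "y1 m - y1 u" "y2 u" "y2 m - y2 u"] *] by simp
  show "norm (Dop G (y2 m) - Dop G (y2 u)) \<le> L * C * q"
    using DG_lip[of "y2 m" "y2 u"] mult_left_mono[OF d(2) L0] by simp
qed

lemma Z_qp:
  assumes "\<tau> \<le> s" "s < t" "t \<le> \<tau> + h" "t \<le> T" "(t - s) powr \<alpha> \<le> P" "qp t s \<le> q"
  shows "norm (z1 t s - z2 t s) \<le> \<eta> * N * (P * q)" "norm (z1 t s) \<le> C * (P * q)"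
proof -
  have "(t - s) powr \<alpha> * qp t s \<le> P * q"
    using assms qp_nonneg[of t s] by (intro mult_mono) (auto intro: order_trans[OF powr_ge_zero])
  then have "\<eta> * N * ((t - s) powr \<alpha> * qp t s) \<le> \<eta> * N * (P * q)" "C * ((t - s) powr \<alpha> * qp t s) \<le> C * (P * q)"
    using \<eta> N s1.C0 by (auto intro!: mult_left_mono)
  then show "norm (z1 t s - z2 t s) \<le> \<eta> * N * (P * q)" "norm (z1 t s) \<le> C * (P * q)"
    using Z_bound[OF assms(1-4)] s1.z_holder[of s t] assms \<tau> unfolding weight_ab by linarith+
qed

text \<open>Splitting the product of \<open>z\<close> and the increment of the derivative isolates
  \<open>z1 - z2\<close> times an increment along a single solution. This is the term bounded by
  \<eta> N without the factor \<open>e\<close>.\<close>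

lemma XiY_difference_defect:
  assumes u: "\<tau> \<le> u" "u < m" "m < v" "v \<le> \<tau> + h" "v \<le> T"
  defines "\<Xi> \<equiv> \<lambda>v u. XiY y1 z1 v u - XiY y2 z2 v u"
  shows "norm (\<Xi> v u - \<Xi> v m - S (v - m) (\<Xi> m u)) \<le> kY * (N * e + \<eta> * N) * weight \<alpha> (2 * \<beta>) v u"
proof -
  have u0: "0 \<le> u" "0 \<le> m" "m \<le> v" "\<tau> \<le> m" using u \<tau> by auto
  define P q where "P = (v - u) powr \<alpha>" and "q = qp v u"
  have P: "0 \<le> P" "(v - m) powr \<alpha> \<le> P" unfolding P_def using u ab0 by (auto intro!: powr_mono2)
  have q: "0 \<le> q" "qp m u \<le> q" "qp v m \<le> q" using qp_nonneg qp_mono[OF u0(1) u(2,3)] by (auto simp: q_def)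
  note inc = increments[OF u(1,2) _ _ q(2)]
  note nn = N e(1) \<eta> CW0 L0 s1.C0 constants_nonneg P(1) q(1)
  let ?R = "rem (y1 u) (y1 m) - rem (y2 u) (y2 m)"
  let ?D = "Dop G (y1 m) - Dop G (y1 u) - (Dop G (y2 m) - Dop G (y2 u))"
  let ?D2 = "Dop G (y2 m) - Dop G (y2 u)"
  have "\<Xi> v u - \<Xi> v m - S (v - m) (\<Xi> m u) =
      (XiY y1 z1 v u - XiY y1 z1 v m - S (v - m) (XiY y1 z1 m u)) - (XiY y2 z2 v u - XiY y2 z2 v m - S (v - m) (XiY y2 z2 m u))"
    by (simp add: \<Xi>_def blinfun.diff_right)
  also have "\<dots> = - ((W v m ?R + z1 v m ?D) + (z1 v m - z2 v m) ?D2)"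
    unfolding s1.XiY_defect_eq[OF u0(1) u(2,3,5)] s2.XiY_defect_eq[OF u0(1) u(2,3,5)]
      W_diff[OF u0(2,3) u(5)] blinfun.diff_right blinfun.diff_left by simp
  finally have "\<Xi> v u - \<Xi> v m - S (v - m) (\<Xi> m u) = - ((W v m ?R + z1 v m ?D) + (z1 v m - z2 v m) ?D2)" .
  moreover have "norm ((W v m ?R + z1 v m ?D) + (z1 v m - z2 v m) ?D2) \<le>
      (CW * (L * k2 * (2 * C + C * C) * (N * e) * (q * q)) * P + C * (P * q) * (L * k2 * (1 + C) * (N * e) * q)) +
      \<eta> * N * (P * q) * (L * C * q)"
  proof (intro norm_triangle_mono)
    show "norm (W v m ?R) \<le> CW * (L * k2 * (2 * C + C * C) * (N * e) * (q * q)) * P"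
      using inc(1) u nn P by (intro order_trans[OF W_bound[OF u0(2,3) u(5)]] mult_mono) auto
    show "norm (z1 v m ?D) \<le> C * (P * q) * (L * k2 * (1 + C) * (N * e) * q)"
      using Z_qp(2)[OF u0(4) u(3,4,5) P(2) q(3)] inc(3) u nn
      by (intro order_trans[OF norm_blinfun] mult_mono) auto
    show "norm ((z1 v m - z2 v m) ?D2) \<le> \<eta> * N * (P * q) * (L * C * q)"
      using Z_qp(1)[OF u0(4) u(3,4,5) P(2) q(3)] inc(4) u nn
      by (intro order_trans[OF norm_blinfun] mult_mono) auto
  qed
  moreover have "\<dots> \<le> kY * (N * e + \<eta> * N) * weight \<alpha> (2 * \<beta>) v u"
  proof -
    have "0 \<le> P * (q * q)" "0 \<le> N * e" "0 \<le> \<eta> * N" using nn by auto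
    define K1 K2 where "K1 = CW * (L * k2 * (2 * C + C * C)) + C * (L * k2 * (1 + C))" and "K2 = L * C"
    have "0 \<le> K1" "0 \<le> K2" using nn by (auto simp: K1_def K2_def)
    have "(K1 * (N * e) + K2 * (\<eta> * N)) * (P * (q * q)) \<le> (K1 + K2) * (N * e + \<eta> * N) * (P * (q * q))"
    proof (rule mult_right_mono)
      have "0 \<le> K1 * (\<eta> * N) + K2 * (N * e)"
        using \<open>0 \<le> K1\<close> \<open>0 \<le> K2\<close> \<open>0 \<le> N * e\<close> \<open>0 \<le> \<eta> * N\<close>
        by (intro add_nonneg_nonneg mult_nonneg_nonneg[of K1 "\<eta> * N"] mult_nonneg_nonneg[of K2 "N * e"])
      then show "K1 * (N * e) + K2 * (\<eta> * N) \<le> (K1 + K2) * (N * e + \<eta> * N)" by (simp add: algebra_simps)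
    qed fact
    then show ?thesis
      unfolding weight_a2b P_def[symmetric] q_def[symmetric] kY_def K1_def K2_def by (simp add: algebra_simps)
  qed
  ultimately show ?thesis by (simp only: norm_minus_cancel)
qed

lemma Y_remainder:
  assumes s: "\<tau> \<le> s" "s < t" "t \<le> \<tau> + h" "t \<le> T"
  shows "norm ((Y t - S (t - s) (Y s)) - (XiY y1 z1 t s - XiY y2 z2 t s)) \<le>
    wsew_const M \<alpha> (2 * \<beta>) * kY * (N * e + \<eta> * N) * weight \<alpha> (2 * \<beta>) t s"
proof -
  have s0: "0 \<le> s" using s \<tau> by simp
  have eq: "(y1 t - S (t - s) (y1 s)) - (y2 t - S (t - s) (y2 s)) = Y t - S (t - s) (Y s)"
    by (simp add: Y_def blinfun.diff_right)
  have lim: "(sew_sum S (\<lambda>v u. XiY y1 z1 v u - XiY y2 z2 v u) t \<longlongrightarrow> Y t - S (t - s) (Y s)) (mesh_filter s t)"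
    using tendsto_diff[OF s1.sewing_Y[OF s0 less_imp_le[OF s(2)] s(4)] s2.sewing_Y[OF s0 less_imp_le[OF s(2)] s(4)]]
    unfolding eq sew_sum_diff_fun .
  have "norm ((Y t - S (t - s) (Y s)) - (XiY y1 z1 t s - XiY y2 z2 t s)) \<le>
      wsew_const M \<alpha> (2 * \<beta>) * (kY * (N * e + \<eta> * N)) * weight \<alpha> (2 * \<beta>) (t - 0) (s - 0)"
  proof (rule weight_sew_bound[OF lim s(2) s0 ab0(1)])
    fix u m v assume u: "s \<le> u" "u < m" "m < v" "v \<le> t"
    show "norm (XiY y1 z1 v u - XiY y2 z2 v u - (XiY y1 z1 v m - XiY y2 z2 v m) - S (v - m) (XiY y1 z1 m u - XiY y2 z2 m u)) \<le>
        kY * (N * e + \<eta> * N) * weight \<alpha> (2 * \<beta>) (v - 0) (u - 0)"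
      using XiY_difference_defect[of u m v] u s by simp
  qed (use ab0 expo constants_nonneg N e \<eta> in auto)
  then show ?thesis by (simp only: diff_0_right mult.assoc)
qed

text \<open>Besides the sewing error, the germ itself contributes a \<open>W\<close> term of size
  \<open>N * e\<close> by the Lipschitz bound, and \<open>z1 - z2\<close> applied to a bounded
  derivative, of size \<eta> N. The second is why \<eta> has to be small.\<close>

lemma hat_Y_improved:
  assumes s: "\<tau> \<le> s" "s < t" "t \<le> \<tau> + h" "t \<le> T"
  shows "norm (Y t - S (t - s) (Y s) - W t s (G (y1 s) - G (y2 s))) \<le> k\<rho> * (N * e + \<eta> * N) * ((t - s) powr \<alpha> * qp t s)"
    and "norm (Y t - S (t - s) (Y s)) \<le> kA * (N * e + \<eta> * N) * (t - s) powr \<alpha>"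
proof -
  define P q K where "P = (t - s) powr \<alpha>" and "q = qp t s" and "K = N * e + \<eta> * N"
  have s0: "0 \<le> s" "s \<le> t" using s \<tau> by auto
  have P: "0 \<le> P" "(t - s) powr \<alpha> \<le> P" by (auto simp: P_def)
  have q: "0 \<le> q" "q \<le> 1" "qp t s \<le> q" using qp_nonneg qp_le_1[OF s0(1) s(2)] by (auto simp: q_def)
  have K: "N * e \<le> K" "\<eta> * N \<le> K" "0 \<le> K" using N e \<eta> by (auto simp: K_def)
  note nn = N e(1) \<eta> CW0 L0 s1.C0 constants_nonneg P(1) q(1) K(3)
  have Ys: "norm (y1 s - y2 s) \<le> k2 * (N * e)" using Y_bound[of s] s by (simp add: Y_def)
  then have Ys': "L * norm (y1 s - y2 s) \<le> L * k2 * K"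
  proof -
    have "norm (y1 s - y2 s) \<le> k2 * K" using Ys mult_left_mono[OF K(1), of k2] nn by linarith
    then show ?thesis using mult_left_mono[OF _ L0] by (fastforce simp: mult.assoc)
  qed
  have "Y t - S (t - s) (Y s) - W t s (G (y1 s) - G (y2 s)) =
      ((Y t - S (t - s) (Y s)) - (XiY y1 z1 t s - XiY y2 z2 t s)) +
      (z1 t s (Dop G (y1 s) - Dop G (y2 s)) + (z1 t s - z2 t s) (Dop G (y2 s)))"
    by (simp add: XiY_def W_diff[OF s0 s(4)] blinfun.diff_right blinfun.diff_left)
  also have "norm \<dots> \<le> wsew_const M \<alpha> (2 * \<beta>) * kY * K * (P * q) + (C * (P * q) * (L * k2 * K) + K * (P * q) * L)"
  proof (intro norm_triangle_mono)
    have w: "0 \<le> wsew_const M \<alpha> (2 * \<beta>) * kY * K"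
      using nn wsew_const_nonneg[of \<alpha> "2 * \<beta>"] ab0 expo by simp
    have "P * (q * q) \<le> P * (q * 1)" using nn q by (intro mult_left_mono) auto
    then show "norm ((Y t - S (t - s) (Y s)) - (XiY y1 z1 t s - XiY y2 z2 t s)) \<le> wsew_const M \<alpha> (2 * \<beta>) * kY * K * (P * q)"
      using order_trans[OF Y_remainder[OF s, folded K_def, unfolded weight_a2b, folded P_def q_def] mult_left_mono[OF _ w]] by simp
    have "norm (Dop G (y1 s) - Dop G (y2 s)) \<le> L * k2 * K"
      using DG_lip[of "y1 s" "y2 s"] Ys' by linarith
    then show "norm (z1 t s (Dop G (y1 s) - Dop G (y2 s))) \<le> C * (P * q) * (L * k2 * K)"
      using Z_qp(2)[OF s P(2) q(3)] nn by (intro order_trans[OF norm_blinfun] mult_mono) auto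
    have "norm (z1 t s - z2 t s) \<le> K * (P * q)"
      using Z_qp(1)[OF s P(2) q(3)] mult_right_mono[OF K(2), of "P * q"] nn by simp
    then show "norm ((z1 t s - z2 t s) (Dop G (y2 s))) \<le> K * (P * q) * L"
      using nn DG_bound by (intro order_trans[OF norm_blinfun] mult_mono) auto
  qed
  also have "\<dots> = k\<rho> * K * (P * q)" by (simp add: k\<rho>_def algebra_simps)
  finally have \<rho>: "norm (Y t - S (t - s) (Y s) - W t s (G (y1 s) - G (y2 s))) \<le> k\<rho> * K * (P * q)" .
  then show "norm (Y t - S (t - s) (Y s) - W t s (G (y1 s) - G (y2 s))) \<le> k\<rho> * (N * e + \<eta> * N) * ((t - s) powr \<alpha> * qp t s)"
    by (simp add: P_def q_def K_def)
  have "norm (W t s (G (y1 s) - G (y2 s))) \<le> CW * (L * k2 * K) * P"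
    using G_lip[of "y1 s" "y2 s"] Ys' nn
    by (intro order_trans[OF W_bound[OF s0 s(4)]] mult_mono) (auto simp: P_def)
  moreover have "k\<rho> * K * (P * q) \<le> k\<rho> * K * (P * 1)"
    using q nn by (intro mult_left_mono) auto
  ultimately have "norm ((Y t - S (t - s) (Y s) - W t s (G (y1 s) - G (y2 s))) + W t s (G (y1 s) - G (y2 s))) \<le>
      k\<rho> * K * (P * 1) + CW * (L * k2 * K) * P"
    using \<rho> by (intro norm_triangle_mono) auto
  then show "norm (Y t - S (t - s) (Y s)) \<le> kA * (N * e + \<eta> * N) * (t - s) powr \<alpha>"
    by (simp add: kA_def K_def P_def algebra_simps)
qed

text \<open>Here \<open>N * e\<close> and \<open>\<eta> * N\<close> are simply estimated by
  \<open>N\<close>; the defect has order 2 \<alpha>, and the surplus \<alpha> over the norm of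
  \<open>Z\<close> supplies the small factor afterwards.\<close>

lemma XiZ_difference_defect:
  fixes E :: "'w \<Rightarrow>\<^sub>L 'v \<Rightarrow>\<^sub>L 'w"
  assumes u: "\<tau> \<le> u" "u < m" "m < v" "v \<le> \<tau> + h" "v \<le> T"
  defines "\<Xi> \<equiv> \<lambda>v u. XiZ y1 E v u - XiZ y2 E v u"
  shows "norm (\<Xi> v u - \<Xi> v m - S (v - m) (\<Xi> m u)) \<le> kZ * norm E * N * weight (2 * \<alpha>) \<beta> v u"
proof -
  have u0: "0 \<le> u" "0 \<le> m" "m \<le> v" "\<tau> \<le> m" "u \<le> m" "m \<le> T" "m \<le> \<tau> + h" using u \<tau> by auto
  define P q where "P = (v - u) powr \<alpha>" and "q = qp v u"
  have P: "0 \<le> P" "(v - m) powr \<alpha> \<le> P" "(m - u) powr \<alpha> \<le> P" unfolding P_def using u ab0 by (auto intro!: powr_mono2)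
  have q: "0 \<le> q" "qp m u \<le> q" using qp_nonneg qp_mono[OF u0(1) u(2,3)] by (auto simp: q_def)
  have Ne: "N * e \<le> N" "0 \<le> N * e" "\<eta> * N \<le> N"
    using N e \<eta> mult_left_mono[of e 1 N] mult_right_mono[of \<eta> 1 N] by auto
  note nn = N e(1) \<eta> CW0 L0 s1.C0 constants_nonneg P(1) q(1) Ne(2) Ca_nonneg Cc_nonneg Cb_nonneg
  define K where "K = G (y1 m) - G (y1 u) - (G (y2 m) - G (y2 u))"
  have K_eq: "K = (G (y1 m) - G (y2 m)) - (G (y1 u) - G (y2 u))" by (simp add: K_def)
  define r where "r = Y m - S (m - u) (Y u) - W m u (G (y1 u) - G (y2 u))"
  have r_eq: "r = (y1 m - S (m - u) (y1 u) - W m u (G (y1 u))) - (y2 m - S (m - u) (y2 u) - W m u (G (y2 u)))"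
    by (simp add: r_def Y_def blinfun.diff_right W_diff[OF u0(1,5,6)])
  have "\<Xi> v u - \<Xi> v m - S (v - m) (\<Xi> m u) =
      (XiZ y1 E v u - XiZ y1 E v m - S (v - m) (XiZ y1 E m u)) - (XiZ y2 E v u - XiZ y2 E v m - S (v - m) (XiZ y2 E m u))"
    by (simp add: \<Xi>_def blinfun.diff_right)
  also have "\<dots> = - (pa v m E r + pb v m E K)"
    unfolding s1.XiZ_defect_eq[OF u0(1) u(2,3,5)] s2.XiZ_defect_eq[OF u0(1) u(2,3,5)]
      r_eq K_def pa_diff[OF u0(2,3) u(5), of E "y1 m - S (m - u) (y1 u) - W m u (G (y1 u))"]
      pb_diff[OF G_fav_diff G_fav_diff u0(2,3) u(5)] by simp
  finally have "\<Xi> v u - \<Xi> v m - S (v - m) (\<Xi> m u) = - (pa v m E r + pb v m E K)" .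
  moreover have "norm (pa v m E r + pb v m E K) \<le> Ca * norm E * (k\<rho> * (2 * N) * (P * q)) * P +
      norm E * (Cc * (L * k2 * (1 + C) * N * q) * (P * P) + Cb * (2 * L * k2 * N) * (P * P * ((1 + T) * q)))"
  proof (rule norm_triangle_mono)
    have "norm r \<le> k\<rho> * (N * e + \<eta> * N) * ((m - u) powr \<alpha> * qp m u)"
      unfolding r_def by (rule hat_Y_improved(1)[OF u(1,2) u0(7,6)])
    also have "\<dots> \<le> k\<rho> * (2 * N) * (P * q)"
      using nn Ne P q qp_nonneg by (intro mult_mono) auto
    finally show "norm (pa v m E r) \<le> Ca * norm E * (k\<rho> * (2 * N) * (P * q)) * P"
      using P nn by (intro order_trans[OF pa_bound[OF u0(2,3) u(5)]] mult_mono) auto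
    have LY: "L * norm (y1 x - y2 x) \<le> L * k2 * N" if "\<tau> \<le> x" "x \<le> \<tau> + h" "x \<le> T" for x
    proof -
      have "norm (y1 x - y2 x) \<le> k2 * N"
        using order_trans[OF Y_bound[OF that] mult_left_mono[OF Ne(1)]] nn by (simp add: Y_def)
      then show ?thesis using mult_left_mono[OF _ L0] by (fastforce simp: mult.assoc)
    qed
    have KN: "norm K \<le> L * k2 * (1 + C) * N * q"
    proof -
      have "norm K \<le> L * k2 * (1 + C) * (N * e) * q"
        unfolding K_def by (rule increments(2)[OF u(1,2) u0(7,6) q(2)])
      also have "\<dots> \<le> L * k2 * (1 + C) * N * q"
        using nn Ne by (intro mult_right_mono mult_left_mono) auto
      finally show ?thesis .
    qed
    have p2: "(v - m) powr (2 * \<alpha>) \<le> P * P" "(v - m) powr (2 * \<alpha> + \<beta>) \<le> P * P * ((1 + T) * q)"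
    proof -
      have "(v - m) powr (2 * \<alpha>) = (v - m) powr \<alpha> * (v - m) powr \<alpha>" by (simp add: powr_add[symmetric])
      also have "\<dots> \<le> P * P" using P by (intro mult_mono) auto
      finally show p: "(v - m) powr (2 * \<alpha>) \<le> P * P" .
      have "(v - m) powr \<beta> \<le> (v - u) powr \<beta>" using u ab0 by (intro powr_mono2) auto
      also have "\<dots> \<le> (1 + T) * q" unfolding q_def using u u0 by (intro powr_le_qp) auto
      finally show "(v - m) powr (2 * \<alpha> + \<beta>) \<le> P * P * ((1 + T) * q)"
        unfolding powr_add using p P by (intro mult_mono) auto
    qed
    have "fav K (L * norm (y1 m - y2 m) + L * norm (y1 u - y2 u))"
      unfolding K_eq by (intro fav_diff G_fav_diff)
    from pb_bound[OF this u0(2) u(3,5), of E]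
    have "norm (pb v m E K) \<le> norm E * (Cc * norm K * (v - m) powr (2 * \<alpha>) +
        Cb * (L * norm (y1 m - y2 m) + L * norm (y1 u - y2 u)) * (v - m) powr (2 * \<alpha> + \<beta>))" .
    also have "\<dots> \<le> norm E * (Cc * (L * k2 * (1 + C) * N * q) * (P * P) + Cb * (2 * L * k2 * N) * (P * P * ((1 + T) * q)))"
    proof (intro mult_left_mono add_mono)
      show "Cc * norm K * (v - m) powr (2 * \<alpha>) \<le> Cc * (L * k2 * (1 + C) * N * q) * (P * P)"
        using KN p2 nn by (intro mult_mono) auto
      have "L * norm (y1 m - y2 m) + L * norm (y1 u - y2 u) \<le> 2 * L * k2 * N"
        using LY[of m] LY[of u] u u0 by simp
      then show "Cb * (L * norm (y1 m - y2 m) + L * norm (y1 u - y2 u)) * (v - m) powr (2 * \<alpha> + \<beta>) \<le>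
          Cb * (2 * L * k2 * N) * (P * P * ((1 + T) * q))"
        using p2 nn T by (intro mult_mono) auto
    qed auto
    finally show "norm (pb v m E K) \<le> \<dots>" .
  qed
  moreover have "\<dots> = kZ * norm E * N * weight (2 * \<alpha>) \<beta> v u"
    unfolding weight_2ab P_def[symmetric] q_def[symmetric] kZ_def by (simp add: algebra_simps)
  ultimately show ?thesis by (simp only: norm_minus_cancel)
qed

text \<open>Three contributions carry \<open>e\<close>: the sewing error through its surplus order
  \<alpha>, the difference of \<open>pb\<close> through the size of \<open>Y s\<close>, and
  \<open>pa - W\<close> at \<open>Y s\<close> through the Favard regularity of \<open>Y s\<close>.
  No term in \<eta> survives.\<close>

lemma Z_improved:
  assumes s: "\<tau> \<le> s" "s < t" "t \<le> \<tau> + h" "t \<le> T"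
  shows "norm (z1 t s - z2 t s) \<le> kE * (N * e) * weight \<alpha> \<beta> t s"
proof (rule norm_blinfun_bound)
  show "0 \<le> kE * (N * e) * weight \<alpha> \<beta> t s" using constants_nonneg N e weight_nonneg[of \<alpha> \<beta> t s] by simp
  fix E :: "'w \<Rightarrow>\<^sub>L 'v \<Rightarrow>\<^sub>L 'w"
  have s0: "0 \<le> s" "s \<le> t" "s \<le> \<tau> + h" "s \<le> T" "t - s \<le> h" using s \<tau> by auto
  define P q where "P = (t - s) powr \<alpha>" and "q = qp t s"
  have P: "0 \<le> P" "P \<le> e" "P \<le> (1 + T) * q" "(t - s) powr \<beta> \<le> (1 + T) * q" "P \<le> 1"
    using powr_alpha_le[of s t] s s0 powr_le_qp[of s t] e by (auto simp: P_def q_def)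
  have q: "0 \<le> q" using qp_nonneg by (auto simp: q_def)
  note nn = N e(1) CW0 L0 constants_nonneg P(1) q(1) Cc_nonneg Cb_nonneg
  have lim: "(sew_sum S (\<lambda>v u. XiZ y1 E v u - XiZ y2 E v u) t \<longlongrightarrow>
      (z1 t s E + W t s (E (y1 s))) - (z2 t s E + W t s (E (y2 s)))) (mesh_filter s t)"
    using tendsto_diff[OF s1.sewing_Z[OF s0(1) s(2,4), of E] s2.sewing_Z[OF s0(1) s(2,4), of E]]
    unfolding sew_sum_diff_fun .
  have "norm (((z1 t s E + W t s (E (y1 s))) - (z2 t s E + W t s (E (y2 s)))) - (XiZ y1 E t s - XiZ y2 E t s)) \<le>
      wsew_const M (2 * \<alpha>) \<beta> * (kZ * norm E * N) * weight (2 * \<alpha>) \<beta> (t - 0) (s - 0)"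
  proof (rule weight_sew_bound[OF lim s(2) s0(1) s1.two_ab(1)])
    fix u m v assume u: "s \<le> u" "u < m" "m < v" "v \<le> t"
    show "norm (XiZ y1 E v u - XiZ y2 E v u - (XiZ y1 E v m - XiZ y2 E v m) - S (v - m) (XiZ y1 E m u - XiZ y2 E m u)) \<le>
        kZ * norm E * N * weight (2 * \<alpha>) \<beta> (v - 0) (u - 0)"
      using XiZ_difference_defect[of u m v E] u s by simp
  qed (use ab0 s1.two_ab constants_nonneg N in auto)
  also have "\<dots> = wsew_const M (2 * \<alpha>) \<beta> * (kZ * norm E * N) * (P * P * q)"
    by (simp add: weight_2ab P_def q_def)
  also have "\<dots> \<le> wsew_const M (2 * \<alpha>) \<beta> * (kZ * norm E * N) * (P * e * q)"
    using P nn wsew_const_nonneg[of "2 * \<alpha>" \<beta>] s1.two_ab ab0 by (intro mult_left_mono mult_right_mono) auto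
  finally have r: "norm (((z1 t s E + W t s (E (y1 s))) - (z2 t s E + W t s (E (y2 s)))) - (XiZ y1 E t s - XiZ y2 E t s)) \<le>
    wsew_const M (2 * \<alpha>) \<beta> * (kZ * norm E * N) * (P * e * q)" .
  have "norm (pb t s E (G (y1 s) - G (y2 s))) \<le> norm E * (Cc * norm (G (y1 s) - G (y2 s)) * (t - s) powr (2 * \<alpha>) +
      Cb * (L * norm (y1 s - y2 s)) * (t - s) powr (2 * \<alpha> + \<beta>))"
    by (rule pb_bound[OF G_fav_diff s0(1) s(2,4)])
  also have "\<dots> \<le> norm E * (Cc * (L * (k2 * (N * e))) * (P * ((1 + T) * q)) + Cb * (L * (k2 * (N * e))) * (P * ((1 + T) * q)))"
  proof (intro mult_left_mono add_mono)
    have LY: "L * norm (y1 s - y2 s) \<le> L * (k2 * (N * e))"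
      using Y_bound[OF s(1) s0(3,4)] L0 by (intro mult_left_mono) (auto simp: Y_def)
    have "(t - s) powr (2 * \<alpha>) = P * P" by (simp add: P_def powr_add[symmetric])
    then have p: "(t - s) powr (2 * \<alpha>) \<le> P * ((1 + T) * q)" "(t - s) powr (2 * \<alpha> + \<beta>) \<le> P * ((1 + T) * q)"
    proof -
      show "(t - s) powr (2 * \<alpha>) \<le> P * ((1 + T) * q)"
        unfolding \<open>(t - s) powr (2 * \<alpha>) = P * P\<close> using P by (intro mult_left_mono)
      have "P * P * (t - s) powr \<beta> \<le> P * 1 * ((1 + T) * q)" using P by (intro mult_mono) auto
      then show "(t - s) powr (2 * \<alpha> + \<beta>) \<le> P * ((1 + T) * q)"
        unfolding powr_add \<open>(t - s) powr (2 * \<alpha>) = P * P\<close> by simp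
    qed
    note G = order_trans[OF G_lip LY]
    show "Cc * norm (G (y1 s) - G (y2 s)) * (t - s) powr (2 * \<alpha>) \<le> Cc * (L * (k2 * (N * e))) * (P * ((1 + T) * q))"
      using p mult_left_mono[OF G Cc_nonneg] nn by (intro mult_mono[OF _ p(1)]) auto
    show "Cb * (L * norm (y1 s - y2 s)) * (t - s) powr (2 * \<alpha> + \<beta>) \<le> Cb * (L * (k2 * (N * e))) * (P * ((1 + T) * q))"
      using mult_left_mono[OF LY Cb_nonneg] nn by (intro mult_mono[OF _ p(2)]) auto
  qed auto
  finally have b: "norm (pb t s E (G (y1 s) - G (y2 s))) \<le>
    norm E * (Cc * (L * (k2 * (N * e))) * (P * ((1 + T) * q)) + Cb * (L * (k2 * (N * e))) * (P * ((1 + T) * q)))" .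
  \<comment> \<open>One constant majorising both the Favard seminorm of \<open>Y s\<close> and its
    consequence for \<open>AS\<close>, as \<open>pa_minus_W\<close> requires.\<close>
  define B where "B = (1 + fav_const \<beta>) * k1 * (N * e)"
  have B0: "0 \<le> B" using fav_const0 nn by (simp add: B_def)
  have "norm (pa t s E (Y s) - W t s (E (Y s))) \<le> (CW + M * CW / (\<alpha> + \<beta>)) * norm E * B * (t - s) powr (\<alpha> + \<beta>)"
  proof (rule pa_minus_W[OF s0(1,2) s(4)])
    note f = Y_favard[OF s(1) s0(3,4)]
    have "k1 * (N * e) \<le> B" using mult_right_mono[of 1 "1 + fav_const \<beta>" "k1 * (N * e)"] fav_const0 nn by (simp add: B_def mult.assoc)
    then show "norm (S (t - s) (Y s) - Y s) \<le> B * (t - s) powr \<beta>"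
      using s by (intro order_trans[OF favardD[OF f]] mult_right_mono) auto
    have "fav_const \<beta> * (k1 * (N * e)) \<le> B"
      using mult_right_mono[of "fav_const \<beta>" "1 + fav_const \<beta>" "k1 * (N * e)"] nn by (simp add: B_def mult.assoc)
    then show "norm (AS (r - s) (Y s)) \<le> B * (r - s) powr (\<beta> - 1)" if "s < r" "r < t" for r
      using that ab0 nn by (intro order_trans[OF favard_AS[OF f]] mult_right_mono) auto
  qed (use ab0 B0 in auto)
  also have "\<dots> = (CW + M * CW / (\<alpha> + \<beta>)) * norm E * B * (P * (t - s) powr \<beta>)" by (simp add: P_def powr_add)
  also have "\<dots> \<le> (CW + M * CW / (\<alpha> + \<beta>)) * norm E * B * (P * ((1 + T) * q))"
    using P CW0 M0 ab0 B0 by (intro mult_left_mono) auto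
  finally have a: "norm (pa t s E (Y s) - W t s (E (Y s))) \<le>
    (CW + M * CW / (\<alpha> + \<beta>)) * norm E * B * (P * ((1 + T) * q))" .
  have "(z1 t s - z2 t s) E = (((z1 t s E + W t s (E (y1 s))) - (z2 t s E + W t s (E (y2 s)))) - (XiZ y1 E t s - XiZ y2 E t s)) +
      (pb t s E (G (y1 s) - G (y2 s)) + (pa t s E (Y s) - W t s (E (Y s))))"
  proof -
    obtain N1 where N1: "fav (G (y1 s)) N1" using G_fav by blast
    obtain N2 where N2: "fav (G (y2 s)) N2" using G_fav by blast
    show ?thesis
      unfolding Y_def XiZ_def pb_diff[OF N1 N2 s0(1,2) s(4)] pa_diff[OF s0(1,2) s(4)]
        blinfun.diff_right W_diff[OF s0(1,2) s(4)] blinfun.diff_left by simp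
  qed
  also have "norm \<dots> \<le> wsew_const M (2 * \<alpha>) \<beta> * (kZ * norm E * N) * (P * e * q) +
      (norm E * (Cc * (L * (k2 * (N * e))) * (P * ((1 + T) * q)) + Cb * (L * (k2 * (N * e))) * (P * ((1 + T) * q))) +
       (CW + M * CW / (\<alpha> + \<beta>)) * norm E * B * (P * ((1 + T) * q)))"
    by (intro norm_triangle_mono r b a)
  also have "\<dots> = kE * (N * e) * weight \<alpha> \<beta> t s * norm E"
    unfolding weight_ab P_def[symmetric] q_def[symmetric] kE_def kB_def B_def by (simp add: algebra_simps)
  finally show "norm ((z1 t s - z2 t s) E) \<le> kE * (N * e) * weight \<alpha> \<beta> t s * norm E" .
qed

lemma close_on_improved:
  assumes "kA * (e + \<eta>) \<le> 1 / 2" "kE * e \<le> \<eta> / 2"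
  shows "close_on \<tau> h (N / 2) \<eta>"
  unfolding close_on_def
proof (intro allI impI conjI)
  fix s t assume s: "\<tau> \<le> s" "s < t" "t \<le> \<tau> + h" "t \<le> T"
  have "norm (Y t - S (t - s) (Y s)) \<le> kA * (e + \<eta>) * (N * (t - s) powr \<alpha>)"
    using hat_Y_improved(2)[OF s] by (simp add: algebra_simps)
  also have "\<dots> \<le> 1 / 2 * (N * (t - s) powr \<alpha>)" using assms N by (intro mult_right_mono) auto
  finally show "norm (Y t - S (t - s) (Y s)) \<le> N / 2 * (t - s) powr \<alpha>" by simp
  have "norm (z1 t s - z2 t s) \<le> kE * e * (N * weight \<alpha> \<beta> t s)"
    using Z_improved[OF s] by (simp add: mult_ac)
  also have "\<dots> \<le> \<eta> / 2 * (N * weight \<alpha> \<beta> t s)" using assms N weight_nonneg by (intro mult_right_mono) auto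
  finally show "norm (z1 t s - z2 t s) \<le> \<eta> * (N / 2) * weight \<alpha> \<beta> t s" by simp
qed

end

lemma close_on_initial:
  assumes "0 \<le> \<tau>" "0 < \<eta>"
  obtains N where "0 \<le> N" "close_on \<tau> h N \<eta>"
proof -
  obtain c1 where c1: "0 \<le> c1" "\<And>s t. 0 \<le> s \<Longrightarrow> s < t \<Longrightarrow> t \<le> T \<Longrightarrow> norm (y1 t - S (t - s) (y1 s)) \<le> c1 * (t - s) powr \<alpha>"
    using s1.y_hat_bound by blast
  obtain c2 where c2: "0 \<le> c2" "\<And>s t. 0 \<le> s \<Longrightarrow> s < t \<Longrightarrow> t \<le> T \<Longrightarrow> norm (y2 t - S (t - s) (y2 s)) \<le> c2 * (t - s) powr \<alpha>"
    using s2.y_hat_bound by blast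
  \<comment> \<open>The last summand makes \<open>\<eta> * N \<ge> 2 * C\<close>, which covers the
    crude bound on \<open>z1 - z2\<close>.\<close>
  define N where "N = c1 + c2 + 2 * C / \<eta>"
  have "0 \<le> 2 * C / \<eta>" using s1.C0 assms by simp
  then have N: "0 \<le> N" "c1 + c2 \<le> N" "2 * C / \<eta> \<le> N" using c1 c2 by (auto simp: N_def)
  then have N': "2 * C \<le> \<eta> * N" using assms by (simp add: field_simps)
  have "close_on \<tau> h N \<eta>" unfolding close_on_def
  proof (intro allI impI conjI)
    fix s t assume s: "\<tau> \<le> s" "s < t" "t \<le> \<tau> + h" "t \<le> T"
    have s0: "0 \<le> s" using s assms by simp
    have "Y t - S (t - s) (Y s) = (y1 t - S (t - s) (y1 s)) - (y2 t - S (t - s) (y2 s))"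
      by (simp add: Y_def blinfun.diff_right)
    also have "norm \<dots> \<le> c1 * (t - s) powr \<alpha> + c2 * (t - s) powr \<alpha>"
      by (intro norm_diff_le c1 c2 s s0)
    also have "\<dots> = (c1 + c2) * (t - s) powr \<alpha>" by (simp add: distrib_right)
    also have "\<dots> \<le> N * (t - s) powr \<alpha>" using N by (intro mult_right_mono) auto
    finally show "norm (Y t - S (t - s) (Y s)) \<le> N * (t - s) powr \<alpha>" .
    have "norm (z1 t s - z2 t s) \<le> C * weight \<alpha> \<beta> t s + C * weight \<alpha> \<beta> t s"
      by (intro norm_diff_le s1.z_holder s2.z_holder s s0)
    also have "\<dots> = 2 * C * weight \<alpha> \<beta> t s" by simp
    also have "\<dots> \<le> \<eta> * N * weight \<alpha> \<beta> t s" using N' weight_nonneg by (intro mult_right_mono) auto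
    finally show "norm (z1 t s - z2 t s) \<le> \<eta> * N * weight \<alpha> \<beta> t s" .
  qed
  then show ?thesis using that N by blast
qed

text \<open>With \<open>c = 1 + kA + kE\<close> and \<open>\<eta> = 1 / (4 * c)\<close> this gives
  \<open>c * eps step = \<eta> / 2\<close>, the relation needed in
  \<open>close_on_zero\<close>.\<close>

definition step :: real where
  "step = (1 / (8 * (1 + kA + kE)\<^sup>2)) powr (1 / (\<alpha> - \<beta>))"

lemma step: "0 < step" "step \<le> 1" "step powr (\<alpha> - \<beta>) = 1 / (8 * (1 + kA + kE)\<^sup>2)"
proof -
  let ?x = "1 / (8 * (1 + kA + kE)\<^sup>2)"
  have "1\<^sup>2 \<le> (1 + kA + kE)\<^sup>2" using constants_nonneg by (intro power_mono) auto
  then have x: "0 < ?x" "?x \<le> 1" by (auto simp: divide_simps)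
  show "0 < step" unfolding step_def using x by simp
  show "step \<le> 1" unfolding step_def using x expo by (intro powr_le1) auto
  show "step powr (\<alpha> - \<beta>) = ?x" unfolding step_def using x expo by (simp add: powr_powr)
qed

text \<open>The improvement is iterated on a fixed window with fixed \<eta>, so the bound is at most
  \<open>N / 2 ^ n\<close> for every \<open>n\<close>.\<close>

lemma close_on_zero:
  assumes \<tau>: "0 \<le> \<tau>" "Y \<tau> = 0"
  shows "close_on \<tau> step 0 1"
proof -
  define c where "c = 1 + kA + kE"
  \<comment> \<open>\<eta> absorbs the \<eta> N contribution to \<open>Y\<close> with
    \<open>c * \<eta> = 1 / 4\<close>; only afterwards is the window short enough relative to
    \<eta>.\<close>
  define \<eta> where "\<eta> = 1 / (4 * c)"
  have c: "1 \<le> c" "kA \<le> c" "kE \<le> c" using constants_nonneg by (auto simp: c_def)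
  have \<eta>: "0 < \<eta>" "\<eta> \<le> 1" "c * \<eta> = 1 / 4" using c by (auto simp: \<eta>_def divide_simps)
  have ee: "eps step = 1 / (8 * c\<^sup>2)" using step(3) by (simp add: eps_def c_def)
  have "0 < eps step" using ee c by simp
  have ce: "c * eps step = \<eta> / 2" using c by (simp add: ee \<eta>_def power2_eq_square)
  have small: "kA * (eps step + \<eta>) \<le> 1 / 2" "kE * eps step \<le> \<eta> / 2"
  proof -
    have "kA * (eps step + \<eta>) \<le> c * (eps step + \<eta>)" using c \<open>0 < eps step\<close> \<eta> by (intro mult_right_mono) auto
    also have "\<dots> = \<eta> / 2 + 1 / 4" using ce \<eta> by (simp add: distrib_left)
    also have "\<eta> \<le> 1 / 4"
      using c by (simp add: \<eta>_def divide_simps)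
    finally show "kA * (eps step + \<eta>) \<le> 1 / 2" by simp
    have "kE * eps step \<le> c * eps step" using c \<open>0 < eps step\<close> by (intro mult_right_mono) auto
    then show "kE * eps step \<le> \<eta> / 2" using ce by simp
  qed
  obtain N where N: "0 \<le> N" "close_on \<tau> step N \<eta>" using close_on_initial[OF \<tau>(1) \<eta>(1)] by blast
  have halve: "close_on \<tau> step (N / 2 ^ n) \<eta>" for n
  proof (induction n)
    case (Suc n)
    have "0 \<le> N / 2 ^ n" using N by simp
    from close_on_improved[OF \<tau>(1) step(1,2) this less_imp_le[OF \<eta>(1)] \<eta>(2) \<tau>(2) Suc.IH small]
    show ?case by (simp add: field_simps)
  qed (use N in simp)
  have lim: "(\<lambda>n. N / 2 ^ n) \<longlonglongrightarrow> 0"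
    using LIMSEQ_divide_realpow_zero[of 2 N] by simp
  show ?thesis unfolding close_on_def
  proof (intro allI impI conjI)
    fix s t assume s: "\<tau> \<le> s" "s < t" "t \<le> \<tau> + step" "t \<le> T"
    have "norm (Y t - S (t - s) (Y s)) \<le> 0 * (t - s) powr \<alpha>"
      using halve s by (intro LIMSEQ_le_const[OF tendsto_mult_right[OF lim]]) (auto simp: close_on_def)
    then show "norm (Y t - S (t - s) (Y s)) \<le> 0 * (t - s) powr \<alpha>" .
    have "norm (z1 t s - z2 t s) \<le> \<eta> * 0 * weight \<alpha> \<beta> t s"
      using halve s by (intro LIMSEQ_le_const[OF tendsto_mult_right[OF tendsto_mult_left[OF lim]]]) (auto simp: close_on_def)
    then show "norm (z1 t s - z2 t s) \<le> 1 * 0 * weight \<alpha> \<beta> t s" by simp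
  qed
qed

definition agree :: "real \<Rightarrow> bool" where
  "agree \<tau> \<longleftrightarrow> (\<forall>t. 0 \<le> t \<longrightarrow> t \<le> \<tau> \<longrightarrow> y1 t = y2 t) \<and> (\<forall>s t. 0 \<le> s \<longrightarrow> s < t \<longrightarrow> t \<le> \<tau> \<longrightarrow> z1 t s = z2 t s)"

lemma agree_0: "agree 0"
proof -
  have "sewing S T (XiY y z) 0 = 0" if "\<And>s t. 0 \<le> s \<Longrightarrow> s \<le> t \<Longrightarrow> t \<le> T \<Longrightarrow> \<exists>L. (sew_sum S (XiY y z) t \<longlongrightarrow> L) (mesh_filter s t)" for y z
    using sewing_eqI(1)[OF less_imp_le[OF T] that] .
  then have "sewing S T (XiY y1 z1) 0 = 0" "sewing S T (XiY y2 z2) 0 = 0"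
    using s1.sewing_Y s2.sewing_Y by blast+
  then show ?thesis using s1.y_eq[of 0] s2.y_eq[of 0] T by (auto simp: agree_def)
qed

lemma agree_step:
  assumes \<tau>: "0 \<le> \<tau>" "\<tau> \<le> T" and ag: "agree \<tau>"
  shows "agree (min (\<tau> + step) T)"
proof -
  have y\<tau>: "y1 \<tau> = y2 \<tau>" using ag \<tau> by (simp add: agree_def)
  then have Y\<tau>: "Y \<tau> = 0" by (simp add: Y_def)
  note c = close_on_zero[OF \<tau>(1) Y\<tau>]
  have y: "y1 t = y2 t" if t: "0 \<le> t" "t \<le> min (\<tau> + step) T" for t
  proof (cases "t \<le> \<tau>")
    case True
    then show ?thesis using ag t by (simp add: agree_def)
  next
    case False
    then have "norm (Y t - S (t - \<tau>) (Y \<tau>)) \<le> 0 * (t - \<tau>) powr \<alpha>"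
      using c t by (simp add: close_on_def)
    then show ?thesis using Y\<tau> by (simp add: blinfun.zero_right) (simp add: Y_def)
  qed
  have z': "z1 t s = z2 t s" if "\<tau> \<le> s" "s < t" "t \<le> min (\<tau> + step) T" for s t
  proof -
    have "norm (z1 t s - z2 t s) \<le> 1 * 0 * weight \<alpha> \<beta> t s" using c that by (simp add: close_on_def)
    then show ?thesis by simp
  qed
  have z: "z1 t s = z2 t s" if s: "0 \<le> s" "s < t" "t \<le> min (\<tau> + step) T" for s t
  proof -
    consider "t \<le> \<tau>" | "\<tau> \<le> s" | "s < \<tau>" "\<tau> < t" by linarith
    then show ?thesis
    proof cases
      case 1
      then show ?thesis using ag s by (simp add: agree_def)
    next
      case 2
      then show ?thesis using z' s by simp
    next
      \<comment> \<open>For times on both sides of \<tau> the Chen relation of \<open>z\<close>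
        expresses \<open>z t s\<close> through \<open>z t \<tau>\<close>, \<open>z \<tau> s\<close>
        and \<open>y \<tau> - y s\<close>, on which the solutions already agree.\<close>
      case 3
      have "z1 t \<tau> = z2 t \<tau>" "z1 \<tau> s = z2 \<tau> s" "y1 s = y2 s"
        using z'[of \<tau> t] ag s 3 by (auto simp: agree_def)
      then have "z1 t s E = z2 t s E" for E
        using s1.z_chen[OF s(1) 3, of E] s2.z_chen[OF s(1) 3, of E] s y\<tau> by (simp add: algebra_simps)
      then show ?thesis by (intro blinfun_eqI) auto
    qed
  qed
  show ?thesis using y z by (simp add: agree_def)
qed

lemma agree_T: "agree T"
proof -
  have *: "agree (min (real n * step) T)" for n
  proof (induction n)
    case 0
    then show ?case using agree_0 T by simp
  next
    case (Suc n)
    have "agree (min (min (real n * step) T + step) T)"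
      using Suc T step by (intro agree_step) auto
    moreover have "min (min (real n * step) T + step) T = min (real (Suc n) * step) T"
      using step by (auto simp: min_def algebra_simps)
    ultimately show ?case by simp
  qed
  obtain n where "T < real n * step" using reals_Archimedean3[OF step(1)] by blast
  then show ?thesis using *[of n] by (simp add: min_def)
qed

end

section \<open>Uniqueness of fixed points\<close>

lemma bounded_of_SUP_less_top:
  fixes f :: "'a \<Rightarrow> real"
  assumes "(SUP x\<in>X. ennreal (f x)) < \<infinity>"
  shows "\<exists>c\<ge>0. \<forall>x\<in>X. f x \<le> c"
proof (cases "SUP x\<in>X. ennreal (f x)")
  case (real c)
  have "f x \<le> c" if "x \<in> X" for x
    using SUP_upper[OF that, of "\<lambda>x. ennreal (f x)"] real by (simp add: ennreal_le_iff)
  then show ?thesis using real by blast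
next
  case top
  then show ?thesis using assms by (metis infinity_ennreal_def order_less_irrefl)
qed

context rough_equation
begin

text \<open>The constant is quantified upwards so that two fixed points can be given a common
  one.\<close>

lemma fixed_point_solution:
  assumes fp: "is_fixed_point \<alpha> \<beta> tens S A \<omega> \<omega>2 G T \<xi> (y, z)"
  shows "\<exists>c. \<forall>C\<ge>c. solution S M AS tens \<omega> \<omega>2 \<alpha> \<beta> T H A Q G \<xi> L y z C"
proof -
  have X: "(y, z) \<in> X_space \<alpha> \<beta> S A \<omega> T" using fp by (simp add: is_fixed_point_def)
  then have fin: "norm_C_bb \<beta> T y < \<infinity>" "norm_C_a \<alpha> T z < \<infinity>" "norm_C_ab \<alpha> \<beta> T z < \<infinity>"
    and chen_z: "\<And>s m t E. 0 \<le> s \<Longrightarrow> s < m \<Longrightarrow> m < t \<Longrightarrow> t \<le> T \<Longrightarrow>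
      z t s E - z t m E - S (t - m) (z m s E) = omS S A \<omega> t m (E (y m - y s))"
    by (auto simp: X_space_def)
  have "(SUP t\<in>{0..T}. ennreal (norm (y t))) < \<infinity>"
    "(SUP p\<in>{(t, s) \<in> Delta T. 0 < s}. ennreal (case p of (t, s) \<Rightarrow> s powr \<beta> * (norm (y t - y s) / (t - s) powr \<beta>))) < \<infinity>"
    "(SUP p\<in>Delta T. ennreal (case p of (t, s) \<Rightarrow> norm (z t s) / (t - s) powr \<alpha>)) < \<infinity>"
    "(SUP p\<in>{(t, s) \<in> Delta T. 0 < s}. ennreal (case p of (t, s) \<Rightarrow> s powr \<beta> * (norm (z t s) / (t - s) powr (\<alpha> + \<beta>)))) < \<infinity>"
    using fin by (auto simp: norm_C_bb_def norm_C_a_def norm_C_ab_def case_prod_unfold)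
  note b = this[THEN bounded_of_SUP_less_top]
  obtain c1 where c1: "0 \<le> c1" "\<And>t. 0 \<le> t \<Longrightarrow> t \<le> T \<Longrightarrow> norm (y t) \<le> c1" using b(1) by auto
  obtain c2 where c2: "0 \<le> c2" "\<And>s t. 0 < s \<Longrightarrow> s < t \<Longrightarrow> t \<le> T \<Longrightarrow> s powr \<beta> * (norm (y t - y s) / (t - s) powr \<beta>) \<le> c2"
    using b(2) by (fastforce simp: Delta_def)
  obtain c3 where c3: "0 \<le> c3" "\<And>s t. 0 \<le> s \<Longrightarrow> s < t \<Longrightarrow> t \<le> T \<Longrightarrow> norm (z t s) / (t - s) powr \<alpha> \<le> c3"
    using b(3) by (fastforce simp: Delta_def)
  obtain c4 where c4: "0 \<le> c4" "\<And>s t. 0 < s \<Longrightarrow> s < t \<Longrightarrow> t \<le> T \<Longrightarrow> s powr \<beta> * (norm (z t s) / (t - s) powr (\<alpha> + \<beta>)) \<le> c4"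
    using b(4) by (fastforce simp: Delta_def)
  \<comment> \<open>Near time 0 only the supremum bound is available; \<open>qp_interpolate\<close>
    joins it with the weighted Hoelder bound.\<close>
  have y_h: "norm (y t - y s) \<le> 2 * (2 * c1 + c2) * qp t s" if st: "0 \<le> s" "s < t" "t \<le> T" for s t
  proof (rule qp_interpolate[OF st(1,2)])
    have "norm (y t) \<le> c1" "norm (y s) \<le> c1" using c1(2) st by auto
    then show "norm (y t - y s) \<le> 2 * c1" using norm_triangle_ineq4[of "y t" "y s"] by simp
    assume "0 < s"
    then show "norm (y t - y s) \<le> c2 * ((t - s) / s) powr \<beta>"
      using c2(2)[of s t] st by (simp add: powr_divide field_simps)
  qed (use c1 c2 in auto)
  have z_h: "norm (z t s) \<le> 2 * (c3 + c4) * weight \<alpha> \<beta> t s" if st: "0 \<le> s" "s < t" "t \<le> T" for s t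
  proof -
    have "norm (z t s) / (t - s) powr \<alpha> \<le> 2 * (c3 + c4) * qp t s"
    proof (rule qp_interpolate[OF st(1,2)])
      show "norm (z t s) / (t - s) powr \<alpha> \<le> c3" by (rule c3(2)[OF st])
      assume "0 < s"
      then show "norm (z t s) / (t - s) powr \<alpha> \<le> c4 * ((t - s) / s) powr \<beta>"
        using c4(2)[of s t] st by (simp add: powr_divide powr_add field_simps)
    qed (use c3 c4 in auto)
    then show ?thesis using st by (simp add: weight_ab field_simps)
  qed
  have sol_y: "sol_map_y S A \<omega> G T \<xi> y z t = y t" if "0 \<le> t" "t \<le> T" for t
    using fp that by (simp add: is_fixed_point_def)
  have Y: "sewing S T (Xi_y S A \<omega> G y z) = sewing S T (XiY y z)"
    by (rule sewing_cong) (simp add: Xi_y_def XiY_def omS_eq)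
  have y_eq: "y t = S t \<xi> + sewing S T (XiY y z) t" if "0 \<le> t" "t \<le> T" for t
    using sol_y[OF that] by (simp add: sol_map_y_def Y)
  have z_eq: "z t s E = sewing S T (XiZ y E) t - S (t - s) (sewing S T (XiZ y E) s) - W t s (E (y s))"
    if st: "0 \<le> s" "s < t" "t \<le> T" for s t E
  proof -
    \<comment> \<open>The inner path of the solution map is \<open>y\<close> itself on
      \<open>[0, T]\<close> by the first fixed-point equation, so the germ of \<open>z\<close> is
      built from \<open>y\<close> alone.\<close>
    have Z: "sewing S T (Xi_z tens S A \<omega> \<omega>2 G y (sol_map_y S A \<omega> G T \<xi> y z) E) = sewing S T (XiZ y E)"
    proof (rule sewing_cong)
      fix u v assume u: "0 \<le> u" "u < v" "v \<le> T"
      obtain N where N: "fav (G (y u)) N" using G_fav by blast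
      show "Xi_z tens S A \<omega> \<omega>2 G y (sol_map_y S A \<omega> G T \<xi> y z) E v u = XiZ y E v u"
        using u by (simp add: Xi_z_def XiZ_def proc_b_eq[OF N] proc_a_eq sol_y)
    qed
    have "sol_map_z tens S A \<omega> \<omega>2 G T \<xi> y z t s E = z t s E"
      using fp st by (auto simp: is_fixed_point_def Delta_def)
    then show ?thesis using st by (simp add: sol_map_z_def Z Let_def sol_y omS_eq)
  qed
  define c where "c = c1 + 2 * (2 * c1 + c2) + 2 * (c3 + c4)"
  have "solution S M AS tens \<omega> \<omega>2 \<alpha> \<beta> T H A Q G \<xi> L y z C" if C: "c \<le> C" for C
  proof unfold_locales
    have le: "c1 \<le> C" "2 * (2 * c1 + c2) \<le> C" "2 * (c3 + c4) \<le> C"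
      using C c1(1) c2(1) c3(1) c4(1) by (auto simp: c_def)
    show "0 \<le> C" using le c1 by simp
    show "norm (y t) \<le> C" if "0 \<le> t" "t \<le> T" for t using c1(2)[OF that] le by simp
    show "norm (y t - y s) \<le> C * qp t s" if "0 \<le> s" "s < t" "t \<le> T" for s t
      using y_h[OF that] mult_right_mono[OF le(2) qp_nonneg, of t s] by linarith
    show "norm (z t s) \<le> C * weight \<alpha> \<beta> t s" if "0 \<le> s" "s < t" "t \<le> T" for s t
      using z_h[OF that] mult_right_mono[OF le(3) weight_nonneg, of \<alpha> \<beta> t s] by linarith
    show "z t s E - z t m E - S (t - m) (z m s E) = W t m (E (y m - y s))"
      if "0 \<le> s" "s < m" "m < t" "t \<le> T" for s m t E
      using chen_z[OF that, of E] that by (simp add: omS_eq)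
  qed (fact y_eq z_eq)+
  then show ?thesis by blast
qed

end

theorem theorem6p13:
  fixes tens :: "'v::{real_inner,banach} \<Rightarrow> 'v \<Rightarrow> 't::banach"
    and D :: "'w::{banach,second_countable_topology} set"
    and A :: "'w \<Rightarrow> 'w"
    and S :: "real \<Rightarrow> 'w \<Rightarrow>\<^sub>L 'w"
    and G :: "'w \<Rightarrow> 'v \<Rightarrow>\<^sub>L 'w"
    and \<omega> :: "real \<Rightarrow> 'v"
    and \<omega>2 :: "real \<Rightarrow> real \<Rightarrow> 't"
    and \<alpha> \<beta> T :: real
    and \<xi> :: 'w
    and y1 y2 :: "real \<Rightarrow> 'w"
    and z1 z2 :: "real \<Rightarrow> real \<Rightarrow> ('w \<Rightarrow>\<^sub>L 'v \<Rightarrow>\<^sub>L 'w) \<Rightarrow>\<^sub>L 'w"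
  assumes "projective_tensor tens"
    and "sectorial D A" and "{c. 0 \<le> Re c} \<subseteq> resolvent_set D A"
    and "analytic_C0_semigroup S" and "generates D A S"
    and "1 / 3 < \<beta>" and "\<beta> < \<alpha>" and "\<alpha> \<le> 1 / 2" and "\<alpha> + 2 * \<beta> > 1"
    and "C3_bounded_derivs G" and "lipschitz_into_frac S \<beta> G"
    and "T > 0"
    and "rough_path tens \<alpha> T \<omega> \<omega>2"
    and "is_fixed_point \<alpha> \<beta> tens S A \<omega> \<omega>2 G T \<xi> (y1, z1)"
    and "is_fixed_point \<alpha> \<beta> tens S A \<omega> \<omega>2 G T \<xi> (y2, z2)"
  shows "(y1, z1) = (y2, z2)"
proof -
  interpret gen: sectorial_generator D A S by unfold_locales (fact assms)+
  define AS where "AS t = Blinfun (\<lambda>x. A (S t x))" for t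
  obtain M where M: "analytic_semigroup S M AS" and AS: "\<And>t x. 0 < t \<Longrightarrow> AS t x = A (S t x)"
    using gen.ex_analytic_semigroup unfolding AS_def by blast
  obtain Q :: "'w \<Rightarrow>\<^sub>L 'w" where Q: "\<And>y. A (Q y) = y" "\<And>x. x \<in> D \<Longrightarrow> Q (A x) = x"
    using gen.ex_inverse by blast
  obtain H1 H2 where "\<forall>(t, s) \<in> Delta T. norm (\<omega> t - \<omega> s) \<le> H1 * (t - s) powr \<alpha>"
    and "\<forall>(t, s) \<in> Delta T. norm (\<omega>2 t s) \<le> H2 * (t - s) powr (2 * \<alpha>)"
    using assms(13) unfolding rough_path_def by blast
  then have H1: "norm (\<omega> t - \<omega> s) \<le> H1 * (t - s) powr \<alpha>"
    and H2: "norm (\<omega>2 t s) \<le> H2 * (t - s) powr (2 * \<alpha>)" if "0 \<le> s" "s < t" "t \<le> T" for s t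
    using that by (auto simp: Delta_def)
  have chen: "\<omega>2 t s - \<omega>2 u s - \<omega>2 t u = tens (\<omega> u - \<omega> s) (\<omega> t - \<omega> u)"
    if "0 \<le> s" "s \<le> u" "u \<le> t" "t \<le> T" for s u t
    using assms(13) that by (simp add: rough_path_def)
  have bil: "bounded_bilinear tens" using assms(1) by (simp add: projective_tensor_def)
  then obtain H3 where H3: "0 \<le> H3" "\<And>v w. norm (tens v w) \<le> norm v * norm w * H3"
    using bounded_bilinear.nonneg_bounded by blast
  define H where "H = 1 + \<bar>H1\<bar> + \<bar>H2\<bar> + H3"
  have H: "1 \<le> H" "H1 \<le> H" "H2 \<le> H" "H3 \<le> H" using H3(1) by (auto simp: H_def)
  interpret semi: analytic_semigroup S M AS by (rule M)
  interpret rough_setup S M AS tens \<omega> \<omega>2 \<alpha> \<beta> T H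
  proof unfold_locales
    show "norm (\<omega> t - \<omega> s) \<le> H * (t - s) powr \<alpha>" if st: "0 \<le> s" "s \<le> t" "t \<le> T" for s t
    proof (cases "s = t")
      case False
      then show ?thesis
        using st by (intro order_trans[OF H1 mult_right_mono[OF H(2) powr_ge_zero]]) auto
    qed simp
    show "norm (\<omega>2 t s) \<le> H * (t - s) powr (2 * \<alpha>)" if st: "0 \<le> s" "s \<le> t" "t \<le> T" for s t
    proof (cases "s = t")
      case True
      \<comment> \<open>Chen's relation at three coinciding times gives
        \<open>\<omega>2 s s = 0\<close>.\<close>
      then show ?thesis using chen[of s s s] st by (simp add: bounded_bilinear.zero_left[OF bil])
    next
      case False
      then show ?thesis
        using st by (intro order_trans[OF H2 mult_right_mono[OF H(3) powr_ge_zero]]) auto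
    qed
    show "norm (tens v w) \<le> H * (norm v * norm w)" for v w
      using H3(2)[of v w] mult_right_mono[OF H(4), of "norm v * norm w"] by (simp add: mult.commute)
  qed (fact assms H chen)+
  obtain L1 where L1: "0 \<le> L1" "\<And>x y. norm (G x - G y) \<le> L1 * norm (x - y)" "\<And>x. norm (Dop G x) \<le> L1"
    "\<And>x y. norm (Dop G x - Dop G y) \<le> L1 * norm (x - y)"
    "\<And>a p b q. norm (G (a + p) - G a - (G (b + q) - G b)) \<le> L1 * (norm (p - q) + norm p * norm (a - b))"
    "\<And>a p b q. norm (Dop G (a + p) - Dop G a - (Dop G (b + q) - Dop G b)) \<le> L1 * (norm (p - q) + norm p * norm (a - b))"
    "\<And>a p b q. norm ((G (a + p) - G a - Dop G a p) - (G (b + q) - G b - Dop G b q))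
        \<le> L1 * (norm (p - q) * (norm p + norm q) + norm (a - b) * (norm p)\<^sup>2)"
    using C3_estimates[OF assms(10)] by blast
  obtain L2 where L2: "0 \<le> L2"
    "\<And>x y v h. 0 \<le> h \<Longrightarrow> norm (S h ((G x - G y) v) - (G x - G y) v) \<le> (L2 * norm (x - y) * norm v) * h powr \<beta>"
    "\<And>x v h. 0 \<le> h \<Longrightarrow> norm (S h (G x v) - G x v) \<le> (L2 * (1 + norm x) * norm v) * h powr \<beta>"
    using gen.lipschitz_favard[OF ab0(2,3) assms(11)] by blast
  define L where "L = L1 + L2"
  have L: "0 \<le> L" "L1 \<le> L" "L2 \<le> L" using L1(1) L2(1) by (auto simp: L_def)
  interpret rough_equation S M AS tens \<omega> \<omega>2 \<alpha> \<beta> T H A Q G \<xi> L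
  proof unfold_locales
    show "AS t x = A (S t x)" if "0 < t" for t x using that by (rule AS)
    show "A (Q y) = y" for y by (rule Q)
    show "Q (AS t x) = S t x" if "0 < t" for t x using that by (simp add: AS Q gen.S_deriv(1))
    show "0 \<le> L" by (rule L)
    show "norm (G x - G x') \<le> L * norm (x - x')" for x x'
      by (rule order_trans[OF L1(2) mult_right_mono[OF L(2)]]) simp
    show "norm (Dop G x) \<le> L" for x by (rule order_trans[OF L1(3) L(2)])
    show "norm (Dop G x - Dop G x') \<le> L * norm (x - x')" for x x'
      by (rule order_trans[OF L1(4) mult_right_mono[OF L(2)]]) simp
    show "norm (G (a + p) - G a - (G (b + q) - G b)) \<le> L * (norm (p - q) + norm p * norm (a - b))" for a p b q
      by (rule order_trans[OF L1(5) mult_right_mono[OF L(2)]]) simp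
    show "norm (Dop G (a + p) - Dop G a - (Dop G (b + q) - Dop G b)) \<le> L * (norm (p - q) + norm p * norm (a - b))" for a p b q
      by (rule order_trans[OF L1(6) mult_right_mono[OF L(2)]]) simp
    show "norm ((G (a + p) - G a - Dop G a p) - (G (b + q) - G b - Dop G b q))
        \<le> L * (norm (p - q) * (norm p + norm q) + norm (a - b) * (norm p)\<^sup>2)" for a p b q
      by (rule order_trans[OF L1(7) mult_right_mono[OF L(2)]]) simp
    have "L2 * norm (x - x') * norm v * h powr \<beta> \<le> L * norm (x - x') * norm v * h powr \<beta>" for x x' :: 'w and v :: 'v and h
      using L by (intro mult_right_mono) auto
    then show "fav (G x - G x') (L * norm (x - x'))" for x x'
      unfolding fav_def semi.favard_def using L L2(2) by (meson mult_nonneg_nonneg norm_ge_zero order_trans)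
    have "fav (G x) (L2 * (1 + norm x))" for x
      using L2 by (simp add: fav_def semi.favard_def)
    then show "\<exists>N. fav (G x) N" for x by blast
  qed
  obtain c1 where c1: "\<And>C. c1 \<le> C \<Longrightarrow> solution S M AS tens \<omega> \<omega>2 \<alpha> \<beta> T H A Q G \<xi> L y1 z1 C"
    using fixed_point_solution[OF assms(14)] by blast
  obtain c2 where c2: "\<And>C. c2 \<le> C \<Longrightarrow> solution S M AS tens \<omega> \<omega>2 \<alpha> \<beta> T H A Q G \<xi> L y2 z2 C"
    using fixed_point_solution[OF assms(15)] by blast
  have "two_solutions S M AS tens \<omega> \<omega>2 \<alpha> \<beta> T H A Q G \<xi> L y1 z1 y2 z2 (max c1 c2)"
    by (intro two_solutions.intro c1 c2 rough_equation_axioms) auto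
  from two_solutions.agree_T[OF this]
  have ag: "\<And>t. 0 \<le> t \<Longrightarrow> t \<le> T \<Longrightarrow> y1 t = y2 t" "\<And>s t. 0 \<le> s \<Longrightarrow> s < t \<Longrightarrow> t \<le> T \<Longrightarrow> z1 t s = z2 t s"
    unfolding two_solutions.agree_def[OF \<open>two_solutions S M AS tens \<omega> \<omega>2 \<alpha> \<beta> T H A Q G \<xi> L y1 z1 y2 z2 (max c1 c2)\<close>] by blast+
  have X: "(y1, z1) \<in> X_space \<alpha> \<beta> S A \<omega> T" "(y2, z2) \<in> X_space \<alpha> \<beta> S A \<omega> T"
    using assms(14,15) by (auto simp: is_fixed_point_def)
  \<comment> \<open>Outside the time domain both pairs vanish by the convention in
    \<open>X_space\<close>, so agreement there upgrades to equality of functions.\<close>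
  have "y1 t = y2 t" for t
    using X ag(1)[of t] by (cases "t \<in> {0..T}") (auto simp: X_space_def)
  moreover have "z1 t s = z2 t s" for t s
    using X ag(2)[of s t] by (cases "(t, s) \<in> Delta T") (auto simp: X_space_def Delta_def)
  ultimately show ?thesis by (auto simp: fun_eq_iff)
qed

end
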